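(* For $k\ge1$ let $d_k$ be the limit probability (as $n\to\infty$) that a fixed vertex of a uniformly random labelled connected outerplanar graph on $n$ vertices has degree $k$. Then \[ p(w)=\sum_{k\ge1} d_k w^k=\rho\cdot\frac{\partial}{\partial x}\, e^{B^\bullet(x,w)}\Big|_{x=\rho C'(\rho)}, \] where \[ D(x)=\frac{1+x-\sqrt{1-6x+x^2}}{4},\qquad B^\bullet(x,w)=xw+\frac{xw^2}{2}\,\frac{2D(x)-x}{1-(2D(x)-x)w}. \] Moreover $p(1)=1$, so the $d_k$ form a probability distribution, and as $k\to\infty$ \[ d_k\sim c_1\,k^{1/4}e^{c_2\sqrt k}\,q^k, \] where $c_1\approx 0.667187$, $c_2\approx 0.947130$ and $q=2D(\tau)-\tau\approx 0.3808138$, with $\tau=\rho C'(\rho)$.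
   Context: All graphs are simple and labelled; a graph is outerplanar if it can be embedded in the plane with all vertices on the outer face. $C(x)=\sum_n c_n x^n/n!$ is the exponential generating function of labelled connected outerplanar graphs ($c_n$ = number on vertex set $\{1,\dots,n\}$), and $\rho$ is its radius of convergence. Let $B'(x)=\frac{1+5x-\sqrt{1-6x+x^2}}{8}$ (the derivative of the exponential generating function of 2-connected outerplanar graphs) and $\psi(u)=ue^{-B'(u)}$; then $\tau$ is the unique positive root of $\psi'(u)=0$, $\rho=\psi(\tau)$, and $\tau=\rho C'(\rho)$ ($\tau\approx0.17076$, $\rho\approx0.13659$).
   Formalization: The printed constants c_1≈0.667187 and c_2≈0.947130 are incorrect: the asymptotic relation determines them uniquely, and c_2=√(2τ/q)≈0.947018, c_1≈1.590761. The formal theorem proves the same asymptotics with these corrected values. *)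

theory Defs
  imports
    "HOL-Analysis.Analysis"
    "HOL-Probability.Probability"
    "HOL-Library.Landau_Symbols"
begin

text \<open>A simple graph is a vertex set \<open>V\<close> with a set \<open>E\<close> of two-element subsets of \<open>V\<close>.\<close>

definition simple_graph :: "'a set \<Rightarrow> 'a set set \<Rightarrow> bool" where
  "simple_graph V E \<longleftrightarrow> finite V \<and> (\<forall>e\<in>E. e \<subseteq> V \<and> card e = 2)"

definition degree_of :: "'a set set \<Rightarrow> 'a \<Rightarrow> nat" where
  "degree_of E v = card {e \<in> E. v \<in> e}"

text \<open>The graph without vertices is not connected, so the exponential generating function
  below has no constant term.\<close>

definition connected_graph :: "'a set \<Rightarrow> 'a set set \<Rightarrow> bool" where
  "connected_graph V E \<longleftrightarrow> V \<noteq> {} \<and> (\<forall>u\<in>V. \<forall>v\<in>V. (u, v) \<in> {(a, b). {a, b} \<in> E}\<^sup>*)"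

text \<open>Vertices go to distinct points of the plane and edges to arcs joining their endpoints; an
  arc contains no other vertex, and two arcs meet only in the images of common endpoints.\<close>

definition plane_embedding ::
  "'a set \<Rightarrow> 'a set set \<Rightarrow> ('a \<Rightarrow> complex) \<Rightarrow> ('a set \<Rightarrow> real \<Rightarrow> complex) \<Rightarrow> bool" where
  "plane_embedding V E pos \<gamma> \<longleftrightarrow>
     inj_on pos V \<and>
     (\<forall>e\<in>E. arc (\<gamma> e) \<and> {pathstart (\<gamma> e), pathfinish (\<gamma> e)} = pos ` e \<and>
            path_image (\<gamma> e) \<inter> pos ` V = pos ` e) \<and>
     (\<forall>e\<in>E. \<forall>f\<in>E. e \<noteq> f \<longrightarrow> path_image (\<gamma> e) \<inter> path_image (\<gamma> f) = pos ` (e \<inter> f))"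

definition drawing ::
  "'a set \<Rightarrow> 'a set set \<Rightarrow> ('a \<Rightarrow> complex) \<Rightarrow> ('a set \<Rightarrow> real \<Rightarrow> complex) \<Rightarrow> complex set" where
  "drawing V E pos \<gamma> = pos ` V \<union> (\<Union>e\<in>E. path_image (\<gamma> e))"

text \<open>For a finite graph, \<^const>\<open>outside\<close> of the drawing is its unbounded (outer) face.
  A vertex is on a face if it lies on the boundary of that face.\<close>

definition outerplanar :: "'a set \<Rightarrow> 'a set set \<Rightarrow> bool" where
  "outerplanar V E \<longleftrightarrow>
     (\<exists>pos \<gamma>. plane_embedding V E pos \<gamma> \<and> pos ` V \<subseteq> frontier (outside (drawing V E pos \<gamma>)))"

definition connected_outerplanar_graphs :: "nat \<Rightarrow> nat set set set" where
  "connected_outerplanar_graphs n =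
     {E. simple_graph {1..n} E \<and> connected_graph {1..n} E \<and> outerplanar {1..n} E}"

definition C_egf :: "real fps" where
  "C_egf = Abs_fps (\<lambda>n. real (card (connected_outerplanar_graphs n)) / fact n)"

definition rho :: real where
  "rho = real_of_ereal (fps_conv_radius C_egf)"

text \<open>\<open>\<tau> = \<rho> C'(\<rho>)\<close>: here the series \<open>C'\<close> is summed at a point on the boundary of its
  disc of convergence.\<close>

definition tau :: real where
  "tau = rho * (\<Sum>n. fps_nth (fps_deriv C_egf) n * rho ^ n)"

text \<open>The probability that vertex \<open>v\<close> has degree \<open>k\<close> in a uniformly random connected
  outerplanar graph on \<open>{1..n}\<close>; only meaningful for \<open>1 \<le> v \<le> n\<close>.\<close>

definition degree_prob :: "nat \<Rightarrow> nat \<Rightarrow> nat \<Rightarrow> real" where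
  "degree_prob v k n =
     measure_pmf.prob (pmf_of_set (connected_outerplanar_graphs n)) {E. degree_of E v = k}"

definition degree_limit :: "nat \<Rightarrow> nat \<Rightarrow> real" where
  "degree_limit v k = lim (degree_prob v k)"

definition D :: "real \<Rightarrow> real" where
  "D x = (1 + x - sqrt (1 - 6 * x + x\<^sup>2)) / 4"

definition B_bullet :: "real \<Rightarrow> real \<Rightarrow> real" where
  "B_bullet x w = x * w + x * w\<^sup>2 / 2 * ((2 * D x - x) / (1 - (2 * D x - x) * w))"

text \<open>The exponential growth rate of the limiting degree distribution. The function
  \<open>w \<mapsto> B_bullet \<tau> w\<close> has its only singularity, a simple pole, at \<open>w = 1/q\<close>. The saddle
  point method there gives the constants in \<open>d\<^sub>k \<sim> c\<^sub>1 k\<^bsup>1/4\<^esup> exp(c\<^sub>2 sqrt k) q\<^sup>k\<close>: with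
  \<open>A = \<tau>/(2q)\<close> and \<open>s(x) = 2 D(x) - x\<close>,
  \<open>c\<^sub>2 = 2 sqrt A = 0.9470176...\<close> and
  \<open>c\<^sub>1 = \<rho> \<tau> s'(\<tau>) exp(A/2) / (4 q\<^sup>2 sqrt \<pi> A\<^bsup>3/4\<^esup>) = 1.5907605...\<close>.
  The values \<open>c\<^sub>1 \<approx> 0.667187\<close> and \<open>c\<^sub>2 \<approx> 0.947130\<close> printed in the literature are
  inconsistent with the generating function they are derived from.\<close>

definition q :: real where
  "q = 2 * D tau - tau"

end

theory Submission
  imports Defs "HOL-Complex_Analysis.Winding_Numbers" "HOL-Real_Asymp.Real_Asymp"
begin

text \<open>A connected outerplanar graph rooted at \<open>v\<close> is a set of rooted graphs in which \<open>v\<close> is not a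
  cut vertex. The block at the root of such a graph is a single edge or a dissected polygon, with one
  rooted graph hanging from every further vertex, and a polygon with a marked vertex is counted twice
  by its two orientations. Outerplanarity enters only through its combinatorial form: the vertices can
  be put on a line so that the edges, drawn above it, do not cross. For \<open>T(x) = x C'(x)\<close> this gives
  \<open>T = x exp (B'(T))\<close>, and \<open>exp (B\<^sup>\<bullet>(T, w))\<close> is the generating function of the degree of \<open>v\<close>.

  By Lagrange inversion the \<open>n\<close>-th coefficient of \<open>exp (B\<^sup>\<bullet>(T, w))\<close> is a coefficient of a fixed
  series times the \<open>n\<close>-th power of \<open>exp (B')\<close>. Rescaled by \<open>\<tau>\<close>, the latter becomes the \<open>n\<close>-th power
  of a probability generating function of mean 1, and the local limit theorem shows that
  \<open>[x\<^sup>n] exp (B\<^sup>\<bullet>(T, w)) / [x\<^sup>n] exp (B'(T))\<close> tends to \<open>\<rho> (\<partial>/\<partial>x) exp (B\<^sup>\<bullet>(x, w))\<close> at \<open>x = \<tau>\<close>.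

  In \<open>z = q w\<close> the limit is a cubic polynomial times \<open>exp (A z) exp (A z / (1 - z)) / (1 - z)\<^sup>2\<close>,
  \<open>A = \<tau> / (2 q)\<close>. The coefficients of \<open>exp (A z / (1 - z)) / (1 - z)\<^sup>2\<close> are binomial sums, which are
  compared termwise with the power series of a Bessel function.\<close>

section \<open>Faces of planar drawings\<close>

text \<open>Outerplanarity is used only through two obstructions: three internally disjoint paths
  with common ends, and two crossing chords of a cycle. Both come from one consequence of the Jordan
  curve theorem: of three arcs with common ends, one runs inside the closed curve formed by the
  other two. Conversely, a noncrossing order is drawn by chords of a parabola. The weight
  \<open>w\<close> is a fixed real number throughout, so that all series have one variable; the
  limits \<open>d_k\<close> are recovered at the end from the convergence of probability generating
  functions for small \<open>w\<close>. \<open>rho\<close> and \<open>tau\<close> are defined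
  through the counting series, about which nothing analytic is known at the start. The argument
  therefore works with a root \<open>t\<close> of the critical equation, located by the intermediate
  value theorem, and only afterwards proves \<open>tau = t\<close>. Nonnegativity of coefficients
  gives the value of the series at the boundary point \<open>rho\<close>, and Fourier integrals give
  the quotients of coefficients; together they replace a singularity analysis of the implicit
  function \<open>T\<close>.\<close>

lemma theta_inside:
  fixes c1 c2 c3 :: "real \<Rightarrow> complex"
  assumes arcs: "arc c1" "arc c2" "arc c3"
    and ends: "pathstart c1 = a" "pathfinish c1 = b" "pathstart c2 = a" "pathfinish c2 = b"
      "pathstart c3 = a" "pathfinish c3 = b"
    and I12: "path_image c1 \<inter> path_image c2 = {a, b}"
    and I13: "path_image c1 \<inter> path_image c3 = {a, b}"
    and I23: "path_image c2 \<inter> path_image c3 = {a, b}"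
    and ne: "path_image c2 \<noteq> {a, b}" "path_image c3 \<noteq> {a, b}" "path_image c1 \<noteq> {a, b}"
  shows "path_image c3 - {a, b} \<subseteq> inside (path_image c1 \<union> path_image c2)
       \<or> path_image c2 - {a, b} \<subseteq> inside (path_image c1 \<union> path_image c3)
       \<or> path_image c1 - {a, b} \<subseteq> inside (path_image c2 \<union> path_image c3)"
proof -
  have simple: "simple_path (p +++ reversepath r)"
    and img: "path_image (p +++ reversepath r) = path_image p \<union> path_image r"
    and closed: "pathfinish (p +++ reversepath r) = pathstart (p +++ reversepath r)"
    if "arc p" "arc r" "pathstart p = a" "pathfinish p = b" "pathstart r = a" "pathfinish r = b"
      "path_image p \<inter> path_image r = {a, b}" for p r :: "real \<Rightarrow> complex"
    using that by (auto intro!: simple_path_join_loop simp: arc_reversepath path_image_join)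
  have jordan: "open (inside (path_image p \<union> path_image r))"
      "connected (inside (path_image p \<union> path_image r))"
      "inside (path_image p \<union> path_image r) \<noteq> {}"
      "frontier (inside (path_image p \<union> path_image r)) = path_image p \<union> path_image r"
    if "arc p" "arc r" "pathstart p = a" "pathfinish p = b" "pathstart r = a" "pathfinish r = b"
      "path_image p \<inter> path_image r = {a, b}" for p r :: "real \<Rightarrow> complex"
    using Jordan_inside_outside[OF simple[OF that] closed[OF that]] img[OF that] by simp_all
  \<comment> \<open>Each of the three arcs gets a winding number at a point off all of them. For a
    closed curve made of two arcs it is the difference, which is nonzero exactly inside.\<close>
  have wn: "winding_number (p +++ reversepath r) z = winding_number p z - winding_number r z"
    if "arc p" "arc r" "pathstart p = a" "pathfinish p = b" "pathstart r = a" "pathfinish r = b"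
      "path_image p \<inter> path_image r = {a, b}" "z \<notin> path_image p" "z \<notin> path_image r"
    for p r :: "real \<Rightarrow> complex" and z
    using that by (simp add: winding_number_join winding_number_reversepath arc_imp_path)
  have wn_in: "winding_number p z \<noteq> winding_number r z"
    if "arc p" "arc r" "pathstart p = a" "pathfinish p = b" "pathstart r = a" "pathfinish r = b"
      "path_image p \<inter> path_image r = {a, b}" "z \<in> inside (path_image p \<union> path_image r)"
    for p r :: "real \<Rightarrow> complex" and z
  proof -
    have z: "z \<notin> path_image p" "z \<notin> path_image r"
      using that(8) inside_no_overlap by blast+
    have "winding_number (p +++ reversepath r) z \<noteq> 0"
      by (rule simple_closed_path_winding_number_inside[OF simple[OF that(1-7)]])
        (use that(8) img[OF that(1-7)] in auto)
    thus ?thesis using wn[OF that(1-7) z] by simp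
  qed
  have wn_out: "winding_number p z = winding_number r z"
    if "arc p" "arc r" "pathstart p = a" "pathfinish p = b" "pathstart r = a" "pathfinish r = b"
      "path_image p \<inter> path_image r = {a, b}" "z \<notin> inside (path_image p \<union> path_image r)"
      "z \<notin> path_image p" "z \<notin> path_image r"
    for p r :: "real \<Rightarrow> complex" and z
  proof -
    have "z \<in> outside (path_image (p +++ reversepath r))"
      using that(8-10) img[OF that(1-7)] inside_Un_outside[of "path_image p \<union> path_image r"] by (metis ComplI UnE)
    hence "winding_number (p +++ reversepath r) z = 0"
      by (intro winding_number_zero_in_outside simple_path_imp_path simple closed that)
    thus ?thesis using wn[OF that(1-7) that(9,10)] by simp
  qed
  \<comment> \<open>The arc without its ends is connected and misses the frontier of the inside, so
    it cannot leave once it has entered.\<close>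
  have endless: "path_image p - {a, b} \<subseteq> inside (path_image r \<union> path_image s)"
    if "path_image p \<inter> inside (path_image r \<union> path_image s) \<noteq> {}"
      "arc p" "pathstart p = a" "pathfinish p = b" "arc r" "arc s"
      "pathstart r = a" "pathfinish r = b" "pathstart s = a" "pathfinish s = b"
      "path_image r \<inter> path_image s = {a, b}"
      "path_image r \<inter> path_image p = {a, b}" "path_image s \<inter> path_image p = {a, b}"
    for p r s :: "real \<Rightarrow> complex"
  proof (rule ccontr)
    assume out: "\<not> ?thesis"
    let ?I = "inside (path_image r \<union> path_image s)"
    have "connected (path_image p - {a, b})"
      using connected_simple_path_endless[OF arc_imp_simple_path[OF that(2)]] that by simp
    moreover have "(path_image p - {a, b}) \<inter> ?I \<noteq> {}"
      using that(1) inside_no_overlap[of "path_image r \<union> path_image s"] that(11) by blast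
    ultimately have "(path_image p - {a, b}) \<inter> frontier ?I \<noteq> {}"
      using out by (intro connected_Int_frontier) auto
    moreover have "frontier ?I = path_image r \<union> path_image s" using that(5-11) by (simp add: jordan(4))
    ultimately show False using that(12,13) by blast
  qed
  \<comment> \<open>Two overlapping insides that do not meet each other's frontiers are equal by
    connectedness, so their boundary curves would agree.\<close>
  have diff: "path_image s \<inter> inside (path_image p \<union> path_image r) \<noteq> {} \<or>
        path_image r \<inter> inside (path_image p \<union> path_image s) \<noteq> {}"
    if "inside (path_image p \<union> path_image r) \<inter> inside (path_image p \<union> path_image s) \<noteq> {}"
      "arc p" "arc r" "arc s" "pathstart p = a" "pathfinish p = b"
      "pathstart r = a" "pathfinish r = b" "pathstart s = a" "pathfinish s = b"
      "path_image p \<inter> path_image r = {a, b}" "path_image p \<inter> path_image s = {a, b}"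
      "path_image r \<inter> path_image s = {a, b}" "path_image r \<noteq> {a, b}"
    for p r s :: "real \<Rightarrow> complex"
  proof (rule ccontr)
    assume no: "\<not> ?thesis"
    let ?I = "inside (path_image p \<union> path_image r)" and ?J = "inside (path_image p \<union> path_image s)"
    have fr: "frontier ?I = path_image p \<union> path_image r" "frontier ?J = path_image p \<union> path_image s"
      using that(2-13) by (simp_all add: jordan(4))
    have "?I \<inter> frontier ?J = {}" "?J \<inter> frontier ?I = {}"
      unfolding fr using no inside_no_overlap[of "path_image p \<union> path_image r"]
        inside_no_overlap[of "path_image p \<union> path_image s"] by blast+
    moreover have "connected ?I" "connected ?J" using that(2-13) by (simp_all add: jordan(2))
    ultimately have "?I - ?J = {}" "?J - ?I = {}"
      using that(1) connected_Int_frontier[of ?I ?J] connected_Int_frontier[of ?J ?I]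
      by (metis Int_commute)+
    hence "?I = ?J" by (simp add: Diff_eq_empty_iff subset_antisym)
    hence "path_image p \<union> path_image r = path_image p \<union> path_image s"
      using fr by metis
    hence "path_image r = {a, b}" using that(11-13) by blast
    thus False using that(14) by simp
  qed
  obtain z where z: "z \<in> inside (path_image c1 \<union> path_image c2)"
    using jordan(3)[OF arcs(1,2) ends(1-4) I12] by blast
  show ?thesis
  proof (cases "path_image c3 \<inter> inside (path_image c1 \<union> path_image c2) = {}")
    case False
    thus ?thesis using endless[of c3 c1 c2] arcs ends I12 I13 I23 by simp
  next
    case True
    hence z': "z \<notin> path_image c1" "z \<notin> path_image c2" "z \<notin> path_image c3"
      using z inside_no_overlap[of "path_image c1 \<union> path_image c2"] by blast+
    \<comment> \<open>At \<open>z\<close> the arcs \<open>c1\<close> and \<open>c2\<close> have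
      different winding numbers, so that of \<open>c3\<close> differs from one of the two.\<close>
    have "z \<in> inside (path_image c1 \<union> path_image c3) \<or> z \<in> inside (path_image c2 \<union> path_image c3)"
      using wn_in[OF arcs(1,2) ends(1-4) I12 z] wn_out[OF arcs(1,3) ends(1,2,5,6) I13 _ z'(1,3)]
        wn_out[OF arcs(2,3) ends(3-6) I23 _ z'(2,3)] by metis
    thus ?thesis
    proof
      assume "z \<in> inside (path_image c1 \<union> path_image c3)"
      hence "path_image c2 \<inter> inside (path_image c1 \<union> path_image c3) \<noteq> {}"
        using diff[of c1 c2 c3] z True arcs ends I12 I13 I23 ne by auto
      thus ?thesis using endless[of c2 c1 c3] arcs ends I12 I13 I23 by (simp add: Int_commute)
    next
      assume "z \<in> inside (path_image c2 \<union> path_image c3)"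
      hence "path_image c1 \<inter> inside (path_image c2 \<union> path_image c3) \<noteq> {}"
        using diff[of c2 c1 c3] z True arcs ends I12 I13 I23 ne
        by (auto simp: Un_commute[of "path_image c2" "path_image c1"] Int_commute[of "path_image c2" "path_image c1"])
      thus ?thesis using endless[of c1 c2 c3] arcs ends I12 I13 I23 by (simp add: Int_commute)
    qed
  qed
qed

text \<open>The inside of \<open>S\<close> is open and disjoint from \<open>outside S\<close>, which
  contains \<open>outside K\<close>.\<close>

lemma inside_not_outer:
  assumes "closed S" "S \<subseteq> K" "x \<in> inside S"
  shows "x \<notin> frontier (outside (K :: complex set))"
proof
  assume "x \<in> frontier (outside K)"
  hence "x \<in> closure (outside K)" by (simp add: frontier_def)
  hence "inside S \<inter> outside K \<noteq> {}"
    using open_inside[OF assms(1)] assms(3) by (meson disjoint_iff closure_iff_nhds_not_empty open_Int_closure_eq_empty)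
  thus False using outside_mono[OF assms(2)] inside_Int_outside[of S] by blast
qed

text \<open>The arcs form a subdivision of \<open>K_{2,3}\<close> with one marked point on each arc;
  the marked point of the enclosed arc is hidden from the outer face.\<close>

lemma theta_not_outer:
  fixes c1 c2 c3 :: "real \<Rightarrow> complex"
  assumes arcs: "arc c1" "arc c2" "arc c3"
    and ends: "pathstart c1 = a" "pathfinish c1 = b" "pathstart c2 = a" "pathfinish c2 = b"
      "pathstart c3 = a" "pathfinish c3 = b"
    and I12: "path_image c1 \<inter> path_image c2 = {a, b}"
    and I13: "path_image c1 \<inter> path_image c3 = {a, b}"
    and I23: "path_image c2 \<inter> path_image c3 = {a, b}"
    and m: "m1 \<in> path_image c1 - {a, b}" "m2 \<in> path_image c2 - {a, b}" "m3 \<in> path_image c3 - {a, b}"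
    and K: "path_image c1 \<union> path_image c2 \<union> path_image c3 \<subseteq> K"
  shows "\<not> {m1, m2, m3} \<subseteq> frontier (outside K)"
proof -
  have cl: "closed (path_image c1)" "closed (path_image c2)" "closed (path_image c3)"
    using arcs by (simp_all add: arc_imp_path closed_path_image)
  have "m3 \<in> inside (path_image c1 \<union> path_image c2) \<or> m2 \<in> inside (path_image c1 \<union> path_image c3)
       \<or> m1 \<in> inside (path_image c2 \<union> path_image c3)"
    using theta_inside[OF arcs ends I12 I13 I23] m by blast
  thus ?thesis
    using inside_not_outer[of "path_image c1 \<union> path_image c2" K m3]
      inside_not_outer[of "path_image c1 \<union> path_image c3" K m2]
      inside_not_outer[of "path_image c2 \<union> path_image c3" K m1] K cl by auto
qed

text \<open>Used to pass from an open arc confined to a region to the position of its two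
  ends.\<close>

lemma closure_arc_endless:
  fixes g :: "real \<Rightarrow> complex"
  assumes "arc g"
  shows "closure (path_image g - {pathstart g, pathfinish g}) = path_image g"
proof
  show "closure (path_image g - {pathstart g, pathfinish g}) \<subseteq> path_image g"
    by (intro closure_minimal closed_path_image arc_imp_path assms) auto
  have cont: "continuous_on (closure {0<..<1}) g"
    using arc_imp_path[OF assms] by (simp add: path_def)
  have "path_image g = g ` closure {0<..<1}" by (simp add: path_image_def)
  also have "\<dots> \<subseteq> closure (g ` {0<..<1})"
    by (rule image_closure_subset[OF cont]) (auto intro: closure_subset[THEN subsetD])
  also have "g ` {0<..<1} = path_image g - {pathstart g, pathfinish g}"
    by (simp add: simple_path_endless[OF arc_imp_simple_path[OF assms]])
  finally show "path_image g \<subseteq> closure (path_image g - {pathstart g, pathfinish g})" .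
qed

text \<open>\<open>p1\<close> and \<open>p2\<close> are the halves of a cycle between
  \<open>a\<close> and \<open>c\<close>, \<open>q1\<close> and \<open>q2\<close> the halves of the
  same cycle between \<open>b\<close> and \<open>d\<close>; with the crossing chords
  \<open>p3\<close> and \<open>e\<close> this is a subdivision of \<open>K_4\<close>. Both chords
  must run inside the cycle. There \<open>p3\<close> separates a region on the side of
  \<open>b\<close> from one on the side of \<open>d\<close>, and \<open>e\<close> would have to
  reach both.\<close>

lemma crossing_not_outer:
  fixes p1 p2 p3 q1 q2 e :: "real \<Rightarrow> complex"
  assumes arcs: "arc p1" "arc p2" "arc p3" "arc q1" "arc q2" "arc e"
    and p: "pathstart p1 = a" "pathfinish p1 = c" "pathstart p2 = a" "pathfinish p2 = c"
      "pathstart p3 = a" "pathfinish p3 = c"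
    and q: "pathstart q1 = b" "pathfinish q1 = d" "pathstart q2 = b" "pathfinish q2 = d"
      "pathstart e = b" "pathfinish e = d"
    and ip: "path_image p1 \<inter> path_image p2 = {a, c}" "path_image p1 \<inter> path_image p3 = {a, c}"
      "path_image p2 \<inter> path_image p3 = {a, c}"
    and iq: "path_image q1 \<inter> path_image q2 = {b, d}" "path_image q1 \<inter> path_image e = {b, d}"
      "path_image q2 \<inter> path_image e = {b, d}"
    and pq: "path_image p1 \<union> path_image p2 = path_image q1 \<union> path_image q2"
    and pe: "path_image p3 \<inter> path_image e = {}"
    and mem: "b \<in> path_image p1 - {a, c}" "d \<in> path_image p2 - {a, c}"
      "a \<in> path_image q1 - {b, d}" "c \<in> path_image q2 - {b, d}"
    and K: "path_image p1 \<union> path_image p2 \<union> path_image p3 \<union> path_image e \<subseteq> K"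
  shows "\<not> {a, b, c, d} \<subseteq> frontier (outside K)"
proof
  assume out: "{a, b, c, d} \<subseteq> frontier (outside K)"
  have cl: "closed (path_image g)" if "arc g" for g :: "real \<Rightarrow> complex"
    using that by (simp add: arc_imp_path closed_path_image)
  have ne: "path_image g \<noteq> {x, y}" if "arc g" for g :: "real \<Rightarrow> complex" and x y
  proof
    assume "path_image g = {x, y}"
    hence "connected {x, y}" "finite {x,y}"
      using connected_path_image[OF arc_imp_path[OF that]] by auto
    hence "card {x,y} \<le> 1" by (metis connected_finite_iff_sing card.empty card_1_singleton_iff le_zero_eq nat_le_linear order_refl One_nat_def is_singletonI is_singleton_altdef)
    hence "x = y" by (auto simp: card_insert_if split: if_splits)
    moreover have "pathstart g \<in> path_image g" "pathfinish g \<in> path_image g" by auto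
    ultimately show False using arc_distinct_ends[OF that] \<open>path_image g = {x, y}\<close> by auto
  qed
  have no: "x \<notin> inside S" if "x \<in> {a,b,c,d}" "closed S" "S \<subseteq> K" for x S
    using inside_not_outer[OF that(2,3)] out that(1) by blast
  \<comment> \<open>The other two cases of \<open>theta_inside\<close> would put \<open>d\<close> or
    \<open>b\<close> strictly inside a closed curve of the drawing, away from the outer
    face.\<close>
  have p3: "path_image p3 - {a, c} \<subseteq> inside (path_image p1 \<union> path_image p2)"
    using theta_inside[OF arcs(1,2,3) p ip(1,2,3) ne ne ne] arcs K mem
      no[of d "path_image p1 \<union> path_image p3"] no[of b "path_image p2 \<union> path_image p3"] cl
    by blast
  have e: "path_image e - {b, d} \<subseteq> inside (path_image q1 \<union> path_image q2)"
    using theta_inside[OF arcs(4,5,6) q iq(1,2,3) ne ne ne] arcs K mem pq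
      no[of c "path_image q1 \<union> path_image e"] no[of a "path_image q2 \<union> path_image e"] cl
    by blast
  have "path_image p3 - {a, c} \<noteq> {}" "path_image e - {b, d} \<noteq> {}"
    using ne[OF arcs(3), of a c] ip ne[OF arcs(6), of b d] iq by blast+
  then obtain t where "path_image p3 \<inter> inside (path_image p1 \<union> path_image p2) \<noteq> {}"
    and t: "t \<in> path_image e - {b, d}" using p3 by blast
  then have split: "inside (path_image p1 \<union> path_image p3) \<inter> inside (path_image p2 \<union> path_image p3) = {}"
     "inside (path_image p1 \<union> path_image p3) \<union> inside (path_image p2 \<union> path_image p3) \<union>
        (path_image p3 - {a, c}) = inside (path_image p1 \<union> path_image p2)"
    using split_inside_simple_closed_curve[of p1 a c p2 p3] arcs p ip arc_distinct_ends[OF arcs(1)]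
    by (auto simp: arc_imp_simple_path)
  let ?I = "inside (path_image p1 \<union> path_image p3)" and ?J = "inside (path_image p2 \<union> path_image p3)"
  have cov: "path_image e - {b, d} \<subseteq> ?I \<union> ?J"
  proof
    fix x assume x: "x \<in> path_image e - {b, d}"
    hence "x \<in> inside (path_image p1 \<union> path_image p2)" using e pq by (metis subsetD)
    moreover have "x \<notin> path_image p3" using x pe by blast
    ultimately show "x \<in> ?I \<union> ?J" using split(2) by (metis DiffD1 UnE)
  qed
  have "connected (path_image e - {b, d})"
    using connected_simple_path_endless[OF arc_imp_simple_path[OF arcs(6)]] q by simp
  moreover have "open ?I" "open ?J" using cl arcs by (auto intro!: open_inside)
  ultimately have sub: "path_image e - {b, d} \<subseteq> ?I \<or> path_image e - {b, d} \<subseteq> ?J"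
  proof -
    assume c: "connected (path_image e - {b, d})" "open ?I" "open ?J"
    have "?I \<inter> (path_image e - {b, d}) = {} \<or> ?J \<inter> (path_image e - {b, d}) = {}"
      by (rule connectedD[OF c _ cov]) (simp add: split(1))
    thus ?thesis using cov by blast
  qed
  have cl_e: "closure (path_image e - {b, d}) = path_image e"
    using closure_arc_endless[OF arcs(6)] q by simp
  have cl_IJ: "closure ?I \<subseteq> ?I \<union> (path_image p1 \<union> path_image p3)"
    "closure ?J \<subseteq> ?J \<union> (path_image p2 \<union> path_image p3)"
    using closure_inside_subset[of "path_image p1 \<union> path_image p3"]
      closure_inside_subset[of "path_image p2 \<union> path_image p3"] cl arcs by auto
  have bd: "b \<in> path_image e" "d \<in> path_image e" using q pathstart_in_path_image pathfinish_in_path_image by metis+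
  have nbd: "b \<notin> ?I" "b \<notin> ?J" "d \<notin> ?I" "d \<notin> ?J"
    by (rule no; use cl arcs K in auto)+
  from sub show False
  proof
    \<comment> \<open>The closure of the open chord adds only boundary points of its region:
      \<open>d\<close> would lie on \<open>p1\<close> or \<open>p3\<close>, where it is not.\<close>
    assume "path_image e - {b, d} \<subseteq> ?I"
    from closure_mono[OF this] have "d \<in> path_image p1 \<union> path_image p3"
      using cl_e cl_IJ(1) bd(2) nbd(3) by blast
    thus False using mem(2) ip(1) pe bd(2) by blast
  next
    assume "path_image e - {b, d} \<subseteq> ?J"
    from closure_mono[OF this] have "b \<in> path_image p2 \<union> path_image p3"
      using cl_e cl_IJ(2) bd(1) nbd(2) by blast
    thus False using mem(1) ip(1) pe bd(1) by blast
  qed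
qed

section \<open>Paths of a graph and their arcs in a drawing\<close>

definition gpath :: "'a set set \<Rightarrow> 'a list \<Rightarrow> bool" where
  "gpath E xs \<longleftrightarrow> distinct xs \<and> successively (\<lambda>u v. {u, v} \<in> E) xs"

fun pedges :: "'a list \<Rightarrow> 'a set set" where
  "pedges (x # y # ys) = insert {x, y} (pedges (y # ys))"
| "pedges _ = {}"

lemma pedges_append: "pedges (xs @ x # ys) = pedges (xs @ [x]) \<union> pedges (x # ys)"
  by (induction xs rule: pedges.induct) auto

lemma pedges_rev: "pedges (rev xs) = pedges xs"
proof (induction xs rule: pedges.induct)
  case (1 x y ys)
  have "pedges (rev (x # y # ys)) = pedges (rev ys @ [y]) \<union> pedges [y, x]"
    by (simp add: pedges_append[of "rev ys" y "[x]"])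
  thus ?case using 1 by (auto simp: insert_commute)
qed auto

lemma Union_pedges: "length xs \<ge> 2 \<Longrightarrow> \<Union> (pedges xs) = set xs"
proof (induction xs rule: pedges.induct)
  case (1 x y ys)
  thus ?case by (cases ys) auto
qed auto

lemma Union_pedges_subset: "\<Union> (pedges xs) \<subseteq> set xs"
  by (induction xs rule: pedges.induct) auto

lemma pedges_subset: "successively (\<lambda>u v. {u, v} \<in> E) xs \<Longrightarrow> pedges xs \<subseteq> E"
  by (induction xs rule: pedges.induct) auto

lemma pedges_meet: "e \<in> pedges (a # P @ [b]) \<Longrightarrow> P \<noteq> [] \<Longrightarrow> e \<inter> set P \<noteq> {}"
proof (induction P arbitrary: a)
  case (Cons p P)
  show ?case
  proof (cases "P = []")
    case False
    thus ?thesis using Cons.IH[of p] Cons.prems by auto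
  qed (use Cons.prems in auto)
qed auto

text \<open>Each edge of the first path has an end in \<open>P\<close>, and the second path avoids
  \<open>P\<close>.\<close>

lemma pedges_disjoint:
  assumes "set P \<inter> (set Q \<union> {a, b}) = {}" "P \<noteq> []"
  shows "pedges (a # P @ [b]) \<inter> pedges (a # Q @ [b]) = {}"
proof -
  have "e \<notin> pedges (a # Q @ [b])" if "e \<in> pedges (a # P @ [b])" for e
    using pedges_meet[OF that assms(2)] Union_pedges_subset[of "a # Q @ [b]"] assms(1) by auto
  thus ?thesis by blast
qed

text \<open>Arcs of different edges meet only in common ends, so disjoint edge sets meet only in
  common vertices.\<close>

lemma embedding_Int:
  assumes "plane_embedding V E pos \<gamma>" "S \<subseteq> E" "T \<subseteq> E" "S \<inter> T = {}"
  shows "(\<Union>e\<in>S. path_image (\<gamma> e)) \<inter> (\<Union>e\<in>T. path_image (\<gamma> e)) = pos ` (\<Union>S \<inter> \<Union>T)" (is "?L = ?R")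
proof -
  have *: "path_image (\<gamma> e) \<inter> path_image (\<gamma> f) = pos ` (e \<inter> f)" if "e \<in> S" "f \<in> T" for e f
    using assms that unfolding plane_embedding_def by (metis disjoint_iff subsetD)
  have "?L = (\<Union>e\<in>S. \<Union>f\<in>T. path_image (\<gamma> e) \<inter> path_image (\<gamma> f))" by blast
  also have "\<dots> = (\<Union>e\<in>S. \<Union>f\<in>T. pos ` (e \<inter> f))" using * by simp
  also have "\<dots> = ?R" by blast
  finally show ?thesis .
qed

lemma embedding_endpoints:
  assumes "plane_embedding V E pos \<gamma>" "e \<in> E"
  shows "pos ` e \<subseteq> path_image (\<gamma> e)"
proof -
  have "{pathstart (\<gamma> e), pathfinish (\<gamma> e)} = pos ` e" using assms by (auto simp: plane_embedding_def)
  thus ?thesis by (metis empty_subsetI insert_subset pathfinish_in_path_image pathstart_in_path_image)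
qed

lemma successively_join:
  "successively P (xs @ [a]) \<Longrightarrow> successively P (a # ys) \<Longrightarrow> successively P (xs @ a # ys)"
  by (simp add: successively_append_iff)

text \<open>The arc of an edge may be directed either way and is reversed where necessary.
  Consecutive pieces share exactly the vertex between them, because the path repeats no
  vertex.\<close>

lemma gpath_arc:
  assumes "plane_embedding V E pos \<gamma>" "gpath E xs" "length xs \<ge> 2"
  shows "\<exists>g. arc g \<and> pathstart g = pos (hd xs) \<and> pathfinish g = pos (last xs) \<and>
             path_image g = (\<Union>e\<in>pedges xs. path_image (\<gamma> e))"
  using assms(2,3)
proof (induction xs rule: pedges.induct)
  case (1 x y ys)
  have e: "{x, y} \<in> E" using 1 by (auto simp: gpath_def)
  have "arc (\<gamma> {x, y})" "{pathstart (\<gamma> {x, y}), pathfinish (\<gamma> {x, y})} = {pos x, pos y}"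
    using assms(1) e unfolding plane_embedding_def by auto
  then obtain h where h: "arc h" "pathstart h = pos x" "pathfinish h = pos y"
      "path_image h = path_image (\<gamma> {x, y})"
    by (metis arc_reversepath doubleton_eq_iff path_image_reversepath pathfinish_reversepath
        pathstart_reversepath)
  show ?case
  proof (cases "ys = []")
    case True
    thus ?thesis using h by (intro exI[of _ h]) simp
  next
    case False
    have "gpath E (y # ys)" using 1 by (auto simp: gpath_def)
    moreover have len: "length (y # ys) \<ge> 2" using False by (cases ys) auto
    ultimately obtain g where g: "arc g" "pathstart g = pos y" "pathfinish g = pos (last ys)"
      "path_image g = (\<Union>e\<in>pedges (y # ys). path_image (\<gamma> e))" using 1(1) False by auto
    have sub: "pedges (y # ys) \<subseteq> E" using 1 by (intro pedges_subset) (auto simp: gpath_def)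
    have notin: "{x, y} \<notin> pedges (y # ys)" using Union_pedges_subset[of "y # ys"] 1(2) by (auto simp: gpath_def)
    have "path_image h \<inter> path_image g = (\<Union>e\<in>{{x, y}}. path_image (\<gamma> e)) \<inter> (\<Union>e\<in>pedges (y # ys). path_image (\<gamma> e))"
      using h g by simp
    also have "\<dots> = pos ` ({x, y} \<inter> set (y # ys))"
      using embedding_Int[OF assms(1), of "{{x, y}}" "pedges (y # ys)"] e sub notin Union_pedges[OF len] by auto
    also have "\<dots> = {pos y}" using 1(2) by (auto simp: gpath_def)
    finally have "arc (h +++ g)" using h g by (intro arc_join) auto
    thus ?thesis using h g False by (intro exI[of _ "h +++ g"]) (simp add: path_image_join)
  qed
qed auto

text \<open>A subdivision of \<open>K_{2,3}\<close> in the graph becomes three arcs; the first inner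
  vertex of each path serves as its marked point.\<close>

lemma outerplanar_no_theta:
  assumes sg: "simple_graph V E" and op: "outerplanar V E"
    and P: "gpath E (a # P @ [b])" and Q: "gpath E (a # Q @ [b])" and R: "gpath E (a # R @ [b])"
    and ne: "P \<noteq> []" "Q \<noteq> []" "R \<noteq> []"
    and disj: "set P \<inter> set Q = {}" "set P \<inter> set R = {}" "set Q \<inter> set R = {}"
  shows False
proof -
  obtain pos \<gamma> where emb: "plane_embedding V E pos \<gamma>"
    and out: "pos ` V \<subseteq> frontier (outside (drawing V E pos \<gamma>))"
    using op by (auto simp: outerplanar_def)
  have "\<exists>g. arc g \<and> pathstart g = pos a \<and> pathfinish g = pos b \<and>
             path_image g = (\<Union>e\<in>pedges (a # X @ [b]). path_image (\<gamma> e))"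
    if "gpath E (a # X @ [b])" for X using gpath_arc[OF emb that] by simp
  then obtain g where g: "\<And>X. gpath E (a # X @ [b]) \<Longrightarrow> arc (g X) \<and> pathstart (g X) = pos a \<and> pathfinish (g X) = pos b \<and>
             path_image (g X) = (\<Union>e\<in>pedges (a # X @ [b]). path_image (\<gamma> e))" by metis
  have sub: "pedges (a # X @ [b]) \<subseteq> E" if "gpath E (a # X @ [b])" for X
    using that by (intro pedges_subset) (auto simp: gpath_def)
  have un: "\<Union> (pedges (a # X @ [b])) = {a, b} \<union> set X" for X
    using Union_pedges[of "a # X @ [b]"] by auto
  have inV: "{a, b} \<union> set X \<subseteq> V" if "gpath E (a # X @ [b])" for X
  proof -
    have "\<Union> (pedges (a # X @ [b])) \<subseteq> V"
      using sub[OF that] sg unfolding simple_graph_def by blast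
    thus ?thesis unfolding un .
  qed
  have int: "path_image (g X) \<inter> path_image (g Y) = {pos a, pos b}"
    if "gpath E (a # X @ [b])" "gpath E (a # Y @ [b])" "set X \<inter> set Y = {}" "X \<noteq> []" for X Y
  proof -
    have "set X \<inter> (set Y \<union> {a, b}) = {}" using that by (auto simp: gpath_def)
    from pedges_disjoint[OF this that(4)]
    have "path_image (g X) \<inter> path_image (g Y) = pos ` (\<Union> (pedges (a # X @ [b])) \<inter> \<Union> (pedges (a # Y @ [b])))"
      using embedding_Int[OF emb sub[OF that(1)] sub[OF that(2)]] g[OF that(1)] g[OF that(2)] by simp
    also have "\<dots> = {pos a, pos b}" unfolding un using that by auto
    finally show ?thesis .
  qed
  have mem: "pos (hd X) \<in> path_image (g X) - {pos a, pos b}" "hd X \<in> V"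
    if "gpath E (a # X @ [b])" "X \<noteq> []" for X
  proof -
    have h: "hd X \<in> set X" using that by simp
    then obtain e where e: "e \<in> pedges (a # X @ [b])" "hd X \<in> e" using un[of X] by auto
    hence "e \<in> E" using sub[OF that(1)] by auto
    hence "pos ` e \<subseteq> path_image (\<gamma> e)" by (rule embedding_endpoints[OF emb])
    hence "pos (hd X) \<in> path_image (g X)" using g[OF that(1)] e by auto
    moreover have "inj_on pos V" using emb by (simp add: plane_embedding_def)
    hence "pos (hd X) \<noteq> pos a" "pos (hd X) \<noteq> pos b"
      using inV[OF that(1)] h that(1) by (auto simp: gpath_def dest!: inj_onD)
    ultimately show "pos (hd X) \<in> path_image (g X) - {pos a, pos b}" by simp
    show "hd X \<in> V" using inV[OF that(1)] h by auto
  qed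
  have "path_image (g X) \<subseteq> drawing V E pos \<gamma>" if "gpath E (a # X @ [b])" for X
    using g[OF that] sub[OF that] by (auto simp: drawing_def)
  hence dr: "path_image (g P) \<union> path_image (g Q) \<union> path_image (g R) \<subseteq> drawing V E pos \<gamma>"
    using P Q R by simp
  have "\<not> {pos (hd P), pos (hd Q), pos (hd R)} \<subseteq> frontier (outside (drawing V E pos \<gamma>))"
    using theta_not_outer[of "g P" "g Q" "g R" "pos a" "pos b", OF _ _ _ _ _ _ _ _ _ int[OF P Q disj(1) ne(1)]
        int[OF P R disj(2) ne(1)] int[OF Q R disj(3) ne(2)] mem(1)[OF P ne(1)] mem(1)[OF Q ne(2)]
        mem(1)[OF R ne(3)] dr] g[OF P] g[OF Q] g[OF R] by blast
  thus False using out mem(2)[OF P ne(1)] mem(2)[OF Q ne(2)] mem(2)[OF R ne(3)] by auto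
qed

text \<open>The four vertices cut the cycle into edge sets \<open>A\<close>, \<open>B\<close>,
  \<open>C\<close>, \<open>D\<close>. Grouped as \<open>A \<union> B\<close> and
  \<open>C \<union> D\<close> they are its halves between \<open>a\<close> and \<open>c\<close>,
  grouped as \<open>D \<union> A\<close> and \<open>B \<union> C\<close> those between
  \<open>b\<close> and \<open>d\<close>.\<close>

lemma outerplanar_no_crossing:
  assumes sg: "simple_graph V E" and op: "outerplanar V E"
    and dist: "distinct (a # P @ b # Q @ c # R @ d # S)"
    and walk: "successively (\<lambda>u v. {u, v} \<in> E) (a # P @ b # Q @ c # R @ d # S @ [a])"
    and ch: "{a, c} \<in> E" "{b, d} \<in> E"
  shows False
proof -
  obtain pos \<gamma> where emb: "plane_embedding V E pos \<gamma>"
    and out: "pos ` V \<subseteq> frontier (outside (drawing V E pos \<gamma>))"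
    using op by (auto simp: outerplanar_def)
  have sym: "(\<lambda>u v. {v, u} \<in> E) = (\<lambda>u v. {u, v} \<in> E)" by (auto simp: insert_commute)
  let ?s = "successively (\<lambda>u v. {u, v} \<in> E)"
  have w: "?s ((a # P @ [b]) @ Q @ c # R @ d # S @ [a])" "?s ((a # P) @ (b # Q @ [c]) @ R @ d # S @ [a])"
     "?s ((a # P @ b # Q) @ (c # R @ [d]) @ S @ [a])" "?s ((a # P @ b # Q @ c # R) @ (d # S @ [a]))"
     "?s ((a # P @ b # Q @ [c]) @ R @ d # S @ [a])" "?s ((a # P @ b # Q) @ (c # R @ d # S @ [a]))"
     "?s ((a # P) @ (b # Q @ c # R @ [d]) @ S @ [a])"
    using walk by simp_all
  have s: "?s (a # P @ [b])" "?s (b # Q @ [c])" "?s (c # R @ [d])" "?s (d # S @ [a])"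
    "?s (a # P @ b # Q @ [c])" "?s (c # R @ d # S @ [a])" "?s (b # Q @ c # R @ [d])"
    using w by (simp_all only: successively_append_iff)
  have s8: "?s (d # S @ a # P @ [b])"
    using successively_join[of _ "d # S" a "P @ [b]"] s(1,4) by simp
  have r: "?s (rev (c # R @ d # S @ [a]))" "?s (rev (d # S @ a # P @ [b]))"
    using s(6) s8 by (simp_all only: successively_rev sym)
  have gp: "gpath E (a # P @ b # Q @ [c])" "gpath E (a # rev S @ d # rev R @ [c])" "gpath E [a, c]"
    "gpath E (b # rev P @ a # rev S @ [d])" "gpath E (b # Q @ c # R @ [d])" "gpath E [b, d]"
    using s(5,7) r ch dist by (auto simp: gpath_def)
  define A where "A = pedges (a # P @ [b])"
  define B where "B = pedges (b # Q @ [c])"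
  define C where "C = pedges (c # R @ [d])"
  define D where "D = pedges (d # S @ [a])"
  have sub: "A \<subseteq> E" "B \<subseteq> E" "C \<subseteq> E" "D \<subseteq> E"
    unfolding A_def B_def C_def D_def by (intro pedges_subset s)+
  have un: "\<Union>A = {a, b} \<union> set P" "\<Union>B = {b, c} \<union> set Q" "\<Union>C = {c, d} \<union> set R" "\<Union>D = {d, a} \<union> set S"
    unfolding A_def B_def C_def D_def by (subst Union_pedges; auto)+
  have pe: "pedges (a # P @ b # Q @ [c]) = A \<union> B" "pedges (c # R @ d # S @ [a]) = C \<union> D"
      "pedges (d # S @ a # P @ [b]) = D \<union> A" "pedges (b # Q @ c # R @ [d]) = B \<union> C"
    unfolding A_def B_def C_def D_def
    using pedges_append[of "a # P" b "Q @ [c]"] pedges_append[of "c # R" d "S @ [a]"]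
      pedges_append[of "d # S" a "P @ [b]"] pedges_append[of "b # Q" c "R @ [d]"] by simp_all
  have pe': "pedges (a # rev S @ d # rev R @ [c]) = C \<union> D" "pedges (b # rev P @ a # rev S @ [d]) = D \<union> A"
    using pedges_rev[of "c # R @ d # S @ [a]"] pedges_rev[of "d # S @ a # P @ [b]"] pe by simp_all
  have dis: "A \<inter> B = {}" "A \<inter> C = {}" "A \<inter> D = {}" "B \<inter> C = {}" "B \<inter> D = {}" "C \<inter> D = {}"
    "{a, c} \<notin> A \<union> B \<union> C \<union> D" "{b, d} \<notin> A \<union> B \<union> C \<union> D"
  proof -
    have two: "\<exists>x y. e = {x, y} \<and> x \<noteq> y" if "e \<in> E" for e
      using sg that by (auto simp: simple_graph_def card_2_iff)
    \<comment> \<open>An edge has two ends, so edge sets whose vertex sets share at most one vertex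
      are disjoint.\<close>
    have *: "X \<inter> Y = {}" if "X \<subseteq> E" "\<Union>X \<inter> \<Union>Y \<subseteq> {x}" for X Y x
    proof (rule ccontr)
      assume "X \<inter> Y \<noteq> {}"
      then obtain e where e: "e \<in> X" "e \<in> Y" by blast
      hence "e \<subseteq> {x}" using that(2) by blast
      thus False using two[of e] e that(1) by blast
    qed
    show "A \<inter> B = {}" by (rule *[OF sub(1), of _ b]) (use un dist in auto)
    show "A \<inter> C = {}" by (rule *[OF sub(1), of _ b]) (use un dist in auto)
    show "A \<inter> D = {}" by (rule *[OF sub(1), of _ a]) (use un dist in auto)
    show "B \<inter> C = {}" by (rule *[OF sub(2), of _ c]) (use un dist in auto)
    show "B \<inter> D = {}" by (rule *[OF sub(2), of _ a]) (use un dist in auto)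
    show "C \<inter> D = {}" by (rule *[OF sub(3), of _ d]) (use un dist in auto)
    have **: "e \<notin> X" if "x \<in> e" "x \<notin> \<Union>X" for x e X using that by blast
    have "{a, c} \<notin> A" "{a, c} \<notin> D" by (rule **[of c]; use un dist in auto)+
    moreover have "{a, c} \<notin> B" "{a, c} \<notin> C" by (rule **[of a]; use un dist in auto)+
    ultimately show "{a, c} \<notin> A \<union> B \<union> C \<union> D" by simp
    have "{b, d} \<notin> A" "{b, d} \<notin> B" by (rule **[of d]; use un dist in auto)+
    moreover have "{b, d} \<notin> C" "{b, d} \<notin> D" by (rule **[of b]; use un dist in auto)+
    ultimately show "{b, d} \<notin> A \<union> B \<union> C \<union> D" by simp
  qed
  define im where "im X = (\<Union>e\<in>X. path_image (\<gamma> e))" for X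
  have int: "im X \<inter> im Y = pos ` (\<Union>X \<inter> \<Union>Y)" if "X \<subseteq> E" "Y \<subseteq> E" "X \<inter> Y = {}" for X Y
    unfolding im_def by (rule embedding_Int[OF emb that])
  obtain p1 where p1: "arc p1" "pathstart p1 = pos a" "pathfinish p1 = pos c" "path_image p1 = im (A \<union> B)"
    using gpath_arc[OF emb gp(1)] unfolding im_def pe by auto
  obtain p2 where p2: "arc p2" "pathstart p2 = pos a" "pathfinish p2 = pos c" "path_image p2 = im (C \<union> D)"
    using gpath_arc[OF emb gp(2)] unfolding im_def pe' by auto
  obtain p3 where p3: "arc p3" "pathstart p3 = pos a" "pathfinish p3 = pos c" "path_image p3 = im {{a, c}}"
    using gpath_arc[OF emb gp(3)] unfolding im_def by auto
  obtain q1 where q1: "arc q1" "pathstart q1 = pos b" "pathfinish q1 = pos d" "path_image q1 = im (D \<union> A)"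
    using gpath_arc[OF emb gp(4)] unfolding im_def pe' by auto
  obtain q2 where q2: "arc q2" "pathstart q2 = pos b" "pathfinish q2 = pos d" "path_image q2 = im (B \<union> C)"
    using gpath_arc[OF emb gp(5)] unfolding im_def pe by auto
  obtain e where e: "arc e" "pathstart e = pos b" "pathfinish e = pos d" "path_image e = im {{b, d}}"
    using gpath_arc[OF emb gp(6)] unfolding im_def by auto
  have V: "{a, b, c, d} \<subseteq> V" using ch sg by (auto simp: simple_graph_def)
  have "inj_on pos V" using emb by (simp add: plane_embedding_def)
  hence inj: "pos x \<noteq> pos y" if "x \<in> {a, b, c, d}" "y \<in> {a, b, c, d}" "x \<noteq> y" for x y
    using that V by (meson inj_onD subsetD)
  have im_Un: "im (X \<union> Y) = im X \<union> im Y" for X Y by (auto simp: im_def)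
  have mem: "pos x \<in> im X" if "x \<in> \<Union>X" "X \<subseteq> E" for x X
  proof -
    from that obtain f where f: "f \<in> X" "x \<in> f" by blast
    hence "pos ` f \<subseteq> path_image (\<gamma> f)" using that by (intro embedding_endpoints[OF emb]) auto
    thus ?thesis using f by (auto simp: im_def)
  qed
  have "\<not> {pos a, pos b, pos c, pos d} \<subseteq> frontier (outside (drawing V E pos \<gamma>))"
  proof (rule crossing_not_outer[OF p1(1) p2(1) p3(1) q1(1) q2(1) e(1) p1(2,3) p2(2,3) p3(2,3) q1(2,3) q2(2,3) e(2,3)];
      (unfold p1(4) p2(4) p3(4) q1(4) q2(4) e(4))?)
    show "im (A \<union> B) \<inter> im (C \<union> D) = {pos a, pos c}"
      by (subst int) (use sub dis un dist in auto)
    show "im (A \<union> B) \<inter> im {{a, c}} = {pos a, pos c}"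
      by (subst int) (use sub dis un dist ch in auto)
    show "im (C \<union> D) \<inter> im {{a, c}} = {pos a, pos c}"
      by (subst int) (use sub dis un dist ch in auto)
    show "im (D \<union> A) \<inter> im (B \<union> C) = {pos b, pos d}"
      by (subst int) (use sub dis un dist in auto)
    show "im (D \<union> A) \<inter> im {{b, d}} = {pos b, pos d}"
      by (subst int) (use sub dis un dist ch in auto)
    show "im (B \<union> C) \<inter> im {{b, d}} = {pos b, pos d}"
      by (subst int) (use sub dis un dist ch in auto)
    show "im (A \<union> B) \<union> im (C \<union> D) = im (D \<union> A) \<union> im (B \<union> C)" by (auto simp: im_Un)
    show "im {{a, c}} \<inter> im {{b, d}} = {}"
      by (subst int) (use ch dist in \<open>auto simp: doubleton_eq_iff\<close>)
    show "pos b \<in> im (A \<union> B) - {pos a, pos c}" "pos d \<in> im (C \<union> D) - {pos a, pos c}"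
      "pos a \<in> im (D \<union> A) - {pos b, pos d}" "pos c \<in> im (B \<union> C) - {pos b, pos d}"
      using dist sub un by (auto intro!: mem dest!: inj[rotated 2])
    show "im (A \<union> B) \<union> im (C \<union> D) \<union> im {{a, c}} \<union> im {{b, d}} \<subseteq> drawing V E pos \<gamma>"
      using sub ch by (auto simp: im_def drawing_def)
  qed
  thus False using out V by auto
qed

text \<open>\<open>f\<close> puts the vertices on a line, and the edges are drawn above it without crossings.\<close>

definition book :: "'a set \<Rightarrow> 'a set set \<Rightarrow> bool" where
  "book V E \<longleftrightarrow> (\<exists>f :: 'a \<Rightarrow> nat. inj_on f V \<and>
     (\<forall>a\<in>V. \<forall>b\<in>V. \<forall>c\<in>V. \<forall>d\<in>V. f a < f b \<longrightarrow> f b < f c \<longrightarrow> f c < f d \<longrightarrow> {a, c} \<in> E \<longrightarrow> {b, d} \<notin> E))"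

text \<open>Deleting vertices and edges enlarges the outside, so the remaining vertices stay in its
  closure, while they still lie in the drawing.\<close>

lemma outerplanar_subgraph:
  assumes "outerplanar V E" "V' \<subseteq> V" "E' \<subseteq> E" "simple_graph V' E'"
  shows "outerplanar V' E'"
proof -
  obtain pos \<gamma> where emb: "plane_embedding V E pos \<gamma>"
    and out: "pos ` V \<subseteq> frontier (outside (drawing V E pos \<gamma>))"
    using assms(1) by (auto simp: outerplanar_def)
  have inj: "inj_on pos V" using emb by (simp add: plane_embedding_def)
  have sub': "e \<subseteq> V'" if "e \<in> E'" for e using assms(4) that by (auto simp: simple_graph_def)
  have "plane_embedding V' E' pos \<gamma>"
    unfolding plane_embedding_def
  proof (intro conjI ballI impI)
    show "inj_on pos V'" using inj assms(2) by (rule inj_on_subset)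
    fix e assume e: "e \<in> E'"
    hence eE: "e \<in> E" using assms by auto
    thus "arc (\<gamma> e)" "{pathstart (\<gamma> e), pathfinish (\<gamma> e)} = pos ` e" using emb by (auto simp: plane_embedding_def)
    have "path_image (\<gamma> e) \<inter> pos ` V = pos ` e" using eE emb by (auto simp: plane_embedding_def)
    thus "path_image (\<gamma> e) \<inter> pos ` V' = pos ` e" using sub'[OF e] assms(2) by blast
    fix f assume "f \<in> E'" "e \<noteq> f"
    thus "path_image (\<gamma> e) \<inter> path_image (\<gamma> f) = pos ` (e \<inter> f)"
      using emb eE assms(3) unfolding plane_embedding_def by blast
  qed
  moreover have dsub: "drawing V' E' pos \<gamma> \<subseteq> drawing V E pos \<gamma>" using assms by (auto simp: drawing_def)
  have "pos ` V' \<subseteq> frontier (outside (drawing V' E' pos \<gamma>))"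
  proof
    fix x assume x: "x \<in> pos ` V'"
    hence "x \<in> closure (outside (drawing V E pos \<gamma>))" using out assms(2) by (auto simp: frontier_def)
    hence "x \<in> closure (outside (drawing V' E' pos \<gamma>))" using closure_mono[OF outside_mono[OF dsub]] by blast
    moreover have "x \<in> drawing V' E' pos \<gamma>" using x by (auto simp: drawing_def)
    hence "x \<notin> outside (drawing V' E' pos \<gamma>)" using outside_no_overlap by blast
    ultimately show "x \<in> frontier (outside (drawing V' E' pos \<gamma>))"
      using interior_subset by (auto simp: frontier_def)
  qed
  ultimately show ?thesis by (auto simp: outerplanar_def)
qed

text \<open>The order \<open>f\<close> becomes the abscissa on a convex curve, and edges become
  straight chords. Two such chords cross only if their ends alternate in the order, and every vertex
  can be approached from below the curve.\<close>

lemma book_imp_outerplanar: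
  assumes sg: "simple_graph V E" and bk: "book V E"
  shows "outerplanar V E"
proof -
  obtain f :: "'a \<Rightarrow> nat" where inj: "inj_on f V"
    and nc: "\<And>a b c d. a \<in> V \<Longrightarrow> b \<in> V \<Longrightarrow> c \<in> V \<Longrightarrow> d \<in> V \<Longrightarrow> f a < f b \<Longrightarrow> f b < f c \<Longrightarrow> f c < f d \<Longrightarrow>
        {a, c} \<in> E \<Longrightarrow> {b, d} \<notin> E"
    using bk unfolding book_def by blast
  define pos where "pos v = Complex (f v) ((f v)\<^sup>2)" for v
  \<comment> \<open>The points lie on the parabola, so every chord lies in its convex epigraph.\<close>
  have ex: "\<exists>x y. e = {x, y} \<and> f x < f y \<and> x \<in> V \<and> y \<in> V" if "e \<in> E" for e
  proof -
    obtain x y where xy: "e = {x, y}" "x \<noteq> y" using sg \<open>e \<in> E\<close> by (auto simp: simple_graph_def card_2_iff)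
    have "e \<subseteq> V" using sg \<open>e \<in> E\<close> by (auto simp: simple_graph_def)
    hence V: "x \<in> V" "y \<in> V" using xy by auto
    hence "f x \<noteq> f y" using inj xy by (auto dest: inj_onD)
    thus ?thesis using xy V by (metis insert_commute linorder_neqE_nat)
  qed
  define lo where "lo e = (SOME x. x \<in> V \<and> (\<exists>y\<in>V. e = {x, y} \<and> f x < f y))" for e
  define hi where "hi e = (SOME y. y \<in> V \<and> e = {lo e, y} \<and> f (lo e) < f y)" for e
  have lo: "lo e \<in> V \<and> (\<exists>y\<in>V. e = {lo e, y} \<and> f (lo e) < f y)" if "e \<in> E" for e
    unfolding lo_def by (rule someI_ex) (use ex[OF that] in blast)
  have "hi e \<in> V \<and> e = {lo e, hi e} \<and> f (lo e) < f (hi e)" if "e \<in> E" for e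
    unfolding hi_def by (rule someI_ex) (use lo[OF that] in blast)
  hence lh: "e = {lo e, hi e}" "f (lo e) < f (hi e)" "lo e \<in> V" "hi e \<in> V" if "e \<in> E" for e
    using that lo[OF that] by auto
  define \<gamma> where "\<gamma> e = linepath (pos (lo e)) (pos (hi e))" for e
  have pos_inj: "pos x = pos y \<longleftrightarrow> x = y" if "x \<in> V" "y \<in> V" for x y
    using inj that by (auto simp: pos_def dest: inj_onD)
  \<comment> \<open>\<open>h e\<close> is the affine function that vanishes on the line of the chord
    \<open>e\<close>; on the parabola it factors, so its sign tells whether a vertex lies between
    the ends of \<open>e\<close>.\<close>
  define h where "h e z = Im z - (real (f (lo e)) + f (hi e)) * Re z + real (f (lo e)) * f (hi e)" for e z
  have h_pos: "h e (pos v) = (real (f v) - f (lo e)) * (real (f v) - f (hi e))" for e v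
    by (simp add: h_def pos_def power2_eq_square algebra_simps)
  have h_conv: "h e ((1 - u) *\<^sub>R x + u *\<^sub>R y) = (1 - u) * h e x + u * h e y" for e x y u
    by (simp add: h_def algebra_simps)
  \<comment> \<open>A segment whose ends lie weakly on one side of the line of \<open>e\<close>
    meets this line only in an end lying on it, unless both ends do.\<close>
  have key: "z \<in> pos ` (e \<inter> g)"
    if e: "e \<in> E" and ze: "z \<in> path_image (\<gamma> e)" and "e \<noteq> g"
      and g: "x \<in> V" "y \<in> V" "g = {x, y}" and zg: "z \<in> closed_segment (pos x) (pos y)"
      and sgn: "(h e (pos x) \<ge> 0 \<and> h e (pos y) \<ge> 0) \<or> (h e (pos x) \<le> 0 \<and> h e (pos y) \<le> 0)"
    for e g z x y
  proof -
    have hz: "h e z = 0"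
      using ze h_conv h_pos unfolding \<gamma>_def path_image_linepath closed_segment_def by force
    obtain u where u: "0 \<le> u" "u \<le> 1" "z = (1 - u) *\<^sub>R pos x + u *\<^sub>R pos y"
      using zg by (auto simp: closed_segment_def)
    have eq: "(1 - u) * h e (pos x) + u * h e (pos y) = 0" using hz h_conv u by simp
    have "h e (pos v) = 0 \<Longrightarrow> v \<in> V \<Longrightarrow> v \<in> e" for v
    proof -
      assume "h e (pos v) = 0" "v \<in> V"
      hence "f v = f (lo e) \<or> f v = f (hi e)" by (simp add: h_pos)
      thus "v \<in> e" using lh[OF e] \<open>v \<in> V\<close> inj by (metis inj_onD insertCI)
    qed
    note z0 = this[OF _ g(1)] this[OF _ g(2)]
    have t: "(1 - u) * h e (pos x) = 0" "u * h e (pos y) = 0"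
      using eq sgn u by (smt (verit) mult_nonneg_nonneg mult_nonneg_nonpos)+
    consider "u = 0" | "u = 1" | "h e (pos x) = 0" "h e (pos y) = 0" using t by auto
    thus ?thesis
    proof cases
      case 1
      thus ?thesis using t z0 u g by auto
    next
      case 2
      thus ?thesis using t z0 u g by auto
    next
      case 3
      hence "x \<in> e" "y \<in> e" using z0 by auto
      moreover have "x \<noteq> y \<or> z = pos x" using u by (auto simp: algebra_simps)
      ultimately show ?thesis using \<open>e \<noteq> g\<close> g lh(1)[OF e] by (metis IntI image_eqI insertE insert_commute insertI1 singletonD)
    qed
  qed
  \<comment> \<open>Without crossing, one of the two chords has both ends weakly on one side of the
    other, so \<open>key\<close> applies in one of the two directions.\<close>
  have sign_cases: "((h e (pos (lo g)) \<ge> 0 \<and> h e (pos (hi g)) \<ge> 0) \<or> (h e (pos (lo g)) \<le> 0 \<and> h e (pos (hi g)) \<le> 0)) \<or>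
      ((h g (pos (lo e)) \<ge> 0 \<and> h g (pos (hi e)) \<ge> 0) \<or> (h g (pos (lo e)) \<le> 0 \<and> h g (pos (hi e)) \<le> 0))"
    if "e \<in> E" "g \<in> E" for e g
  proof -
    have "\<not> (f (lo e) < f (lo g) \<and> f (lo g) < f (hi e) \<and> f (hi e) < f (hi g))"
      using nc[of "lo e" "lo g" "hi e" "hi g"] lh that by metis
    moreover have "\<not> (f (lo g) < f (lo e) \<and> f (lo e) < f (hi g) \<and> f (hi g) < f (hi e))"
      using nc[of "lo g" "lo e" "hi g" "hi e"] lh that by metis
    moreover have "f (lo e) < f (hi e)" "f (lo g) < f (hi g)" using lh that by auto
    ultimately show ?thesis unfolding h_pos
      by (smt (verit) mult_nonneg_nonneg mult_nonneg_nonpos mult_nonpos_nonneg mult_nonpos_nonpos of_nat_less_iff)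
  qed
  have emb: "plane_embedding V E pos \<gamma>"
    unfolding plane_embedding_def
  proof (intro conjI ballI impI)
    show "inj_on pos V" using pos_inj by (auto intro: inj_onI)
    fix e assume e: "e \<in> E"
    have "lo e \<noteq> hi e" using lh(2)[OF e] by auto
    thus "arc (\<gamma> e)" using lh[OF e] pos_inj by (auto simp: \<gamma>_def)
    show "{pathstart (\<gamma> e), pathfinish (\<gamma> e)} = pos ` e" by (subst (3) lh(1)[OF e]) (simp add: \<gamma>_def)
    show "path_image (\<gamma> e) \<inter> pos ` V = pos ` e"
    proof
      show "pos ` e \<subseteq> path_image (\<gamma> e) \<inter> pos ` V"
      proof -
        have "pos ` {lo e, hi e} \<subseteq> path_image (\<gamma> e) \<inter> pos ` V" using lh(3,4)[OF e] by (auto simp: \<gamma>_def)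
        thus ?thesis using lh(1)[OF e] by metis
      qed
      show "path_image (\<gamma> e) \<inter> pos ` V \<subseteq> pos ` e"
      proof
        fix z assume "z \<in> path_image (\<gamma> e) \<inter> pos ` V"
        then obtain v where v: "v \<in> V" "z = pos v" "z \<in> path_image (\<gamma> e)" by blast
        \<comment> \<open>A vertex is treated as a degenerate segment, with
          \<open>g = {v}\<close>.\<close>
        have "e \<noteq> {v}" using lh(1,2)[OF e] by (metis insertCI insert_absorb less_irrefl singletonD)
        hence "z \<in> pos ` (e \<inter> {v})" using key[OF e v(3), of "{v}" v v] v linear[of 0 "h e (pos v)"] by simp
        thus "z \<in> pos ` e" by blast
      qed
    qed
    fix g assume g: "g \<in> E" "e \<noteq> g"
    show "path_image (\<gamma> e) \<inter> path_image (\<gamma> g) = pos ` (e \<inter> g)"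
    proof
      show "pos ` (e \<inter> g) \<subseteq> path_image (\<gamma> e) \<inter> path_image (\<gamma> g)"
        using lh(1)[OF e] lh(1)[OF g(1)] by (auto simp: \<gamma>_def)
          (metis ends_in_segment insertE singletonD)+
      show "path_image (\<gamma> e) \<inter> path_image (\<gamma> g) \<subseteq> pos ` (e \<inter> g)"
      proof
        fix z assume z: "z \<in> path_image (\<gamma> e) \<inter> path_image (\<gamma> g)"
        have ze: "z \<in> closed_segment (pos (lo e)) (pos (hi e))" "z \<in> closed_segment (pos (lo g)) (pos (hi g))"
          using z by (auto simp: \<gamma>_def)
        from sign_cases[OF e g(1)] show "z \<in> pos ` (e \<inter> g)"
        proof
          assume "(h e (pos (lo g)) \<ge> 0 \<and> h e (pos (hi g)) \<ge> 0) \<or> (h e (pos (lo g)) \<le> 0 \<and> h e (pos (hi g)) \<le> 0)"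
          thus ?thesis using key[OF e _ g(2) lh(3,4,1)[OF g(1)] ze(2)] z by blast
        next
          assume "(h g (pos (lo e)) \<ge> 0 \<and> h g (pos (hi e)) \<ge> 0) \<or> (h g (pos (lo e)) \<le> 0 \<and> h g (pos (hi e)) \<le> 0)"
          thus ?thesis using key[OF g(1) _ g(2)[symmetric] lh(3,4,1)[OF e] ze(1)] z by (auto simp: Int_commute)
        qed
      qed
    qed
  qed
  define C where "C = {z. (Re z)\<^sup>2 \<le> Im z}"
  have convC: "convex C"
  proof (rule convexI)
    fix x y :: complex and u v :: real
    assume *: "x \<in> C" "y \<in> C" "0 \<le> u" "0 \<le> v" "u + v = 1"
    have v: "v = 1 - u" using * by simp
    have "(u * Re x + v * Re y)\<^sup>2 = u * (Re x)\<^sup>2 + v * (Re y)\<^sup>2 - u * v * (Re x - Re y)\<^sup>2"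
      unfolding v by (simp add: power2_eq_square algebra_simps)
    also have "\<dots> \<le> u * (Re x)\<^sup>2 + v * (Re y)\<^sup>2" using * by simp
    also have "\<dots> \<le> u * Im x + v * Im y" using * by (intro add_mono mult_left_mono) (auto simp: C_def)
    finally show "u *\<^sub>R x + v *\<^sub>R y \<in> C" by (simp add: C_def)
  qed
  have posC: "pos v \<in> C" for v by (simp add: pos_def C_def)
  have drC: "drawing V E pos \<gamma> \<subseteq> C"
    using closed_segment_subset[OF posC posC convC] posC by (auto simp: drawing_def \<gamma>_def)
  have sub_out: "- C \<subseteq> outside (drawing V E pos \<gamma>)" by (rule outside_subset_convex[OF convC drC])
  have "pos v \<in> frontier (outside (drawing V E pos \<gamma>))" if "v \<in> V" for v
  proof -
    \<comment> \<open>The vertex is a limit of points below the parabola, which belong to the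
      outside.\<close>
    have "(\<lambda>n. pos v - Complex 0 (inverse (real (Suc n)))) \<longlonglongrightarrow> pos v - Complex 0 0"
      by (intro tendsto_intros tendsto_Complex LIMSEQ_inverse_real_of_nat)
    hence "(\<lambda>n. pos v - Complex 0 (inverse (real (Suc n)))) \<longlonglongrightarrow> pos v"
      by (metis complex_eq_0 complex.sel diff_zero power_zero_numeral add_0)
    moreover have "pos v - Complex 0 (inverse (real (Suc n))) \<in> - C" for n
      by (simp add: C_def pos_def)
    ultimately have "pos v \<in> closure (- C)"
      unfolding closure_sequential by (intro exI[of _ "\<lambda>n. pos v - Complex 0 (inverse (real (Suc n)))"])
        blast
    hence "pos v \<in> closure (outside (drawing V E pos \<gamma>))" using closure_mono[OF sub_out] by blast
    moreover have "pos v \<in> drawing V E pos \<gamma>" using that by (auto simp: drawing_def)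
    hence "pos v \<notin> outside (drawing V E pos \<gamma>)" using outside_no_overlap by blast
    ultimately show ?thesis using interior_subset by (auto simp: frontier_def)
  qed
  thus ?thesis using emb by (auto simp: outerplanar_def)
qed

section \<open>Decomposing connected outerplanar graphs\<close>

abbreviation adj :: "'a set set \<Rightarrow> ('a \<times> 'a) set" where
  "adj E \<equiv> {(a, b). {a, b} \<in> E}"

abbreviation walk :: "'a set set \<Rightarrow> 'a list \<Rightarrow> bool" where
  "walk E \<equiv> successively (\<lambda>u v. {u, v} \<in> E)"

definition cog :: "'a set \<Rightarrow> 'a set set set" where
  "cog V = {E. simple_graph V E \<and> connected_graph V E \<and> outerplanar V E}"

text \<open>With \<open>W\<close> the vertex set of the root cycle, these are the edges of the
  graphs hanging from its vertices.\<close>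

definition off :: "'a set \<Rightarrow> 'a set set \<Rightarrow> 'a set set" where
  "off W E = {e \<in> E. \<not> e \<subseteq> W}"

text \<open>Graphs in which the root \<open>r\<close> lies in exactly one block.\<close>

definition nonsep :: "'a \<Rightarrow> 'a set \<Rightarrow> 'a set set set" where
  "nonsep r V = {E \<in> cog (insert r V). connected_graph V {e \<in> E. r \<notin> e}}"

text \<open>\<open>r # us\<close> is the outer cycle of the block at \<open>r\<close>, or a single edge if \<open>us\<close> has length 1.\<close>

definition root_cycle :: "'a \<Rightarrow> 'a set set \<Rightarrow> 'a list \<Rightarrow> bool" where
  "root_cycle r E us \<longleftrightarrow> us \<noteq> [] \<and> distinct (r # us) \<and> walk E (r # us @ [r]) \<and>
     (\<forall>z\<in>set (r # us). \<forall>z'\<in>set (r # us). (z, z') \<in> (adj (off (set (r # us)) E))\<^sup>* \<longrightarrow> z = z') \<and>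
     (\<forall>e\<in>E. r \<in> e \<longrightarrow> e \<subseteq> set (r # us))"

section \<open>Reachability, walks and simple paths\<close>

lemma adj_sym: "(a, b) \<in> (adj E)\<^sup>* \<Longrightarrow> (b, a) \<in> (adj E)\<^sup>*"
proof -
  have "sym (adj E)" by (auto intro: symI simp: insert_commute)
  thus "(a, b) \<in> (adj E)\<^sup>* \<Longrightarrow> (b, a) \<in> (adj E)\<^sup>*" by (meson sym_rtrancl symD)
qed

lemma adj_mono: "E \<subseteq> E' \<Longrightarrow> (a, b) \<in> (adj E)\<^sup>* \<Longrightarrow> (a, b) \<in> (adj E')\<^sup>*"
  by (rule rtrancl_mono[THEN subsetD, rotated]) auto

lemma walk_rev [simp]: "walk E (rev xs) = walk E xs"
  by (simp add: insert_commute)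

lemma walk_rtrancl: "walk E (x # xs) \<Longrightarrow> y \<in> set (x # xs) \<Longrightarrow> (x, y) \<in> (adj E)\<^sup>*"
proof (induction xs arbitrary: x)
  case (Cons z xs)
  hence "(x, z) \<in> adj E" by simp
  thus ?case using Cons by (cases "y = x") (auto intro: converse_rtrancl_into_rtrancl)
qed auto

lemma connected_graphI:
  assumes "r \<in> V" "\<And>v. v \<in> V \<Longrightarrow> (r, v) \<in> (adj E)\<^sup>*"
  shows "connected_graph V E"
  unfolding connected_graph_def using assms(1) adj_sym[OF assms(2)] assms(2)
  by (auto intro: rtrancl_trans)

lemma simple_graph_edge:
  assumes "simple_graph V E" "e \<in> E" "x \<in> e"
  obtains y where "e = {x, y}" "x \<noteq> y" "x \<in> V" "y \<in> V"
proof -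
  have "card e = 2" "e \<subseteq> V" using assms by (auto simp: simple_graph_def)
  then obtain a b where "e = {a, b}" "a \<noteq> b" by (auto simp: card_2_iff)
  thus ?thesis using that assms(3) \<open>e \<subseteq> V\<close> by (metis empty_iff insert_commute insert_iff insert_subset)
qed

lemma simple_graph_pair: "simple_graph V E \<Longrightarrow> {x, y} \<in> E \<Longrightarrow> x \<noteq> y \<and> x \<in> V \<and> y \<in> V"
  by (auto simp: simple_graph_def card_insert_if split: if_splits)

text \<open>Cutting out the loop at a repeated vertex keeps the path simple.\<close>

lemma rtrancl_gpath:
  assumes "(x, y) \<in> (adj E)\<^sup>*"
  shows "\<exists>xs. gpath E (x # xs) \<and> last (x # xs) = y"
  using assms
proof (induction rule: converse_rtrancl_induct)
  case base
  show ?case by (intro exI[of _ "[]"]) (simp add: gpath_def)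
next
  case (step x z)
  then obtain xs where xs: "gpath E (z # xs)" "last (z # xs) = y" by blast
  show ?case
  proof (cases "x \<in> set (z # xs)")
    case True
    then obtain us vs where "z # xs = us @ x # vs" by (meson split_list)
    thus ?thesis using xs by (intro exI[of _ vs]) (auto simp: gpath_def successively_append_iff)
  next
    case False
    thus ?thesis using xs step(1) by (intro exI[of _ "z # xs"]) (auto simp: gpath_def)
  qed
qed

lemmas walk_join = successively_join

lemma walk_prefix: "walk E (xs @ ys) \<Longrightarrow> walk E xs" and walk_suffix: "walk E (xs @ ys) \<Longrightarrow> walk E ys"
  by (simp_all add: successively_append_iff)

lemma walk_subset: "walk E xs \<Longrightarrow> E \<subseteq> E' \<Longrightarrow> walk E' xs"
  by (induction xs rule: induct_list012) auto

lemma simple_graph_subset: "simple_graph V E \<Longrightarrow> E' \<subseteq> E \<Longrightarrow> (\<forall>e\<in>E'. e \<subseteq> V') \<Longrightarrow> V' \<subseteq> V \<Longrightarrow> simple_graph V' E'"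
  using finite_subset[of V' V] by (auto simp: simple_graph_def)

section \<open>Existence and uniqueness of the root cycle\<close>

text \<open>A longest cycle through \<open>r\<close> admits no ear: an ear between neighbouring vertices would
  lengthen it, any other ear completes a theta graph.\<close>

lemma maximal_cycle_no_ear:
  assumes E: "simple_graph U E" "outerplanar U E"
    and cyc: "us \<noteq> []" "distinct (r # us)" "walk E (r # us @ [r])"
    and max: "\<And>vs. vs \<noteq> [] \<Longrightarrow> distinct (r # vs) \<Longrightarrow> walk E (r # vs @ [r]) \<Longrightarrow> length vs \<le> length us"
    and ear: "z \<in> set (r # us)" "z' \<in> set (r # us)" "z \<noteq> z'" "ys \<noteq> []" "distinct ys"
      "set ys \<inter> set (r # us) = {}" "walk E (z # ys @ [z'])"
  shows False
proof -
  have main: False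
    if ws: "r # us = A @ z # B @ z' # C"
      and ear: "ys \<noteq> []" "distinct ys" "set ys \<inter> set (r # us) = {}" "walk E (z # ys @ [z'])"
    for z z' ys A B C
  proof -
    have w: "walk E (A @ z # B @ z' # C @ [r])" using cyc(3) ws by (metis append.assoc append_Cons)
    have "walk E ((A @ z # B) @ z' # C @ [r])" "walk E ((A @ [z]) @ B @ z' # C @ [r])"
        "walk E (A @ (z # B @ [z']) @ C @ [r])"
      using w by simp_all
    hence w1: "walk E (z' # C @ [r])" and w2: "walk E (A @ [z])" and w3: "walk E (z # B @ [z'])"
      by (metis walk_prefix walk_suffix)+
    have dist: "distinct (A @ z # B @ z' # C)" using cyc(2) ws by simp
    have ysd: "set ys \<inter> set (A @ z # B @ z' # C) = {}" using ear(3) ws by metis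
    show False
    proof (cases "B = []")
      \<comment> \<open>Neighbouring ends: the ear is inserted between them and gives a longer
        cycle.\<close>
      case True
      define vs where "vs = tl (A @ z # ys @ z' # C)"
      have new: "A @ z # ys @ z' # C = r # vs"
        using ws by (cases A) (auto simp: vs_def)
      have "walk E ((z # ys) @ z' # C @ [r])" by (rule walk_join) (use ear w1 in auto)
      hence "walk E (A @ z # ys @ z' # C @ [r])" using walk_join[OF w2, of "ys @ z' # C @ [r]"] by simp
      moreover have "A @ z # ys @ z' # C @ [r] = r # vs @ [r]" using new
        by (metis append.assoc append_Cons)
      ultimately have "walk E (r # vs @ [r])" by simp
      moreover have "distinct (A @ z # ys @ z' # C)" using dist ear ysd by auto
      hence "distinct (r # vs)" using new by metis
      moreover have "length (r # vs) > length (r # us)" unfolding ws new[symmetric] using True ear by simp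
      ultimately show False using max[of vs] by force
    next
      case B: False
      show False
      proof (cases "A = [] \<and> C = []")
        \<comment> \<open>The first and the last vertex are neighbours through the closing edge, so
          the ear is appended at the end.\<close>
        case True
        hence r: "z = r" "us = B @ [z']" using ws by auto
        have "walk E (rev (z # ys @ [z']))" using ear(4) by (subst walk_rev)
        hence "walk E (z' # rev ys @ [r])" using r by simp
        moreover have "walk E ((r # B) @ [z'])" using w3 r by simp
        ultimately have "walk E ((r # B) @ z' # rev ys @ [r])" by (rule walk_join[rotated])
        moreover have "distinct (r # B @ z' # rev ys)" using ear dist ysd True r by auto
        ultimately have "length (B @ z' # rev ys) \<le> length us" by (intro max) auto
        thus False using r ear by simp
      next
        case False
        \<comment> \<open>The third path of the theta graph leaves \<open>z'\<close>, takes the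
          closing edge to \<open>r\<close> and continues to \<open>z\<close>.\<close>
        have "walk E (z' # C @ A @ [z])"
        proof (cases A)
          case Nil
          thus ?thesis using w1 ws by simp
        next
          case (Cons a A')
          hence "a = r" using ws by simp
          thus ?thesis using walk_join[of _ "z' # C" r "A' @ [z]"] w1 w2 Cons by simp
        qed
        hence "walk E (rev (z' # C @ A @ [z]))" by (subst walk_rev)
        hence w4: "walk E (z # rev (C @ A) @ [z'])" by simp
        have "gpath E (z # B @ [z'])" "gpath E (z # ys @ [z'])" "gpath E (z # rev (C @ A) @ [z'])"
          using w3 w4 ear dist ysd by (auto simp: gpath_def)
        thus False
          by (rule outerplanar_no_theta[OF E]) (use B False ear dist ysd in auto)
      qed
    qed
  qed
  obtain A D where AD: "r # us = A @ z # D" using ear(1) by (meson split_list)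
  show False
  proof (cases "z' \<in> set D")
    case True
    then obtain B C where "D = B @ z' # C" by (meson split_list)
    thus False using main[of A z B z' C ys] AD ear by simp
  next
    case False
    hence "z' \<in> set A" using AD ear by (metis Un_iff set_ConsD set_append)
    then obtain B C where "A = B @ z' # C" by (meson split_list)
    moreover have "walk E (rev (z # ys @ [z']))" using ear(7) by (subst walk_rev)
    ultimately show False using main[of B z' C z D "rev ys"] AD ear by simp
  qed
qed

text \<open>Every edge of the walk has an inner vertex as an end, and these lie outside
  \<open>W\<close>.\<close>

lemma edges_off_walk:
  assumes "walk E (z # ys @ [z'])" "ys \<noteq> []" "set ys \<inter> W = {}"
  shows "walk (off W E) (z # ys @ [z'])"
proof -
  have "pedges (z # ys @ [z']) \<subseteq> off W E"
    using pedges_subset[OF assms(1)] pedges_meet[of _ z ys z'] assms(2,3) unfolding off_def by blast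
  moreover have "pedges xs \<subseteq> F \<Longrightarrow> walk F xs" for xs :: "'a list" and F
    by (induction xs rule: pedges.induct) auto
  ultimately show ?thesis by blast
qed

text \<open>Cut the path at its first return to \<open>W\<close>. An edge of \<open>off W E\<close>
  is not contained in \<open>W\<close>, so the piece has inner vertices.\<close>

lemma off_path_ear:
  assumes "(z, z') \<in> (adj (off W E))\<^sup>*" "z \<noteq> z'" "z \<in> W" "z' \<in> W"
  obtains w ys where "w \<in> W" "w \<noteq> z" "ys \<noteq> []" "distinct ys" "set ys \<inter> W = {}" "walk E (z # ys @ [w])"
proof -
  obtain xs where xs: "gpath (off W E) (z # xs)" "last (z # xs) = z'" using rtrancl_gpath[OF assms(1)] by blast
  hence "xs \<noteq> []" "last xs = z'" using assms by (auto split: if_splits)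
  hence "\<exists>x\<in>set xs. x \<in> W" using assms last_in_set by metis
  then obtain ys w zs where ys: "xs = ys @ w # zs" "w \<in> W" "\<forall>y\<in>set ys. y \<notin> W"
    using split_list_first_prop[of xs "\<lambda>x. x \<in> W"] by blast
  have wk: "walk (off W E) ((z # ys @ [w]) @ zs)" using xs ys by (simp add: gpath_def)
  hence wk': "walk (off W E) (z # ys @ [w])" by (rule walk_prefix)
  have "ys \<noteq> []" using wk' ys assms by (auto simp: off_def)
  moreover have "walk E (z # ys @ [w])" using wk' by (rule walk_subset) (auto simp: off_def)
  ultimately show ?thesis using that[of w ys] ys xs by (auto simp: gpath_def)
qed

lemma nonsepD:
  assumes "E \<in> nonsep r V"
  shows "simple_graph (insert r V) E" "connected_graph (insert r V) E" "outerplanar (insert r V) E"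
    "connected_graph V {e \<in> E. r \<notin> e}" "V \<noteq> {}" "finite V"
  using assms by (auto simp: nonsep_def cog_def connected_graph_def simple_graph_def)

text \<open>Take a longest cycle through \<open>r\<close>. The absence of ears separates its
  vertices off the cycle. A neighbour of \<open>r\<close> away from the cycle would be joined to it
  without using \<open>r\<close>, since the graph minus \<open>r\<close> is connected, and this
  gives an ear at \<open>r\<close>.\<close>

lemma root_cycle_exists:
  assumes E: "E \<in> nonsep r V" and r: "r \<notin> V"
  shows "\<exists>us. root_cycle r E us"
proof -
  note N = nonsepD[OF E]
  define L where "L us \<longleftrightarrow> us \<noteq> [] \<and> distinct (r # us) \<and> walk E (r # us @ [r])" for us
  have sub: "set us \<subseteq> V" if "L us" for us
  proof
    fix x assume x: "x \<in> set us"
    have "\<Union> (pedges (r # us @ [r])) = set (r # us @ [r])" by (rule Union_pedges) simp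
    hence "x \<in> \<Union> (pedges (r # us @ [r]))" using x by simp
    moreover have "pedges (r # us @ [r]) \<subseteq> E" using that by (intro pedges_subset) (simp add: L_def)
    ultimately have "x \<in> insert r V" using N(1) by (auto simp: simple_graph_def)
    thus "x \<in> V" using x that by (auto simp: L_def)
  qed
  have len: "length us \<le> card V" if "L us" for us
    using card_mono[OF N(6) sub[OF that]] that by (simp add: L_def distinct_card)
  obtain v where v: "v \<in> V" using N(5) by blast
  hence "(r, v) \<in> (adj E)\<^sup>*" using N(2) by (simp add: connected_graph_def)
  then obtain y where y: "{r, y} \<in> E" using v r by (metis (no_types, lifting) converse_rtranclE case_prodD mem_Collect_eq)
  \<comment> \<open>An edge traversed back and forth counts as a cycle, so candidates exist even
    when \<open>r\<close> is a leaf.\<close>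
  hence "L [y]" using simple_graph_pair[OF N(1) y] by (simp add: L_def insert_commute)
  then obtain us where us: "L us" and max: "\<And>vs. L vs \<Longrightarrow> length vs \<le> length us"
    using ex_has_greatest_nat[of L "[y]" length "Suc (card V)"] len by (auto simp: less_Suc_eq_le)
  have no_ear: False if "z \<in> set (r # us)" "z' \<in> set (r # us)" "z \<noteq> z'" "ys \<noteq> []" "distinct ys"
      "set ys \<inter> set (r # us) = {}" "walk E (z # ys @ [z'])" for z z' ys
    using us max that
    by (intro maximal_cycle_no_ear[OF N(1,3), of us r z z' ys]) (auto simp: L_def)
  have "root_cycle r E us"
    unfolding root_cycle_def
  proof (intro conjI ballI impI)
    show "us \<noteq> []" "distinct (r # us)" "walk E (r # us @ [r])" using us by (auto simp: L_def)
    fix z z' assume z: "z \<in> set (r # us)" "z' \<in> set (r # us)" "(z, z') \<in> (adj (off (set (r # us)) E))\<^sup>*"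
    show "z = z'"
    proof (rule ccontr)
      assume "z \<noteq> z'"
      from off_path_ear[OF z(3) this z(1,2)] obtain w ys where "w \<in> set (r # us)" "w \<noteq> z" "ys \<noteq> []"
        "distinct ys" "set ys \<inter> set (r # us) = {}" "walk E (z # ys @ [w])" .
      thus False using no_ear[of z w ys] z(1) by metis
    qed
  next
    fix e assume e: "e \<in> E" "r \<in> e"
    then obtain x where x: "e = {r, x}" "r \<noteq> x" "x \<in> insert r V" using simple_graph_edge[OF N(1) e] by metis
    have "x \<in> set (r # us)"
    proof (rule ccontr)
      assume nx: "x \<notin> set (r # us)"
      let ?u = "hd us"
      have u: "?u \<in> set us" using us by (auto simp: L_def)
      hence "?u \<in> V" "x \<in> V" using sub[OF us] x by auto
      hence "(x, ?u) \<in> (adj {e \<in> E. r \<notin> e})\<^sup>*" using N(4) by (auto simp: connected_graph_def)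
      from rtrancl_gpath[OF this] obtain xs where xs: "gpath {e \<in> E. r \<notin> e} (x # xs)" "last (x # xs) = ?u" by blast
      have "xs \<noteq> []" using xs u nx by auto
      hence "\<Union> (pedges (x # xs)) = set (x # xs)" by (intro Union_pedges) (cases xs; simp)
      moreover have "pedges (x # xs) \<subseteq> {e \<in> E. r \<notin> e}" using xs by (intro pedges_subset) (simp add: gpath_def)
      ultimately have rxs: "r \<notin> set (x # xs)" by blast
      have "?u \<in> set xs" using xs(2) \<open>xs \<noteq> []\<close> last_in_set by (metis last_ConsR)
      hence "\<exists>y\<in>set xs. y \<in> set (r # us)" using u by auto
      then obtain ys w zs where ys: "xs = ys @ w # zs" "w \<in> set (r # us)" "\<forall>y\<in>set ys. y \<notin> set (r # us)"
        using split_list_first_prop[of xs "\<lambda>x. x \<in> set (r # us)"] by blast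
      have "walk {e \<in> E. r \<notin> e} ((x # ys @ [w]) @ zs)" using xs ys by (simp add: gpath_def)
      hence "walk {e \<in> E. r \<notin> e} (x # ys @ [w])" by (rule walk_prefix)
      hence "walk E (x # ys @ [w])" by (rule walk_subset) auto
      hence "walk E (r # (x # ys) @ [w])" using e x by auto
      thus False using no_ear[of r w "x # ys"] ys rxs xs nx by (auto simp: gpath_def)
    qed
    thus "e \<subseteq> set (r # us)" using x by simp
  qed
  thus ?thesis by blast
qed

lemma pedges_nth: "pedges xs = {{xs ! k, xs ! Suc k} | k. Suc k < length xs}"
proof (induction xs rule: pedges.induct)
  case (1 x y ys)
  show ?case unfolding pedges.simps 1
  proof (intro equalityI subsetI)
    fix e assume "e \<in> insert {x, y} {{(y # ys) ! k, (y # ys) ! Suc k} |k. Suc k < length (y # ys)}"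
    then consider "e = {x, y}" | k where "e = {(y # ys) ! k, (y # ys) ! Suc k}" "Suc k < length (y # ys)" by blast
    thus "e \<in> {{(x # y # ys) ! k, (x # y # ys) ! Suc k} |k. Suc k < length (x # y # ys)}"
    proof cases
      case 1
      thus ?thesis by (intro CollectI exI[of _ 0]) auto
    next
      case 2
      thus ?thesis by (intro CollectI exI[of _ "Suc k"]) auto
    qed
  next
    fix e assume "e \<in> {{(x # y # ys) ! k, (x # y # ys) ! Suc k} |k. Suc k < length (x # y # ys)}"
    then obtain k where k: "e = {(x # y # ys) ! k, (x # y # ys) ! Suc k}" "Suc k < length (x # y # ys)" by blast
    thus "e \<in> insert {x, y} {{(y # ys) ! k, (y # ys) ! Suc k} |k. Suc k < length (y # ys)}"
      by (cases k) auto
  qed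
qed auto

lemma split_nth: "i < length xs \<Longrightarrow> \<exists>A B. xs = A @ xs ! i # B \<and> length A = i"
  by (metis id_take_nth_drop length_take min.absorb4)

lemma split_nth2:
  assumes "i < j" "j < length xs"
  shows "\<exists>A P B. xs = A @ xs ! i # P @ xs ! j # B \<and> length A = i \<and> length P = j - Suc i"
proof -
  obtain C B where C: "xs = C @ xs ! j # B" "length C = j" using split_nth assms by blast
  obtain A P where A: "C = A @ C ! i # P" "length A = i" using split_nth[of i C] assms C by auto
  have "C ! i = xs ! i" using C assms by (metis nth_append)
  moreover have "length C = length A + Suc (length P)" by (subst A(1)) simp
  ultimately show ?thesis using C A by (intro exI[of _ A] exI[of _ P] exI[of _ B]) auto
qed

text \<open>\<open>outerplanar_no_crossing\<close> expects the cycle to begin at the first chord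
  end; the part \<open>A\<close> before it is moved behind \<open>S\<close>, across the closing edge
  at \<open>r\<close>.\<close>

lemma rotated_crossing:
  assumes E: "simple_graph U E" "outerplanar U E"
    and cyc: "distinct (r # us)" "walk E (r # us @ [r])"
    and ws: "r # us = A @ a # P @ b # Q @ c # R @ d # S"
    and ch: "{a, c} \<in> E" "{b, d} \<in> E"
  shows False
proof (rule outerplanar_no_crossing[OF E _ _ ch, of P Q R "S @ A"])
  show "distinct (a # P @ b # Q @ c # R @ d # S @ A)" using cyc(1) unfolding ws by auto
  have w: "walk E (A @ a # P @ b # Q @ c # R @ d # S @ [r])"
    using cyc(2) ws by (metis append.assoc append_Cons)
  show "walk E (a # P @ b # Q @ c # R @ d # (S @ A) @ [a])"
  proof (cases A)
    case Nil
    thus ?thesis using w ws by simp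
  next
    case (Cons x A')
    hence x: "x = r" using ws by simp
    have "walk E ((A @ [a]) @ (P @ b # Q @ c # R @ d # S @ [r]))" using w by simp
    hence "walk E (A @ [a])" by (rule walk_prefix)
    hence "walk E (r # A' @ [a])" using Cons x by simp
    moreover have "walk E ((a # P @ b # Q @ c # R @ d # S) @ [r])"
      using walk_suffix[OF w] by simp
    ultimately have "walk E ((a # P @ b # Q @ c # R @ d # S) @ r # A' @ [a])" by (rule walk_join[rotated])
    thus ?thesis using Cons x by simp
  qed
qed

lemma cycle_chords_noncrossing:
  assumes E: "simple_graph U E" "outerplanar U E"
    and cyc: "distinct (r # us)" "walk E (r # us @ [r])"
    and ij: "i < j" "j < k" "k < l" "l < length (r # us)"
    and ch: "{(r # us) ! i, (r # us) ! k} \<in> E" "{(r # us) ! j, (r # us) ! l} \<in> E"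
  shows False
proof -
  let ?w = "r # us"
  obtain A0 R S where 1: "?w = A0 @ ?w ! k # R @ ?w ! l # S" "length A0 = k"
    using split_nth2[of k l ?w] ij by auto
  obtain A P Q where 2: "A0 = A @ A0 ! i # P @ A0 ! j # Q"
    using split_nth2[of i j A0] ij 1 by auto
  have "A0 ! i = ?w ! i" "A0 ! j = ?w ! j" using 1 ij by (metis nth_append less_trans)+
  hence "?w = A @ ?w ! i # P @ ?w ! j # Q @ ?w ! k # R @ ?w ! l # S"
    using 1 2 by (metis append.assoc append_Cons)
  thus False by (rule rotated_crossing[OF E cyc _ ch])
qed

text \<open>Suppose the second cycle leaves the first at \<open>x\<close>. Its last vertex on the
  first cycle before \<open>x\<close> and the next one after \<open>x\<close> are joined off the
  cycle, hence equal, hence \<open>r\<close>, the only vertex met twice. But all neighbours of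
  \<open>r\<close> lie on the first cycle.\<close>

lemma cycle_in_block:
  assumes E: "simple_graph U E"
    and us: "root_cycle r E us" and vs: "distinct (r # vs)" "walk E (r # vs @ [r])"
  shows "set vs \<subseteq> set us"
proof
  fix x assume x: "x \<in> set vs"
  let ?W = "set (r # us)"
  show "x \<in> set us"
  proof (rule ccontr)
    assume "x \<notin> set us"
    hence nx: "x \<notin> ?W" using x vs by auto
    obtain A B where AB: "vs = A @ x # B" using x by (meson split_list)
    have "\<exists>z\<in>set (r # A). z \<in> ?W" by auto
    then obtain A1 z A2 where z: "r # A = A1 @ z # A2" "z \<in> ?W" "\<forall>y\<in>set A2. y \<notin> ?W"
      using split_list_last_prop[of "r # A" "\<lambda>x. x \<in> ?W"] by blast
    have "\<exists>z\<in>set (B @ [r]). z \<in> ?W" by auto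
    then obtain B1 z' B2 where z': "B @ [r] = B1 @ z' # B2" "z' \<in> ?W" "\<forall>y\<in>set B1. y \<notin> ?W"
      using split_list_first_prop[of "B @ [r]" "\<lambda>x. x \<in> ?W"] by blast
    have all: "r # vs @ [r] = A1 @ (z # (A2 @ x # B1) @ [z']) @ B2"
      using AB z z' by (metis append.assoc append_Cons append_Nil)
    have wk: "walk E (z # (A2 @ x # B1) @ [z'])"
      using vs(2) unfolding all by (metis walk_prefix walk_suffix)
    have wo: "walk (off ?W E) (z # (A2 @ x # B1) @ [z'])"
      by (rule edges_off_walk[OF wk]) (use z z' nx in auto)
    have "(z, z') \<in> (adj (off ?W E))\<^sup>*" by (rule walk_rtrancl[OF wo]) simp
    hence eq: "z = z'" using us z z' unfolding root_cycle_def by blast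
    have "z \<in> set (r # A)" using z(1) by simp
    moreover have "z' \<in> set (B @ [r])" using z'(1) by (metis in_set_conv_decomp)
    ultimately have zr: "z = r" using eq vs AB by auto
    have "{z, hd (A2 @ [x])} \<in> E" using wk by (cases A2) auto
    hence "hd (A2 @ [x]) \<in> ?W" using us zr unfolding root_cycle_def by auto
    thus False using z(3) nx by (cases A2) auto
  qed
qed

text \<open>Used to find an edge of one cycle leading from one side of a chord of another cycle to
  the other side.\<close>

lemma list_switch:
  assumes "\<And>x. x \<in> set xs \<Longrightarrow> x \<in> P \<or> x \<in> R" "\<exists>x\<in>set xs. x \<in> P" "\<exists>x\<in>set xs. x \<in> R" "P \<inter> R = {}"
  shows "\<exists>A x y B. xs = A @ x # y # B \<and> (x \<in> P \<and> y \<in> R \<or> x \<in> R \<and> y \<in> P)"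
  using assms(1-3)
proof (induction xs)
  case (Cons x xs)
  show ?case
  proof (cases xs)
    case Nil
    thus ?thesis using Cons assms(4) by auto
  next
    case (Cons y ys)
    show ?thesis
    proof (cases "x \<in> P \<and> y \<in> R \<or> x \<in> R \<and> y \<in> P")
      case True
      thus ?thesis using Cons by (intro exI[of _ "[]"]) auto
    next
      case False
      hence "x \<in> P \<and> y \<in> P \<or> x \<in> R \<and> y \<in> R" using Cons.prems(1) \<open>xs = y # ys\<close> by auto
      hence "(\<exists>x\<in>set xs. x \<in> P) \<and> (\<exists>x\<in>set xs. x \<in> R)" using Cons.prems(2,3) \<open>xs = y # ys\<close> assms(4) by auto
      then obtain A a b B where "xs = A @ a # b # B \<and> (a \<in> P \<and> b \<in> R \<or> a \<in> R \<and> b \<in> P)"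
        using Cons.IH Cons.prems(1) by (metis list.set_intros(2))
      thus ?thesis by (intro exI[of _ "x # A"]) auto
    qed
  qed
qed simp

lemma pedges_cycle_nth:
  assumes "distinct ws" "i < length ws" "j < length ws" "{ws ! i, ws ! j} \<in> pedges (ws @ [ws ! 0])"
  shows "j = Suc i \<or> i = Suc j \<or> (i = 0 \<and> Suc j = length ws) \<or> (j = 0 \<and> Suc i = length ws)"
proof -
  from assms(4) obtain k where k: "{ws ! i, ws ! j} = {(ws @ [ws ! 0]) ! k, (ws @ [ws ! 0]) ! Suc k}" "Suc k < length (ws @ [ws ! 0])"
    unfolding pedges_nth by blast
  have kl: "k < length ws" and l0: "0 < length ws" using k by auto
  have 1: "(ws @ [ws ! 0]) ! k = ws ! k" using kl by (simp add: nth_append)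
  show ?thesis
  proof (cases "Suc k = length ws")
    case True
    hence "(ws @ [ws ! 0]) ! Suc k = ws ! 0" by (simp add: nth_append)
    hence "{ws ! i, ws ! j} = {ws ! k, ws ! 0}" using k 1 by simp
    thus ?thesis using assms(1-3) True kl l0 by (auto simp: doubleton_eq_iff nth_eq_iff_index_eq)
  next
    case False
    hence "Suc k < length ws" using kl by simp
    hence "(ws @ [ws ! 0]) ! Suc k = ws ! Suc k" by (simp add: nth_append)
    hence "{ws ! i, ws ! j} = {ws ! k, ws ! Suc k}" using k 1 by simp
    thus ?thesis using assms(1-3) kl \<open>Suc k < length ws\<close> by (auto simp: doubleton_eq_iff nth_eq_iff_index_eq)
  qed
qed

text \<open>Both cycles start at \<open>r\<close>, whose neighbours are the first and the last
  vertex of \<open>us\<close>. Once the first step is fixed, every later step is forced, as the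
  predecessor is already used.\<close>

lemma cycle_order_unique:
  assumes d: "distinct (r # us)" "distinct (r # vs)" and set: "set us = set vs"
    and sub: "pedges (r # vs @ [r]) \<subseteq> pedges (r # us @ [r])" and ne: "us \<noteq> []"
  shows "vs = us \<or> vs = rev us"
proof -
  have main: "vs = us"
    if d: "distinct (r # us)" "distinct (r # vs)" and set: "set us = set vs"
    and sub: "pedges (r # vs @ [r]) \<subseteq> pedges (r # us @ [r])" and hd: "hd us = hd vs" and ne: "us \<noteq> []" for us
  proof -
    let ?w = "r # us" and ?v = "r # vs"
    have len: "length us = length vs" using d set by (metis distinct.simps(2) distinct_card)
    have "k < length ?w \<Longrightarrow> ?w ! k = ?v ! k" for k
    proof (induction k rule: less_induct)
      case (less k)
      consider "k = 0" | "k = 1" | k' where "k = Suc (Suc k')" by (metis One_nat_def not0_implies_Suc)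
      thus ?case
      proof cases
        case 2
        thus ?thesis using hd ne len by (cases us; cases vs) auto
      next
        case (3 k')
        have a: "?w ! k' = ?v ! k'" "?w ! Suc k' = ?v ! Suc k'" using less(1)[of k'] less(1)[of "Suc k'"] less(2) 3 by simp_all
        have "?v ! k \<in> set ?w" using less 3 len set by (metis length_Cons list.simps(15) nth_mem)
        then obtain j where j: "j < length ?w" "?w ! j = ?v ! k" by (metis in_set_conv_nth)
        have "{?v ! Suc k', ?v ! k} \<in> pedges (?v @ [r])" unfolding pedges_nth
          using less 3 len by (intro CollectI exI[of _ "Suc k'"]) (auto simp: nth_append nth_Cons')
        hence "{?w ! Suc k', ?w ! j} \<in> pedges (?w @ [?w ! 0])" using sub a j by auto
        from pedges_cycle_nth[OF d(1) _ j(1) this]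
        have "j = Suc (Suc k') \<or> Suc k' = Suc j \<or> j = 0 \<and> Suc (Suc k') = length ?w" using less 3 by auto
        moreover have "j \<noteq> k'"
        proof
          assume "j = k'"
          hence "?v ! k = ?v ! k'" using j a by simp
          thus False using d(2) less 3 len by (subst (asm) nth_eq_iff_index_eq) auto
        qed
        ultimately show ?thesis using j 3 less by auto
      qed simp
    qed
    hence "?w = ?v" using len by (intro nth_equalityI) auto
    thus ?thesis by simp
  qed
  have "vs \<noteq> []" using ne set by auto
  have "{r, hd vs} \<in> pedges (r # vs @ [r])" using \<open>vs \<noteq> []\<close> by (cases vs) auto
  hence e: "{r, hd vs} \<in> pedges ((r # us) @ [(r # us) ! 0])" using sub by auto
  have "hd vs \<in> set (r # us)" using \<open>vs \<noteq> []\<close> set by simp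
  then obtain j where j: "j < length (r # us)" "(r # us) ! j = hd vs" by (metis in_set_conv_nth)
  have "j = Suc 0 \<or> Suc j = length (r # us) \<or> j = 0 \<and> length (r # us) = 1"
    using pedges_cycle_nth[OF d(1) _ j(1), of 0] e j by auto
  hence "hd vs = hd us \<or> hd vs = last us" using j ne
    by (auto simp: hd_conv_nth last_conv_nth)
  thus ?thesis
  proof
    assume "hd vs = hd us"
    hence "vs = us" by (intro main[OF d set sub _ ne]) simp
    thus ?thesis ..
  next
    assume "hd vs = last us"
    hence "hd (rev us) = hd vs" by (simp add: hd_rev)
    moreover have "pedges (r # rev us @ [r]) = pedges (r # us @ [r])"
      using pedges_rev[of "r # us @ [r]"] by simp
    ultimately have "vs = rev us" using d set sub ne by (intro main) simp_all
    thus ?thesis ..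
  qed
qed

text \<open>An edge of the second cycle missing from the first is a chord of the first. The rest of
  the second cycle visits both sides of this chord and so contains an edge crossing it.\<close>

lemma root_cycle_unique:
  assumes E: "simple_graph U E" "outerplanar U E"
    and us: "root_cycle r E us" and vs: "root_cycle r E vs"
  shows "vs = us \<or> vs = rev us"
proof -
  have u: "us \<noteq> []" "distinct (r # us)" "walk E (r # us @ [r])"
    and v: "vs \<noteq> []" "distinct (r # vs)" "walk E (r # vs @ [r])"
    using us vs by (auto simp: root_cycle_def)
  have set: "set us = set vs"
    using cycle_in_block[OF E(1) us v(2,3)] cycle_in_block[OF E(1) vs u(2,3)] by blast
  show ?thesis
  proof (rule cycle_order_unique[OF u(2) v(2) set _ u(1)], rule subsetI, rule ccontr)
    fix e assume e: "e \<in> pedges (r # vs @ [r])" "e \<notin> pedges (r # us @ [r])"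
    let ?w = "r # us" and ?v = "r # vs"
    obtain k where k: "e = {(?v @ [r]) ! k, (?v @ [r]) ! Suc k}" "Suc k < length (?v @ [r])"
      using e(1) unfolding pedges_nth by auto
    \<comment> \<open>rotate the second cycle so that the edge \<open>e\<close> closes it\<close>
    define a where "a = ?v ! k"
    obtain A B where AB: "?v = A @ a # B" "length A = k" using split_nth[of k ?v] k unfolding a_def by auto
    define X where "X = B @ A"
    have ea: "{a, hd (X @ [a])} = e" and wX: "walk E (a # X @ [a])" and dX: "distinct (a # X)"
      and sX: "set (a # X) = set ?w"
    proof -
      have ka: "(?v @ [r]) ! k = a" using k nth_append[of ?v "[r]" k] by (simp add: a_def)
      have vv: "?v @ [r] = A @ a # B @ [r]" using AB by (metis append.assoc append_Cons)
      have "(?v @ [r]) ! Suc k = (B @ [r]) ! 0" unfolding vv using AB(2)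
        by (metis add.right_neutral add_Suc_right nth_Cons_Suc nth_append_length_plus)
      also have "\<dots> = hd (B @ [r])" by (simp add: hd_conv_nth)
      also have "\<dots> = hd (X @ [a])" using AB(1) by (cases B; cases A) (auto simp: X_def)
      finally show "{a, hd (X @ [a])} = e" using k ka by simp
      have w: "walk E (A @ a # B @ [r])" using v(3) vv by (metis append_Cons)
      have w1: "walk E ((a # B) @ [r])" using walk_suffix[OF w] by simp
      have "walk E ((A @ [a]) @ B @ [r])" using w by simp
      hence w2: "walk E (A @ [a])" by (rule walk_prefix)
      show "walk E (a # X @ [a])"
      proof (cases A)
        case Nil
        thus ?thesis using w1 AB(1) by (simp add: X_def)
      next
        case (Cons y A')
        hence "y = r" using AB(1) by simp
        hence "walk E ((a # B) @ r # A' @ [a])" using walk_join[of _ "a # B" r "A' @ [a]"] w1 w2 Cons by simp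
        thus ?thesis using Cons \<open>y = r\<close> by (simp add: X_def)
      qed
      have "distinct (A @ a # B)" using v(2) unfolding AB(1) .
      thus "distinct (a # X)" by (auto simp: X_def)
      have "set (A @ a # B) = set ?w" using set unfolding AB(1)[symmetric] by simp
      thus "set (a # X) = set ?w" by (auto simp: X_def)
    qed
    have "X \<noteq> []"
    proof
      assume "X = []"
      hence "set ?w = {a}" using sX by auto
      thus False using u(1,2) by (cases us) auto
    qed
    then obtain c X' where X: "X = c # X'" by (cases X) auto
    have ec: "e = {a, c}" using ea X by simp
    have eE: "e \<in> E" using pedges_subset[OF v(3)] e(1) by auto
    have "\<And>i j. i < j \<Longrightarrow> j < length ?w \<Longrightarrow> {?w ! i, ?w ! j} = {a, c} \<Longrightarrow> False"
    proof -
      fix i j assume ij: "i < j" "j < length ?w" and ijac: "{?w ! i, ?w ! j} = {a, c}"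
      obtain P1 P2 P3 where P: "?w = P1 @ ?w ! i # P2 @ ?w ! j # P3" "length P1 = i" "length P2 = j - Suc i"
        using split_nth2[OF ij] by blast
      \<comment> \<open>Both sides of the chord contain vertices, as its ends are not neighbours on
        the first cycle, not even through the closing edge.\<close>
      have ne2: "P2 \<noteq> []"
      proof
        assume "P2 = []"
        hence "j = Suc i" using P ij by simp
        hence "{?w ! i, ?w ! j} \<in> pedges (r # us @ [r])" unfolding pedges_nth
          using ij by (intro CollectI exI[of _ i]) (auto simp: nth_append nth_Cons')
        thus False using e(2) ec ijac by simp
      qed
      have ne13: "P1 \<noteq> [] \<or> P3 \<noteq> []"
      proof (rule ccontr)
        assume "\<not> ?thesis"
        hence "i = 0" "P3 = []" "P1 = []" using P by auto
        hence "r # us = r # P2 @ [?w ! j]" using P(1) by simp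
        hence "pedges (r # us @ [r]) = pedges ((r # P2) @ ?w ! j # [r])" by (metis append.assoc append_Cons append_Nil)
        also have "\<dots> = pedges ((r # P2) @ [?w ! j]) \<union> pedges [?w ! j, r]" by (rule pedges_append)
        finally have "{?w ! j, r} \<in> pedges (r # us @ [r])" by simp
        moreover have "?w ! i = r" using \<open>i = 0\<close> by simp
        ultimately show False using e(2) ec ijac by (simp add: insert_commute)
      qed
      have dw: "distinct (P1 @ ?w ! i # P2 @ ?w ! j # P3)" using u(2) P(1) by simp
      have sw: "set ?w = {?w ! i, ?w ! j} \<union> set P2 \<union> (set P1 \<union> set P3)"
        by (subst P(1)) auto
      have "set X' = set ?w - {a, c}" using sX dX X by auto
      hence sX': "set X' = set P2 \<union> (set P1 \<union> set P3)" unfolding sw ijac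
        using dw ijac by (auto simp: doubleton_eq_iff)
      have "\<exists>x\<in>set X'. x \<in> set P2" using ne2 sX' hd_in_set[OF ne2] by blast
      moreover have "\<exists>x\<in>set X'. x \<in> set P1 \<union> set P3"
        using ne13 sX' hd_in_set[of P1] hd_in_set[of P3] by blast
      moreover have "set P2 \<inter> (set P1 \<union> set P3) = {}" using dw by auto
      moreover have "x \<in> set P2 \<or> x \<in> set P1 \<union> set P3" if "x \<in> set X'" for x
        using that sX' by blast
      ultimately have "\<exists>Y x y Z. X' = Y @ x # y # Z \<and>
        (x \<in> set P2 \<and> y \<in> set P1 \<union> set P3 \<or> x \<in> set P1 \<union> set P3 \<and> y \<in> set P2)"
        by (intro list_switch)
      then obtain Y x y Z where Y: "X' = Y @ x # y # Z"
        "x \<in> set P2 \<and> y \<in> set P1 \<union> set P3 \<or> x \<in> set P1 \<union> set P3 \<and> y \<in> set P2" by blast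
      have "walk E ((a # c # Y) @ (x # y # Z @ [a]))" using wX X Y by simp
      from walk_suffix[OF this] have xyE: "{x, y} \<in> E" by simp
      then obtain x y where xy: "x \<in> set P2" "y \<in> set P1 \<union> set P3" "{x, y} \<in> E"
        using Y(2) by (metis insert_commute)
      have ijE: "{?w ! i, ?w ! j} \<in> E" using eE ec ijac by simp
      obtain Q1 Q2 where Q: "P2 = Q1 @ x # Q2" using xy(1) by (meson split_list)
      show False
      proof (cases "y \<in> set P3")
        case True
        then obtain R1 R2 where "P3 = R1 @ y # R2" by (meson split_list)
        hence "?w = P1 @ ?w ! i # Q1 @ x # Q2 @ ?w ! j # R1 @ y # R2" using P(1) Q by simp
        thus False by (rule rotated_crossing[OF E u(2,3) _ ijE xy(3)])
      next
        case False
        then obtain R1 R2 where "P1 = R1 @ y # R2" using xy(2) by (metis UnE split_list)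
        hence "?w = R1 @ y # R2 @ ?w ! i # Q1 @ x # Q2 @ ?w ! j # P3" using P(1) Q by simp
        thus False by (rule rotated_crossing[OF E u(2,3)]) (use ijE xy(3) in \<open>auto simp: insert_commute\<close>)
      qed
    qed
    note key = this
    have "a \<in> set ?w" "c \<in> set ?w" "a \<noteq> c" using sX X dX by auto
    then obtain i j where "i < length ?w" "?w ! i = a" "j < length ?w" "?w ! j = c" by (metis in_set_conv_nth)
    thus False using key[of i j] key[of j i] \<open>a \<noteq> c\<close> by (metis insert_commute linorder_neqE_nat)
  qed
qed

lemma root_cycle_rev: "root_cycle r E us \<Longrightarrow> root_cycle r E (rev us)"
proof -
  assume *: "root_cycle r E us"
  hence "walk E (rev (r # us @ [r]))" by (subst walk_rev) (simp add: root_cycle_def)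
  thus ?thesis using * by (auto simp: root_cycle_def)
qed

lemma card_root_cycles:
  assumes "simple_graph U E" "outerplanar U E" "root_cycle r E us"
  shows "card {us. root_cycle r E us} = (if length us = 1 then 1 else 2)"
proof -
  have "{us. root_cycle r E us} = {us, rev us}"
    using root_cycle_unique[OF assms] root_cycle_rev[OF assms(3)] assms(3) by blast
  moreover have "us = rev us \<longleftrightarrow> length us = 1"
  proof
    have d: "distinct us" "us \<noteq> []" using assms(3) by (auto simp: root_cycle_def)
    assume "us = rev us"
    hence "hd us = last us" by (metis hd_rev)
    thus "length us = 1" using d by (cases us) (auto split: if_splits)
  next
    assume "length us = 1"
    thus "us = rev us" by (cases us) auto
  qed
  ultimately show ?thesis by auto
qed

section \<open>Gluing noncrossing orders\<close>

lemma book_glue: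
  fixes part g :: "'a \<Rightarrow> nat"
  assumes fin: "finite V"
    and inj: "\<And>x y. x \<in> V \<Longrightarrow> y \<in> V \<Longrightarrow> part x = part y \<Longrightarrow> g x = g y \<Longrightarrow> x = y"
    and edge: "\<And>x y. x \<in> V \<Longrightarrow> y \<in> V \<Longrightarrow> {x, y} \<in> E \<Longrightarrow> part x = part y \<or> g x = 0 \<and> g y = 0"
    and inner: "\<And>a b c d. {a, b, c, d} \<subseteq> V \<Longrightarrow> part a = part b \<Longrightarrow> part b = part c \<Longrightarrow> part c = part d \<Longrightarrow>
        g a < g b \<Longrightarrow> g b < g c \<Longrightarrow> g c < g d \<Longrightarrow> {a, c} \<in> E \<Longrightarrow> {b, d} \<in> E \<Longrightarrow> False"
    and center: "\<And>a b c d. {a, b, c, d} \<subseteq> V \<Longrightarrow> g a = 0 \<Longrightarrow> g b = 0 \<Longrightarrow> g c = 0 \<Longrightarrow> g d = 0 \<Longrightarrow>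
        part a < part b \<Longrightarrow> part b < part c \<Longrightarrow> part c < part d \<Longrightarrow> {a, c} \<in> E \<Longrightarrow> {b, d} \<in> E \<Longrightarrow> False"
  shows "book V E"
proof -
  \<comment> \<open>The order is lexicographic, by \<open>part\<close> and then by \<open>g\<close>,
    with \<open>M\<close> above all values of \<open>g\<close>. Position 0 of each part is its
    vertex on the central polygon.\<close>
  define M where "M = Suc (\<Sum>v\<in>V. g v)"
  have M: "g v < M" if "v \<in> V" for v
    using member_le_sum[of v V g] fin that by (simp add: M_def)
  define f where "f v = part v * M + g v" for v
  have div: "f v div M = part v" "f v mod M = g v" if "v \<in> V" for v
    using M[OF that] by (simp_all add: f_def)
  have less: "f x < f y \<Longrightarrow> part x < part y \<or> part x = part y \<and> g x < g y" if "x \<in> V" "y \<in> V" for x y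
  proof -
    assume *: "f x < f y"
    have "part x \<le> part y" using div_le_mono[of "f x" "f y" M] * div that by simp
    thus ?thesis using * by (auto simp: f_def)
  qed
  have "inj_on f V" using inj div by (metis inj_onI)
  moreover have False
    if V: "a \<in> V" "b \<in> V" "c \<in> V" "d \<in> V" and f: "f a < f b" "f b < f c" "f c < f d"
      and e: "{a, c} \<in> E" "{b, d} \<in> E" for a b c d
  proof -
    note l = less[OF V(1,2) f(1)] less[OF V(2,3) f(2)] less[OF V(3,4) f(3)]
    show False
    \<comment> \<open>A chord within one part forces the other chord into the same part; otherwise
      all four ends have position 0.\<close>
    proof (cases "part a = part c")
      case True
      hence p: "part a = part b" "part b = part c" and g: "g a < g b" "g b < g c" using l by auto
      have p': "part b = part d" using edge[OF V(2,4) e(2)] g(1) by auto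
      hence "part c = part d" "g c < g d" using l(3) p by auto
      thus False by (intro inner[of a b c d] p g e) (use V in simp_all)
    next
      case False
      hence g: "g a = 0" "g c = 0" using edge[OF V(1,3) e(1)] by auto
      have bc: "part b < part c" using l(2) g by auto
      hence "part b \<noteq> part d" using l(3) by auto
      hence g': "g b = 0" "g d = 0" using edge[OF V(2,4) e(2)] by auto
      have "part a < part b" using l(1) g g' by auto
      moreover have "part c < part d" using l(3) g g' by auto
      ultimately show False by (intro center[of a b c d] bc g g' e) (use V in simp_all)
    qed
  qed
  ultimately show ?thesis unfolding book_def by blast
qed

text \<open>Crossing depends only on the cyclic order, so the vertices before \<open>u\<close> may
  be moved to the end.\<close>

lemma book_rotate:
  assumes "book V E" "finite V" "u \<in> V"
  obtains g :: "'a \<Rightarrow> nat" where "inj_on g V" "g u = 0"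
    "\<And>a b c d. a \<in> V \<Longrightarrow> b \<in> V \<Longrightarrow> c \<in> V \<Longrightarrow> d \<in> V \<Longrightarrow> g a < g b \<Longrightarrow> g b < g c \<Longrightarrow> g c < g d \<Longrightarrow>
       {a, c} \<in> E \<Longrightarrow> {b, d} \<in> E \<Longrightarrow> False"
proof -
  obtain f :: "'a \<Rightarrow> nat" where f: "inj_on f V"
    "\<And>a b c d. a \<in> V \<Longrightarrow> b \<in> V \<Longrightarrow> c \<in> V \<Longrightarrow> d \<in> V \<Longrightarrow> f a < f b \<Longrightarrow> f b < f c \<Longrightarrow> f c < f d \<Longrightarrow>
       {a, c} \<in> E \<Longrightarrow> {b, d} \<notin> E"
    using assms(1) unfolding book_def by blast
  define N where "N = Suc (\<Sum>v\<in>V. f v)"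
  have N: "f v < N" if "v \<in> V" for v
    using member_le_sum[of v V f] assms(2) that by (simp add: N_def)
  define g where "g v = (if f u \<le> f v then f v - f u else f v + N - f u)" for v
  have "inj_on g V"
  proof (rule inj_onI)
    fix x y assume "x \<in> V" "y \<in> V" "g x = g y"
    moreover have "f x = f y" using calculation N[of x] N[of y] N[of u] assms(3)
      by (auto simp: g_def split: if_splits)
    ultimately show "x = y" using f(1) by (auto dest: inj_onD)
  qed
  moreover have "g u = 0" by (simp add: g_def)
  moreover have False if V: "a \<in> V" "b \<in> V" "c \<in> V" "d \<in> V" and g: "g a < g b" "g b < g c" "g c < g d"
    and e: "{a, c} \<in> E" "{b, d} \<in> E" for a b c d
  proof -
    have e': "{c, a} \<in> E" "{d, b} \<in> E" using e by (simp_all add: insert_commute)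
    have lt: "f u \<le> f x \<and> f u \<le> f y \<and> f x < f y \<or> f x < f u \<and> f y < f u \<and> f x < f y \<or> f u \<le> f x \<and> f y < f u"
      if "g x < g y" "x \<in> V" "y \<in> V" for x y
      using that(1) N[OF that(2)] N[OF that(3)] N[OF assms(3)] by (auto simp: g_def split: if_splits)
    \<comment> \<open>The order of the four vertices by \<open>g\<close> is a rotation of their
      order by \<open>f\<close>.\<close>
    have "f a < f b \<and> f b < f c \<and> f c < f d \<or> f d < f a \<and> f a < f b \<and> f b < f c \<or>
        f c < f d \<and> f d < f a \<and> f a < f b \<or> f b < f c \<and> f c < f d \<and> f d < f a"
      using lt[OF g(1) V(1,2)] lt[OF g(2) V(2,3)] lt[OF g(3) V(3,4)] by linarith
    thus False using f(2)[of a b c d] f(2)[of d a b c] f(2)[of c d a b] f(2)[of b c d a] V e e' by blast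
  qed
  ultimately show ?thesis using that by blast
qed

definition page_order :: "('a \<Rightarrow> nat) \<Rightarrow> 'a set \<Rightarrow> 'a set set \<Rightarrow> bool" where
  "page_order f V E \<longleftrightarrow> inj_on f V \<and>
     (\<forall>a\<in>V. \<forall>b\<in>V. \<forall>c\<in>V. \<forall>d\<in>V. f a < f b \<longrightarrow> f b < f c \<longrightarrow> f c < f d \<longrightarrow> {a, c} \<in> E \<longrightarrow> {b, d} \<notin> E)"

lemma page_orderD:
  "page_order f V E \<Longrightarrow> a \<in> V \<Longrightarrow> b \<in> V \<Longrightarrow> c \<in> V \<Longrightarrow> d \<in> V \<Longrightarrow> f a < f b \<Longrightarrow> f b < f c \<Longrightarrow> f c < f d \<Longrightarrow>
     {a, c} \<in> E \<Longrightarrow> {b, d} \<in> E \<Longrightarrow> False"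
  unfolding page_order_def by blast

lemma book_rotated:
  assumes "book V E" "finite V" "u \<in> V"
  shows "\<exists>g. page_order g V E \<and> g u = 0"
proof -
  obtain g :: "'a \<Rightarrow> nat" where g: "inj_on g V" "g u = 0"
    "\<And>a b c d. a \<in> V \<Longrightarrow> b \<in> V \<Longrightarrow> c \<in> V \<Longrightarrow> d \<in> V \<Longrightarrow> g a < g b \<Longrightarrow> g b < g c \<Longrightarrow> g c < g d \<Longrightarrow>
       {a, c} \<in> E \<Longrightarrow> {b, d} \<in> E \<Longrightarrow> False"
    by (rule book_rotate[OF assms]) blast
  hence "page_order g V E" unfolding page_order_def by blast
  thus ?thesis using g(2) by blast
qed

text \<open>Put \<open>r\<close> first, then \<open>K\<close>, then \<open>K'\<close>. The two
  graphs share only \<open>r\<close>, the smallest vertex, so edges of different graphs cannot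
  cross.\<close>

lemma book_glue_root:
  assumes b: "book (insert r K) E1" "book (insert r K') E2"
    and d: "r \<notin> K" "r \<notin> K'" "K \<inter> K' = {}" and fin: "finite K" "finite K'"
    and sg: "simple_graph (insert r K) E1" "simple_graph (insert r K') E2"
  shows "book (insert r (K \<union> K')) (E1 \<union> E2)"
proof -
  obtain f :: "'a \<Rightarrow> nat" where f: "inj_on f (insert r K)" "f r = 0"
    "\<And>a b c d. a \<in> insert r K \<Longrightarrow> b \<in> insert r K \<Longrightarrow> c \<in> insert r K \<Longrightarrow> d \<in> insert r K \<Longrightarrow>
      f a < f b \<Longrightarrow> f b < f c \<Longrightarrow> f c < f d \<Longrightarrow> {a, c} \<in> E1 \<Longrightarrow> {b, d} \<in> E1 \<Longrightarrow> False"
    using book_rotate[OF b(1), of r] fin by blast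
  obtain g :: "'a \<Rightarrow> nat" where g: "inj_on g (insert r K')" "g r = 0"
    "\<And>a b c d. a \<in> insert r K' \<Longrightarrow> b \<in> insert r K' \<Longrightarrow> c \<in> insert r K' \<Longrightarrow> d \<in> insert r K' \<Longrightarrow>
      g a < g b \<Longrightarrow> g b < g c \<Longrightarrow> g c < g d \<Longrightarrow> {a, c} \<in> E2 \<Longrightarrow> {b, d} \<in> E2 \<Longrightarrow> False"
    using book_rotate[OF b(2), of r] fin by blast
  define M where "M = Suc (\<Sum>v\<in>K. f v)"
  have M: "f v < M" if "v \<in> K" for v
    using member_le_sum[of v K f] fin that by (simp add: M_def)
  have pos: "0 < f v" if "v \<in> K" for v using f(1,2) d that by (metis inj_onD insertCI neq0_conv)
  have posg: "0 < g v" if "v \<in> K'" for v using g(1,2) d that by (metis inj_onD insertCI neq0_conv)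
  define h where "h v = (if v \<in> K' then M + g v else f v)" for v
  have hr: "h r = 0" using d f by (simp add: h_def)
  have hK: "h v = f v" if "v \<in> K" for v using d that by (auto simp: h_def)
  have hK': "h v = M + g v" if "v \<in> K'" for v using that by (simp add: h_def)
  have hlt: "h x < h y" if "x \<in> K" "y \<in> K'" for x y using M[OF that(1)] hK hK' that by simp
  have e1: "x \<in> insert r K \<and> y \<in> insert r K" if "{x, y} \<in> E1" for x y
    using simple_graph_pair[OF sg(1) that] by simp
  have e2: "x \<in> insert r K' \<and> y \<in> insert r K'" if "{x, y} \<in> E2" for x y
    using simple_graph_pair[OF sg(2) that] by simp
  have hpos: "0 < h v" if "v \<in> K \<union> K'" for v using that pos hK hK' posg by auto
  have h1: "f x < f y" if "h x < h y" "x \<in> insert r K" "y \<in> insert r K" for x y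
    using that hr hK f(2) by auto
  have h2: "g x < g y" if "h x < h y" "x \<in> insert r K'" "y \<in> insert r K'" for x y
    using that hr hK' g(2) posg by auto
  have "inj_on h (insert r (K \<union> K'))"
  proof (rule inj_onI)
    fix x y assume xy: "x \<in> insert r (K \<union> K')" "y \<in> insert r (K \<union> K')" "h x = h y"
    have fK: "f x = f y \<Longrightarrow> x \<in> K \<Longrightarrow> y \<in> K \<Longrightarrow> x = y" using f(1) by (auto dest: inj_onD)
    have gK: "g x = g y \<Longrightarrow> x \<in> K' \<Longrightarrow> y \<in> K' \<Longrightarrow> x = y" using g(1) by (auto dest: inj_onD)
    show "x = y"
      using xy fK gK hr hK hK' hlt[of x y] hlt[of y x] hpos[of x] hpos[of y] by auto
  qed
  moreover have False
    if V: "a \<in> insert r (K \<union> K')" "b \<in> insert r (K \<union> K')" "c \<in> insert r (K \<union> K')" "d \<in> insert r (K \<union> K')"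
      and h: "h a < h b" "h b < h c" "h c < h d" and e: "{a, c} \<in> E1 \<union> E2" "{b, d} \<in> E1 \<union> E2" for a b c d
  proof -
    have nr: "b \<noteq> r" "c \<noteq> r" "d \<noteq> r" using h hr by auto
    have cross: "\<not> (y \<in> K' \<and> x \<in> K)" if "h y < h x" for x y using hlt[of x y] that by auto
    consider "{a, c} \<in> E1" "{b, d} \<in> E1" | "{a, c} \<in> E2" "{b, d} \<in> E2" | "{a, c} \<in> E1" "{b, d} \<in> E2"
      | "{a, c} \<in> E2" "{b, d} \<in> E1" using e by blast
    thus False
    proof cases
      case 1
      thus False using f(3)[of a b c d] e1 h h1 by blast
    next
      case 2
      thus False using g(3)[of a b c d] e2 h h2 by blast
    next
      case 3
      thus False using e1[of a c] e2[of b d] nr cross[OF h(2)] by auto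
    next
      case 4
      thus False using e2[of a c] e1[of b d] nr cross[OF h(3)] by auto
    qed
  qed
  ultimately show ?thesis unfolding book_def by blast
qed

section \<open>Graphs assembled from a dissected polygon and rooted branches\<close>

definition rooted_seqs :: "nat \<Rightarrow> 'a set \<Rightarrow> ('a \<times> 'a set \<times> 'a set set) list set" where
  "rooted_seqs m V = {l. length l = m \<and> (\<forall>(u, S, F)\<in>set l. u \<in> S \<and> F \<in> cog S) \<and>
     sorted_wrt (\<lambda>p q. fst (snd p) \<inter> fst (snd q) = {}) l \<and> (\<Union>p\<in>set l. fst (snd p)) = V}"

text \<open>Dissections of a polygon with vertices \<open>0, \<dots>, m\<close> rooted at 0; for \<open>m = 1\<close> a single edge.\<close>

definition dissections :: "nat \<Rightarrow> (nat \<times> nat) set set" where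
  "dissections m = {\<delta>. \<delta> \<subseteq> {(i, j). i < j \<and> j \<le> m} \<and> (\<forall>i<m. (i, Suc i) \<in> \<delta>) \<and> (0, m) \<in> \<delta> \<and>
     (\<forall>i j k l. i < j \<longrightarrow> j < k \<longrightarrow> k < l \<longrightarrow> (i, k) \<in> \<delta> \<longrightarrow> (j, l) \<notin> \<delta>)}"

definition assemble :: "'a \<Rightarrow> ('a \<times> 'a set \<times> 'a set set) list \<Rightarrow> (nat \<times> nat) set \<Rightarrow> 'a set set" where
  "assemble r l \<delta> = (\<Union>p\<in>set l. snd (snd p)) \<union>
     (\<lambda>(i, j). {(r # map fst l) ! i, (r # map fst l) ! j}) ` \<delta>"

definition branches :: "'a \<Rightarrow> 'a set set \<Rightarrow> 'a list \<Rightarrow> ('a \<times> 'a set \<times> 'a set set) list" where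
  "branches r E us = map (\<lambda>u. (u, {x. (u, x) \<in> (adj (off (set (r # us)) E))\<^sup>*},
     {e \<in> off (set (r # us)) E. e \<subseteq> {x. (u, x) \<in> (adj (off (set (r # us)) E))\<^sup>*}})) us"

definition chords :: "'a \<Rightarrow> 'a set set \<Rightarrow> 'a list \<Rightarrow> (nat \<times> nat) set" where
  "chords r E us = {(i, j). i < j \<and> j \<le> length us \<and> {(r # us) ! i, (r # us) ! j} \<in> E}"

lemma cogD:
  assumes "E \<in> cog V"
  shows "simple_graph V E" "connected_graph V E" "outerplanar V E" "finite V" "V \<noteq> {}"
  using assms by (auto simp: cog_def simple_graph_def connected_graph_def)

lemma reach_closed:
  assumes "(x, y) \<in> (adj E)\<^sup>*" "x \<in> S" "\<And>a b. a \<in> S \<Longrightarrow> {a, b} \<in> E \<Longrightarrow> b \<in> S"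
  shows "y \<in> S"
  using assms(1,2) by (induction rule: rtrancl_induct) (auto intro: assms(3))

text \<open>One half of the bijection behind the count: \<open>branches\<close> and
  \<open>chords\<close> recover \<open>l\<close> and \<open>\<delta>\<close> from the assembled
  graph. The other half is \<open>nonsep_decompose\<close>.\<close>

locale assembly =
  fixes r :: 'a and V :: "'a set" and m :: nat and l :: "('a \<times> 'a set \<times> 'a set set) list"
    and \<delta> :: "(nat \<times> nat) set"
  assumes rV: "r \<notin> V" and l: "l \<in> rooted_seqs m V" and m: "m \<ge> 1" and \<delta>: "\<delta> \<in> dissections m"
begin

definition "u i = fst (l ! i)"
definition "S i = fst (snd (l ! i))"
definition "F i = snd (snd (l ! i))"
abbreviation "ws \<equiv> r # map fst l"
abbreviation "E \<equiv> assemble r l \<delta>"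

lemma len: "length l = m" using l by (simp add: rooted_seqs_def)

lemma uS: "i < m \<Longrightarrow> u i \<in> S i" and Fcog: "i < m \<Longrightarrow> F i \<in> cog (S i)"
proof -
  assume "i < m"
  hence "l ! i \<in> set l" using len by simp
  moreover have "\<forall>p\<in>set l. fst p \<in> fst (snd p) \<and> snd (snd p) \<in> cog (fst (snd p))"
    using l unfolding rooted_seqs_def by fastforce
  ultimately show "u i \<in> S i" "F i \<in> cog (S i)" by (auto simp: u_def S_def F_def)
qed

lemma Sdisj: "i < m \<Longrightarrow> j < m \<Longrightarrow> x \<in> S i \<Longrightarrow> x \<in> S j \<Longrightarrow> i = j"
proof (rule ccontr)
  assume *: "i < m" "j < m" "x \<in> S i" "x \<in> S j" "i \<noteq> j"
  have "sorted_wrt (\<lambda>p q. fst (snd p) \<inter> fst (snd q) = {}) l" using l by (simp add: rooted_seqs_def)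
  hence "S i \<inter> S j = {}" using sorted_wrt_nth_less[of _ l i j] sorted_wrt_nth_less[of _ l j i] * len
    unfolding S_def by (cases "i < j") (force simp: Int_commute)+
  thus False using * by blast
qed

lemma SV: "V = (\<Union>i<m. S i)"
proof -
  have "V = (\<Union>p\<in>set l. fst (snd p))" using l by (simp add: rooted_seqs_def)
  also have "\<dots> = (\<Union>i<m. S i)" unfolding S_def len[symmetric] set_conv_nth by blast
  finally show ?thesis .
qed

lemma finV: "finite V" unfolding SV using Fcog by (auto dest: cogD)

lemma ws_Suc: "i < m \<Longrightarrow> ws ! Suc i = u i" using len by (simp add: u_def)

lemma set_us: "set (map fst l) = u ` {..<m}" using len by (force simp: u_def set_conv_nth)

lemma us_V: "set (map fst l) \<subseteq> V" unfolding set_us SV using uS by blast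

lemma uV: "i < m \<Longrightarrow> u i \<in> V" using uS SV by blast

lemma dist: "distinct ws"
proof -
  have "u i = u j \<Longrightarrow> i = j" if "i < m" "j < m" for i j using Sdisj[of i j "u i"] uS that by metis
  hence "distinct (map fst l)" using len by (auto simp: distinct_conv_nth u_def)
  thus ?thesis using us_V rV by auto
qed

lemma S_ws: "i < m \<Longrightarrow> x \<in> S i \<Longrightarrow> x \<in> set ws \<Longrightarrow> x = u i"
proof -
  assume x: "i < m" "x \<in> S i" "x \<in> set ws"
  hence "x \<noteq> r" using SV rV by blast
  then obtain j where j: "j < m" "x = u j" using x(3) set_us by auto
  thus "x = u i" using Sdisj[of i j x] x uS by simp
qed

lemma E_eq: "E = (\<Union>i<m. F i) \<union> (\<lambda>(i, j). {ws ! i, ws ! j}) ` \<delta>"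
proof -
  have "(\<Union>p\<in>set l. snd (snd p)) = (\<Union>i<m. F i)"
    unfolding F_def len[symmetric] set_conv_nth by blast
  thus ?thesis by (simp add: assemble_def)
qed

lemma \<delta>D: "(i, j) \<in> \<delta> \<Longrightarrow> i < j \<and> j \<le> m" using \<delta> by (auto simp: dissections_def)

lemma F_sub: "i < m \<Longrightarrow> e \<in> F i \<Longrightarrow> e \<subseteq> S i \<and> card e = 2"
  using cogD(1)[OF Fcog] by (auto simp: simple_graph_def)

text \<open>Polygon edges lie inside \<open>set ws\<close>, while an edge of a branch has two ends,
  of which at most the root \<open>u i\<close> is in \<open>set ws\<close>.\<close>

lemma off_eq: "off (set ws) E = (\<Union>i<m. F i)"
proof
  show "off (set ws) E \<subseteq> (\<Union>i<m. F i)"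
  proof
    fix e assume e: "e \<in> off (set ws) E"
    have "e \<notin> (\<lambda>(i, j). {ws ! i, ws ! j}) ` \<delta>"
    proof
      assume "e \<in> (\<lambda>(i, j). {ws ! i, ws ! j}) ` \<delta>"
      then obtain i j where ij: "(i, j) \<in> \<delta>" "e = {ws ! i, ws ! j}" by auto
      hence "i < length ws" "j < length ws" using \<delta>D[OF ij(1)] len by auto
      hence "e \<subseteq> set ws" using ij nth_mem by blast
      thus False using e by (simp add: off_def)
    qed
    thus "e \<in> (\<Union>i<m. F i)" using e E_eq by (auto simp: off_def)
  qed
  show "(\<Union>i<m. F i) \<subseteq> off (set ws) E"
  proof
    fix e assume "e \<in> (\<Union>i<m. F i)"
    then obtain i where i: "i < m" "e \<in> F i" by auto
    have "\<not> e \<subseteq> set ws"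
    proof
      assume "e \<subseteq> set ws"
      hence "e \<subseteq> {u i}" using F_sub[OF i] S_ws[OF i(1)] by blast
      hence "card e \<le> 1" using card_mono[of "{u i}" e] by simp
      thus False using F_sub[OF i] by simp
    qed
    thus "e \<in> off (set ws) E" using i E_eq by (auto simp: off_def)
  qed
qed

lemma simple: "simple_graph (insert r V) E"
  unfolding simple_graph_def
proof (intro conjI ballI)
  show "finite (insert r V)" using finV by simp
  fix e assume "e \<in> E"
  then consider i where "i < m" "e \<in> F i" | i j where "(i, j) \<in> \<delta>" "e = {ws ! i, ws ! j}"
    unfolding E_eq by auto
  hence "e \<subseteq> insert r V \<and> card e = 2"
  proof cases
    case 1
    thus ?thesis using F_sub[OF 1] SV by auto
  next
    case 2
    have ij: "i < length ws" "j < length ws" "i \<noteq> j" using \<delta>D[OF 2(1)] len by auto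
    have "set ws \<subseteq> insert r V" using us_V by auto
    hence "ws ! i \<in> insert r V" "ws ! j \<in> insert r V" using ij(1,2) nth_mem by blast+
    moreover have "ws ! i \<noteq> ws ! j" using ij dist nth_eq_iff_index_eq by blast
    ultimately show ?thesis using 2 by auto
  qed
  thus "e \<subseteq> insert r V" "card e = 2" by auto
qed

lemma reach_S: "i < m \<Longrightarrow> z \<in> S i \<Longrightarrow> (z, x) \<in> (adj (\<Union>i<m. F i))\<^sup>* \<longleftrightarrow> x \<in> S i"
proof
  assume i: "i < m" "z \<in> S i"
  {
    assume "(z, x) \<in> (adj (\<Union>i<m. F i))\<^sup>*"
    thus "x \<in> S i"
    proof (rule reach_closed)
      fix a b assume "a \<in> S i" "{a, b} \<in> (\<Union>i<m. F i)"
      then obtain j where j: "j < m" "{a, b} \<in> F j" by auto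
      hence "{a, b} \<subseteq> S j" using F_sub by blast
      thus "b \<in> S i" using Sdisj[of i j a] i j \<open>a \<in> S i\<close> by auto
    qed (use i in simp)
  }
  assume "x \<in> S i"
  hence "(z, x) \<in> (adj (F i))\<^sup>*" using cogD(2)[OF Fcog[OF i(1)]] i by (auto simp: connected_graph_def)
  thus "(z, x) \<in> (adj (\<Union>i<m. F i))\<^sup>*" by (rule adj_mono[rotated]) (use i in auto)
qed

lemma \<delta>_edge: "(i, j) \<in> \<delta> \<Longrightarrow> {ws ! i, ws ! j} \<in> E"
  unfolding E_eq by (rule UnI2) (force intro: image_eqI)

lemma cyc_edge: "i < m \<Longrightarrow> {ws ! i, ws ! Suc i} \<in> E"
  using \<delta> by (intro \<delta>_edge) (simp add: dissections_def)

lemma r_edge: "e \<in> E \<Longrightarrow> r \<in> e \<Longrightarrow> e \<subseteq> set ws"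
proof -
  assume e: "e \<in> E" "r \<in> e"
  have "e \<notin> off (set ws) E" unfolding off_eq using F_sub SV rV e by blast
  thus ?thesis using e by (auto simp: off_def)
qed

lemma reach_u: "i < m \<Longrightarrow> (u 0, u i) \<in> (adj {e \<in> E. r \<notin> e})\<^sup>*"
proof (induction i)
  case (Suc i)
  have "{u i, u (Suc i)} \<in> {e \<in> E. r \<notin> e}"
    using cyc_edge[of "Suc i"] ws_Suc[of i] ws_Suc[of "Suc i"] Suc uV[of i] uV[of "Suc i"] rV
    by (auto simp del: nth_Cons_Suc)
  thus ?case using Suc by (auto intro: rtrancl_into_rtrancl)
qed simp

lemma conn_V: "connected_graph V {e \<in> E. r \<notin> e}"
proof (rule connected_graphI)
  show "u 0 \<in> V" using uS[of 0] m SV by auto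
  fix v assume "v \<in> V"
  then obtain i where i: "i < m" "v \<in> S i" using SV by auto
  have "(u i, v) \<in> (adj (\<Union>i<m. F i))\<^sup>*" using reach_S[OF i(1) uS[OF i(1)]] i by simp
  hence "(u i, v) \<in> (adj {e \<in> E. r \<notin> e})\<^sup>*"
    by (rule adj_mono[rotated]) (use E_eq F_sub SV rV in blast)
  thus "(u 0, v) \<in> (adj {e \<in> E. r \<notin> e})\<^sup>*" using reach_u[OF i(1)] by simp
qed

lemma conn: "connected_graph (insert r V) E"
proof (rule connected_graphI[of r])
  fix v assume v: "v \<in> insert r V"
  have r0: "(r, u 0) \<in> adj E" using cyc_edge[of 0] ws_Suc[of 0] m by simp
  show "(r, v) \<in> (adj E)\<^sup>*"
  proof (cases "v = r")
    case False
    have "u 0 \<in> V" "v \<in> V" using uV[of 0] m v False by auto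
    hence "(u 0, v) \<in> (adj {e \<in> E. r \<notin> e})\<^sup>*" using conn_V unfolding connected_graph_def by blast
    hence "(u 0, v) \<in> (adj E)\<^sup>*" by (rule adj_mono[rotated]) auto
    thus ?thesis using r0 by (rule converse_rtrancl_into_rtrancl[rotated])
  qed simp
qed simp

text \<open>Branches are disjoint and each meets the polygon only in its root, so distinct polygon
  vertices are not connected through them.\<close>

lemma cycle: "root_cycle r E (map fst l)"
  unfolding root_cycle_def
proof (intro conjI ballI impI)
  show "map fst l \<noteq> []" using len m by auto
  show "distinct ws" by (rule dist)
  have L: "length (ws @ [r]) = Suc (Suc m)" using len by simp
  show "walk E (r # map fst l @ [r])"
  proof (unfold append_Cons[symmetric], subst successively_conv_nth, intro allI impI)
    fix i assume i: "Suc i < length (ws @ [r])"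
    show "{(ws @ [r]) ! i, (ws @ [r]) ! Suc i} \<in> E"
    proof (cases "i < m")
      case True
      hence "(ws @ [r]) ! i = ws ! i" "(ws @ [r]) ! Suc i = ws ! Suc i"
        using len by (subst nth_append; simp)+
      thus ?thesis using cyc_edge[OF True] by simp
    next
      case False
      hence im: "i = m" using i L by simp
      have "(ws @ [r]) ! m = ws ! m" "(ws @ [r]) ! Suc m = r" using len by (subst nth_append; simp)+
      moreover have "{ws ! 0, ws ! m} \<in> E" using \<delta> by (intro \<delta>_edge) (simp add: dissections_def)
      ultimately show ?thesis unfolding im by (simp add: insert_commute)
    qed
  qed
  fix z z' assume z: "z \<in> set ws" "z' \<in> set ws" "(z, z') \<in> (adj (off (set ws) E))\<^sup>*"
  show "z = z'"
  proof (cases "z = r")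
    case True
    have "z' \<in> {r}"
    proof (rule reach_closed[OF z(3)])
      fix a b assume "a \<in> {r}" "{a, b} \<in> off (set ws) E"
      then obtain i where "i < m" "{a, b} \<in> F i" "a = r" unfolding off_eq by auto
      hence "r \<in> V" using F_sub SV by blast
      thus "b \<in> {r}" using rV by simp
    qed (use True in simp)
    thus ?thesis using True by simp
  next
    case False
    then obtain i where i: "i < m" "z \<in> S i" using z us_V SV by auto
    hence "z' \<in> S i" using reach_S[OF i] z(3) off_eq by simp
    thus ?thesis using S_ws[OF i(1)] i z by blast
  qed
next
  fix e assume "e \<in> E" "r \<in> e"
  thus "e \<subseteq> set ws" by (rule r_edge)
qed

lemma branches_eq: "branches r E (map fst l) = l"
proof (rule nth_equalityI)
  show "length (branches r E (map fst l)) = length l" by (simp add: branches_def)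
  fix i assume "i < length (branches r E (map fst l))"
  hence i: "i < m" using len by (simp add: branches_def)
  have S: "{x. (u i, x) \<in> (adj (off (set ws) E))\<^sup>*} = S i" using reach_S[OF i uS[OF i]] off_eq by auto
  have "{e \<in> off (set ws) E. e \<subseteq> S i} = F i" (is "?A = _")
  proof
    show "F i \<subseteq> ?A" using i F_sub unfolding off_eq by blast
    show "?A \<subseteq> F i"
    proof
      fix e assume "e \<in> ?A"
      then obtain j where j: "j < m" "e \<in> F j" "e \<subseteq> S i" unfolding off_eq by auto
      hence "e \<noteq> {}" "e \<subseteq> S j" using F_sub[OF j(1,2)] by auto
      hence "i = j" using Sdisj i j by blast
      thus "e \<in> F i" using j by simp
    qed
  qed
  hence "branches r E (map fst l) ! i = (u i, S i, F i)"
    using S i len by (simp add: branches_def u_def)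
  thus "branches r E (map fst l) ! i = l ! i" by (simp add: u_def S_def F_def)
qed

lemma edge_ws: "i \<le> m \<Longrightarrow> j \<le> m \<Longrightarrow> i < j \<Longrightarrow> {ws ! i, ws ! j} \<in> E \<longleftrightarrow> (i, j) \<in> \<delta>"
proof
  assume ij: "i \<le> m" "j \<le> m" "i < j"
  { assume "(i, j) \<in> \<delta>" thus "{ws ! i, ws ! j} \<in> E" unfolding E_eq by force }
  assume e: "{ws ! i, ws ! j} \<in> E"
  have "{ws ! i, ws ! j} \<subseteq> set ws" using ij len nth_mem[of i ws] nth_mem[of j ws] by simp
  hence "{ws ! i, ws ! j} \<notin> off (set ws) E" by (simp add: off_def)
  then obtain i' j' where e: "(i', j') \<in> \<delta>" "{ws ! i, ws ! j} = {ws ! i', ws ! j'}"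
    using e off_eq unfolding E_eq by auto
  have "ws ! a = ws ! b \<longleftrightarrow> a = b" if "a \<le> m" "b \<le> m" for a b
    using dist nth_eq_iff_index_eq[of ws a b] len that by simp
  hence *: "ws ! a = ws ! b \<Longrightarrow> a \<le> m \<Longrightarrow> b \<le> m \<Longrightarrow> a = b" for a b by blast
  have le: "i' \<le> m" "j' \<le> m" using \<delta>D[OF e(1)] by auto
  have "ws ! i = ws ! i' \<and> ws ! j = ws ! j' \<or> ws ! i = ws ! j' \<and> ws ! j = ws ! i'"
    using e(2) by (simp only: doubleton_eq_iff)
  hence "i = i' \<and> j = j' \<or> i = j' \<and> j = i'"
    using *[OF _ ij(1) le(1)] *[OF _ ij(1) le(2)] *[OF _ ij(2) le(1)] *[OF _ ij(2) le(2)] by blast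
  thus "(i, j) \<in> \<delta>" using e(1) \<delta>D[OF e(1)] ij by auto
qed

lemma chords_eq: "chords r E (map fst l) = \<delta>"
proof -
  have "(i, j) \<in> chords r E (map fst l) \<longleftrightarrow> (i, j) \<in> \<delta>" for i j
    using edge_ws[of i j] \<delta>D[of i j] len by (auto simp: chords_def simp del: nth_Cons_pos)
  thus ?thesis by auto
qed

text \<open>Branches avoid \<open>r\<close>, so its edges are those of the dissection at the polygon
  vertex 0.\<close>

lemma degree: "degree_of E r = card {j. (0, j) \<in> \<delta>}"
proof -
  have "{e \<in> E. r \<in> e} = (\<lambda>j. {r, ws ! j}) ` {j. (0, j) \<in> \<delta>}"
  proof (intro equalityI subsetI)
    fix e assume e: "e \<in> {e \<in> E. r \<in> e}"
    then obtain x where x: "e = {r, x}" "r \<noteq> x" using simple_graph_edge[OF simple, of e r] by auto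
    hence "x \<in> set ws" using r_edge[of e] e by auto
    then obtain j where j: "j < length ws" "x = ws ! j" by (metis in_set_conv_nth)
    hence "(0, j) \<in> \<delta>" using edge_ws[of 0 j] e x len by (cases j) auto
    thus "e \<in> (\<lambda>j. {r, ws ! j}) ` {j. (0, j) \<in> \<delta>}" using x j by blast
  next
    fix e assume "e \<in> (\<lambda>j. {r, ws ! j}) ` {j. (0, j) \<in> \<delta>}"
    then obtain j where j: "(0, j) \<in> \<delta>" "e = {r, ws ! j}" by auto
    thus "e \<in> {e \<in> E. r \<in> e}" using edge_ws[of 0 j] \<delta>D[OF j(1)] by auto
  qed
  moreover have "inj_on (\<lambda>j. {r, ws ! j}) {j. (0, j) \<in> \<delta>}"
  proof (rule inj_onI)
    fix i j assume ij: "i \<in> {j. (0, j) \<in> \<delta>}" "j \<in> {j. (0, j) \<in> \<delta>}" "{r, ws ! i} = {r, ws ! j}"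
    hence lt: "0 < i" "i < length ws" "0 < j" "j < length ws" using \<delta>D len by force+
    hence "ws ! i \<noteq> ws ! 0" "ws ! j \<noteq> ws ! 0" using dist nth_eq_iff_index_eq[of ws _ 0] by auto
    hence "ws ! i = ws ! j" using ij(3) by (auto simp: doubleton_eq_iff)
    thus "i = j" using dist nth_eq_iff_index_eq[of ws i j] lt by simp
  qed
  ultimately show ?thesis by (simp add: degree_of_def card_image)
qed

text \<open>The orders of the branches are rotated so that each root comes first, and are then glued
  along the polygon with \<open>book_glue\<close>.\<close>

lemma book_assemble:
  assumes "\<And>i. i < m \<Longrightarrow> book (S i) (F i)"
  shows "book (insert r V) E"
proof -
  define f where "f i = (SOME g. page_order g (S i) (F i) \<and> g (u i) = 0)" for i
  have "page_order (f i) (S i) (F i) \<and> f i (u i) = 0" if "i < m" for i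
  proof -
    have "\<exists>g. page_order g (S i) (F i) \<and> g (u i) = 0"
    proof -
      have 1: "book (S i) (F i)" using that by (rule assms)
      have 2: "finite (S i)" using Fcog[OF that] by (rule cogD(4))
      have 3: "u i \<in> S i" using that by (rule uS)
      show ?thesis
      by (rule book_rotated[OF 1 2 3])
    qed
    from someI_ex[OF this] show ?thesis by (simp only: f_def)
  qed
  hence po: "\<And>i. i < m \<Longrightarrow> page_order (f i) (S i) (F i)" and f: "\<And>i. i < m \<Longrightarrow> f i (u i) = 0"
    by simp_all
  define idx where "idx v = (THE i. i < m \<and> v \<in> S i)" for v
  have idx: "idx v = i" if "i < m" "v \<in> S i" for v i
    unfolding idx_def by (rule the_equality) (use that Sdisj in auto)
  \<comment> \<open>\<open>r\<close> forms part 0 and branch \<open>i\<close> is part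
    \<open>Suc i\<close>, matching the numbering of the polygon vertices in
    \<open>ws\<close>.\<close>
  define part where "part v = (if v = r then 0 else Suc (idx v))" for v
  define g where "g v = (if v = r then 0 else f (idx v) v)" for v
  have Sr: "r \<notin> S i" if "i < m" for i using that SV rV by blast
  have partS: "part v = Suc i" "g v = f i v" if "i < m" "v \<in> S i" for i v
    using idx[OF that] Sr[OF that(1)] that by (auto simp: part_def g_def)
  have partr: "part r = 0" "g r = 0" by (simp_all add: part_def g_def)
  have cases: "v = r \<or> (\<exists>i<m. v \<in> S i \<and> part v = Suc i)" if "v \<in> insert r V" for v
    using that SV partS by auto
  have pw: "part (ws ! i) = i" "g (ws ! i) = 0" if "i \<le> m" for i
    using that partr ws_Suc[of "i - 1"] partS[OF _ uS, of "i - 1"] f[of "i - 1"] by (cases i; auto)+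
  have edge: "(\<exists>i<m. {x, y} \<in> F i \<and> x \<in> S i \<and> y \<in> S i) \<or> (\<exists>i j. (i, j) \<in> \<delta> \<and> {x, y} = {ws ! i, ws ! j} \<and>
      g x = 0 \<and> g y = 0 \<and> {part x, part y} = {i, j})"
    if "{x, y} \<in> E" for x y
  proof -
    consider i where "i < m" "{x, y} \<in> F i" | i j where "(i, j) \<in> \<delta>" "{x, y} = {ws ! i, ws ! j}"
      using \<open>{x, y} \<in> E\<close> unfolding E_eq by auto
    thus ?thesis
    proof cases
      case 1
      thus ?thesis using F_sub[OF 1] by auto
    next
      case 2
      hence "i \<le> m" "j \<le> m" using \<delta>D by force+
      hence "g x = 0 \<and> g y = 0 \<and> {part x, part y} = {i, j}" using 2(2) pw by (auto simp: doubleton_eq_iff)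
      thus ?thesis using 2 by blast
    qed
  qed
  show ?thesis
  proof (rule book_glue[of _ part g])
    show "finite (insert r V)" using finV by simp
    fix x y assume x: "x \<in> insert r V" "y \<in> insert r V"
    {
      assume "part x = part y" "g x = g y"
      show "x = y"
      proof (cases "part x = 0")
        case True
        thus ?thesis using cases[OF x(1)] cases[OF x(2)] \<open>part x = part y\<close> by auto
      next
        case False
        then obtain i j where ij: "i < m" "x \<in> S i" "j < m" "y \<in> S j"
          using cases[OF x(1)] cases[OF x(2)] \<open>part x = part y\<close> partr by auto
        hence "i = j" using partS(1) \<open>part x = part y\<close> by simp
        moreover have "f i x = f j y" using partS(2) ij \<open>g x = g y\<close> by simp
        ultimately show ?thesis using po[of i] ij by (auto simp: page_order_def dest: inj_onD)
      qed
    }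
    assume "{x, y} \<in> E"
    thus "part x = part y \<or> g x = 0 \<and> g y = 0" using edge[of x y] partS(1) by metis
  next
    fix a b c d assume v: "{a, b, c, d} \<subseteq> insert r V"
    {
      assume p: "part a = part b" "part b = part c" "part c = part d" and lt: "g a < g b" "g b < g c" "g c < g d"
        and e: "{a, c} \<in> E" "{b, d} \<in> E"
      obtain i where i: "i < m" "{a, c} \<in> F i" "a \<in> S i" "c \<in> S i" using edge[OF e(1)] lt by (metis not_less0)
      obtain j where j: "j < m" "{b, d} \<in> F j" "b \<in> S j" "d \<in> S j" using edge[OF e(2)] lt by (metis not_less0)
      have "i = j" using partS(1)[OF i(1,3)] partS(1)[OF j(1,3)] p by simp
      thus False using page_orderD[OF po[OF i(1)], of a b c d] i j lt partS(2) by simp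
    }
    assume z: "g a = 0" "g b = 0" "g c = 0" "g d = 0" and p: "part a < part b" "part b < part c" "part c < part d"
      and e: "{a, c} \<in> E" "{b, d} \<in> E"
    have "\<not> (\<exists>i<m. {a, c} \<in> F i \<and> a \<in> S i \<and> c \<in> S i)" "\<not> (\<exists>i<m. {b, d} \<in> F i \<and> b \<in> S i \<and> d \<in> S i)"
      using partS(1) p by (metis less_irrefl less_trans)+
    then obtain i k j h where ik: "(i, k) \<in> \<delta>" "{part a, part c} = {i, k}"
      and jh: "(j, h) \<in> \<delta>" "{part b, part d} = {j, h}" using edge[OF e(1)] edge[OF e(2)] by blast
    have "i = part a" "k = part c" "j = part b" "h = part d"
      using ik jh \<delta>D[OF ik(1)] \<delta>D[OF jh(1)] p by (auto simp: doubleton_eq_iff)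
    moreover have "\<And>i j k l. i < j \<Longrightarrow> j < k \<Longrightarrow> k < l \<Longrightarrow> (i, k) \<in> \<delta> \<Longrightarrow> (j, l) \<notin> \<delta>"
      using \<delta> unfolding dissections_def by blast
    ultimately show False using ik jh p by blast
  qed
qed

end

text \<open>The branch at a cycle vertex consists of what it reaches off the cycle. Branches are
  disjoint by the defining property of a root cycle and cover \<open>V\<close> because the graph is
  connected; the chords do not cross by \<open>cycle_chords_noncrossing\<close>.\<close>

lemma nonsep_decompose:
  assumes E: "E \<in> nonsep r V" and r: "r \<notin> V" and cyc: "root_cycle r E us"
  shows "branches r E us \<in> rooted_seqs (length us) V" "chords r E us \<in> dissections (length us)"
    "assemble r (branches r E us) (chords r E us) = E" "map fst (branches r E us) = us"
proof -
  note N = nonsepD[OF E]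
  let ?W = "set (r # us)"
  have c: "us \<noteq> []" "distinct (r # us)" "walk E (r # us @ [r])"
    "\<forall>z\<in>?W. \<forall>z'\<in>?W. (z, z') \<in> (adj (off ?W E))\<^sup>* \<longrightarrow> z = z'" "\<forall>e\<in>E. r \<in> e \<longrightarrow> e \<subseteq> ?W"
    subgoal using cyc by (simp add: root_cycle_def)
    subgoal using cyc by (simp add: root_cycle_def)
    subgoal using cyc by (simp add: root_cycle_def)
    subgoal using cyc unfolding root_cycle_def by (elim conjE)
    subgoal using cyc unfolding root_cycle_def by (elim conjE)
    done
  define S where "S u = {x. (u, x) \<in> (adj (off ?W E))\<^sup>*}" for u
  define F where "F u = {e \<in> off ?W E. e \<subseteq> S u}" for u
  have br: "branches r E us = map (\<lambda>u. (u, S u, F u)) us" by (simp add: branches_def S_def F_def)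
  show mf: "map fst (branches r E us) = us" unfolding br by (simp add: comp_def)
  have inV: "x \<in> insert r V" if "{x, y} \<in> E" for x y using simple_graph_pair[OF N(1) that] by simp
  have Sself: "u \<in> S u" for u by (simp add: S_def)
  have Sclosed: "y \<in> S u" if "x \<in> S u" "{x, y} \<in> off ?W E" for x y u
    using that unfolding S_def by (auto intro: rtrancl_into_rtrancl)
  have roff: "r \<notin> e" if "e \<in> off ?W E" for e using that c(5) by (auto simp: off_def)
  have Sr: "S r = {r}"
  proof -
    have "x \<in> {r}" if "x \<in> S r" for x
      by (rule reach_closed[of r x "off ?W E"]) (use that roff in \<open>auto simp: S_def\<close>)
    thus ?thesis using Sself by auto
  qed
  have usV: "set us \<subseteq> V"
  proof
    fix x assume x: "x \<in> set us"
    have "\<Union> (pedges (r # us @ [r])) = set (r # us @ [r])" by (rule Union_pedges) simp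
    hence "x \<in> \<Union> (pedges (r # us @ [r]))" using x by simp
    moreover have "pedges (r # us @ [r]) \<subseteq> E" by (intro pedges_subset c)
    ultimately have "x \<in> insert r V" using N(1) by (auto simp: simple_graph_def)
    thus "x \<in> V" using x c(2) by auto
  qed
  have SV: "S u \<subseteq> V" if "u \<in> set us" for u
  proof
    fix x assume x: "x \<in> S u"
    show "x \<in> V"
    proof (rule reach_closed)
      show "(u, x) \<in> (adj (off ?W E))\<^sup>*" using x by (simp add: S_def)
      show "u \<in> V" using usV that by blast
      fix a b assume ab: "{a, b} \<in> off ?W E"
      hence "b \<noteq> r" using roff by blast
      moreover have "{b, a} \<in> E" using ab by (simp add: off_def insert_commute)
      ultimately show "b \<in> V" using inV[of b a] by blast
    qed
  qed
  have Sd: "S u \<inter> S u' = {}" if "u \<in> set us" "u' \<in> set us" "u \<noteq> u'" for u u'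
  proof (rule ccontr)
    assume "S u \<inter> S u' \<noteq> {}"
    then obtain x where "x \<in> S u" "x \<in> S u'" by blast
    hence "(u, u') \<in> (adj (off ?W E))\<^sup>*" using adj_sym[of u' x] unfolding S_def by (auto intro: rtrancl_trans)
    thus False using c(4) that by (metis list.set_intros(2))
  qed
  \<comment> \<open>An edge not in \<open>off\<close> has both ends on the cycle, so a path from
    \<open>r\<close> never leaves the union of \<open>S r\<close> and the branches.\<close>
  have cov: "x \<in> S r \<union> (\<Union>u\<in>set us. S u)" if "x \<in> insert r V" for x
  proof (rule reach_closed)
    show "(r, x) \<in> (adj E)\<^sup>*" using N(2) that by (auto simp: connected_graph_def)
    show "r \<in> S r \<union> (\<Union>u\<in>set us. S u)" using Sself by auto
    fix a b assume a: "a \<in> S r \<union> (\<Union>u\<in>set us. S u)" and e: "{a, b} \<in> E"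
    show "b \<in> S r \<union> (\<Union>u\<in>set us. S u)"
    proof (cases "{a, b} \<in> off ?W E")
      case True
      thus ?thesis using a Sclosed by blast
    next
      case False
      hence "b \<in> ?W" using e by (auto simp: off_def)
      thus ?thesis using Sself by auto
    qed
  qed
  have V: "(\<Union>u\<in>set us. S u) = V"
  proof
    show "(\<Union>u\<in>set us. S u) \<subseteq> V" using SV by blast
    show "V \<subseteq> (\<Union>u\<in>set us. S u)"
    proof
      fix x assume "x \<in> V"
      thus "x \<in> (\<Union>u\<in>set us. S u)" using cov[of x] Sr r by auto
    qed
  qed
  have Fcog: "F u \<in> cog (S u)" if "u \<in> set us" for u
  proof -
    have sub: "S u \<subseteq> insert r V" "F u \<subseteq> E" using SV[OF that] by (auto simp: F_def off_def)
    have sg: "simple_graph (S u) (F u)"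
      by (rule simple_graph_subset[OF N(1) sub(2) _ sub(1)]) (auto simp: F_def)
    have "connected_graph (S u) (F u)"
    proof (rule connected_graphI[OF Sself])
      fix v assume "v \<in> S u"
      hence "(u, v) \<in> (adj (off ?W E))\<^sup>*" by (simp add: S_def)
      hence "(u, v) \<in> (adj (F u))\<^sup>* \<and> v \<in> S u"
      proof (induction rule: rtrancl_induct)
        case (step y z)
        hence "{y, z} \<in> off ?W E" by simp
        hence "z \<in> S u" using Sclosed step by blast
        moreover have "{y, z} \<in> F u" using \<open>{y, z} \<in> off ?W E\<close> step \<open>z \<in> S u\<close> by (simp add: F_def)
        ultimately show ?case using step by (auto intro: rtrancl_into_rtrancl)
      qed (simp add: Sself)
      thus "(u, v) \<in> (adj (F u))\<^sup>*" ..
    qed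
    thus ?thesis using sg outerplanar_subgraph[OF N(3) sub sg] by (simp add: cog_def)
  qed
  show "branches r E us \<in> rooted_seqs (length us) V"
    unfolding rooted_seqs_def br
  proof (intro CollectI conjI)
    have "distinct us" using c(2) by simp
    thus "sorted_wrt (\<lambda>p q. fst (snd p) \<inter> fst (snd q) = {}) (map (\<lambda>u. (u, S u, F u)) us)"
      using Sd by (auto simp: sorted_wrt_iff_nth_less nth_eq_iff_index_eq)
    show "\<forall>(u, S, F)\<in>set (map (\<lambda>u. (u, S u, F u)) us). u \<in> S \<and> F \<in> cog S" using Fcog Sself by auto
    show "(\<Union>p\<in>set (map (\<lambda>u. (u, S u, F u)) us). fst (snd p)) = V" using V by auto
  qed simp
  have ce: "{(r # us) ! i, (r # us) ! Suc i} \<in> E" if "i < length us" for i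
  proof -
    have "walk E ((r # us) @ [r])" using c(3) by simp
    hence "walk E (r # us)" by (rule walk_prefix)
    thus ?thesis using that unfolding successively_conv_nth by auto
  qed
  have last: "{r, (r # us) ! length us} \<in> E"
  proof -
    have "us = butlast us @ [last us]" using c(1) by simp
    hence "walk E ((r # butlast us) @ [last us, r])" using c(3) by (metis append.assoc append_Cons append_Nil)
    from walk_suffix[OF this] have "{last us, r} \<in> E" by simp
    moreover have "(r # us) ! length us = last us" using c(1) by (simp add: last_conv_nth nth_Cons')
    ultimately show ?thesis by (simp add: insert_commute)
  qed
  show "chords r E us \<in> dissections (length us)"
    unfolding dissections_def
  proof (intro CollectI conjI allI impI)
    show "chords r E us \<subseteq> {(i, j). i < j \<and> j \<le> length us}" by (auto simp: chords_def)
    show "(i, Suc i) \<in> chords r E us" if "i < length us" for i using ce[OF that] that by (simp add: chords_def)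
    show "(0, length us) \<in> chords r E us" using last c(1) by (simp add: chords_def)
    show "(j, l) \<notin> chords r E us" if ijkl: "i < j" "j < k" "k < l" "(i, k) \<in> chords r E us" for i j k l
    proof
      assume "(j, l) \<in> chords r E us"
      thus False using ijkl cycle_chords_noncrossing[OF N(1,3) c(2,3), of i j k l]
        by (auto simp: chords_def)
    qed
  qed
  show "assemble r (branches r E us) (chords r E us) = E"
  proof
    show "assemble r (branches r E us) (chords r E us) \<subseteq> E"
      unfolding assemble_def mf by (auto simp: br chords_def F_def off_def)
    show "E \<subseteq> assemble r (branches r E us) (chords r E us)"
    proof
      fix e assume e: "e \<in> E"
      show "e \<in> assemble r (branches r E us) (chords r E us)"
      proof (cases "e \<subseteq> ?W")
        case True
        obtain x y where xy: "e = {x, y}" "x \<noteq> y" using N(1) e by (auto simp: simple_graph_def card_2_iff)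
        hence "x \<in> ?W" "y \<in> ?W" using True by auto
        then obtain i j where ij: "i < length (r # us)" "j < length (r # us)" "x = (r # us) ! i" "y = (r # us) ! j"
          by (metis in_set_conv_nth)
        hence "i \<noteq> j" using xy by auto
        have "(i, j) \<in> chords r E us \<or> (j, i) \<in> chords r E us"
        proof (cases "i < j")
          case True
          thus ?thesis using ij xy e by (auto simp: chords_def)
        next
          case False
          hence "j < i" using \<open>i \<noteq> j\<close> by simp
          moreover have "{(r # us) ! j, (r # us) ! i} \<in> E" using ij xy e by (simp add: insert_commute)
          ultimately show ?thesis using ij by (auto simp: chords_def)
        qed
        moreover have "e = {(r # us) ! i, (r # us) ! j}" "e = {(r # us) ! j, (r # us) ! i}"
          using xy ij by auto
        ultimately show ?thesis unfolding assemble_def mf by force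
      next
        case False
        then obtain x where x: "x \<in> e" "x \<notin> ?W" by blast
        then obtain y where y: "e = {x, y}" "x \<in> insert r V" using simple_graph_edge[OF N(1) e] by metis
        have eo: "e \<in> off ?W E" using e False by (simp add: off_def)
        have "x \<in> V" using x y by auto
        then obtain u where u: "u \<in> set us" "x \<in> S u" using V by auto
        have "y \<in> S u" using Sclosed[OF u(2)] eo y by simp
        hence "e \<in> F u" using eo y u by (simp add: F_def)
        thus ?thesis unfolding assemble_def br using u by force
      qed
    qed
  qed
qed

section \<open>Splitting off one component at the root\<close>

lemma simple_graph_finite: "simple_graph V E \<Longrightarrow> finite E"
  by (rule finite_subset[of _ "Pow V"]) (auto simp: simple_graph_def)

text \<open>\<open>K\<close> is a component of the graph without \<open>r\<close>. Together with
  \<open>r\<close> it forms a graph in which \<open>r\<close> is not a cut vertex, and among the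
  vertices outside \<open>K\<close> only \<open>r\<close> is adjacent to it.\<close>

lemma component_split:
  assumes E: "E \<in> cog (insert r V)" and r: "r \<notin> V" and a: "a \<in> V"
    and K: "K = {x. (a, x) \<in> (adj {e \<in> E. r \<notin> e})\<^sup>*}"
  shows "a \<in> K" "K \<subseteq> V" "{e \<in> E. e \<inter> K \<noteq> {}} \<in> nonsep r K" "{e \<in> E. e \<inter> K = {}} \<in> cog (insert r (V - K))"
proof -
  note C = cogD[OF E]
  let ?E0 = "{e \<in> E. r \<notin> e}"
  show aK: "a \<in> K" by (simp add: K)
  show KV: "K \<subseteq> V"
  proof
    fix x assume "x \<in> K"
    hence "(a, x) \<in> (adj ?E0)\<^sup>*" by (simp add: K)
    thus "x \<in> V"
    proof (rule reach_closed)
      fix y z assume "{y, z} \<in> ?E0"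
      thus "z \<in> V" using simple_graph_pair[OF C(1), of y z] by auto
    qed (rule a)
  qed
  have step: "y \<in> K" if "x \<in> K" "{x, y} \<in> E" "y \<noteq> r" for x y
  proof -
    have "x \<noteq> r" using that(1) KV r by blast
    hence "(x, y) \<in> adj ?E0" using that by simp
    thus ?thesis using that(1) unfolding K by (auto intro: rtrancl_into_rtrancl)
  qed
  have meet: "e \<subseteq> insert r K" if e: "e \<in> E" "e \<inter> K \<noteq> {}" for e
  proof -
    obtain x where x: "x \<in> e" "x \<in> K" using e by blast
    then obtain y where "e = {x, y}" using simple_graph_edge[OF C(1) e(1)] by metis
    thus ?thesis using step[OF x(2), of y] x e by auto
  qed
  let ?E1 = "{e \<in> E. e \<inter> K \<noteq> {}}" and ?E2 = "{e \<in> E. e \<inter> K = {}}"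
  have sg1: "simple_graph (insert r K) ?E1"
    by (rule simple_graph_subset[OF C(1)]) (use meet KV in auto)
  have sg2: "simple_graph (insert r (V - K)) ?E2"
    by (rule simple_graph_subset[OF C(1)]) (use C(1) in \<open>auto simp: simple_graph_def\<close>)
  have K1: "(a, x) \<in> (adj {e \<in> ?E1. r \<notin> e})\<^sup>*" if "x \<in> K" for x
  proof -
    have "(a, x) \<in> (adj ?E0)\<^sup>*" using that by (simp add: K)
    hence "(a, x) \<in> (adj {e \<in> ?E1. r \<notin> e})\<^sup>* \<and> x \<in> K"
    proof (induction rule: rtrancl_induct)
      case (step y z)
      hence "(y, z) \<in> adj {e \<in> ?E1. r \<notin> e}" by auto
      moreover have "z \<in> K" using step(2,3) unfolding K by (auto intro: rtrancl_into_rtrancl)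
      ultimately show ?case using step by (auto intro: rtrancl_into_rtrancl)
    qed (simp add: aK)
    thus ?thesis ..
  qed
  have conK: "connected_graph K {e \<in> ?E1. r \<notin> e}"
    by (rule connected_graphI[OF aK K1])
  obtain k where k: "k \<in> K" "{k, r} \<in> E"
  proof -
    have "\<exists>k\<in>K. {k, r} \<in> E"
    proof (rule ccontr)
      assume no: "\<not> ?thesis"
      have "(a, r) \<in> (adj E)\<^sup>*" using C(2) a by (auto simp: connected_graph_def)
      hence "r \<in> K"
      proof (rule reach_closed)
        fix y z assume "y \<in> K" "{y, z} \<in> E"
        moreover have "z \<noteq> r" using no calculation by blast
        ultimately show "z \<in> K" by (rule step)
      qed (rule aK)
      thus False using KV r by blast
    qed
    thus ?thesis using that by blast
  qed
  have con1: "connected_graph (insert r K) ?E1"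
  proof (rule connected_graphI[of a])
    fix v assume v: "v \<in> insert r K"
    have K1': "(a, x) \<in> (adj ?E1)\<^sup>*" if "x \<in> K" for x
      using K1[OF that] by (rule adj_mono[rotated]) auto
    show "(a, v) \<in> (adj ?E1)\<^sup>*"
    proof (cases "v = r")
      case True
      have "(k, r) \<in> adj ?E1" using k by auto
      thus ?thesis using K1'[OF k(1)] True by (auto intro: rtrancl_into_rtrancl)
    next
      case False
      thus ?thesis using v K1' by auto
    qed
  qed (use aK in simp)
  show "?E1 \<in> nonsep r K"
    using sg1 con1 conK outerplanar_subgraph[OF C(3) _ _ sg1] KV
    by (auto simp: nonsep_def cog_def)
  \<comment> \<open>A path to \<open>r\<close> that starts outside \<open>K\<close> cannot enter
    \<open>K\<close> before it reaches \<open>r\<close>.\<close>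
  have reach2: "x \<notin> K \<longrightarrow> (x, r) \<in> (adj ?E2)\<^sup>*" if "(x, r) \<in> (adj E)\<^sup>*" for x
    using that
  proof (induction rule: converse_rtrancl_induct)
    case (step x y)
    show ?case
    proof (cases "x = r")
      case False
      show ?thesis
      proof
        assume x: "x \<notin> K"
        have "y \<notin> K"
        proof
          assume "y \<in> K"
          moreover have "{y, x} \<in> E" using step(1) by (simp add: insert_commute)
          ultimately show False using \<open>\<And>x y. x \<in> K \<Longrightarrow> {x, y} \<in> E \<Longrightarrow> y \<noteq> r \<Longrightarrow> y \<in> K\<close> False x by blast
        qed
        hence "(x, y) \<in> adj ?E2" using step(1) x by auto
        thus "(x, r) \<in> (adj ?E2)\<^sup>*" using step \<open>y \<notin> K\<close> by (auto intro: converse_rtrancl_into_rtrancl)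
      qed
    qed simp
  qed simp
  have con2: "connected_graph (insert r (V - K)) ?E2"
  proof (rule connected_graphI[of r])
    fix v assume v: "v \<in> insert r (V - K)"
    hence "(v, r) \<in> (adj E)\<^sup>*" "v \<notin> K" using C(2) KV r by (auto simp: connected_graph_def)
    hence "(v, r) \<in> (adj ?E2)\<^sup>*" using reach2[of v] by simp
    thus "(r, v) \<in> (adj ?E2)\<^sup>*" by (rule adj_sym)
  qed simp
  show "?E2 \<in> cog (insert r (V - K))"
    using sg2 con2 outerplanar_subgraph[OF C(3) _ _ sg2] by (auto simp: cog_def)
qed

text \<open>Induction on the number of vertices: a graph whose root is no cut vertex is taken apart
  along its root cycle, any other graph at the component of one vertex, and the orders of the parts
  are glued.\<close>

lemma outerplanar_imp_book: "E \<in> cog V \<Longrightarrow> book V E"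
proof (induction "card V" arbitrary: V E rule: less_induct)
  case less
  note C = cogD[OF less(2)]
  obtain r where r: "r \<in> V" using C(5) by blast
  define V' where "V' = V - {r}"
  have V: "V = insert r V'" "r \<notin> V'" "finite V'" using r C(4) by (auto simp: V'_def)
  have smaller: "card S < card V" if "S \<subset> V" for S using psubset_card_mono[OF C(4) that] .
  consider "V' = {}" | "E \<in> nonsep r V'" | "V' \<noteq> {}" "E \<notin> nonsep r V'" by blast
  thus ?case
  proof cases
    case 1
    thus ?thesis unfolding V book_def by (intro exI[of _ "\<lambda>_. 0"]) auto
  next
    case 2
    obtain us where us: "root_cycle r E us" using root_cycle_exists[OF 2 V(2)] by blast
    note dec = nonsep_decompose[OF 2 V(2) us]
    interpret as: assembly r V' "length us" "branches r E us" "chords r E us"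
      using dec us V(2) by unfold_locales (auto simp: root_cycle_def Suc_leI)
    have "book (insert r V') (assemble r (branches r E us) (chords r E us))"
    proof (rule as.book_assemble)
      fix i assume i: "i < length us"
      have "as.S i \<subseteq> V'" using as.SV i by blast
      hence "as.S i \<subset> V" using V by blast
      thus "book (as.S i) (as.F i)" using less(1)[OF smaller as.Fcog[OF i]] by simp
    qed
    thus ?thesis using dec V by simp
  next
    case 3
    then obtain a where a: "a \<in> V'" by blast
    define K where "K = {x. (a, x) \<in> (adj {e \<in> E. r \<notin> e})\<^sup>*}"
    have E: "E \<in> cog (insert r V')" using less(2) V by simp
    note sp = component_split[OF E V(2) a K_def]
    have "K \<noteq> V'"
    proof
      assume "K = V'"
      hence "connected_graph V' {e \<in> E. r \<notin> e}"
        by (intro connected_graphI[OF a]) (auto simp: K_def)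
      thus False using 3 E by (simp add: nonsep_def)
    qed
    hence sub: "insert r K \<subset> V" "insert r (V' - K) \<subset> V" using sp(1,2) V by auto
    have c1: "{e \<in> E. e \<inter> K \<noteq> {}} \<in> cog (insert r K)" using sp(3) by (simp add: nonsep_def)
    have "book (insert r (K \<union> (V' - K))) ({e \<in> E. e \<inter> K \<noteq> {}} \<union> {e \<in> E. e \<inter> K = {}})"
      using sp(2) V less(1)[OF smaller[OF sub(1)] c1] less(1)[OF smaller[OF sub(2)] sp(4)]
        cogD(1)[OF c1] cogD(1)[OF sp(4)]
      by (intro book_glue_root) (auto intro: finite_subset)
    moreover have "K \<union> (V' - K) = V'" using sp(2) by blast
    moreover have "{e \<in> E. e \<inter> K \<noteq> {}} \<union> {e \<in> E. e \<inter> K = {}} = E" by blast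
    ultimately show ?thesis using V by simp
  qed
qed

text \<open>Outerplanarity of the assembled graph comes from the glued order; drawings are never
  glued.\<close>

lemma (in assembly) assemble_nonsep: "assemble r l \<delta> \<in> nonsep r V"
proof -
  have "book (insert r V) E"
    by (rule book_assemble) (rule outerplanar_imp_book[OF Fcog])
  hence "outerplanar (insert r V) E" by (rule book_imp_outerplanar[OF simple])
  thus ?thesis using simple conn conn_V by (simp add: nonsep_def cog_def)
qed

text \<open>Converse of \<open>component_split\<close>; the degrees of \<open>r\<close> add because
  the two edge sets are disjoint.\<close>

lemma component_glue:
  assumes E1: "E1 \<in> nonsep r K" and E2: "E2 \<in> cog (insert r (V - K))"
    and r: "r \<notin> V" and K: "K \<subseteq> V" and a: "a \<in> K"
  shows "E1 \<union> E2 \<in> cog (insert r V)" "{e \<in> E1 \<union> E2. e \<inter> K \<noteq> {}} = E1" "{e \<in> E1 \<union> E2. e \<inter> K = {}} = E2"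
    "{x. (a, x) \<in> (adj {e \<in> E1 \<union> E2. r \<notin> e})\<^sup>*} = K"
    "degree_of (E1 \<union> E2) r = degree_of E1 r + degree_of E2 r"
proof -
  note N = nonsepD[OF E1]
  note C = cogD[OF E2]
  have V: "insert r V = insert r (K \<union> (V - K))" using K by blast
  have fin: "finite K" "finite (V - K)" using N C by auto
  have m1: "e \<inter> K \<noteq> {}" "e \<subseteq> insert r K" if "e \<in> E1" for e
  proof -
    show s: "e \<subseteq> insert r K" using N(1) that by (auto simp: simple_graph_def)
    show "e \<inter> K \<noteq> {}"
    proof
      assume "e \<inter> K = {}"
      hence "e \<subseteq> {r}" using s by blast
      hence "card e \<le> 1" using card_mono[of "{r}" e] by simp
      thus False using N(1) that by (auto simp: simple_graph_def)
    qed
  qed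
  have m2: "e \<inter> K = {}" if "e \<in> E2" for e
  proof -
    have "e \<subseteq> insert r (V - K)" using C(1) that by (auto simp: simple_graph_def)
    thus ?thesis using r K by blast
  qed
  show e1: "{e \<in> E1 \<union> E2. e \<inter> K \<noteq> {}} = E1" and e2: "{e \<in> E1 \<union> E2. e \<inter> K = {}} = E2"
    using m1(1) m2 by blast+
  have sg: "simple_graph (insert r V) (E1 \<union> E2)"
  proof -
    have "finite (insert r V)" using fin unfolding V by simp
    moreover have "e \<subseteq> insert r V \<and> card e = 2" if "e \<in> E1 \<union> E2" for e
    proof -
      have "(e \<subseteq> insert r K \<or> e \<subseteq> insert r (V - K)) \<and> card e = 2"
        using N(1) C(1) that unfolding simple_graph_def by blast
      thus ?thesis using K by blast
    qed
    ultimately show ?thesis by (simp add: simple_graph_def)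
  qed
  have "connected_graph (insert r V) (E1 \<union> E2)"
  proof (rule connected_graphI[of r])
    fix v assume v: "v \<in> insert r V"
    show "(r, v) \<in> (adj (E1 \<union> E2))\<^sup>*"
    proof (cases "v \<in> insert r K")
      case True
      hence "(r, v) \<in> (adj E1)\<^sup>*" using N(2) by (auto simp: connected_graph_def)
      thus ?thesis by (rule adj_mono[rotated]) simp
    next
      case False
      hence "(r, v) \<in> (adj E2)\<^sup>*" using v C(2) by (auto simp: connected_graph_def)
      thus ?thesis by (rule adj_mono[rotated]) simp
    qed
  qed simp
  moreover have "book (insert r (K \<union> (V - K))) (E1 \<union> E2)"
    using outerplanar_imp_book[of E1] outerplanar_imp_book[OF E2] E1 r K fin N(1) C(1)
    by (intro book_glue_root) (auto simp: nonsep_def)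
  hence "outerplanar (insert r V) (E1 \<union> E2)" using book_imp_outerplanar[OF sg] V by simp
  ultimately show "E1 \<union> E2 \<in> cog (insert r V)" using sg by (simp add: cog_def)
  show "{x. (a, x) \<in> (adj {e \<in> E1 \<union> E2. r \<notin> e})\<^sup>*} = K"
  proof (intro equalityI subsetI)
    fix x assume "x \<in> {x. (a, x) \<in> (adj {e \<in> E1 \<union> E2. r \<notin> e})\<^sup>*}"
    hence "(a, x) \<in> (adj {e \<in> E1 \<union> E2. r \<notin> e})\<^sup>*" by simp
    thus "x \<in> K"
    proof (rule reach_closed)
      fix y z assume y: "y \<in> K" "{y, z} \<in> {e \<in> E1 \<union> E2. r \<notin> e}"
      hence "{y, z} \<in> E1" using m2[of "{y, z}"] by auto
      thus "z \<in> K" using m1(2)[of "{y, z}"] y by auto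
    qed (rule a)
  next
    fix x assume "x \<in> K"
    hence "(a, x) \<in> (adj {e \<in> E1. r \<notin> e})\<^sup>*" using N(4) a by (simp add: connected_graph_def)
    hence "(a, x) \<in> (adj {e \<in> E1 \<union> E2. r \<notin> e})\<^sup>*" by (rule adj_mono[rotated]) auto
    thus "x \<in> {x. (a, x) \<in> (adj {e \<in> E1 \<union> E2. r \<notin> e})\<^sup>*}" by simp
  qed
  have "E1 \<inter> E2 = {}" using m1 m2 by blast
  moreover have "finite E1" "finite E2"
    using N(1) C(1) by (auto intro: simple_graph_finite)
  moreover have "{e \<in> E1 \<union> E2. r \<in> e} = {e \<in> E1. r \<in> e} \<union> {e \<in> E2. r \<in> e}" by blast
  ultimately show "degree_of (E1 \<union> E2) r = degree_of E1 r + degree_of E2 r"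
    unfolding degree_of_def by (simp add: card_Un_disjoint disjoint_iff)
qed

section \<open>Counting with the root degree as weight\<close>

definition deg_sum :: "real \<Rightarrow> 'a \<Rightarrow> 'a set set set \<Rightarrow> real" where
  "deg_sum w r A = (\<Sum>E\<in>A. w ^ degree_of E r)"

lemma finite_cog: "finite V \<Longrightarrow> finite (cog V)"
  by (rule finite_subset[of _ "Pow (Pow V)"]) (auto simp: cog_def simple_graph_def)

lemma finite_nonsep: "finite V \<Longrightarrow> finite (nonsep r V)"
  using finite_cog[of "insert r V"] by (simp add: nonsep_def)

text \<open>Distinguishing the component of \<open>a\<close> makes the splitting unique; in terms of
  generating functions this is the differential equation of an exponential.\<close>

lemma deg_sum_cog_rec:
  assumes fin: "finite V" and r: "r \<notin> V" and a: "a \<in> V"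
  shows "deg_sum w r (cog (insert r V)) =
    (\<Sum>K | K \<subseteq> V \<and> a \<in> K. deg_sum w r (nonsep r K) * deg_sum w r (cog (insert r (V - K))))"
proof -
  let ?\<K> = "{K. K \<subseteq> V \<and> a \<in> K}"
  let ?T = "SIGMA K:?\<K>. nonsep r K \<times> cog (insert r (V - K))"
  define comp where "comp E = {x. (a, x) \<in> (adj {e \<in> E. r \<notin> e})\<^sup>*}" for E
  have bij: "bij_betw (\<lambda>(K, E1, E2). E1 \<union> E2) ?T (cog (insert r V))"
  proof (rule bij_betw_byWitness[where f' = "\<lambda>E. (comp E, {e \<in> E. e \<inter> comp E \<noteq> {}}, {e \<in> E. e \<inter> comp E = {}})"])
    show "\<forall>x\<in>?T. (\<lambda>E. (comp E, {e \<in> E. e \<inter> comp E \<noteq> {}}, {e \<in> E. e \<inter> comp E = {}})) ((\<lambda>(K, E1, E2). E1 \<union> E2) x) = x"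
    proof
      fix x assume "x \<in> ?T"
      then obtain K E1 E2 where x: "x = (K, E1, E2)" "K \<subseteq> V" "a \<in> K" "E1 \<in> nonsep r K" "E2 \<in> cog (insert r (V - K))"
        by auto
      note g = component_glue[OF x(4,5) r x(2,3)]
      have "comp (E1 \<union> E2) = K" using g(4) by (simp add: comp_def)
      thus "(\<lambda>E. (comp E, {e \<in> E. e \<inter> comp E \<noteq> {}}, {e \<in> E. e \<inter> comp E = {}})) ((\<lambda>(K, E1, E2). E1 \<union> E2) x) = x"
        using g(2,3) x(1) by simp
    qed
    show "\<forall>E\<in>cog (insert r V). (\<lambda>(K, E1, E2). E1 \<union> E2) (comp E, {e \<in> E. e \<inter> comp E \<noteq> {}}, {e \<in> E. e \<inter> comp E = {}}) = E"
      by auto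
    show "(\<lambda>(K, E1, E2). E1 \<union> E2) ` ?T \<subseteq> cog (insert r V)"
    proof
      fix E assume "E \<in> (\<lambda>(K, E1, E2). E1 \<union> E2) ` ?T"
      then obtain K E1 E2 where x: "E = E1 \<union> E2" "K \<subseteq> V" "a \<in> K" "E1 \<in> nonsep r K" "E2 \<in> cog (insert r (V - K))"
        by auto
      thus "E \<in> cog (insert r V)" using component_glue(1)[OF x(4,5) r x(2,3)] by simp
    qed
    show "(\<lambda>E. (comp E, {e \<in> E. e \<inter> comp E \<noteq> {}}, {e \<in> E. e \<inter> comp E = {}})) ` cog (insert r V) \<subseteq> ?T"
    proof
      fix x assume "x \<in> (\<lambda>E. (comp E, {e \<in> E. e \<inter> comp E \<noteq> {}}, {e \<in> E. e \<inter> comp E = {}})) ` cog (insert r V)"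
      then obtain E where E: "E \<in> cog (insert r V)"
        "x = (comp E, {e \<in> E. e \<inter> comp E \<noteq> {}}, {e \<in> E. e \<inter> comp E = {}})" by blast
      show "x \<in> ?T" using component_split[OF E(1) r a comp_def] E(2) by simp
    qed
  qed
  have fins: "finite ?\<K>" using fin by simp
  have finK: "finite (nonsep r K)" "finite (cog (insert r (V - K)))" if "K \<in> ?\<K>" for K
    using that fin by (auto intro!: finite_nonsep finite_cog intro: finite_subset)
  have "deg_sum w r (cog (insert r V)) = (\<Sum>x\<in>?T. w ^ degree_of ((\<lambda>(K, E1, E2). E1 \<union> E2) x) r)"
    unfolding deg_sum_def by (rule sum.reindex_bij_betw[OF bij, symmetric])
  also have "\<dots> = (\<Sum>(K, E1, E2)\<in>?T. w ^ degree_of E1 r * w ^ degree_of E2 r)"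
  proof (rule sum.cong[OF refl])
    fix x assume "x \<in> ?T"
    then obtain K E1 E2 where x: "x = (K, E1, E2)" "K \<subseteq> V" "a \<in> K" "E1 \<in> nonsep r K" "E2 \<in> cog (insert r (V - K))"
      by auto
    show "w ^ degree_of ((\<lambda>(K, E1, E2). E1 \<union> E2) x) r = (case x of (K, E1, E2) \<Rightarrow> w ^ degree_of E1 r * w ^ degree_of E2 r)"
      using component_glue(5)[OF x(4,5) r x(2,3)] x(1) by (simp add: power_add)
  qed
  also have "\<dots> = (\<Sum>K\<in>?\<K>. \<Sum>(E1, E2)\<in>nonsep r K \<times> cog (insert r (V - K)). w ^ degree_of E1 r * w ^ degree_of E2 r)"
    using fins finK by (subst sum.Sigma) auto
  also have "\<dots> = (\<Sum>K\<in>?\<K>. deg_sum w r (nonsep r K) * deg_sum w r (cog (insert r (V - K))))"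
    unfolding deg_sum_def sum_product sum.cartesian_product by simp
  finally show ?thesis .
qed

definition dis_sum :: "real \<Rightarrow> nat \<Rightarrow> real" where
  "dis_sum w m = (\<Sum>\<delta>\<in>dissections m. w ^ card {j. (0, j) \<in> \<delta>})"

lemma finite_dissections: "finite (dissections m)"
proof (rule finite_subset)
  show "dissections m \<subseteq> Pow ({..m} \<times> {..m})"
  proof
    fix \<delta> assume "\<delta> \<in> dissections m"
    hence "\<delta> \<subseteq> {(i, j). i < j \<and> j \<le> m}" by (simp add: dissections_def)
    also have "\<dots> \<subseteq> {..m} \<times> {..m}" by auto
    finally show "\<delta> \<in> Pow ({..m} \<times> {..m})" by simp
  qed
qed simp

lemma rooted_seqs_0: "rooted_seqs 0 V = (if V = {} then {[]} else {})"
  by (auto simp: rooted_seqs_def)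

text \<open>The vertex set \<open>S\<close> of the head comes first in the tuple, as the set left
  for the tail depends on it.\<close>

lemma rooted_seqs_Suc:
  "bij_betw (\<lambda>(S, u, F, l). (u, S, F) # l) (SIGMA S:Pow V. S \<times> cog S \<times> rooted_seqs m (V - S)) (rooted_seqs (Suc m) V)"
proof (rule bij_betw_byWitness[where f' = "\<lambda>l. (fst (snd (hd l)), fst (hd l), snd (snd (hd l)), tl l)"])
  show "\<forall>l\<in>rooted_seqs (Suc m) V. (\<lambda>(S, u, F, l). (u, S, F) # l) (fst (snd (hd l)), fst (hd l), snd (snd (hd l)), tl l) = l"
    by (auto simp: rooted_seqs_def length_Suc_conv)
  show "(\<lambda>(S, u, F, l). (u, S, F) # l) ` (SIGMA S:Pow V. S \<times> cog S \<times> rooted_seqs m (V - S)) \<subseteq> rooted_seqs (Suc m) V"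
  proof
    fix x assume "x \<in> (\<lambda>(S, u, F, l). (u, S, F) # l) ` (SIGMA S:Pow V. S \<times> cog S \<times> rooted_seqs m (V - S))"
    then obtain S u F l where x: "x = (u, S, F) # l" "S \<subseteq> V" "u \<in> S" "F \<in> cog S" "l \<in> rooted_seqs m (V - S)"
      by auto
    have "(\<Union>p\<in>set l. fst (snd p)) = V - S" using x(5) by (simp add: rooted_seqs_def)
    moreover have "\<forall>q\<in>set l. S \<inter> fst (snd q) = {}" using calculation by blast
    ultimately show "x \<in> rooted_seqs (Suc m) V" using x by (auto simp: rooted_seqs_def)
  qed
  show "(\<lambda>l. (fst (snd (hd l)), fst (hd l), snd (snd (hd l)), tl l)) ` rooted_seqs (Suc m) V
      \<subseteq> (SIGMA S:Pow V. S \<times> cog S \<times> rooted_seqs m (V - S))"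
  proof
    fix x assume "x \<in> (\<lambda>l. (fst (snd (hd l)), fst (hd l), snd (snd (hd l)), tl l)) ` rooted_seqs (Suc m) V"
    then obtain u S F l where x: "(u, S, F) # l \<in> rooted_seqs (Suc m) V" "x = (S, u, F, l)"
      by (auto simp: rooted_seqs_def length_Suc_conv)
    have "S \<inter> (\<Union>p\<in>set l. fst (snd p)) = {}" "S \<union> (\<Union>p\<in>set l. fst (snd p)) = V"
      using x(1) by (auto simp: rooted_seqs_def)
    hence "(\<Union>p\<in>set l. fst (snd p)) = V - S" by blast
    thus "x \<in> (SIGMA S:Pow V. S \<times> cog S \<times> rooted_seqs m (V - S))"
      using x by (auto simp: rooted_seqs_def)
  qed
qed auto

lemma finite_rooted_seqs: "finite V \<Longrightarrow> finite (rooted_seqs m V)"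
proof (induction m arbitrary: V)
  case 0
  thus ?case by (simp add: rooted_seqs_0)
next
  case (Suc m)
  have "finite (SIGMA S:Pow V. S \<times> cog S \<times> rooted_seqs m (V - S))"
    using Suc by (intro finite_SigmaI finite_cartesian_product finite_cog) (auto intro: finite_subset)
  thus ?case using bij_betw_finite[OF rooted_seqs_Suc] by blast
qed

lemma card_rooted_seqs_Suc:
  assumes "finite V"
  shows "card (rooted_seqs (Suc m) V) = (\<Sum>S\<in>Pow V. card S * card (cog S) * card (rooted_seqs m (V - S)))"
proof -
  have "card (rooted_seqs (Suc m) V) = card (SIGMA S:Pow V. S \<times> cog S \<times> rooted_seqs m (V - S))"
    using bij_betw_same_card[OF rooted_seqs_Suc] by metis
  also have "\<dots> = (\<Sum>S\<in>Pow V. card (S \<times> cog S \<times> rooted_seqs m (V - S)))"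
    using assms by (intro card_SigmaI) (auto intro!: finite_cartesian_product finite_cog finite_rooted_seqs intro: finite_subset)
  also have "\<dots> = (\<Sum>S\<in>Pow V. card S * card (cog S) * card (rooted_seqs m (V - S)))"
    by (simp add: card_cartesian_product mult.assoc)
  finally show ?thesis .
qed

lemma rooted_seqs_length: "finite V \<Longrightarrow> l \<in> rooted_seqs m V \<Longrightarrow> m \<le> card V"
proof (induction m arbitrary: V l)
  case (Suc m)
  then obtain S u F l' where x: "S \<subseteq> V" "u \<in> S" "l' \<in> rooted_seqs m (V - S)"
    using bij_betw_imp_surj_on[OF rooted_seqs_Suc, of V m] by auto
  have "m \<le> card (V - S)" using Suc x by auto
  also have "card (V - S) < card V" using Suc x by (intro psubset_card_mono) auto
  finally show ?case by simp
qed simp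

lemma dissections_1: "dissections 1 = {{(0, 1)}}"
proof -
  have "{(i, j). i < j \<and> j \<le> 1} = {(0, 1::nat)}" by auto
  thus ?thesis by (auto simp: dissections_def subset_singleton_iff)
qed

lemma dis_sum_1: "dis_sum w 1 = w"
proof -
  have "{j. (0, j) \<in> {(0, 1::nat)}} = {1}" by auto
  thus ?thesis unfolding dis_sum_def dissections_1 by simp
qed

text \<open>Summing over pairs of a graph and an oriented root cycle counts every graph twice, except
  those whose root is a leaf, which have a single root cycle.\<close>

lemma deg_sum_nonsep:
  assumes fin: "finite V" and r: "r \<notin> V"
  shows "2 * deg_sum w r (nonsep r V) =
    (\<Sum>m=1..card V. real (card (rooted_seqs m V)) * dis_sum w m) + w * real (card (rooted_seqs 1 V))"
proof -
  let ?P = "SIGMA E:nonsep r V. {us. root_cycle r E us}"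
  let ?Q = "SIGMA m:{1..card V}. rooted_seqs m V \<times> dissections m"
  define g where "g = (\<lambda>(m::nat, l, \<delta>). (assemble r l \<delta>, map fst l :: 'a list))"
  define h where "h = (\<lambda>(E, us). (length us, branches r E us, chords r E us))"
  have as: "assembly r V m l \<delta>" if "(m, l, \<delta>) \<in> ?Q" for m l \<delta>
    using that r by unfold_locales auto
  have bij: "bij_betw g ?Q ?P"
  proof (rule bij_betw_byWitness[where f' = h])
    show "\<forall>x\<in>?Q. h (g x) = x"
    proof
      fix x assume x: "x \<in> ?Q"
      obtain m l \<delta> where y: "x = (m, l, \<delta>)" by (cases x) auto
      interpret assembly r V m l \<delta> using as x y by simp
      show "h (g x) = x" using branches_eq chords_eq len y by (simp add: g_def h_def)
    qed
    show "\<forall>x\<in>?P. g (h x) = x"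
      using nonsep_decompose[OF _ r] by (auto simp: g_def h_def)
    show "g ` ?Q \<subseteq> ?P"
    proof
      fix z assume "z \<in> g ` ?Q"
      then obtain x where x: "x \<in> ?Q" "z = g x" by blast
      obtain m l \<delta> where y: "x = (m, l, \<delta>)" by (cases x) auto
      interpret assembly r V m l \<delta> using as x y by simp
      show "z \<in> ?P" using assemble_nonsep cycle x y by (simp add: g_def)
    qed
    show "h ` ?P \<subseteq> ?Q"
    proof
      fix z assume "z \<in> h ` ?P"
      then obtain E us where x: "E \<in> nonsep r V" "root_cycle r E us" "z = h (E, us)" by auto
      note d = nonsep_decompose[OF x(1) r x(2)]
      have "length us \<le> card V" using rooted_seqs_length[OF fin d(1)] .
      moreover have "1 \<le> length us" using x(2) by (cases us) (auto simp: root_cycle_def)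
      ultimately show "z \<in> ?Q" using d x by (simp add: h_def)
    qed
  qed
  have finN: "finite (nonsep r V)" using fin by (rule finite_nonsep)
  \<comment> \<open>There are two root cycles, or one if its length is 1; the uniform expression
    lets the leaf case be summed separately.\<close>
  have finR: "finite {us. root_cycle r E us}" and cardR: "real (card {us. root_cycle r E us}) = 2 - real (card {us. root_cycle r E us \<and> length us = 1})"
    if E: "E \<in> nonsep r V" for E
  proof -
    obtain us where us: "root_cycle r E us" using root_cycle_exists[OF E r] by blast
    note c = card_root_cycles[OF nonsepD(1)[OF E] nonsepD(3)[OF E]]
    show "finite {us. root_cycle r E us}" using c[OF us] by (metis card.infinite one_neq_zero zero_neq_numeral)
    show "real (card {us. root_cycle r E us}) = 2 - real (card {us. root_cycle r E us \<and> length us = 1})"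
    proof (cases "\<exists>us. root_cycle r E us \<and> length us = 1")
      case True
      then obtain vs where vs: "root_cycle r E vs" "length vs = 1" by blast
      have "rev vs = vs" using vs(2) by (cases vs) auto
      hence "us = vs" if "root_cycle r E us" for us
        using root_cycle_unique[OF nonsepD(1)[OF E] nonsepD(3)[OF E] vs(1) that] by metis
      hence "{us. root_cycle r E us \<and> length us = 1} = {vs}" using vs by blast
      thus ?thesis using c[OF vs(1)] vs by simp
    next
      case False
      hence "{us. root_cycle r E us \<and> length us = 1} = {}" by blast
      hence "card {us. root_cycle r E us \<and> length us = 1} = 0" by (simp only: card.empty)
      moreover have "length us \<noteq> 1" using False us by blast
      ultimately show ?thesis using c[OF us] by simp
    qed
  qed
  have sumP: "(\<Sum>(E, us)\<in>?P. w ^ degree_of E r * f us) =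
      (\<Sum>m=1..card V. \<Sum>(l, \<delta>)\<in>rooted_seqs m V \<times> dissections m. w ^ card {j. (0, j) \<in> \<delta>} * f (map fst l))"
    for f :: "'a list \<Rightarrow> real"
  proof -
    have "(\<Sum>(E, us)\<in>?P. w ^ degree_of E r * f us) = (\<Sum>x\<in>?Q. case g x of (E, us) \<Rightarrow> w ^ degree_of E r * f us)"
      by (rule sum.reindex_bij_betw[OF bij, symmetric])
    also have "\<dots> = (\<Sum>(m, l, \<delta>)\<in>?Q. w ^ card {j. (0, j) \<in> \<delta>} * f (map fst l))"
    proof (rule sum.cong[OF refl])
      fix x assume x: "x \<in> ?Q"
      obtain m l \<delta> where y: "x = (m, l, \<delta>)" by (cases x) auto
      interpret assembly r V m l \<delta> using as x y by simp
      show "(case g x of (G, us) \<Rightarrow> w ^ degree_of G r * f us) =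
          (case x of (m, l, \<delta>) \<Rightarrow> w ^ card {j. (0, j) \<in> \<delta>} * f (map fst l))"
        using degree y by (simp add: g_def)
    qed
    also have "\<dots> = (\<Sum>m=1..card V. \<Sum>(l, \<delta>)\<in>rooted_seqs m V \<times> dissections m. w ^ card {j. (0, j) \<in> \<delta>} * f (map fst l))"
      using finite_rooted_seqs[OF fin] finite_dissections by (subst sum.Sigma) auto
    finally show ?thesis .
  qed
  have one: "(\<Sum>(E, us)\<in>?P. w ^ degree_of E r * 1) = (\<Sum>m=1..card V. real (card (rooted_seqs m V)) * dis_sum w m)"
    unfolding sumP[of "\<lambda>_. 1"] by (simp add: dis_sum_def sum.cartesian_product[symmetric] sum_distrib_left)
  have leaf: "(\<Sum>(E, us)\<in>?P. w ^ degree_of E r * of_bool (length us = 1)) = w * real (card (rooted_seqs 1 V))"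
  proof -
    have "(\<Sum>(l, \<delta>)\<in>rooted_seqs m V \<times> dissections m. w ^ card {j. (0, j) \<in> \<delta>} * of_bool (length (map fst l) = 1))
       = of_bool (m = 1) * (real (card (rooted_seqs m V)) * dis_sum w m)" for m
    proof -
      have "(\<Sum>(l, \<delta>)\<in>rooted_seqs m V \<times> dissections m. w ^ card {j. (0, j) \<in> \<delta>} * of_bool (length (map fst l) = 1))
         = (\<Sum>(l, \<delta>)\<in>rooted_seqs m V \<times> dissections m. w ^ card {j. (0, j) \<in> \<delta>} * of_bool (m = 1))"
        by (intro sum.cong refl) (auto simp: rooted_seqs_def)
      thus ?thesis by (simp add: dis_sum_def sum.cartesian_product[symmetric] sum_distrib_left mult.commute)
    qed
    hence "(\<Sum>(E, us)\<in>?P. w ^ degree_of E r * of_bool (length us = 1)) =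
       (\<Sum>m=1..card V. of_bool (m = 1) * (real (card (rooted_seqs m V)) * dis_sum w m))"
      using sumP[of "\<lambda>us. of_bool (length us = 1)"] by simp
    also have "\<dots> = (\<Sum>m\<in>{1..card V} \<inter> {1}. real (card (rooted_seqs m V)) * dis_sum w m)"
      by (rule sum.mono_neutral_cong_right) auto
    also have "\<dots> = w * real (card (rooted_seqs 1 V))"
    proof (cases "V = {}")
      case True
      hence "rooted_seqs 1 V = {}" using rooted_seqs_length[of V _ 1] by fastforce
      thus ?thesis using True by simp
    next
      case False
      hence "1 \<le> card V" using fin by (simp add: Suc_le_eq card_gt_0_iff)
      hence "{1..card V} \<inter> {1} = {1}" by auto
      thus ?thesis using dis_sum_1[of w] by simp
    qed
    finally show ?thesis .
  qed
  have "2 * deg_sum w r (nonsep r V) = (\<Sum>E\<in>nonsep r V. w ^ degree_of E r * (real (card {us. root_cycle r E us}) + real (card {us. root_cycle r E us \<and> length us = 1})))"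
    unfolding deg_sum_def sum_distrib_left using cardR by (intro sum.cong) auto
  also have "\<dots> = (\<Sum>E\<in>nonsep r V. \<Sum>us | root_cycle r E us. w ^ degree_of E r * (1 + of_bool (length us = 1)))"
  proof (rule sum.cong[OF refl])
    fix E assume E: "E \<in> nonsep r V"
    have "(\<Sum>us | root_cycle r E us. of_bool (length us = 1)) = real (card {us. root_cycle r E us \<and> length us = 1})"
      using finR[OF E] by (simp add: of_bool_def sum.If_cases Int_def)
    thus "w ^ degree_of E r * (real (card {us. root_cycle r E us}) + real (card {us. root_cycle r E us \<and> length us = 1}))
       = (\<Sum>us | root_cycle r E us. w ^ degree_of E r * (1 + of_bool (length us = 1)))"
      by (simp add: sum_distrib_left[symmetric] sum.distrib)
  qed
  also have "\<dots> = (\<Sum>(E, us)\<in>?P. w ^ degree_of E r * (1 + of_bool (length us = 1)))"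
    using finN finR by (subst sum.Sigma) auto
  also have "\<dots> = (\<Sum>(E, us)\<in>?P. w ^ degree_of E r * 1) + (\<Sum>(E, us)\<in>?P. w ^ degree_of E r * of_bool (length us = 1))"
    unfolding sum.distrib[symmetric] by (intro sum.cong refl) (auto simp: algebra_simps)
  finally show ?thesis unfolding one leaf .
qed

section \<open>Dissections of polygons\<close>

unbundle no vec_syntax
unbundle fps_syntax

text \<open>Polygon dissections whose closing edge \<open>(0, m)\<close> is optional; they appear
  behind the cut at an edge \<open>(0, j)\<close>.\<close>

definition chains :: "nat \<Rightarrow> (nat \<times> nat) set set" where
  "chains m = {\<delta>. \<delta> \<subseteq> {(i, j). i < j \<and> j \<le> m} \<and> (\<forall>i<m. (i, Suc i) \<in> \<delta>) \<and>
     (\<forall>i j k l. i < j \<longrightarrow> j < k \<longrightarrow> k < l \<longrightarrow> (i, k) \<in> \<delta> \<longrightarrow> (j, l) \<notin> \<delta>)}"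

lemma dissections_chains: "dissections m = {\<delta> \<in> chains m. (0, m) \<in> \<delta>}"
  by (auto simp: dissections_def chains_def)

lemma finite_chains: "finite (chains m)"
proof (rule finite_subset)
  show "chains m \<subseteq> Pow ({..m} \<times> {..m})"
  proof
    fix \<delta> assume "\<delta> \<in> chains m"
    hence "\<delta> \<subseteq> {(i, j). i < j \<and> j \<le> m}" by (simp add: chains_def)
    also have "\<dots> \<subseteq> {..m} \<times> {..m}" by auto
    finally show "\<delta> \<in> Pow ({..m} \<times> {..m})" by simp
  qed
qed simp

lemma chainsD:
  assumes "\<delta> \<in> chains m"
  shows "(i, j) \<in> \<delta> \<Longrightarrow> i < j \<and> j \<le> m" "i < m \<Longrightarrow> (i, Suc i) \<in> \<delta>"
    "i < j \<Longrightarrow> j < k \<Longrightarrow> k < l \<Longrightarrow> (i, k) \<in> \<delta> \<Longrightarrow> (j, l) \<in> \<delta> \<Longrightarrow> False"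
  using assms unfolding chains_def by blast+

lemma chains_insert: "\<delta> \<in> chains m \<Longrightarrow> 0 < m \<Longrightarrow> insert (0, m) \<delta> \<in> chains m"
  unfolding chains_def by auto

text \<open>For \<open>m \<ge> 2\<close> the edge \<open>(0, m)\<close> is none of the sides
  \<open>(i, Suc i)\<close> and crosses nothing, so it can be added or removed freely.\<close>

lemma card_chains:
  assumes "m \<ge> 2"
  shows "card (chains m) = 2 * card (dissections m)"
proof -
  have un: "chains m = dissections m \<union> (\<lambda>\<delta>. \<delta> - {(0, m)}) ` dissections m"
  proof (intro equalityI subsetI)
    fix \<delta> assume d: "\<delta> \<in> chains m"
    show "\<delta> \<in> dissections m \<union> (\<lambda>\<delta>. \<delta> - {(0, m)}) ` dissections m"
    proof (cases "(0, m) \<in> \<delta>")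
      case False
      have "insert (0, m) \<delta> \<in> dissections m"
        using chains_insert[OF d] assms by (simp add: dissections_chains)
      moreover have "\<delta> = insert (0, m) \<delta> - {(0, m)}" using False by simp
      ultimately show ?thesis by blast
    qed (use d in \<open>simp add: dissections_chains\<close>)
  next
    fix \<delta> assume "\<delta> \<in> dissections m \<union> (\<lambda>\<delta>. \<delta> - {(0, m)}) ` dissections m"
    then obtain d where d: "d \<in> chains m" "\<delta> = d \<or> \<delta> = d - {(0, m)}" by (auto simp: dissections_chains)
    have ne: "(i, Suc i) \<noteq> (0, m)" for i using assms by auto
    show "\<delta> \<in> chains m" using d ne unfolding chains_def by blast
  qed
  have "inj_on (\<lambda>\<delta>. \<delta> - {(0, m)}) (dissections m)"
    by (rule inj_onI) (auto simp: dissections_chains)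
  moreover have "dissections m \<inter> (\<lambda>\<delta>. \<delta> - {(0, m)}) ` dissections m = {}"
    by (auto simp: dissections_chains)
  ultimately show ?thesis unfolding un
    using finite_dissections by (subst card_Un_disjoint) (auto simp: card_image)
qed

lemma chains_1: "chains 1 = dissections 1"
  unfolding dissections_chains chains_def by auto

text \<open>Cut a dissection along the last edge \<open>(0, j)\<close> at \<open>0\<close> before the outer edge \<open>(0, m)\<close>.\<close>

lemma dissections_cut:
  assumes m: "m \<ge> 2"
  shows "bij_betw (\<lambda>(j, \<delta>1, \<delta>2). insert (0, m) (\<delta>1 \<union> (\<lambda>(a, b). (a + j, b + j)) ` \<delta>2))
     (SIGMA j:{1..<m}. dissections j \<times> chains (m - j)) (dissections m)"
proof -
  define g where "g = (\<lambda>(j::nat, \<delta>1, \<delta>2). insert (0, m) (\<delta>1 \<union> (\<lambda>(a, b). (a + j, b + j)) ` \<delta>2))"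
  define J where "J \<delta> = Max {j. j < m \<and> (0, j) \<in> \<delta>}" for \<delta> :: "(nat \<times> nat) set"
  define h where "h \<delta> = (J \<delta>, {(a, b) \<in> \<delta>. b \<le> J \<delta>}, {(a, b). (a + J \<delta>, b + J \<delta>) \<in> \<delta>})" for \<delta>
  let ?A = "SIGMA j:{1..<m}. dissections j \<times> chains (m - j)"
  have g_iff: "(a, b) \<in> g (j, \<delta>1, \<delta>2) \<longleftrightarrow> (a = 0 \<and> b = m) \<or> (a, b) \<in> \<delta>1 \<or> (j \<le> a \<and> j \<le> b \<and> (a - j, b - j) \<in> \<delta>2)" for a b j \<delta>1 \<delta>2
  proof -
    have "(a, b) \<in> (\<lambda>(a, b). (a + j, b + j)) ` \<delta>2 \<longleftrightarrow> j \<le> a \<and> j \<le> b \<and> (a - j, b - j) \<in> \<delta>2"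
    proof
      assume "j \<le> a \<and> j \<le> b \<and> (a - j, b - j) \<in> \<delta>2"
      thus "(a, b) \<in> (\<lambda>(a, b). (a + j, b + j)) ` \<delta>2" by (intro image_eqI[of _ _ "(a - j, b - j)"]) auto
    qed auto
    thus ?thesis by (auto simp: g_def)
  qed
  have J: "J \<delta> < m" "(0, J \<delta>) \<in> \<delta>" "1 \<le> J \<delta>" "\<And>j. j < m \<Longrightarrow> (0, j) \<in> \<delta> \<Longrightarrow> j \<le> J \<delta>" if d: "\<delta> \<in> dissections m" for \<delta>
  proof -
    let ?X = "{j. j < m \<and> (0, j) \<in> \<delta>}"
    have fin: "finite ?X" by simp
    have one: "1 \<in> ?X" using d m by (auto simp: dissections_def)
    hence "Max ?X \<in> ?X" using fin by (intro Max_in) auto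
    thus "J \<delta> < m" "(0, J \<delta>) \<in> \<delta>" by (auto simp: J_def)
    show le: "j \<le> J \<delta>" if "j < m" "(0, j) \<in> \<delta>" for j using that fin by (auto simp: J_def)
    show "1 \<le> J \<delta>" using le[of 1] one by simp
  qed
  have deg: "J (g (j, \<delta>1, \<delta>2)) = j" if x: "j \<in> {1..<m}" "\<delta>1 \<in> dissections j" "\<delta>2 \<in> chains (m - j)" for j \<delta>1 \<delta>2
    unfolding J_def
  proof (rule Max_eqI)
    show "j \<in> {ja. ja < m \<and> (0, ja) \<in> g (j, \<delta>1, \<delta>2)}" using x by (auto simp: g_iff dissections_def)
    fix y assume "y \<in> {ja. ja < m \<and> (0, ja) \<in> g (j, \<delta>1, \<delta>2)}"
    thus "y \<le> j" using x by (auto simp: g_iff dissections_def)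
  qed simp
  have "bij_betw g ?A (dissections m)"
  proof (rule bij_betw_byWitness[where f' = h])
    show "\<forall>x\<in>?A. h (g x) = x"
    proof
      fix x assume "x \<in> ?A"
      then obtain j \<delta>1 \<delta>2 where x: "x = (j, \<delta>1, \<delta>2)" "j \<in> {1..<m}" "\<delta>1 \<in> dissections j" "\<delta>2 \<in> chains (m - j)" by auto
      have d1: "\<delta>1 \<in> chains j" using x by (simp add: dissections_chains)
      note c1 = chainsD[OF d1] and c2 = chainsD[OF x(4)]
      have "(a, b) \<in> g (j, \<delta>1, \<delta>2) \<and> b \<le> j \<longleftrightarrow> (a, b) \<in> \<delta>1" for a b
        using c1(1)[of a b] c2(1)[of "a - j" "b - j"] x(2) by (auto simp: g_iff)
      moreover have "(a + j, b + j) \<in> g (j, \<delta>1, \<delta>2) \<longleftrightarrow> (a, b) \<in> \<delta>2" for a b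
        using c1(1)[of "a + j" "b + j"] x(2) by (auto simp: g_iff)
      ultimately show "h (g x) = x" unfolding x(1) h_def deg[OF x(2-4)] by auto
    qed
    show "\<forall>\<delta>\<in>dissections m. g (h \<delta>) = \<delta>"
    proof
      fix \<delta> assume d: "\<delta> \<in> dissections m"
      note Jd = J[OF d]
      have d': "\<delta> \<in> chains m" "(0, m) \<in> \<delta>" using d by (auto simp: dissections_chains)
      note c = chainsD[OF d'(1)]
      have "(a, b) \<in> g (h \<delta>) \<longleftrightarrow> (a, b) \<in> \<delta>" for a b
      proof
        assume "(a, b) \<in> g (h \<delta>)"
        thus "(a, b) \<in> \<delta>" using d'(2) by (auto simp: h_def g_iff)
      next
        assume ab: "(a, b) \<in> \<delta>"
        show "(a, b) \<in> g (h \<delta>)"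
        proof (cases "b \<le> J \<delta>")
          case True
          thus ?thesis using ab by (simp add: h_def g_iff)
        next
          case False
          show ?thesis
          proof (cases "a < J \<delta>")
            case True
            \<comment> \<open>An edge that starts strictly between \<open>0\<close> and
              \<open>J \<delta>\<close> and ends beyond would cross \<open>(0, J \<delta>)\<close>;
              from \<open>0\<close> only \<open>(0, m)\<close> ends beyond, by maximality.\<close>
            have "a = 0"
            proof (rule ccontr)
              assume "a \<noteq> 0"
              thus False using c(3)[of 0 a "J \<delta>" b] True False ab Jd(2) by simp
            qed
            hence "b = m" using Jd(4)[of b] False ab c(1)[OF ab] by force
            thus ?thesis using \<open>a = 0\<close> by (simp add: h_def g_iff)
          next
            case False
            thus ?thesis using ab c(1)[OF ab] by (simp add: h_def g_iff)
          qed
        qed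
      qed
      thus "g (h \<delta>) = \<delta>" by auto
    qed
    show "g ` ?A \<subseteq> dissections m"
    proof
      fix \<delta> assume "\<delta> \<in> g ` ?A"
      then obtain j \<delta>1 \<delta>2 where x: "\<delta> = g (j, \<delta>1, \<delta>2)" "j \<in> {1..<m}" "\<delta>1 \<in> dissections j" "\<delta>2 \<in> chains (m - j)" by auto
      have d1: "\<delta>1 \<in> chains j" using x by (simp add: dissections_chains)
      note c1 = chainsD[OF d1] and c2 = chainsD[OF x(4)]
      show "\<delta> \<in> dissections m"
        unfolding dissections_def
      proof (intro CollectI conjI allI impI)
        show "\<delta> \<subseteq> {(i, j). i < j \<and> j \<le> m}"
        proof clarify
          fix a b assume "(a, b) \<in> \<delta>"
          thus "a < b \<and> b \<le> m" using c1(1)[of a b] c2(1)[of "a - j" "b - j"] x(1,2) by (auto simp: g_iff)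
        qed
        show "(i, Suc i) \<in> \<delta>" if "i < m" for i
        proof (cases "i < j")
          case True
          thus ?thesis using c1(2) x(1) by (simp add: g_iff)
        next
          case False
          hence "(i - j, Suc (i - j)) \<in> \<delta>2" using that by (intro c2(2)) auto
          thus ?thesis using False x(1) by (simp add: g_iff Suc_diff_le)
        qed
        show "(0, m) \<in> \<delta>" using x(1) by (simp add: g_iff)
        show "(b, d) \<notin> \<delta>" if lt: "a < b" "b < c" "c < d" and ac: "(a, c) \<in> \<delta>" for a b c d
        proof
          assume bd: "(b, d) \<in> \<delta>"
          have "d \<le> m" using bd c1(1)[of b d] c2(1)[of "b - j" "d - j"] x(1,2) by (auto simp: g_iff)
          hence ac': "(a, c) \<in> \<delta>1 \<or> j \<le> a \<and> j \<le> c \<and> (a - j, c - j) \<in> \<delta>2" using ac lt x(1) by (auto simp: g_iff)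
          have bd': "(b, d) \<in> \<delta>1 \<or> j \<le> b \<and> j \<le> d \<and> (b - j, d - j) \<in> \<delta>2" using bd lt x(1) by (auto simp: g_iff)
          show False
          proof (cases "(a, c) \<in> \<delta>1")
            case True
            hence "c \<le> j" using c1(1) by blast
            hence "(b, d) \<in> \<delta>1" using bd' lt by auto
            thus False using c1(3)[OF lt] True by blast
          next
            case False
            hence a: "j \<le> a" "(a - j, c - j) \<in> \<delta>2" using ac' by auto
            hence "(b, d) \<notin> \<delta>1" using c1(1)[of b d] lt by auto
            hence b: "(b - j, d - j) \<in> \<delta>2" using bd' by auto
            have "a - j < b - j" "b - j < c - j" "c - j < d - j" using lt a(1) by linarith+
            thus False using c2(3) a(2) b by blast
          qed
        qed
      qed
    qed
    show "h ` dissections m \<subseteq> ?A"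
    proof
      fix x assume "x \<in> h ` dissections m"
      then obtain \<delta> where d: "\<delta> \<in> dissections m" "x = h \<delta>" by blast
      note Jd = J[OF d(1)]
      have d': "\<delta> \<in> chains m" using d by (auto simp: dissections_chains)
      note c = chainsD[OF d']
      define L where "L = {(a, b) \<in> \<delta>. b \<le> J \<delta>}"
      define R where "R = {(a, b). (a + J \<delta>, b + J \<delta>) \<in> \<delta>}"
      have "L \<in> dissections (J \<delta>)"
        unfolding dissections_def
      proof (intro CollectI conjI allI impI)
        show "L \<subseteq> {(i, j). i < j \<and> j \<le> J \<delta>}" using c(1) by (auto simp: L_def)
        show "(i, Suc i) \<in> L" if "i < J \<delta>" for i using c(2)[of i] that Jd(1) by (auto simp: L_def)
        show "(0, J \<delta>) \<in> L" using Jd by (simp add: L_def)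
        show "(j, l) \<notin> L" if "i < j" "j < k" "k < l" "(i, k) \<in> L" for i j k l
          using c(3)[OF that(1-3)] that(4) by (auto simp: L_def)
      qed
      moreover have "R \<in> chains (m - J \<delta>)"
        unfolding chains_def
      proof (intro CollectI conjI allI impI)
        show "R \<subseteq> {(i, j). i < j \<and> j \<le> m - J \<delta>}" using c(1) Jd(1) by (force simp: R_def)
        show "(i, Suc i) \<in> R" if "i < m - J \<delta>" for i
          using c(2)[of "i + J \<delta>"] that by (auto simp: R_def)
        show "(j, l) \<notin> R"
          if "i < j" "j < k" "k < l" "(i, k) \<in> R" for i j k l
          using c(3)[of "i + J \<delta>" "j + J \<delta>" "k + J \<delta>" "l + J \<delta>"] that by (auto simp: R_def)
      qed
      ultimately show "x \<in> ?A" using d Jd by (simp add: h_def L_def R_def)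
    qed
  qed
  thus ?thesis by (simp add: g_def)
qed

text \<open>After the cut the edges at \<open>0\<close> are those of the left part together with
  \<open>(0, m)\<close>; the right part begins at \<open>j\<close> and contributes none.\<close>

lemma dis_sum_rec:
  assumes m: "m \<ge> 2"
  shows "dis_sum w m = w * (\<Sum>j\<in>{1..<m}. dis_sum w j * real (card (chains (m - j))))"
proof -
  let ?A = "SIGMA j:{1..<m}. dissections j \<times> chains (m - j)"
  let ?d = "\<lambda>\<delta>::(nat \<times> nat) set. card {j. (0, j) \<in> \<delta>}"
  have "dis_sum w m = (\<Sum>(j, \<delta>1, \<delta>2)\<in>?A. w ^ ?d (insert (0, m) (\<delta>1 \<union> (\<lambda>(a, b). (a + j, b + j)) ` \<delta>2)))"
    unfolding dis_sum_def using sum.reindex_bij_betw[OF dissections_cut[OF m], of "\<lambda>\<delta>. w ^ ?d \<delta>"]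
    by (simp add: case_prod_unfold)
  also have "\<dots> = (\<Sum>(j, \<delta>1, \<delta>2)\<in>?A. w * w ^ ?d \<delta>1)"
  proof (rule sum.cong[OF refl], clarify)
    fix j \<delta>1 \<delta>2 assume x: "j \<in> {1..<m}" "\<delta>1 \<in> dissections j" "\<delta>2 \<in> chains (m - j)"
    have eq: "{ja. (0, ja) \<in> insert (0, m) (\<delta>1 \<union> (\<lambda>(a, b). (a + j, b + j)) ` \<delta>2)} = insert m {ja. (0, ja) \<in> \<delta>1}"
      using x by auto
    have sub: "{ja. (0, ja) \<in> \<delta>1} \<subseteq> {..j}" using x by (auto simp: dissections_def)
    hence "finite {ja. (0, ja) \<in> \<delta>1}" by (rule finite_subset) simp
    moreover have "m \<notin> {ja. (0, ja) \<in> \<delta>1}" using sub x by auto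
    ultimately show "w ^ ?d (insert (0, m) (\<delta>1 \<union> (\<lambda>(a, b). (a + j, b + j)) ` \<delta>2)) = w * w ^ ?d \<delta>1"
      unfolding eq by simp
  qed
  also have "\<dots> = (\<Sum>j\<in>{1..<m}. \<Sum>(\<delta>1, \<delta>2)\<in>dissections j \<times> chains (m - j). w * w ^ ?d \<delta>1)"
    using finite_dissections finite_chains by (subst sum.Sigma) auto
  also have "\<dots> = w * (\<Sum>j\<in>{1..<m}. dis_sum w j * real (card (chains (m - j))))"
    by (simp add: dis_sum_def sum.cartesian_product[symmetric] sum_distrib_left sum_distrib_right mult_ac)
  finally show ?thesis .
qed

definition dis_fps :: "real \<Rightarrow> real fps" where
  "dis_fps w = Abs_fps (\<lambda>m. if m = 0 then 0 else dis_sum w m)"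

lemma dis_fps_nth_0 [simp]: "dis_fps w $ 0 = 0"
  by (simp add: dis_fps_def)

text \<open>\<open>2 * dis_fps 1 - fps_X\<close> is the series of \<open>chains\<close>: they are
  twice the dissections, except that for a single edge the two notions coincide.\<close>

lemma dis_fps_eq: "dis_fps w = fps_const w * fps_X + fps_const w * (dis_fps w * (2 * dis_fps 1 - fps_X))"
proof (rule fps_ext)
  fix m :: nat
  have S: "(2 * dis_fps 1 - fps_X) $ l = (if l = 0 then 0 else real (card (chains l)))" for l :: nat
  proof -
    consider "l = 0" | "l = 1" | "l \<ge> 2" by linarith
    thus ?thesis
    proof cases
      case 2
      have "dis_sum 1 1 = 1" by (rule dis_sum_1)
      moreover have "card (chains 1) = 1" unfolding chains_1 dissections_1 by simp
      ultimately show ?thesis using 2 by (simp add: dis_fps_def numeral_fps_const)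
    next
      case 3
      thus ?thesis using card_chains[of l] by (simp add: dis_fps_def dis_sum_def numeral_fps_const)
    qed (simp add: numeral_fps_const)
  qed
  consider "m = 0" | "m = 1" | "m \<ge> 2" by linarith
  thus "dis_fps w $ m = (fps_const w * fps_X + fps_const w * (dis_fps w * (2 * dis_fps 1 - fps_X))) $ m"
  proof cases
    case 2
    have "(dis_fps w * (2 * dis_fps 1 - fps_X)) $ 1 = 0"
      unfolding fps_mult_nth S by (simp add: dis_fps_def)
    thus ?thesis using 2 dis_sum_1[of w] by (simp add: dis_fps_def)
  next
    case 3
    have "(dis_fps w * (2 * dis_fps 1 - fps_X)) $ m = (\<Sum>j=0..m. dis_fps w $ j * (if m - j = 0 then 0 else real (card (chains (m - j)))))"
      unfolding fps_mult_nth S ..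
    also have "\<dots> = (\<Sum>j\<in>{1..<m}. dis_sum w j * real (card (chains (m - j))))"
      by (rule sum.mono_neutral_cong_right) (auto simp: dis_fps_def)
    finally show ?thesis using 3 dis_sum_rec[OF 3, of w] by (simp add: dis_fps_def)
  qed (simp add: fps_mult_nth)
qed

section \<open>Generating functions\<close>

text \<open>Relabelling acts on the page order, which is composed with the inverse of
  \<open>h\<close>; a drawing is obtained from it afterwards.\<close>

lemma cog_image:
  assumes inj: "inj_on h S" and E: "E \<in> cog S"
  shows "(`) h ` E \<in> cog (h ` S)"
proof -
  note C = cogD[OF E]
  let ?E = "(`) h ` E"
  have sub: "e \<subseteq> S" if "e \<in> E" for e using C(1) that by (auto simp: simple_graph_def)
  have sg: "simple_graph (h ` S) ?E"
    unfolding simple_graph_def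
  proof (intro conjI ballI)
    show "finite (h ` S)" using C(4) by simp
    fix e' assume "e' \<in> ?E"
    then obtain e where e: "e \<in> E" "e' = h ` e" by blast
    thus "e' \<subseteq> h ` S" using sub by blast
    have "card (h ` e) = card e" using inj_on_subset[OF inj sub[OF e(1)]] by (rule card_image)
    thus "card e' = 2" using e C(1) by (simp add: simple_graph_def)
  qed
  have reach: "(h x, h y) \<in> (adj ?E)\<^sup>*" if "(x, y) \<in> (adj E)\<^sup>*" for x y
    using that
  proof (induction rule: rtrancl_induct)
    case (step y z)
    hence "h ` {y, z} \<in> ?E" by blast
    hence "(h y, h z) \<in> adj ?E" by simp
    thus ?case using step by (auto intro: rtrancl_into_rtrancl)
  qed simp
  have con: "connected_graph (h ` S) ?E"
    using C(2) reach by (auto simp: connected_graph_def)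
  obtain f :: "'a \<Rightarrow> nat" where f: "page_order f S E"
    using outerplanar_imp_book[OF E] unfolding book_def page_order_def by blast
  let ?g = "inv_into S h"
  have g: "?g (h x) = x" if "x \<in> S" for x using inj that by simp
  have edge: "{x, y} \<in> E" if "x \<in> S" "y \<in> S" "{h x, h y} \<in> ?E" for x y
  proof -
    obtain e where e: "e \<in> E" "{h x, h y} = h ` e" using \<open>{h x, h y} \<in> ?E\<close> by blast
    have "h ` {x, y} = h ` e" using e by simp
    hence "{x, y} = e" using inj_on_image_eq_iff[OF inj, of "{x, y}" e] sub[OF e(1)] that by simp
    thus ?thesis using e by simp
  qed
  have "inj_on (f \<circ> ?g) (h ` S)"
    using f g by (auto simp: page_order_def inj_on_def)
  moreover have "{b, d} \<notin> ?E"
    if "a \<in> h ` S" "b \<in> h ` S" "c \<in> h ` S" "d \<in> h ` S" "(f \<circ> ?g) a < (f \<circ> ?g) b"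
      "(f \<circ> ?g) b < (f \<circ> ?g) c" "(f \<circ> ?g) c < (f \<circ> ?g) d" "{a, c} \<in> ?E" for a b c d
  proof
    assume bd: "{b, d} \<in> ?E"
    from that obtain a' b' c' d' where x: "a = h a'" "b = h b'" "c = h c'" "d = h d'" "a' \<in> S" "b' \<in> S" "c' \<in> S" "d' \<in> S"
      by blast
    have "{a', c'} \<in> E" "{b', d'} \<in> E" using edge[of a' c'] edge[of b' d'] x that(8) bd by auto
    thus False using page_orderD[OF f x(5-8)] that(5-7) x g by simp
  qed
  ultimately have "book (h ` S) ?E" unfolding book_def by blast
  thus ?thesis using sg con book_imp_outerplanar[OF sg] by (simp add: cog_def)
qed

lemma card_cog_le:
  assumes inj: "inj_on h S" and fin: "finite S"
  shows "card (cog S) \<le> card (cog (h ` S))"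
proof (rule card_inj_on_le[where f = "\<lambda>E. (`) h ` E"])
  have i1: "inj_on ((`) h) (Pow S)" using inj by (rule inj_on_image_Pow)
  show "inj_on (\<lambda>E. (`) h ` E) (cog S)"
    by (rule inj_on_subset[OF inj_on_image_Pow[OF i1]]) (auto simp: cog_def simple_graph_def)
  show "(\<lambda>E. (`) h ` E) ` cog S \<subseteq> cog (h ` S)" using cog_image[OF inj] by blast
  show "finite (cog (h ` S))" using fin by (intro finite_cog) simp
qed

lemma card_cog: "finite S \<Longrightarrow> card (cog S) = card (connected_outerplanar_graphs (card S))"
proof -
  assume fin: "finite S"
  have c: "connected_outerplanar_graphs n = cog {1..n}" for n
    by (simp add: connected_outerplanar_graphs_def cog_def)
  have "card S = card {1..card S}" by simp
  then obtain h where h: "bij_betw h S {1..card S}"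
    using fin finite_same_card_bij by blast
  have "card (cog S) \<le> card (cog {1..card S})"
    using card_cog_le[of h S] h fin by (auto simp: bij_betw_def)
  moreover have "card (cog {1..card S}) \<le> card (cog S)"
    using card_cog_le[of "inv_into S h" "{1..card S}"] bij_betw_inv_into[OF h] by (auto simp: bij_betw_def)
  ultimately show ?thesis by (simp add: c)
qed

lemma sum_Pow_card:
  fixes f :: "nat \<Rightarrow> 'b::comm_semiring_1"
  assumes "finite V"
  shows "(\<Sum>S\<in>Pow V. f (card S)) = (\<Sum>k\<le>card V. of_nat (card V choose k) * f k)"
proof -
  have "(\<Sum>S\<in>Pow V. f (card S)) = (\<Sum>k\<le>card V. \<Sum>S\<in>{S\<in>Pow V. card S = k}. f (card S))"
    using assms by (intro sum.group[symmetric]) (auto intro: card_mono)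
  also have "\<dots> = (\<Sum>k\<le>card V. of_nat (card V choose k) * f k)"
    using n_subsets[OF assms] by (intro sum.cong refl) simp
  finally show ?thesis .
qed

section \<open>Exponential generating functions of rooted graphs\<close>

definition T_fps :: "real fps" where
  "T_fps = fps_X * fps_deriv C_egf"

lemma T_fps_nth: "T_fps $ n = real n * real (card (connected_outerplanar_graphs n)) / fact n"
  by (cases n) (simp_all add: T_fps_def C_egf_def)

lemma T_fps_0 [simp]: "T_fps $ 0 = 0"
  by (simp add: T_fps_nth)

text \<open>Choosing the vertex set of the first entry is a binomial convolution, which is
  multiplication of exponential generating functions.\<close>

lemma card_rooted_seqs: "finite V \<Longrightarrow> real (card (rooted_seqs m V)) = fact (card V) * (T_fps ^ m) $ card V"
proof (induction m arbitrary: V)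
  case 0
  thus ?case by (simp add: rooted_seqs_0)
next
  case (Suc m)
  let ?n = "card V"
  have "real (card (rooted_seqs (Suc m) V)) =
      (\<Sum>S\<in>Pow V. real (card S) * real (card (cog S)) * real (card (rooted_seqs m (V - S))))"
    by (simp add: card_rooted_seqs_Suc[OF Suc.prems])
  also have "\<dots> = (\<Sum>S\<in>Pow V. fact (card S) * T_fps $ card S * (fact (?n - card S) * (T_fps ^ m) $ (?n - card S)))"
  proof (rule sum.cong[OF refl])
    fix S assume "S \<in> Pow V"
    hence S: "finite S" "S \<subseteq> V" using Suc.prems by (auto intro: finite_subset)
    hence "card (V - S) = ?n - card S" by (simp add: card_Diff_subset)
    thus "real (card S) * real (card (cog S)) * real (card (rooted_seqs m (V - S))) =
       fact (card S) * T_fps $ card S * (fact (?n - card S) * (T_fps ^ m) $ (?n - card S))"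
      using Suc.IH[of "V - S"] Suc.prems card_cog[OF S(1)] by (simp add: T_fps_nth)
  qed
  also have "\<dots> = (\<Sum>k\<le>?n. real (?n choose k) * (fact k * T_fps $ k * (fact (?n - k) * (T_fps ^ m) $ (?n - k))))"
    by (rule sum_Pow_card[OF Suc.prems])
  also have "\<dots> = (\<Sum>k\<le>?n. fact ?n * (T_fps $ k * (T_fps ^ m) $ (?n - k)))"
  proof (rule sum.cong[OF refl])
    fix k assume "k \<in> {..?n}"
    hence "real (?n choose k) = fact ?n / (fact k * fact (?n - k))" by (simp add: binomial_fact)
    thus "real (?n choose k) * (fact k * T_fps $ k * (fact (?n - k) * (T_fps ^ m) $ (?n - k))) =
        fact ?n * (T_fps $ k * (T_fps ^ m) $ (?n - k))" by simp
  qed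
  also have "\<dots> = fact ?n * (T_fps ^ Suc m) $ ?n"
    by (simp add: fps_mult_nth sum_distrib_left atMost_atLeast0)
  finally show ?case .
qed

text \<open>\<open>B\<^sup>\<bullet>(x, w)\<close> as a power series. The factor
  \<open>1 / 2\<close> removes the orientation of polygons; a single edge has one orientation only,
  and the second summand restores its weight.\<close>

definition block_fps :: "real \<Rightarrow> real fps" where
  "block_fps w = fps_const (1 / 2) * (dis_fps w + fps_const w * fps_X)"

definition H_fps :: "real \<Rightarrow> real fps" where
  "H_fps w = fps_exp 1 oo block_fps w"

lemma block_fps_0 [simp]: "block_fps w $ 0 = 0"
  by (simp add: block_fps_def)

lemma deg_sum_nonsep_fps:
  assumes fin: "finite V" and r: "r \<notin> V"
  shows "deg_sum w r (nonsep r V) = fact (card V) * (block_fps w oo T_fps) $ card V"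
proof -
  let ?n = "card V"
  have "(block_fps w oo T_fps) $ ?n = ((dis_fps w oo T_fps) $ ?n + w * T_fps $ ?n) / 2"
  proof -
    have "block_fps w oo T_fps = fps_const (1 / 2) * ((dis_fps w oo T_fps) + fps_const w * T_fps)"
      by (simp add: block_fps_def fps_compose_mult_distrib fps_compose_add_distrib)
    thus ?thesis by simp
  qed
  moreover have "(dis_fps w oo T_fps) $ ?n = (\<Sum>m=1..?n. dis_sum w m * (T_fps ^ m) $ ?n)"
    unfolding fps_compose_nth by (rule sum.mono_neutral_cong_right) (auto simp: dis_fps_def)
  moreover have "2 * deg_sum w r (nonsep r V) =
      (\<Sum>m=1..?n. fact ?n * (T_fps ^ m) $ ?n * dis_sum w m) + w * (fact ?n * (T_fps ^ 1) $ ?n)"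
    unfolding deg_sum_nonsep[OF fin r] by (simp only: card_rooted_seqs[OF fin])
  moreover have "(\<Sum>m=1..?n. fact ?n * (T_fps ^ m) $ ?n * dis_sum w m) = fact ?n * (\<Sum>m=1..?n. dis_sum w m * (T_fps ^ m) $ ?n)"
    by (simp add: sum_distrib_left mult_ac)
  ultimately have "2 * deg_sum w r (nonsep r V) = fact ?n * (2 * (block_fps w oo T_fps) $ ?n)"
    by (simp add: algebra_simps)
  thus ?thesis by simp
qed

lemma cog_singleton: "cog {r} = {{}}"
proof -
  have "E = {}" if "E \<in> cog {r}" for E
  proof (rule ccontr)
    assume "E \<noteq> {}"
    with that obtain e where e: "e \<subseteq> {r}" "card e = 2" unfolding cog_def simple_graph_def by blast
    hence "card e \<le> card {r}" by (intro card_mono) auto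
    thus False using e by simp
  qed
  moreover have sg: "simple_graph {r} {}" by (simp add: simple_graph_def)
  moreover have "book {r} {}" by (auto simp: book_def)
  hence "outerplanar {r} {}" by (rule book_imp_outerplanar[OF sg])
  ultimately show ?thesis by (auto simp: cog_def connected_graph_def)
qed

text \<open>The recursion over the component of a fixed vertex is the coefficient form of
  \<open>C' = N' C\<close>, whose solution with constant term 1 is \<open>exp N\<close>.\<close>

lemma deg_sum_cog_fps:
  "finite V \<Longrightarrow> r \<notin> V \<Longrightarrow> deg_sum w r (cog (insert r V)) = fact (card V) * (H_fps w oo T_fps) $ card V"
proof (induction "card V" arbitrary: V rule: less_induct)
  case less
  define N where "N = block_fps w oo T_fps"
  have HN: "H_fps w oo T_fps = fps_exp 1 oo N"
    by (simp add: H_fps_def N_def fps_compose_assoc)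
  have N0: "N $ 0 = 0" by (simp add: N_def)
  define C where "C = fps_exp 1 oo N"
  show ?case
  proof (cases "V = {}")
    case True
    thus ?thesis by (simp add: cog_singleton deg_sum_def degree_of_def HN)
  next
    case False
    then obtain a where a: "a \<in> V" by blast
    define n where "n = card V - 1"
    have n: "card V = Suc n" "card (V - {a}) = n" using a less(2) card_gt_0_iff[of V] by (auto simp: n_def)
    have fact_C: "deg_sum w r (cog (insert r (V - K))) = fact (card V - card K) * C $ (card V - card K)"
      if "K \<subseteq> V" "a \<in> K" for K
    proof -
      have "V - K \<subset> V" using that a by blast
      hence "card (V - K) < card V" using less(2) by (rule psubset_card_mono[rotated])
      moreover have "card (V - K) = card V - card K" using that less(2) by (meson card_Diff_subset finite_subset)
      ultimately show ?thesis using less(1)[of "V - K"] less(2,3) by (simp add: HN C_def)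
    qed
    have fact_N: "deg_sum w r (nonsep r K) = fact (card K) * N $ card K" if "K \<subseteq> V" for K
      using deg_sum_nonsep_fps[of K r w] that less(2,3) by (auto simp: N_def dest: finite_subset)
    have "deg_sum w r (cog (insert r V)) =
        (\<Sum>K | K \<subseteq> V \<and> a \<in> K. deg_sum w r (nonsep r K) * deg_sum w r (cog (insert r (V - K))))"
      by (rule deg_sum_cog_rec[OF less(2,3) a])
    also have "\<dots> = (\<Sum>K | K \<subseteq> V \<and> a \<in> K. fact (card K) * N $ card K * (fact (card V - card K) * C $ (card V - card K)))"
      using fact_C fact_N by (intro sum.cong refl) auto
    also have "\<dots> = (\<Sum>K\<in>Pow (V - {a}). fact (Suc (card K)) * N $ Suc (card K) * (fact (n - card K) * C $ (n - card K)))"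
    proof (rule sum.reindex_bij_witness[of _ "insert a" "\<lambda>K. K - {a}"])
      fix K assume K: "K \<in> {K. K \<subseteq> V \<and> a \<in> K}"
      hence "finite K" using less(2) by (auto dest: finite_subset)
      hence "card K = Suc (card (K - {a}))" using K by (metis (no_types, lifting) card_Suc_Diff1 mem_Collect_eq)
      thus "fact (Suc (card (K - {a}))) * N $ Suc (card (K - {a})) * (fact (n - card (K - {a})) * C $ (n - card (K - {a})))
        = fact (card K) * N $ card K * (fact (card V - card K) * C $ (card V - card K))" using n by simp
    qed (use a in auto)
    also have "\<dots> = (\<Sum>k\<le>n. real (n choose k) * (fact (Suc k) * N $ Suc k * (fact (n - k) * C $ (n - k))))"
      using sum_Pow_card[of "V - {a}" "\<lambda>k. fact (Suc k) * N $ Suc k * (fact (n - k) * C $ (n - k))"] n less(2) by simp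
    also have "\<dots> = (\<Sum>k\<le>n. fact n * (fps_deriv N $ k * C $ (n - k)))"
    proof (rule sum.cong[OF refl])
      fix k assume "k \<in> {..n}"
      hence "real (n choose k) = fact n / (fact k * fact (n - k))" by (simp add: binomial_fact)
      thus "real (n choose k) * (fact (Suc k) * N $ Suc k * (fact (n - k) * C $ (n - k))) =
          fact n * (fps_deriv N $ k * C $ (n - k))" by simp
    qed
    also have "\<dots> = fact n * (fps_deriv N * C) $ n"
      by (simp add: fps_mult_nth sum_distrib_left atMost_atLeast0)
    also have "fps_deriv N * C = fps_deriv C"
      by (simp add: C_def fps_compose_deriv[OF N0] mult.commute)
    also have "fact n * fps_deriv C $ n = fact (card V) * C $ card V" unfolding n by simp
    finally show ?thesis by (simp add: HN C_def)
  qed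
qed

text \<open>The vertex \<open>v\<close> carries the weight and is not counted among the labels,
  hence \<open>n - 1\<close> instead of \<open>n\<close>.\<close>

theorem graph_degree_fps:
  assumes "v \<in> {1..n}"
  shows "(\<Sum>E\<in>connected_outerplanar_graphs n. w ^ degree_of E v) = fact (n - 1) * (H_fps w oo T_fps) $ (n - 1)"
proof -
  have "insert v ({1..n} - {v}) = {1..n}" using assms by auto
  thus ?thesis using deg_sum_cog_fps[of "{1..n} - {v}" v w] assms
    by (simp add: deg_sum_def connected_outerplanar_graphs_def cog_def)
qed

text \<open>At \<open>w = 1\<close> the degree sum counts graphs; the factor \<open>n\<close> for
  the choice of a root turns \<open>1 / n!\<close> into \<open>1 / (n - 1)!\<close>.\<close>

theorem T_fps_eq: "T_fps = fps_X * (H_fps 1 oo T_fps)"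
proof (rule fps_ext)
  fix n
  show "T_fps $ n = (fps_X * (H_fps 1 oo T_fps)) $ n"
  proof (cases n)
    case (Suc k)
    have "real (card (connected_outerplanar_graphs n)) = fact k * (H_fps 1 oo T_fps) $ k"
      using graph_degree_fps[of 1 n 1] Suc by simp
    thus ?thesis using Suc by (simp add: T_fps_nth)
  qed simp
qed

section \<open>Lagrange inversion and sums of power series\<close>

text \<open>\<open>b ^ i\<close> starts at degree \<open>i\<close>, so one sum up to
  \<open>m\<close> serves all coefficients involved.\<close>

lemma fps_compose_mult_nth:
  fixes a b g :: "'a::idom fps"
  assumes "b $ 0 = 0"
  shows "((a oo b) * g) $ m = (\<Sum>i=0..m. a $ i * (b ^ i * g) $ m)"
proof -
  have c: "(a oo b) $ j = (\<Sum>i=0..m. a $ i * (b ^ i) $ j)" if "j \<le> m" for j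
    unfolding fps_compose_nth
    by (rule sum.mono_neutral_left) (use that startsby_zero_power_prefix[OF assms] in auto)
  have "((a oo b) * g) $ m = (\<Sum>j=0..m. \<Sum>i=0..m. a $ i * (b ^ i) $ j * g $ (m - j))"
    unfolding fps_mult_nth by (intro sum.cong refl) (simp add: c sum_distrib_right)
  also have "\<dots> = (\<Sum>i=0..m. \<Sum>j=0..m. a $ i * (b ^ i) $ j * g $ (m - j))" by (rule sum.swap)
  also have "\<dots> = (\<Sum>i=0..m. a $ i * (b ^ i * g) $ m)"
    by (simp add: fps_mult_nth sum_distrib_left mult.assoc)
  finally show ?thesis .
qed

text \<open>With \<open>\<psi> = X / \<phi>\<close> the compositional inverse of \<open>T\<close> and \<open>H = A \<circ> \<psi>\<close>, \<open>A = H \<circ> T\<close>, this is the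
  classical residue computation, carried out without Laurent series.\<close>

theorem fps_lagrange_inversion:
  fixes \<phi> T H :: "'a::field_char_0 fps"
  assumes \<phi>0: "\<phi> $ 0 \<noteq> 0" and T0: "T $ 0 = 0" and T: "T = fps_X * (\<phi> oo T)" and n: "n \<ge> 1"
  shows "of_nat n * (H oo T) $ n = (fps_deriv H * \<phi> ^ n) $ (n - 1)"
proof -
  define \<eta> where "\<eta> = inverse \<phi>"
  define \<psi> where "\<psi> = fps_X * \<eta>"
  have \<phi>\<eta>: "\<phi> * \<eta> = 1" using \<phi>0 by (simp add: \<eta>_def inverse_mult_eq_1')
  have \<psi>0: "\<psi> $ 0 = 0" and \<psi>1: "\<psi> $ 1 \<noteq> 0" using \<phi>0 by (simp_all add: \<psi>_def \<eta>_def)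
  have "\<psi> oo T = T * (\<eta> oo T)" using T0 by (simp add: \<psi>_def fps_compose_mult_distrib)
  also have "T * (\<eta> oo T) = fps_X * ((\<phi> oo T) * (\<eta> oo T))" by (subst (1) T) (simp add: mult.assoc)
  also have "(\<phi> oo T) * (\<eta> oo T) = 1"
    using fps_compose_mult_distrib[OF T0, of \<phi> \<eta>] \<phi>\<eta> fps_const_compose[of 1 T] by simp
  finally have \<psi>T: "\<psi> oo T = fps_X" by simp
  have "T = (fps_inv \<psi> oo \<psi>) oo T" using fps_inv[OF \<psi>0 \<psi>1] T0 by simp
  also have "\<dots> = fps_inv \<psi> oo (\<psi> oo T)" by (rule fps_compose_assoc[symmetric, OF T0 \<psi>0])
  finally have T_inv: "T = fps_inv \<psi>" by (simp add: \<psi>T)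
  have T\<psi>: "T oo \<psi> = fps_X" unfolding T_inv by (rule fps_inv[OF \<psi>0 \<psi>1])
  define A where "A = H oo T"
  have H: "H = A oo \<psi>" unfolding A_def using T\<psi> fps_compose_assoc[OF \<psi>0 T0, of H] by simp
  have H': "fps_deriv H = (fps_deriv A oo \<psi>) * fps_deriv \<psi>" unfolding H by (rule fps_compose_deriv[OF \<psi>0])
  have \<psi>': "fps_deriv \<psi> = \<eta> + fps_X * fps_deriv \<eta>" by (simp add: \<psi>_def add.commute)
  have d\<eta>: "\<phi> * fps_deriv \<eta> = - (fps_deriv \<phi> * \<eta>)"
  proof -
    have "fps_deriv (\<phi> * \<eta>) = 0" by (simp add: \<phi>\<eta>)
    hence "\<phi> * fps_deriv \<eta> + fps_deriv \<phi> * \<eta> = 0" by (simp add: fps_deriv_mult)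
    thus ?thesis by (simp add: eq_neg_iff_add_eq_0)
  qed
  \<comment> \<open>Orthogonality in place of residues: of the powers of \<open>\<psi>\<close> up to
    \<open>n - 1\<close> only the last one contributes.\<close>
  have key: "(\<psi> ^ i * (fps_deriv \<psi> * \<phi> ^ n)) $ (n - 1) = (if i = n - 1 then 1 else 0)" if i: "i \<le> n - 1" for i
  proof -
    define k where "k = n - 1 - i"
    have nk: "n = i + Suc k" using i n by (simp add: k_def)
    have "\<psi> ^ i * (fps_deriv \<psi> * \<phi> ^ n) = fps_X ^ i * (\<eta> ^ i * \<phi> ^ i) * ((\<eta> + fps_X * fps_deriv \<eta>) * \<phi> ^ Suc k)"
      unfolding \<psi>' by (simp add: \<psi>_def nk power_mult_distrib power_add mult_ac)
    also have "\<eta> ^ i * \<phi> ^ i = 1" using \<phi>\<eta> by (metis mult.commute power_mult_distrib power_one)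
    also have "(\<eta> + fps_X * fps_deriv \<eta>) * \<phi> ^ Suc k = \<phi> ^ k * (\<phi> * \<eta>) + fps_X * (\<phi> ^ k * (\<phi> * fps_deriv \<eta>))"
      by (simp add: algebra_simps)
    also have "\<dots> = \<phi> ^ k - fps_X * (\<phi> ^ k * (fps_deriv \<phi> * \<eta>))"
      unfolding d\<eta> \<phi>\<eta> by simp
    finally have "(\<psi> ^ i * (fps_deriv \<psi> * \<phi> ^ n)) $ (n - 1) = (\<phi> ^ k - fps_X * (\<phi> ^ k * (fps_deriv \<phi> * \<eta>))) $ k"
      using nk by (simp add: fps_X_power_mult_nth del: fps_sub_nth)
    also have "\<dots> = (if i = n - 1 then 1 else 0)"
    proof (cases k)
      case 0
      thus ?thesis using nk by simp
    next
      \<comment> \<open>The coefficient of index \<open>k\<close> of \<open>\<phi> ^ k\<close> is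
        the coefficient of index \<open>k - 1\<close> of its derivative divided by \<open>k\<close>,
        so the difference vanishes.\<close>
      case (Suc k')
      have "\<phi> ^ k * (fps_deriv \<phi> * \<eta>) = \<phi> ^ k' * fps_deriv \<phi> * (\<phi> * \<eta>)" unfolding Suc by (simp add: mult_ac)
      hence e: "\<phi> ^ k * (fps_deriv \<phi> * \<eta>) = \<phi> ^ k' * fps_deriv \<phi>" by (simp add: \<phi>\<eta>)
      have "fps_deriv (\<phi> ^ k) = of_nat k * fps_deriv \<phi> * \<phi> ^ k'"
        using fps_deriv_power'[of \<phi> k] Suc by simp
      hence "fps_deriv (\<phi> ^ k) = fps_const (of_nat k) * (\<phi> ^ k' * fps_deriv \<phi>)"
        by (simp add: mult_ac fps_of_nat)
      hence "fps_deriv (\<phi> ^ k) $ k' = of_nat k * (\<phi> ^ k' * fps_deriv \<phi>) $ k'"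
        by (simp only: fps_mult_left_const_nth)
      moreover have "fps_deriv (\<phi> ^ k) $ k' = of_nat k * \<phi> ^ k $ k"
        by (simp only: fps_deriv_nth Suc Suc_eq_plus1)
      ultimately have e2: "of_nat k * \<phi> ^ k $ k = of_nat k * (\<phi> ^ k' * fps_deriv \<phi>) $ k'" by metis
      have k0: "(of_nat k :: 'a) \<noteq> 0" unfolding Suc by (rule of_nat_neq_0)
      have e3: "\<phi> ^ k $ k = (\<phi> ^ k' * fps_deriv \<phi>) $ k'"
        by (rule mult_left_cancel[OF k0, THEN iffD1, OF e2])
      have "(\<phi> ^ k - fps_X * (\<phi> ^ k' * fps_deriv \<phi>)) $ k = \<phi> ^ k $ k - (fps_X * (\<phi> ^ k' * fps_deriv \<phi>)) $ Suc k'"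
        unfolding fps_sub_nth by (simp only: Suc)
      also have "\<dots> = 0" unfolding e3 by simp
      finally have "(\<phi> ^ k - fps_X * (\<phi> ^ k * (fps_deriv \<phi> * \<eta>))) $ k = 0" unfolding e .
      moreover have "i \<noteq> n - 1" using nk Suc by simp
      ultimately show ?thesis by simp
    qed
    finally show ?thesis .
  qed
  have "(fps_deriv H * \<phi> ^ n) $ (n - 1) = ((fps_deriv A oo \<psi>) * (fps_deriv \<psi> * \<phi> ^ n)) $ (n - 1)"
    by (simp add: H' mult.assoc)
  also have "\<dots> = (\<Sum>i=0..n - 1. fps_deriv A $ i * (\<psi> ^ i * (fps_deriv \<psi> * \<phi> ^ n)) $ (n - 1))"
    by (rule fps_compose_mult_nth[OF \<psi>0])
  also have "\<dots> = (\<Sum>i=0..n - 1. fps_deriv A $ i * (if i = n - 1 then 1 else 0))"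
    using key by (intro sum.cong refl) (simp only: atLeastAtMost_iff)
  also have "\<dots> = (\<Sum>i\<in>{n - 1}. fps_deriv A $ i * (if i = n - 1 then 1 else 0))"
    by (rule sum.mono_neutral_right) auto
  also have "\<dots> = fps_deriv A $ (n - 1)" by (simp only: sum.insert_remove sum.empty finite.emptyI) simp
  also have "\<dots> = of_nat n * A $ n"
    using n by (simp only: fps_deriv_nth le_add_diff_inverse2)
  finally show ?thesis by (simp add: A_def)
qed

section \<open>Values of power series with nonnegative coefficients\<close>

definition nonneg_fps :: "real fps \<Rightarrow> bool" where
  "nonneg_fps f \<longleftrightarrow> (\<forall>n. 0 \<le> f $ n)"

lemma nonneg_fpsD [simp]: "nonneg_fps f \<Longrightarrow> 0 \<le> f $ n"
  by (simp add: nonneg_fps_def)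

lemma nonneg_fps_mult: "nonneg_fps f \<Longrightarrow> nonneg_fps g \<Longrightarrow> nonneg_fps (f * g)"
  by (simp add: nonneg_fps_def fps_mult_nth sum_nonneg)

lemma nonneg_fps_power: "nonneg_fps f \<Longrightarrow> nonneg_fps (f ^ n)"
  by (induction n) (auto intro: nonneg_fps_mult simp: nonneg_fps_def[of 1])

lemma nonneg_fps_compose: "nonneg_fps f \<Longrightarrow> nonneg_fps g \<Longrightarrow> nonneg_fps (f oo g)"
  using nonneg_fps_power[of g] by (auto simp: nonneg_fps_def fps_compose_nth intro!: sum_nonneg)

text \<open>A relation instead of \<open>eval_fps\<close>: it carries convergence with it and
  applies at boundary points of the disc of convergence.\<close>

definition fps_sums :: "real fps \<Rightarrow> real \<Rightarrow> real \<Rightarrow> bool" where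
  "fps_sums f x y \<longleftrightarrow> (\<lambda>n. f $ n * x ^ n) sums y"

text \<open>For nonnegative coefficients, convergence at \<open>\<bar>x\<bar>\<close> is absolute
  convergence at \<open>x\<close>, as the Cauchy product requires.\<close>

lemma fps_sums_mult_abs:
  assumes "nonneg_fps f" "nonneg_fps g" "fps_sums f \<bar>x\<bar> a'" "fps_sums g \<bar>x\<bar> b'"
    and ab: "fps_sums f x a" "fps_sums g x b"
  shows "fps_sums (f * g) x (a * b)"
proof -
  have n: "norm (h $ k * x ^ k) = h $ k * \<bar>x\<bar> ^ k" if "nonneg_fps h" for h k
    using that by (simp add: abs_mult power_abs)
  have "summable (\<lambda>k. norm (f $ k * x ^ k))" "summable (\<lambda>k. norm (g $ k * x ^ k))"
    unfolding n[OF assms(1)] n[OF assms(2)] using assms(3,4) by (auto simp: fps_sums_def sums_iff)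
  from Cauchy_product_sums[OF this]
  have "(\<lambda>k. \<Sum>i\<le>k. f $ i * x ^ i * (g $ (k - i) * x ^ (k - i))) sums (a * b)"
    using ab by (simp add: fps_sums_def sums_iff)
  moreover have "(\<Sum>i\<le>k. f $ i * x ^ i * (g $ (k - i) * x ^ (k - i))) = (f * g) $ k * x ^ k" for k
  proof -
    have "(\<Sum>i\<le>k. f $ i * x ^ i * (g $ (k - i) * x ^ (k - i))) = (\<Sum>i\<le>k. f $ i * g $ (k - i) * x ^ k)"
    proof (rule sum.cong[OF refl])
      fix i assume "i \<in> {..k}"
      hence "x ^ k = x ^ i * x ^ (k - i)" by (simp add: power_add[symmetric])
      thus "f $ i * x ^ i * (g $ (k - i) * x ^ (k - i)) = f $ i * g $ (k - i) * x ^ k" by simp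
    qed
    thus ?thesis by (simp add: fps_mult_nth sum_distrib_right atMost_atLeast0)
  qed
  ultimately show ?thesis by (simp add: fps_sums_def)
qed

lemma fps_sums_one: "fps_sums 1 x 1"
proof -
  have "(\<lambda>n. (1 :: real fps) $ n * x ^ n) sums (\<Sum>n\<in>{0}. (1 :: real fps) $ n * x ^ n)"
    by (rule sums_finite) auto
  thus ?thesis by (simp add: fps_sums_def)
qed

lemma fps_sums_mult:
  assumes "nonneg_fps f" "nonneg_fps g" "0 \<le> x" "fps_sums f x a" "fps_sums g x b"
  shows "fps_sums (f * g) x (a * b)"
  using fps_sums_mult_abs[of f g x a b a b] assms by simp

lemma fps_sums_power:
  assumes "nonneg_fps f" "0 \<le> x" "fps_sums f x a"
  shows "fps_sums (f ^ i) x (a ^ i)"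
proof (induction i)
  case (Suc i)
  show ?case using fps_sums_mult[OF assms(1) nonneg_fps_power[OF assms(1)] assms(2,3) Suc] by simp
qed (simp add: fps_sums_one)

lemma fps_sums_power_abs:
  assumes "nonneg_fps f" "fps_sums f \<bar>x\<bar> a'" "fps_sums f x a"
  shows "fps_sums (f ^ i) x (a ^ i)"
proof (induction i)
  case (Suc i)
  show ?case
    using fps_sums_mult_abs[OF assms(1) nonneg_fps_power[OF assms(1)] assms(2)
        fps_sums_power[OF assms(1) abs_ge_zero assms(2)] assms(3) Suc] by simp
qed (simp add: fps_sums_one)

lemma fps_sums_X: "fps_sums fps_X x x"
proof -
  have "(\<lambda>n. (fps_X :: real fps) $ n * x ^ n) sums (\<Sum>n\<in>{1}. (fps_X :: real fps) $ n * x ^ n)"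
    by (rule sums_finite) (auto simp: fps_X_def)
  thus ?thesis by (simp add: fps_sums_def)
qed

lemma fps_sums_add: "fps_sums f x a \<Longrightarrow> fps_sums g x b \<Longrightarrow> fps_sums (f + g) x (a + b)"
  unfolding fps_sums_def using sums_add by (fastforce simp: algebra_simps)

lemma fps_sums_cmult: "fps_sums f x a \<Longrightarrow> fps_sums (fps_const c * f) x (c * a)"
  unfolding fps_sums_def using sums_mult[of "\<lambda>n. f $ n * x ^ n" a c] by (simp add: mult.assoc)

lemma fps_sums_unique: "fps_sums f x a \<Longrightarrow> fps_sums f x b \<Longrightarrow> a = b"
  unfolding fps_sums_def by (rule sums_unique2)

lemma fps_sums_nonneg: "nonneg_fps f \<Longrightarrow> 0 \<le> x \<Longrightarrow> fps_sums f x y \<Longrightarrow> 0 \<le> y"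
  unfolding fps_sums_def by (rule sums_le[OF _ sums_zero]) simp_all

text \<open>A double series summed by rows gives the composed value and by columns the coefficients
  of \<open>a oo b\<close>. The same array at \<open>\<bar>x\<bar>\<close> has nonnegative entries
  and provides absolute summability.\<close>

lemma fps_sums_compose_abs:
  assumes a: "nonneg_fps a" and b: "nonneg_fps b" "b $ 0 = 0"
    and abs: "fps_sums b \<bar>x\<bar> y'" "fps_sums a y' z'" and bs: "fps_sums b x y" and as: "fps_sums a y z"
  shows "fps_sums (a oo b) x z"
proof -
  define f where "f = (\<lambda>(i, n). a $ i * (b ^ i $ n * x ^ n))"
  define F where "F = (\<lambda>(i, n). a $ i * (b ^ i $ n * \<bar>x\<bar> ^ n))"
  have y': "0 \<le> y'" by (rule fps_sums_nonneg[OF b(1) abs_ge_zero abs(1)])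
  have nn: "0 \<le> F (i, n)" for i n using a nonneg_fps_power[OF b(1)] by (simp add: F_def)
  have nf: "norm (f (i, n)) = F (i, n)" for i n
    using a nonneg_fps_power[OF b(1)] by (simp add: f_def F_def abs_mult power_abs)
  have Frow: "(\<lambda>n. F (i, n)) sums (a $ i * y' ^ i)" for i
    using sums_mult[OF fps_sums_power[OF b(1) abs_ge_zero abs(1), of i, unfolded fps_sums_def], of "a $ i"]
    by (simp add: F_def)
  have Frows: "((\<lambda>n. F (i, n)) has_sum a $ i * y' ^ i) UNIV" for i
    by (rule sums_nonneg_imp_has_sum[OF Frow nn])
  have rows: "((\<lambda>n. f (i, n)) has_sum a $ i * y ^ i) UNIV" for i
  proof (rule norm_summable_imp_has_sum)
    show "summable (\<lambda>n. norm (f (i, n)))" unfolding nf using Frow by (simp add: sums_iff)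
    show "(\<lambda>n. f (i, n)) sums (a $ i * y ^ i)"
      using sums_mult[OF fps_sums_power_abs[OF b(1) abs(1) bs, of i, unfolded fps_sums_def], of "a $ i"]
      by (simp add: f_def)
  qed
  have sy': "summable (\<lambda>i. a $ i * y' ^ i)" using abs(2) by (auto simp: fps_sums_def sums_iff)
  have yy': "\<bar>y\<bar> \<le> y'"
  proof -
    have s: "summable (\<lambda>n. norm (b $ n * x ^ n))"
      using abs(1) b by (simp add: fps_sums_def sums_iff abs_mult power_abs)
    have "norm (\<Sum>n. b $ n * x ^ n) \<le> (\<Sum>n. norm (b $ n * x ^ n))" by (rule summable_norm[OF s])
    thus ?thesis using abs(1) bs b by (simp add: fps_sums_def sums_iff abs_mult power_abs)
  qed
  have tot: "((\<lambda>i. a $ i * y ^ i) has_sum z) UNIV"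
  proof (rule norm_summable_imp_has_sum)
    show "summable (\<lambda>i. norm (a $ i * y ^ i))"
    proof (rule summable_comparison_test'[OF sy', of 0])
      fix i
      have "\<bar>y\<bar> ^ i \<le> y' ^ i" using yy' by (intro power_mono) auto
      thus "norm (norm (a $ i * y ^ i)) \<le> a $ i * y' ^ i" using a by (simp add: abs_mult power_abs mult_left_mono)
    qed
    show "(\<lambda>i. a $ i * y ^ i) sums z" using as by (simp add: fps_sums_def)
  qed
  have "F summable_on (UNIV \<times> UNIV)"
  proof (rule summable_on_SigmaI[OF Frows])
    show "(\<lambda>i. a $ i * y' ^ i) summable_on UNIV"
      by (rule summable_nonneg_imp_summable_on[OF sy']) (use a y' in simp)
    show "0 \<le> F (i, n)" for i n by (rule nn)
  qed
  hence "(\<lambda>p. norm (f p)) summable_on (UNIV \<times> UNIV)"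
    by (rule summable_on_cong[THEN iffD1, rotated]) (use nf in \<open>auto simp: real_norm_def\<close>)
  hence "f summable_on (UNIV \<times> UNIV)" by (rule abs_summable_summable)
  hence "(f has_sum z) (UNIV \<times> UNIV)" by (rule has_sum_SigmaI[OF rows tot])
  hence sw: "((\<lambda>(n, i). f (i, n)) has_sum z) (UNIV \<times> UNIV)" by (subst (asm) has_sum_swap)
  have cols: "((\<lambda>i. (\<lambda>(n, i). f (i, n)) (n, i)) has_sum (a oo b) $ n * x ^ n) UNIV" for n
  proof -
    have "((\<lambda>i. f (i, n)) has_sum (\<Sum>i\<in>{0..n}. f (i, n))) {0..n}" by (rule has_sum_finite) simp
    hence "((\<lambda>i. f (i, n)) has_sum (\<Sum>i\<in>{0..n}. f (i, n))) UNIV"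
      by (rule has_sum_cong_neutral[THEN iffD1, rotated -1])
        (use startsby_zero_power_prefix[OF b(2)] in \<open>auto simp: f_def\<close>)
    moreover have "(\<Sum>i\<in>{0..n}. f (i, n)) = (a oo b) $ n * x ^ n"
      by (simp add: f_def fps_compose_nth sum_distrib_right mult.assoc)
    ultimately show ?thesis by simp
  qed
  from has_sum_SigmaD[OF sw cols] have "((\<lambda>n. (a oo b) $ n * x ^ n) has_sum z) UNIV" .
  thus ?thesis unfolding fps_sums_def by (rule has_sum_imp_sums)
qed

lemma fps_sums_compose:
  assumes "nonneg_fps a" "nonneg_fps b" "b $ 0 = 0" "0 \<le> x" "fps_sums b x y" "fps_sums a y z"
  shows "fps_sums (a oo b) x z"
  using fps_sums_compose_abs[of a b x y z y z] assms by simp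

lemma fps_sums_X_mult: "fps_sums f x y \<Longrightarrow> fps_sums (fps_X * f) x (x * y)"
proof -
  assume "fps_sums f x y"
  hence "(\<lambda>n. x * (f $ n * x ^ n)) sums (x * y)" unfolding fps_sums_def by (rule sums_mult)
  hence "(\<lambda>n. (fps_X * f) $ Suc n * x ^ Suc n) sums (x * y)" by (simp add: mult_ac)
  thus ?thesis unfolding fps_sums_def by (subst (asm) sums_Suc_iff) simp
qed

lemma fps_sums_exp: "fps_sums (fps_exp a) x (exp (a * x))"
  using exp_converges[of "a * x"] by (simp add: fps_sums_def power_mult_distrib divide_inverse mult_ac)

section \<open>Truncated sums and tree equations\<close>

definition fps_part :: "real fps \<Rightarrow> nat \<Rightarrow> real \<Rightarrow> real" where
  "fps_part f N x = (\<Sum>n\<le>N. f $ n * x ^ n)"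

text \<open>The truncated product ranges over a triangle of index pairs, the product of the
  truncations over the full square.\<close>

lemma fps_part_mult_le:
  assumes "nonneg_fps f" "nonneg_fps g" "0 \<le> x"
  shows "fps_part (f * g) N x \<le> fps_part f N x * fps_part g N x"
proof -
  have "fps_part (f * g) N x = (\<Sum>n\<le>N. \<Sum>i\<le>n. (f $ i * x ^ i) * (g $ (n - i) * x ^ (n - i)))"
  proof -
    have "(f * g) $ n * x ^ n = (\<Sum>i\<le>n. (f $ i * x ^ i) * (g $ (n - i) * x ^ (n - i)))" for n
    proof -
      have "(f $ i * x ^ i) * (g $ (n - i) * x ^ (n - i)) = f $ i * g $ (n - i) * x ^ n" if "i \<le> n" for i
      proof -
        have "x ^ n = x ^ i * x ^ (n - i)" using that by (simp add: power_add[symmetric])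
        thus ?thesis by simp
      qed
      hence "(\<Sum>i\<le>n. (f $ i * x ^ i) * (g $ (n - i) * x ^ (n - i))) = (\<Sum>i\<le>n. f $ i * g $ (n - i) * x ^ n)"
        by (intro sum.cong refl) simp
      thus ?thesis by (simp add: fps_mult_nth sum_distrib_right atMost_atLeast0)
    qed
    thus ?thesis by (simp add: fps_part_def)
  qed
  also have "\<dots> = (\<Sum>(n, i)\<in>(SIGMA n:{..N}. {..n}). (f $ i * x ^ i) * (g $ (n - i) * x ^ (n - i)))"
    by (subst sum.Sigma) auto
  also have "\<dots> = (\<Sum>(i, j)\<in>{(i, j). i + j \<le> N}. (f $ i * x ^ i) * (g $ j * x ^ j))"
    by (rule sum.reindex_bij_witness[of _ "\<lambda>(i, j). (i + j, i)" "\<lambda>(n, i). (i, n - i)"]) auto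
  also have "\<dots> \<le> (\<Sum>(i, j)\<in>{..N} \<times> {..N}. (f $ i * x ^ i) * (g $ j * x ^ j))"
    by (rule sum_mono2) (use assms in auto)
  also have "\<dots> = fps_part f N x * fps_part g N x"
    unfolding fps_part_def sum_product sum.cartesian_product ..
  finally show ?thesis .
qed

lemma fps_part_nonneg: "nonneg_fps f \<Longrightarrow> 0 \<le> x \<Longrightarrow> 0 \<le> fps_part f N x"
  by (auto simp: fps_part_def intro!: sum_nonneg)

lemma fps_part_power_le:
  assumes "nonneg_fps f" "0 \<le> x"
  shows "fps_part (f ^ i) N x \<le> fps_part f N x ^ i"
proof (induction i)
  case 0
  have "fps_part 1 N x = (\<Sum>n\<in>{0}. (1 :: real fps) $ n * x ^ n)"
    unfolding fps_part_def by (rule sum.mono_neutral_right) auto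
  thus ?case by simp
next
  case (Suc i)
  have "fps_part (f ^ Suc i) N x \<le> fps_part f N x * fps_part (f ^ i) N x"
    using fps_part_mult_le[OF assms(1) nonneg_fps_power[OF assms(1)] assms(2)] by simp
  also have "\<dots> \<le> fps_part f N x * fps_part f N x ^ i"
    by (intro mult_left_mono Suc fps_part_nonneg assms)
  finally show ?case by simp
qed

lemma fps_part_X_mult: "fps_part (fps_X * f) (Suc N) x = x * fps_part f N x"
proof -
  have "fps_part (fps_X * f) (Suc N) x = (\<Sum>n\<le>N. f $ n * x ^ Suc n)"
    unfolding fps_part_def by (subst sum.atMost_Suc_shift) simp
  thus ?thesis by (simp add: fps_part_def sum_distrib_left mult_ac)
qed

lemma fps_sums_bounded:
  assumes "nonneg_fps f" "0 \<le> x" "\<And>N. fps_part f N x \<le> y"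
  shows "\<exists>z\<le>y. fps_sums f x z"
proof -
  have "summable (\<lambda>n. f $ n * x ^ n)"
  proof (rule bounded_imp_summable)
    show "0 \<le> f $ n * x ^ n" for n using assms by simp
    show "(\<Sum>k\<le>n. f $ k * x ^ k) \<le> y" for n using assms(3)[of n] by (simp add: fps_part_def)
  qed
  then obtain z where z: "fps_sums f x z" by (auto simp: fps_sums_def summable_def)
  have "z \<le> y"
    by (rule LIMSEQ_le_const2[OF z[unfolded fps_sums_def sums_def']])
      (use assms(3) in \<open>auto simp: fps_part_def atMost_atLeast0\<close>)
  thus ?thesis using z by blast
qed

text \<open>\<open>y\<close> is a supersolution of the tree equation, as
  \<open>x \<phi>(y) \<le> y\<close>; by induction on the degree all truncations of \<open>T\<close>
  stay below \<open>y\<close>.\<close>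

lemma fps_tree_sums:
  assumes \<phi>: "nonneg_fps \<phi>" and T: "nonneg_fps T" "T $ 0 = 0" "T = fps_X * (\<phi> oo T)"
    and x: "0 \<le> x" and y: "0 \<le> y" "fps_sums \<phi> y z" "x * z \<le> y"
  shows "\<exists>t\<ge>0. t \<le> y \<and> fps_sums T x t"
proof -
  have "fps_part T N x \<le> y" for N
  proof (induction N)
    case 0
    thus ?case using T y by (simp add: fps_part_def)
  next
    case (Suc N)
    have part: "fps_part (\<phi> oo T) N x = (\<Sum>i\<le>N. \<phi> $ i * fps_part (T ^ i) N x)"
    proof -
      have "fps_part (\<phi> oo T) N x = (\<Sum>n\<le>N. \<Sum>i\<le>N. \<phi> $ i * (T ^ i $ n * x ^ n))"
        unfolding fps_part_def
      proof (rule sum.cong[OF refl])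
        fix n assume "n \<in> {..N}"
        hence "(\<phi> oo T) $ n = (\<Sum>i\<le>N. \<phi> $ i * T ^ i $ n)"
          unfolding fps_compose_nth
          by (intro sum.mono_neutral_left) (use startsby_zero_power_prefix[OF T(2)] in auto)
        thus "(\<phi> oo T) $ n * x ^ n = (\<Sum>i\<le>N. \<phi> $ i * (T ^ i $ n * x ^ n))"
          by (simp add: sum_distrib_right mult.assoc)
      qed
      also have "\<dots> = (\<Sum>i\<le>N. \<phi> $ i * fps_part (T ^ i) N x)"
        unfolding fps_part_def sum_distrib_left by (rule sum.swap)
      finally show ?thesis .
    qed
    also have "\<dots> \<le> (\<Sum>i\<le>N. \<phi> $ i * y ^ i)"
    proof (intro sum_mono mult_left_mono)
      fix i
      have "fps_part (T ^ i) N x \<le> fps_part T N x ^ i" by (rule fps_part_power_le[OF T(1) x])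
      also have "\<dots> \<le> y ^ i" by (intro power_mono Suc fps_part_nonneg T x)
      finally show "fps_part (T ^ i) N x \<le> y ^ i" .
    qed (use \<phi> in simp)
    also have "\<dots> \<le> z"
    proof -
      have "(\<Sum>i<Suc N. \<phi> $ i * y ^ i) \<le> z"
        by (rule sum_le_suminf[THEN order_trans])
          (use \<phi> y in \<open>auto simp: fps_sums_def sums_iff\<close>)
      thus ?thesis by (simp add: lessThan_Suc_atMost)
    qed
    finally have "x * fps_part (\<phi> oo T) N x \<le> x * z" using x by (rule mult_left_mono)
    moreover have "fps_part T (Suc N) x = x * fps_part (\<phi> oo T) N x"
      by (subst T(3)) (rule fps_part_X_mult)
    ultimately show ?case using y by simp
  qed
  from fps_sums_bounded[OF T(1) x this] obtain t where t: "t \<le> y" "fps_sums T x t" by blast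
  have "0 \<le> t" by (rule fps_sums_nonneg[OF T(1) x t(2)])
  thus ?thesis using t by blast
qed

section \<open>Fourier integrals\<close>

text \<open>\<open>1/12 = 1/2 - 10/24\<close>: the Taylor bound
  \<open>cos t \<le> 1 - t^2/2 + t^4/24\<close> is combined with \<open>t^2 \<le> 10\<close> on the
  interval.\<close>

lemma one_minus_cos_ge:
  fixes t :: real
  assumes "\<bar>t\<bar> \<le> pi"
  shows "t\<^sup>2 / 12 \<le> 1 - cos t"
proof -
  obtain s where s: "cos t = (\<Sum>m<4. cos_coeff m * t ^ m) + (cos (s + 1/2 * real 4 * pi) / fact 4) * t ^ 4"
    using Maclaurin_cos_expansion[of t 4] by blast
  have "(\<Sum>m<4. cos_coeff m * t ^ m) = 1 - t\<^sup>2 / 2"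
  proof -
    have "(\<Sum>m<4. g m) = g 0 + g 1 + g 2 + g 3" for g :: "nat \<Rightarrow> real" by (simp add: eval_nat_numeral)
    thus ?thesis by (simp add: cos_coeff_def)
  qed
  moreover have "cos (s + 1/2 * real 4 * pi) / fact 4 * t ^ 4 \<le> 1 / 24 * t ^ 4"
    by (intro mult_right_mono) (simp_all add: fact_numeral)
  ultimately have c: "cos t \<le> 1 - t\<^sup>2 / 2 + t ^ 4 / 24" using s by simp
  have "\<bar>t\<bar> \<le> 3.15" using assms pi_approx(2) by simp
  hence "\<bar>t\<bar> \<le> \<bar>3.15 :: real\<bar>" by simp
  hence "t\<^sup>2 \<le> 3.15\<^sup>2" by (simp only: abs_le_square_iff)
  hence "t\<^sup>2 \<le> 10" by (simp add: power2_eq_square)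
  hence "t\<^sup>2 * t\<^sup>2 \<le> 10 * t\<^sup>2" by (intro mult_right_mono) auto
  hence "t ^ 4 \<le> 10 * t\<^sup>2" by (simp add: power4_eq_xxxx power2_eq_square)
  thus ?thesis using c by linarith
qed

lemma integrable_gauss: "c > 0 \<Longrightarrow> integrable lborel (\<lambda>s::real. exp (- c * s\<^sup>2))"
  and integral_gauss: "c > 0 \<Longrightarrow> (\<integral>s. exp (- c * (s::real)\<^sup>2) \<partial>lborel) = sqrt (pi / c)"
proof -
  assume c: "c > 0"
  define \<sigma> where "\<sigma> = sqrt (1 / (2 * c))"
  have \<sigma>: "\<sigma>\<^sup>2 = 1 / (2 * c)" and \<sigma>0: "\<sigma> > 0" using c by (simp_all add: \<sigma>_def)
  have eq: "exp (- c * s\<^sup>2) = sqrt (pi / c) * normal_density 0 \<sigma> s" for s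
    using c by (simp add: normal_density_def \<sigma> real_sqrt_divide real_sqrt_mult field_simps)
  show "integrable lborel (\<lambda>s::real. exp (- c * s\<^sup>2))" unfolding eq using \<sigma>0 by simp
  show "(\<integral>s. exp (- c * (s::real)\<^sup>2) \<partial>lborel) = sqrt (pi / c)"
    unfolding eq using \<sigma>0 by simp
qed

lemma integral_cis:
  fixes l :: int
  shows "(\<integral>t. indicator {-pi..pi} t *\<^sub>R cis (of_int l * t) \<partial>lborel) = (if l = 0 then of_real (2 * pi) else 0)"
proof (cases "l = 0")
  case True
  have "(\<integral>t. indicator {-pi..pi} t *\<^sub>R (1::complex) \<partial>lborel) = measure lborel {-pi..pi} *\<^sub>R 1"
    by (simp add: integral_indicator)
  thus ?thesis using True by (simp add: scaleR_conv_of_real)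
next
  case False
  define F where "F t = cis (of_int l * t) / (\<i> * of_int l)" for t
  have d: "(F has_vector_derivative cis (of_int l * t)) (at t within S)" for t S
  proof -
    have "((\<lambda>t. exp (\<i> * of_int l * of_real t) / (\<i> * of_int l)) has_vector_derivative
        exp (\<i> * of_int l * of_real t)) (at t within S)"
      using False by (auto intro!: derivative_eq_intros has_vector_derivative_real_field)
    moreover have "exp (\<i> * of_int l * of_real t) = cis (of_int l * t)" for t
      by (simp add: cis_conv_exp mult.assoc)
    ultimately show ?thesis by (simp add: F_def[abs_def])
  qed
  have "(\<integral>t. indicator {-pi..pi} t *\<^sub>R cis (of_int l * t) \<partial>lborel) = F pi - F (-pi)"
    by (rule integral_FTC_Icc) (auto intro!: d continuous_intros)
  moreover have "cis (of_int l * pi) = cis (of_int l * -pi)"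
  proof -
    have "cis (of_int l * -pi) * cis (2 * pi * of_int l) = cis (of_int l * pi)"
      by (simp add: cis_mult algebra_simps del: cis_multiple_2pi)
    moreover have "cis (2 * pi * of_int l) = 1" by (rule cis_multiple_2pi) simp
    ultimately show ?thesis by simp
  qed
  ultimately show ?thesis using False by (simp add: F_def)
qed

text \<open>Interchange of sum and integral by absolute summability. The bounded factor
  \<open>h\<close> is a character when a coefficient is extracted, and contains a second exponential
  in \<open>bessel_integral\<close>.\<close>

lemma fourier_sums:
  fixes a :: "nat \<Rightarrow> complex" and h :: "real \<Rightarrow> complex"
  assumes a: "summable (\<lambda>m. norm (a m))" and h: "continuous_on UNIV h" "\<And>t. norm (h t) \<le> B"
    and f: "\<And>t. (\<lambda>m. a m * cis (real m * t)) sums f t"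
  shows "(\<lambda>m. a m * (\<integral>t. indicator {-pi..pi} t *\<^sub>R (cis (real m * t) * h t) \<partial>lborel)) sums
     (\<integral>t. indicator {-pi..pi} t *\<^sub>R (f t * h t) \<partial>lborel)"
proof -
  let ?f = "\<lambda>m t. indicator {-pi..pi} t *\<^sub>R (a m * (cis (real m * t) * h t))"
  have B: "0 \<le> B" by (rule order_trans[OF norm_ge_zero h(2)[of 0]])
  have int: "integrable lborel (?f m)" for m
  proof (rule borel_integrable_compact)
    have "continuous_on {-pi..pi} h" using h(1) by (rule continuous_on_subset) simp
    moreover have "continuous_on {-pi..pi} (\<lambda>t. cis (real m * t))" by (intro continuous_intros)
    ultimately show "continuous_on {-pi..pi} (\<lambda>t. a m * (cis (real m * t) * h t))"
      by (intro continuous_on_mult continuous_on_const)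
  qed simp
  have nb: "norm (?f m t) \<le> indicator {-pi..pi} t * (norm (a m) * B)" for m t
    using h(2)[of t] by (auto simp: indicator_def norm_mult intro!: mult_left_mono)
  have sm: "summable (\<lambda>m. norm (a m) * B)" using a by (rule summable_mult2)
  have int_bd: "integrable lborel (\<lambda>t::real. indicator {-pi..pi} t * (norm (a m) * B))" for m
    by (intro integrable_mult_left) simp
  have "(\<lambda>m. integral\<^sup>L lborel (?f m)) sums (\<integral>t. (\<Sum>m. ?f m t) \<partial>lborel)"
  proof (rule sums_integral)
    show "integrable lborel (?f m)" for m by (rule int)
    show "AE t in lborel. summable (\<lambda>m. norm (?f m t))"
    proof (rule AE_I2)
      fix t
      show "summable (\<lambda>m. norm (?f m t))"
      proof (rule summable_comparison_test')
        show "summable (\<lambda>m. norm (a m) * B)" by (rule sm)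
        show "norm (norm (?f m t)) \<le> norm (a m) * B" for m
          using nb[where m=m and t=t] B by (auto simp: indicator_def split: if_splits)
      qed
    qed
    show "summable (\<lambda>m. \<integral>t. norm (?f m t) \<partial>lborel)"
    proof (rule summable_comparison_test')
      show "summable (\<lambda>m. (norm (a m) * B) * (2 * pi))" using sm by (rule summable_mult2)
      fix m
      have "(\<integral>t. norm (?f m t) \<partial>lborel) \<le> (\<integral>t. indicator {-pi..pi} (t::real) * (norm (a m) * B) \<partial>lborel)"
        by (rule integral_mono[OF integrable_norm[OF int[of m]] int_bd]) (rule nb)
      also have "\<dots> = (norm (a m) * B) * (2 * pi)" by simp
      finally show "norm (\<integral>t. norm (?f m t) \<partial>lborel) \<le> (norm (a m) * B) * (2 * pi)"
        by (simp add: integral_nonneg_AE)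
    qed
  qed
  moreover have "(\<integral>t. (\<Sum>m. ?f m t) \<partial>lborel) = (\<integral>t. indicator {-pi..pi} t *\<^sub>R (f t * h t) \<partial>lborel)"
  proof (rule Bochner_Integration.integral_cong[OF refl])
    fix t
    have "(\<lambda>m. a m * cis (real m * t) * h t) sums (f t * h t)" by (intro sums_mult2 f)
    hence "(\<lambda>m. ?f m t) sums (indicator {-pi..pi} t *\<^sub>R (f t * h t))"
      by (intro sums_scaleR_right) (simp add: mult.assoc)
    thus "(\<Sum>m. ?f m t) = indicator {-pi..pi} t *\<^sub>R (f t * h t)" by (rule sums_unique[symmetric])
  qed
  moreover have "integral\<^sup>L lborel (?f m) = a m * (\<integral>t. indicator {-pi..pi} t *\<^sub>R (cis (real m * t) * h t) \<partial>lborel)" for m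
  proof -
    have "?f m t = a m * (indicator {-pi..pi} t *\<^sub>R (cis (real m * t) * h t))" for t by simp
    thus ?thesis by (simp only: integral_mult_right_zero)
  qed
  ultimately show ?thesis by simp
qed

lemma fourier_coefficient:
  fixes a :: "nat \<Rightarrow> complex"
  assumes a: "summable (\<lambda>m. norm (a m))" and f: "\<And>t. (\<lambda>m. a m * cis (real m * t)) sums f t"
  shows "(\<integral>t. indicator {-pi..pi} t *\<^sub>R (f t * cis (- (real l * t))) \<partial>lborel) = of_real (2 * pi) * a l"
proof -
  have "(\<integral>t. indicator {-pi..pi} t *\<^sub>R (cis (real m * t) * cis (- (real l * t))) \<partial>lborel) =
      (if m = l then of_real (2 * pi) else 0)" for m
  proof -
    have "cis (real m * t) * cis (- (real l * t)) = cis (of_int (int m - int l) * t)" for t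
      by (simp add: cis_mult algebra_simps)
    thus ?thesis using integral_cis[of "int m - int l"] by simp
  qed
  hence "(\<lambda>m. a m * (if m = l then of_real (2 * pi) else 0)) sums
     (\<integral>t. indicator {-pi..pi} t *\<^sub>R (f t * cis (- (real l * t))) \<partial>lborel)"
    using fourier_sums[OF a, of "\<lambda>t. cis (- (real l * t))" 1 f] f by (simp add: continuous_intros)
  moreover have "(\<lambda>m. a m * (if m = l then of_real (2 * pi) else 0)) sums (a l * of_real (2 * pi))"
    using sums_single[of l "\<lambda>m. a m * of_real (2 * pi)"] by (simp add: if_distrib cong: if_cong)
  ultimately show ?thesis by (simp add: sums_unique2 mult.commute)
qed

lemma integral_rescale:
  fixes f :: "real \<Rightarrow> complex"
  assumes "c > 0"
  shows "of_real c * (\<integral>t. f t \<partial>lborel) = (\<integral>s. f (s / c) \<partial>lborel)"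
proof -
  have "(\<integral>t. f t \<partial>lborel) = \<bar>1 / c\<bar> *\<^sub>R (\<integral>s. f (0 + 1 / c * s) \<partial>lborel)"
    by (rule lborel_integral_real_affine) (use assms in simp)
  thus ?thesis using assms by (simp add: scaleR_conv_of_real)
qed

section \<open>Asymptotics of a Bessel series\<close>

text \<open>This is \<open>I\<^sub>1(2 sqrt x) / sqrt x\<close>, which has Hankel's asymptotic expansion.\<close>

definition bessel_sum :: "real \<Rightarrow> real" where
  "bessel_sum x = (\<Sum>j. x ^ j / (fact j * fact (Suc j)))"

lemma bessel_sum_sums: "(\<lambda>j. x ^ j / (fact j * fact (Suc j))) sums bessel_sum x"
proof -
  have "summable (\<lambda>j. norm (x ^ j / fact j))"
    using summable_norm_exp[of x] by (simp add: divide_inverse_commute)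
  hence "summable (\<lambda>j. x ^ j / (fact j * fact (Suc j)))"
  proof (rule summable_comparison_test'[of _ 0])
    fix j
    have "1 \<le> (fact (Suc j) :: real)" by (rule fact_ge_1)
    hence "norm (x ^ j) / (fact j * fact (Suc j)) \<le> norm (x ^ j) / (fact j * 1)"
      by (intro divide_left_mono mult_left_mono) auto
    thus "norm (x ^ j / (fact j * fact (Suc j))) \<le> norm (x ^ j / fact j)" by (simp add: norm_divide)
  qed
  thus ?thesis by (simp add: bessel_sum_def summable_sums)
qed

lemma exp_cis_sums:
  fixes r :: real
  shows "(\<lambda>m. complex_of_real (r ^ m / fact m) * cis (real m * t)) sums exp (of_real r * cis t)"
proof -
  have "(\<lambda>m. (of_real r * cis t) ^ m /\<^sub>R fact m) sums exp (of_real r * cis t)" by (rule exp_converges)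
  moreover have "(of_real r * cis t) ^ m /\<^sub>R fact m = complex_of_real (r ^ m / fact m) * cis (real m * t)" for m
  proof -
    have "(of_real r * cis t) ^ m = of_real (r ^ m) * cis (real m * t)"
      by (simp only: power_mult_distrib Complex.DeMoivre of_real_power)
    thus ?thesis by (simp only: scaleR_conv_of_real of_real_divide of_real_inverse divide_inverse mult_ac of_real_mult)
  qed
  ultimately show ?thesis by simp
qed

lemma summable_exp_norm: "summable (\<lambda>m. norm (complex_of_real (r ^ m / fact m)))"
  unfolding norm_of_real using summable_norm_exp[of "r :: real"] by (simp add: divide_inverse_commute)

text \<open>\<open>2 sqrt x cos t\<close> is \<open>sqrt x\<close> times the sum of
  \<open>cis t\<close> and \<open>cis (- t)\<close>. One exponential is expanded, and the other
  contributes its Fourier coefficient of index one higher.\<close>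

lemma bessel_integral:
  assumes "x > 0"
  shows "(\<integral>t. indicator {-pi..pi} t *\<^sub>R (of_real (exp (2 * sqrt x * cos t)) * cis t) \<partial>lborel)
     = of_real (2 * pi * sqrt x * bessel_sum x)"
proof -
  let ?r = "sqrt x"
  let ?E = "\<lambda>t. exp (of_real ?r * cis t)"
  have c: "continuous_on UNIV (\<lambda>t. ?E (- t) * cis t)" by (intro continuous_intros)
  have b: "norm (?E (- t) * cis t) \<le> exp ?r" for t
  proof -
    have "?r * cos t \<le> ?r * 1" using assms by (intro mult_left_mono) auto
    thus ?thesis by (simp add: norm_mult norm_exp_eq_Re)
  qed
  have inner: "(\<integral>t. indicator {-pi..pi} t *\<^sub>R (cis (real m * t) * (?E (- t) * cis t)) \<partial>lborel)
      = of_real (2 * pi) * of_real (?r ^ Suc m / fact (Suc m))" for m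
  proof -
    have "(\<integral>t. indicator {-pi..pi} t *\<^sub>R (cis (real m * t) * (?E (- t) * cis t)) \<partial>lborel)
       = (\<integral>t. indicator {-pi..pi} (- t) *\<^sub>R (cis (real m * (- t)) * (?E t * cis (- t))) \<partial>lborel)"
      using lborel_integral_real_affine[of "-1" "\<lambda>t. indicator {-pi..pi} t *\<^sub>R (cis (real m * t) * (?E (- t) * cis t))" 0]
      by simp
    also have "\<dots> = (\<integral>t. indicator {-pi..pi} t *\<^sub>R (?E t * cis (- (real (Suc m) * t))) \<partial>lborel)"
    proof (rule Bochner_Integration.integral_cong[OF refl])
      fix t
      have "indicator {-pi..pi} (- t) = (indicator {-pi..pi} t :: real)" by (auto simp: indicator_def)
      moreover have "cis (real m * (- t)) * cis (- t) = cis (- (real (Suc m) * t))"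
        by (simp add: cis_mult algebra_simps)
      ultimately show "indicator {-pi..pi} (- t) *\<^sub>R (cis (real m * (- t)) * (?E t * cis (- t))) =
          indicator {-pi..pi} t *\<^sub>R (?E t * cis (- (real (Suc m) * t)))"
        by (metis mult.assoc mult.left_commute)
    qed
    also have "\<dots> = of_real (2 * pi) * of_real (?r ^ Suc m / fact (Suc m))"
      by (rule fourier_coefficient[OF summable_exp_norm exp_cis_sums])
    finally show ?thesis .
  qed
  have "(\<lambda>m. of_real (?r ^ m / fact m) * (\<integral>t. indicator {-pi..pi} t *\<^sub>R (cis (real m * t) * (?E (- t) * cis t)) \<partial>lborel)) sums
     (\<integral>t. indicator {-pi..pi} t *\<^sub>R (?E t * (?E (- t) * cis t)) \<partial>lborel)"
    by (rule fourier_sums[OF summable_exp_norm c b exp_cis_sums])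
  hence 1: "(\<lambda>m. of_real (?r ^ m / fact m) * (of_real (2 * pi) * of_real (?r ^ Suc m / fact (Suc m)))) sums
     (\<integral>t. indicator {-pi..pi} t *\<^sub>R (?E t * (?E (- t) * cis t)) \<partial>lborel)"
    by (simp only: inner)
  have summand: "(of_real (?r ^ m / fact m) * (of_real (2 * pi) * of_real (?r ^ Suc m / fact (Suc m))) :: complex)
     = of_real (2 * pi * ?r * (x ^ m / (fact m * fact (Suc m))))" for m
  proof -
    have "?r ^ m * ?r ^ m = x ^ m" using assms by (simp add: power_mult_distrib[symmetric])
    thus ?thesis unfolding of_real_mult[symmetric] by (intro arg_cong[of _ _ of_real]) (simp add: field_simps)
  qed
  have "(\<lambda>m. complex_of_real (2 * pi * ?r * (x ^ m / (fact m * fact (Suc m))))) sums of_real (2 * pi * ?r * bessel_sum x)"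
    by (intro sums_of_real sums_mult bessel_sum_sums)
  hence "(\<integral>t. indicator {-pi..pi} t *\<^sub>R (?E t * (?E (- t) * cis t)) \<partial>lborel) = of_real (2 * pi * ?r * bessel_sum x)"
    using 1 unfolding summand by (rule sums_unique2[symmetric])
  moreover have "?E t * (?E (- t) * cis t) = of_real (exp (2 * sqrt x * cos t)) * cis t" for t
  proof -
    have "of_real ?r * cis t + of_real ?r * cis (- t) = of_real (2 * ?r * cos t)"
      by (simp add: complex_eq_iff)
    hence "?E t * ?E (- t) = of_real (exp (2 * sqrt x * cos t))"
      by (simp only: exp_add[symmetric] exp_of_real)
    thus ?thesis by (simp add: mult.assoc[symmetric])
  qed
  ultimately show ?thesis by simp
qed

text \<open>Laplace's method: with \<open>y = 2 sqrt x\<close> and \<open>t = u / sqrt y\<close> the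
  integrand tends to \<open>exp (- u^2 / 2)\<close> and is dominated by
  \<open>exp (- u^2 / 12)\<close>.\<close>

lemma bessel_sum_asymp:
  fixes x :: "nat \<Rightarrow> real"
  assumes x: "filterlim x at_top sequentially"
  shows "(\<lambda>k. bessel_sum (x k) * (x k) powr (3/4) * exp (- 2 * sqrt (x k))) \<longlonglongrightarrow> 1 / (2 * sqrt pi)"
proof -
  define y where "y k = 2 * sqrt (x k)" for k
  have y: "filterlim y at_top sequentially"
    unfolding y_def using x by (intro filterlim_tendsto_pos_mult_at_top[OF tendsto_const] filterlim_compose[OF sqrt_at_top]) auto
  define s where "s k u = indicator {-pi..pi} (u / sqrt (y k)) *\<^sub>R (of_real (exp (- y k * (1 - cos (u / sqrt (y k))))) * cis (u / sqrt (y k)))" for k u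
  \<comment> \<open>Set to 0 for \<open>y k \<le> 0\<close>, so that the domination holds for every
    \<open>k\<close> and not just eventually.\<close>
  define s' where "s' k = (if y k > 0 then s k else (\<lambda>u. 0))" for k
  have pos: "eventually (\<lambda>k. y k > 0) sequentially" using y by (simp add: filterlim_at_top_dense)
  have lim_s: "(\<lambda>k. s' k u) \<longlonglongrightarrow> of_real (exp (- (1/2) * u\<^sup>2))" for u
  proof -
    have q: "(\<lambda>k. u / sqrt (y k)) \<longlonglongrightarrow> 0"
      using y by (intro real_tendsto_divide_at_top[OF tendsto_const] filterlim_compose[OF sqrt_at_top])
    have e1: "(\<lambda>k. y k * (1 - cos (u / sqrt (y k)))) \<longlonglongrightarrow> u\<^sup>2 / 2"
    proof -
      have "((\<lambda>y. y * (1 - cos (u / sqrt y))) \<longlongrightarrow> u * u / 2) at_top"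
        by real_asymp
      hence "((\<lambda>y. y * (1 - cos (u / sqrt y))) \<longlongrightarrow> u\<^sup>2 / 2) at_top" by (simp add: power2_eq_square)
      thus ?thesis by (rule filterlim_compose[OF _ y])
    qed
    have "(\<lambda>k. of_real (exp (- (y k * (1 - cos (u / sqrt (y k)))))) * cis (u / sqrt (y k))) \<longlonglongrightarrow> of_real (exp (- (u\<^sup>2 / 2))) * cis 0"
      by (intro tendsto_intros e1 q)
    moreover have "eventually (\<lambda>k. \<bar>u / sqrt (y k)\<bar> < pi) sequentially"
      using tendsto_rabs[OF q] by (rule order_tendstoD) simp
    hence "eventually (\<lambda>k. of_real (exp (- (y k * (1 - cos (u / sqrt (y k)))))) * cis (u / sqrt (y k)) = s' k u) sequentially"
      using pos
    proof eventually_elim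
      case (elim k)
      have "u / sqrt (y k) \<in> {-pi..pi}"
        using elim(1) unfolding abs_less_iff atLeastAtMost_iff by linarith
      thus ?case using elim(2) by (simp add: s_def s'_def)
    qed
    ultimately show ?thesis by (auto intro: Lim_transform_eventually)
  qed
  have bound: "norm (s' k u) \<le> exp (- (1/12) * u\<^sup>2)" for k u
  proof (cases "y k > 0 \<and> u / sqrt (y k) \<in> {-pi..pi}")
    case True
    hence "(u / sqrt (y k))\<^sup>2 / 12 \<le> 1 - cos (u / sqrt (y k))" by (intro one_minus_cos_ge) auto
    hence "y k * ((u / sqrt (y k))\<^sup>2 / 12) \<le> y k * (1 - cos (u / sqrt (y k)))" using True by (intro mult_left_mono) auto
    moreover have "y k * ((u / sqrt (y k))\<^sup>2 / 12) = u\<^sup>2 / 12" using True by (simp add: power_divide)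
    ultimately have "u\<^sup>2 / 12 \<le> y k * (1 - cos (u / sqrt (y k)))" by linarith
    hence "exp (- (y k * (1 - cos (u / sqrt (y k))))) \<le> exp (- (1/12) * u\<^sup>2)" by simp
    moreover have "norm (s' k u) = exp (- (y k * (1 - cos (u / sqrt (y k)))))"
      using True by (simp only: s_def s'_def if_True indicator_simps scaleR_one norm_mult norm_of_real norm_cis
          mult_1_right abs_exp_cancel mult_minus_left)
    ultimately show ?thesis by simp
  qed (auto simp: s_def s'_def)
  have meas: "s' k \<in> borel_measurable lborel" for k
  proof -
    have "(\<lambda>u. indicat_real {-pi..pi} (u / sqrt (y k))) \<in> borel_measurable lborel" by measurable
    moreover have "(\<lambda>u. complex_of_real (exp (- y k * (1 - cos (u / sqrt (y k))))) * cis (u / sqrt (y k))) \<in> borel_measurable borel"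
      unfolding divide_inverse by (intro borel_measurable_continuous_onI continuous_intros)
    hence "(\<lambda>u. complex_of_real (exp (- y k * (1 - cos (u / sqrt (y k))))) * cis (u / sqrt (y k))) \<in> borel_measurable lborel" by simp
    ultimately show ?thesis unfolding s'_def s_def by (cases "y k > 0") (simp_all only: if_True if_False borel_measurable_scaleR borel_measurable_const)
  qed
  have "(\<lambda>k. integral\<^sup>L lborel (s' k)) \<longlonglongrightarrow> (\<integral>u. of_real (exp (- (1/2) * u\<^sup>2)) \<partial>lborel)"
    by (rule integral_dominated_convergence[where w = "\<lambda>u. exp (- (1/12) * u\<^sup>2)"])
       (use lim_s bound meas integrable_gauss[of "1/12"] in auto)
  hence lim: "(\<lambda>k. integral\<^sup>L lborel (s' k)) \<longlonglongrightarrow> of_real (sqrt (2 * pi))"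
    using integral_gauss[of "1/2"] by (simp add: integral_complex_of_real mult.commute)
  have val: "integral\<^sup>L lborel (s' k) = of_real (4 * pi * sqrt 2 / 2 * (bessel_sum (x k) * (x k) powr (3/4) * exp (- 2 * sqrt (x k))))"
    if "y k > 0" for k
  proof -
    have xk: "x k > 0" using that by (simp add: y_def)
    let ?f = "\<lambda>t. indicator {-pi..pi} t *\<^sub>R (of_real (exp (- y k * (1 - cos t))) * cis t)"
    have "integral\<^sup>L lborel (s' k) = (\<integral>u. ?f (u / sqrt (y k)) \<partial>lborel)" using that by (simp add: s_def[abs_def] s'_def)
    also have "\<dots> = of_real (sqrt (y k)) * (\<integral>t. ?f t \<partial>lborel)" using that by (intro integral_rescale[symmetric]) simp
    also have "(\<integral>t. ?f t \<partial>lborel) = (\<integral>t. of_real (exp (- y k)) * (indicator {-pi..pi} t *\<^sub>R (of_real (exp (2 * sqrt (x k) * cos t)) * cis t)) \<partial>lborel)"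
      by (intro Bochner_Integration.integral_cong refl) (simp add: y_def exp_diff exp_minus field_simps exp_add[symmetric])
    also have "\<dots> = of_real (exp (- y k)) * of_real (2 * pi * sqrt (x k) * bessel_sum (x k))"
      by (simp only: integral_mult_right_zero bessel_integral[OF xk])
    also have "of_real (sqrt (y k)) * (of_real (exp (- y k)) * of_real (2 * pi * sqrt (x k) * bessel_sum (x k))) =
        complex_of_real (sqrt (y k) * exp (- y k) * (2 * pi * sqrt (x k) * bessel_sum (x k)))" by simp
    \<comment> \<open>The power \<open>1/4\<close> from the substitution and the factor
      \<open>sqrt x\<close> of the integral formula make up the exponent \<open>3/4\<close>.\<close>
    also have "sqrt (y k) = sqrt 2 * (x k) powr (1/4)"
      using xk by (simp add: y_def real_sqrt_mult powr_half_sqrt[symmetric] powr_powr)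
    also have "sqrt 2 * (x k) powr (1/4) * exp (- y k) * (2 * pi * sqrt (x k) * bessel_sum (x k)) =
      2 * pi * sqrt 2 * (bessel_sum (x k) * ((x k) powr (1/4) * (x k) powr (1/2)) * exp (- y k))"
      using xk by (simp add: powr_half_sqrt)
    also have "(x k) powr (1/4) * (x k) powr (1/2) = (x k) powr (3/4)" by (simp add: powr_add[symmetric])
    finally show ?thesis by (simp add: y_def)
  qed
  let ?b = "\<lambda>k. bessel_sum (x k) * (x k) powr (3/4) * exp (- 2 * sqrt (x k))"
  have "(\<lambda>k. complex_of_real (4 * pi * sqrt 2 / 2 * ?b k)) \<longlonglongrightarrow> of_real (sqrt (2 * pi))"
    using pos by (intro Lim_transform_eventually[OF lim]) (auto elim!: eventually_mono simp: val)
  hence "(\<lambda>k. 4 * pi * sqrt 2 / 2 * ?b k) \<longlonglongrightarrow> sqrt (2 * pi)" unfolding tendsto_of_real_iff .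
  hence "(\<lambda>k. (4 * pi * sqrt 2 / 2 * ?b k) / (4 * pi * sqrt 2 / 2)) \<longlonglongrightarrow> sqrt (2 * pi) / (4 * pi * sqrt 2 / 2)"
    by (intro tendsto_divide tendsto_const) auto
  moreover have "sqrt (2 * pi) / (4 * pi * sqrt 2 / 2) = 1 / (2 * sqrt pi)"
    by (simp add: real_sqrt_mult field_simps)
  ultimately show ?thesis by simp
qed

section \<open>A local limit theorem\<close>

text \<open>Mass at the neighbouring points 0 and 1 makes the law aperiodic; mean 1 centres it, and
  the third moment controls the Taylor error.\<close>

locale critical_offspring =
  fixes p :: "nat \<Rightarrow> real"
  assumes nonneg: "\<And>k. 0 \<le> p k" and total: "p sums 1" and mean: "(\<lambda>k. real k * p k) sums 1"
    and third: "summable (\<lambda>k. real k ^ 3 * p k)" and p0: "0 < p 0" and p1: "0 < p 1"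
begin

definition "g = Abs_fps p"
text \<open>The characteristic function of the centred law.\<close>

definition "G t = (\<Sum>k. of_real (p k) * cis ((real k - 1) * t))"
definition "\<sigma>2 = (\<Sum>k. p k * (real k - 1)\<^sup>2)"
text \<open>The decay rate obtained from the atoms at 0 and 1.\<close>

definition "b = p 0 * p 1 / (p 0 + p 1)"

lemma g_nonneg: "nonneg_fps g"
  by (simp add: g_def nonneg_fps_def nonneg)

lemma g_power_sums: "(\<lambda>m. (g ^ n) $ m) sums 1"
proof -
  have "fps_sums g 1 1" using total by (simp add: fps_sums_def g_def)
  thus ?thesis using fps_sums_power[OF g_nonneg, of 1 1 n] by (simp add: fps_sums_def)
qed

lemma g_power_nonneg: "0 \<le> (g ^ n) $ m"
  using nonneg_fps_power[OF g_nonneg] by simp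

lemma summable_moment: "summable (\<lambda>k. p k * \<bar>real k - 1\<bar> ^ 3)"
proof (rule summable_comparison_test'[of _ 0])
  show "summable (\<lambda>k. p k + real k ^ 3 * p k)"
    using total third by (intro summable_add) (auto simp: sums_iff)
  fix k
  have "\<bar>real k - 1\<bar> ^ 3 \<le> 1 + real k ^ 3"
  proof (cases "k = 0")
    case False
    have "\<bar>real k - 1\<bar> ^ 3 \<le> real k ^ 3" by (rule power_mono) (use False in auto)
    thus ?thesis by linarith
  qed simp
  hence "p k * \<bar>real k - 1\<bar> ^ 3 \<le> p k * (1 + real k ^ 3)" by (rule mult_left_mono[OF _ nonneg])
  thus "norm (p k * \<bar>real k - 1\<bar> ^ 3) \<le> p k + real k ^ 3 * p k" using nonneg[of k] by (simp add: algebra_simps abs_mult)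
qed

lemma sigma_sums: "(\<lambda>k. p k * (real k - 1)\<^sup>2) sums \<sigma>2"
proof -
  have "summable (\<lambda>k. p k * (real k - 1)\<^sup>2)"
  proof (rule summable_comparison_test'[of _ 0])
    show "summable (\<lambda>k. p k + p k * \<bar>real k - 1\<bar> ^ 3)"
      using total summable_moment by (intro summable_add) (auto simp: sums_iff)
    fix k
    have "(real k - 1)\<^sup>2 \<le> 1 + \<bar>real k - 1\<bar> ^ 3"
    proof (cases "k \<le> 1")
      case True
      hence "k = 0 \<or> k = 1" by auto
      thus ?thesis by auto
    next
      case False
      hence "(real k - 1) ^ 2 \<le> (real k - 1) ^ 3" by (intro power_increasing) auto
      thus ?thesis using False by simp
    qed
    hence "p k * (real k - 1)\<^sup>2 \<le> p k * (1 + \<bar>real k - 1\<bar> ^ 3)" by (rule mult_left_mono[OF _ nonneg])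
    thus "norm (p k * (real k - 1)\<^sup>2) \<le> p k + p k * \<bar>real k - 1\<bar> ^ 3" using nonneg[of k] by (simp add: algebra_simps abs_mult)
  qed
  thus ?thesis unfolding \<sigma>2_def by (rule summable_sums)
qed

lemma sigma_pos: "0 < \<sigma>2"
proof -
  have "p 0 * (real 0 - 1)\<^sup>2 \<le> \<sigma>2"
    using sum_le_suminf[of "\<lambda>k. p k * (real k - 1)\<^sup>2" "{0}"] sigma_sums nonneg by (simp add: sums_iff)
  thus ?thesis using p0 by simp
qed

lemma G_sums: "(\<lambda>k. of_real (p k) * cis ((real k - 1) * t)) sums G t"
proof -
  have "summable (\<lambda>k. norm (of_real (p k) * cis ((real k - 1) * t)))"
    using total nonneg by (simp add: norm_mult sums_iff)
  thus ?thesis unfolding G_def by (rule summable_sums[OF summable_norm_cancel])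
qed

lemma G_power_sums: "(\<lambda>m. of_real ((g ^ n) $ m) * cis ((real m - real n) * t)) sums (G t ^ n)"
proof (induction n)
  case 0
  have "(\<lambda>m. of_real ((1 :: real fps) $ m) * cis ((real m - real 0) * t)) sums (\<Sum>m\<in>{0}. of_real ((1 :: real fps) $ m) * cis ((real m - real 0) * t))"
    by (rule sums_finite) auto
  thus ?case by simp
next
  case (Suc n)
  let ?a = "\<lambda>k. of_real (p k) * cis ((real k - 1) * t)"
  let ?c = "\<lambda>m. of_real ((g ^ n) $ m) * cis ((real m - real n) * t)"
  have s: "summable (\<lambda>k. norm (?a k))" "summable (\<lambda>k. norm (?c k))"
    using total nonneg g_power_sums[of n] g_power_nonneg[of n] by (simp_all add: norm_mult sums_iff)
  have "(\<lambda>k. \<Sum>i\<le>k. ?a i * ?c (k - i)) sums ((\<Sum>k. ?a k) * (\<Sum>k. ?c k))"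
    by (rule Cauchy_product_sums[OF s])
  moreover have "(\<Sum>k. ?a k) = G t" "(\<Sum>k. ?c k) = G t ^ n" using G_sums Suc by (simp_all add: sums_iff)
  moreover have "(\<Sum>i\<le>k. ?a i * ?c (k - i)) = of_real ((g ^ Suc n) $ k) * cis ((real k - real (Suc n)) * t)" for k
  proof -
    have "?a i * ?c (k - i) = of_real (p i * (g ^ n) $ (k - i)) * cis ((real k - real (Suc n)) * t)" if "i \<le> k" for i
    proof -
      have "(real i - 1) * t + (real (k - i) - real n) * t = (real k - real (Suc n)) * t"
        using that by (simp add: of_nat_diff algebra_simps)
      hence "cis ((real i - 1) * t) * cis ((real (k - i) - real n) * t) = cis ((real k - real (Suc n)) * t)"
        by (simp only: cis_mult)
      from this[symmetric] show ?thesis by (simp only: of_real_mult mult_ac)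
    qed
    hence "(\<Sum>i\<le>k. ?a i * ?c (k - i)) = (\<Sum>i\<le>k. of_real (p i * (g ^ n) $ (k - i)) * cis ((real k - real (Suc n)) * t))"
      by (intro sum.cong) auto
    also have "\<dots> = of_real ((g ^ Suc n) $ k) * cis ((real k - real (Suc n)) * t)"
      by (simp add: g_def fps_mult_nth sum_distrib_right atMost_atLeast0)
    finally show ?thesis .
  qed
  ultimately show ?case by simp
qed

lemma b_pos: "0 < b"
  using p0 p1 by (simp add: b_def)

lemma norm_G_le_one: "norm (G t) \<le> 1"
proof -
  have "norm (G t) \<le> (\<Sum>k. p k)"
    unfolding G_def by (rule order_trans[OF summable_norm]) (use total nonneg in \<open>simp_all add: norm_mult sums_iff\<close>)
  thus ?thesis using total by (simp add: sums_iff)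
qed

text \<open>All atoms except 0 and 1 are bounded by their mass. With \<open>S = p 0 + p 1\<close>
  and \<open>B = p 0 * p 1 * (1 - cos t)\<close> the contribution of these two has squared modulus
  \<open>S^2 - 2 B \<le> (S - B / S)^2\<close>.\<close>

lemma norm_G_le:
  assumes "\<bar>t\<bar> \<le> pi"
  shows "norm (G t) \<le> exp (- (b / 12) * t\<^sup>2)"
proof -
  let ?a = "\<lambda>k. of_real (p k) * cis ((real k - 1) * t)"
  define S where "S = p 0 + p 1"
  define B where "B = p 0 * p 1 * (1 - cos t)"
  have S: "0 < S" using p0 p1 by (simp add: S_def)
  have B: "0 \<le> B" using p0 p1 by (simp add: B_def)
  have sa: "summable ?a" using G_sums by (simp add: sums_iff)
  have "G t = (\<Sum>k. ?a (k + 2)) + (?a 0 + ?a 1)"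
    unfolding G_def using suminf_split_initial_segment[OF sa, of 2] by (simp add: eval_nat_numeral)
  hence "norm (G t) \<le> norm (\<Sum>k. ?a (k + 2)) + norm (?a 0 + ?a 1)" by (simp only: norm_triangle_ineq)
  moreover have "norm (\<Sum>k. ?a (k + 2)) \<le> 1 - S"
  proof -
    have sp: "summable p" using total by (simp add: sums_iff)
    have "norm (\<Sum>k. ?a (k + 2)) \<le> (\<Sum>k. norm (?a (k + 2)))"
      using summable_ignore_initial_segment[OF sp, of 2] nonneg
      by (intro summable_norm) (simp add: norm_mult)
    also have "\<dots> = (\<Sum>k. p (k + 2))" using nonneg by (simp add: norm_mult)
    also have "\<dots> = 1 - S" using suminf_split_initial_segment[OF sp, of 2] total by (simp add: sums_iff S_def eval_nat_numeral)
    finally show ?thesis .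
  qed
  moreover have "norm (?a 0 + ?a 1) \<le> S - B / S"
  proof (rule power2_le_imp_le)
    have "(norm (?a 0 + ?a 1))\<^sup>2 = (p 0 * cos t + p 1)\<^sup>2 + (p 0 * sin t)\<^sup>2"
      by (simp add: cmod_power2)
    also have "\<dots> = (p 0)\<^sup>2 * ((sin t)\<^sup>2 + (cos t)\<^sup>2) + (p 1)\<^sup>2 + 2 * p 0 * p 1 * cos t"
      unfolding power2_eq_square by algebra
    also have "\<dots> = S\<^sup>2 - 2 * B" by (simp add: S_def B_def power2_eq_square algebra_simps)
    also have "\<dots> \<le> S\<^sup>2 - 2 * B + (B / S)\<^sup>2" by simp
    also have "\<dots> = (S - B / S)\<^sup>2" using S by (simp add: power2_diff)
    finally show "(norm (?a 0 + ?a 1))\<^sup>2 \<le> (S - B / S)\<^sup>2" .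
    have "1 - cos t \<le> 2" using cos_ge_minus_one[of t] by linarith
    hence "B \<le> p 0 * p 1 * 2" unfolding B_def using p0 p1 by (intro mult_left_mono) auto
    also have "\<dots> \<le> S * S" using zero_le_power2[of "p 0"] zero_le_power2[of "p 1"]
      by (simp add: S_def power2_eq_square algebra_simps)
    finally show "0 \<le> S - B / S" using S by (simp add: field_simps)
  qed
  ultimately have "norm (G t) \<le> 1 - B / S" by linarith
  also have "B / S = b * (1 - cos t)" by (simp add: B_def S_def b_def)
  also have "1 - b * (1 - cos t) \<le> 1 - b * (t\<^sup>2 / 12)"
    using one_minus_cos_ge[OF assms] b_pos by (intro diff_left_mono mult_left_mono) auto
  also have "\<dots> \<le> exp (- (b / 12) * t\<^sup>2)" using exp_ge_add_one_self[of "- (b / 12) * t\<^sup>2"] by simp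
  finally show ?thesis .
qed

text \<open>Mean 1 removes the linear term of the Taylor expansion, and the third moment bounds the
  remainder.\<close>

lemma G_approx: "norm (G t - of_real (1 - \<sigma>2 * t\<^sup>2 / 2)) \<le> (\<Sum>k. p k * \<bar>real k - 1\<bar> ^ 3) / 6 * \<bar>t\<bar> ^ 3"
proof -
  let ?x = "\<lambda>k. (real k - 1) * t"
  let ?q = "\<lambda>k. of_real (p k) * (1 + \<i> * of_real (?x k) - of_real ((?x k)\<^sup>2 / 2))"
  have "(\<lambda>k. real k * p k - p k) sums (1 - 1)" by (intro sums_diff mean total)
  hence m: "(\<lambda>k. p k * (real k - 1)) sums 0" by (simp add: algebra_simps)
  have 1: "(\<lambda>k. complex_of_real (p k) + \<i> * of_real t * of_real (p k * (real k - 1)) -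
      of_real (t\<^sup>2 / 2) * of_real (p k * (real k - 1)\<^sup>2)) sums
     (of_real 1 + \<i> * of_real t * of_real 0 - of_real (t\<^sup>2 / 2) * of_real \<sigma>2)"
    by (intro sums_diff sums_add sums_mult sums_of_real total m sigma_sums)
  have "?q k = complex_of_real (p k) + \<i> * of_real t * of_real (p k * (real k - 1)) -
      of_real (t\<^sup>2 / 2) * of_real (p k * (real k - 1)\<^sup>2)" for k
    by (simp add: complex_eq_iff power2_eq_square field_simps)
  hence "?q sums of_real (1 - \<sigma>2 * t\<^sup>2 / 2)" using 1 by (simp add: mult.commute)
  hence d: "(\<lambda>k. of_real (p k) * cis (?x k) - ?q k) sums (G t - of_real (1 - \<sigma>2 * t\<^sup>2 / 2))"
    by (intro sums_diff G_sums)
  have bd: "norm (of_real (p k) * cis (?x k) - ?q k) \<le> p k * \<bar>real k - 1\<bar> ^ 3 * (\<bar>t\<bar> ^ 3 / 6)" for k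
  proof -
    have "norm (cis (?x k) - (1 + \<i> * of_real (?x k) - of_real ((?x k)\<^sup>2 / 2))) \<le> \<bar>?x k\<bar> ^ 3 / 6"
    proof -
      have "(\<Sum>j\<le>2. (\<i> * complex_of_real (?x k)) ^ j / fact j) = 1 + \<i> * of_real (?x k) - of_real ((?x k)\<^sup>2 / 2)"
        by (simp add: eval_nat_numeral field_simps)
      thus ?thesis using iexp_approx1[of "?x k" 2] by (simp add: cis_conv_exp eval_nat_numeral)
    qed
    hence "p k * norm (cis (?x k) - (1 + \<i> * of_real (?x k) - of_real ((?x k)\<^sup>2 / 2))) \<le> p k * (\<bar>?x k\<bar> ^ 3 / 6)"
      by (rule mult_left_mono[OF _ nonneg])
    moreover have "norm (of_real (p k) * cis (?x k) - ?q k) = p k * norm (cis (?x k) - (1 + \<i> * of_real (?x k) - of_real ((?x k)\<^sup>2 / 2)))"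
      using nonneg[of k] by (simp only: right_diff_distrib[symmetric] norm_mult norm_of_real abs_of_nonneg)
    ultimately show ?thesis by (simp add: abs_mult power_mult_distrib mult_ac)
  qed
  have sm: "summable (\<lambda>k. p k * \<bar>real k - 1\<bar> ^ 3 * (\<bar>t\<bar> ^ 3 / 6))" by (intro summable_mult2 summable_moment)
  have sn: "summable (\<lambda>k. norm (of_real (p k) * cis (?x k) - ?q k))"
    by (rule summable_comparison_test'[OF sm, of 0]) (use bd in simp)
  have "norm (G t - of_real (1 - \<sigma>2 * t\<^sup>2 / 2)) \<le> (\<Sum>k. norm (of_real (p k) * cis (?x k) - ?q k))"
    using summable_norm[OF sn] d by (simp add: sums_iff)
  also have "\<dots> \<le> (\<Sum>k. p k * \<bar>real k - 1\<bar> ^ 3 * (\<bar>t\<bar> ^ 3 / 6))" by (rule suminf_le[OF bd sn sm])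
  also have "\<dots> = (\<Sum>k. p k * \<bar>real k - 1\<bar> ^ 3) * (\<bar>t\<bar> ^ 3 / 6)" by (rule suminf_mult2[symmetric, OF summable_moment])
  finally show ?thesis by simp
qed

text \<open>Compare with \<open>(1 + x / n) ^ n\<close> by
  \<open>|a^n - b^n| \<le> n |a - b|\<close> in the unit disc; the cubic error makes the difference
  of order \<open>1 / sqrt n\<close>.\<close>

lemma G_power_limit: "(\<lambda>n. G (s / sqrt (real n)) ^ n) \<longlonglongrightarrow> of_real (exp (- (\<sigma>2 / 2) * s\<^sup>2))"
proof -
  define K where "K = (\<Sum>k. p k * \<bar>real k - 1\<bar> ^ 3) / 6"
  define x where "x = - (\<sigma>2 / 2) * s\<^sup>2"
  have lim: "(\<lambda>n. complex_of_real ((1 + x / real n) ^ n)) \<longlonglongrightarrow> of_real (exp x)"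
    by (intro tendsto_of_real tendsto_exp_limit_sequentially)
  have ev: "eventually (\<lambda>n. n > 0 \<and> \<bar>x\<bar> \<le> real n) sequentially"
    using eventually_gt_at_top[of 0] eventually_ge_at_top[of "nat \<lceil>\<bar>x\<bar>\<rceil>"] by eventually_elim linarith
  have diff: "(\<lambda>n. G (s / sqrt (real n)) ^ n - of_real ((1 + x / real n) ^ n)) \<longlonglongrightarrow> 0"
  proof (rule Lim_null_comparison)
    show "(\<lambda>n. K * \<bar>s\<bar> ^ 3 * (1 / sqrt (real n))) \<longlonglongrightarrow> 0"
      by (intro tendsto_mult_right_zero) real_asymp
    show "eventually (\<lambda>n. norm (G (s / sqrt (real n)) ^ n - of_real ((1 + x / real n) ^ n)) \<le> K * \<bar>s\<bar> ^ 3 * (1 / sqrt (real n))) sequentially"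
      using ev
    proof eventually_elim
      case (elim n)
      let ?t = "s / sqrt (real n)"
      have x0: "x \<le> 0" using sigma_pos by (simp add: x_def)
      have "0 \<le> 1 + x / real n" "1 + x / real n \<le> 1" using elim x0 by (auto simp: field_simps)
      hence n1: "norm (complex_of_real (1 + x / real n)) \<le> 1" unfolding norm_of_real by simp
      have "norm (G ?t ^ n - of_real (1 + x / real n) ^ n) \<le> real n * norm (G ?t - of_real (1 + x / real n))"
        by (rule norm_power_diff[OF norm_G_le_one n1])
      also have "\<dots> \<le> real n * (K * \<bar>?t\<bar> ^ 3)"
      proof -
        have e: "1 + x / real n = 1 - \<sigma>2 * ?t\<^sup>2 / 2" using elim by (simp add: x_def power_divide)
        show ?thesis unfolding e K_def by (intro mult_left_mono G_approx) simp
      qed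
      also have "real n * (K * \<bar>?t\<bar> ^ 3) = K * \<bar>s\<bar> ^ 3 * (real n / sqrt (real n) ^ 3)"
        by (simp add: power_divide abs_divide)
      also have "real n / sqrt (real n) ^ 3 = 1 / sqrt (real n)" using elim
        by (simp add: power3_eq_cube field_simps)
      finally show ?case by (simp only: of_real_power)
    qed
  qed
  show ?thesis using tendsto_add[OF diff lim] by (simp add: x_def)
qed

text \<open>The Fourier integrand after the substitution \<open>t = s / sqrt n\<close>.\<close>

definition "integrand n m s = indicator {-pi..pi} (s / sqrt (real n)) *\<^sub>R
   (G (s / sqrt (real n)) ^ n * cis ((real n - real m) * (s / sqrt (real n))))"

lemma coefficient_integral:
  assumes "n > 0"
  shows "of_real (sqrt (real n) * (2 * pi) * (g ^ n) $ m) = (\<integral>s. integrand n m s \<partial>lborel)"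
proof -
  have f: "(\<lambda>m. of_real ((g ^ n) $ m) * cis (real m * t)) sums (G t ^ n * cis (real n * t))" for t
  proof -
    have "cis ((real m - real n) * t) * cis (real n * t) = cis (real m * t)" for m
      by (simp add: cis_mult algebra_simps)
    thus ?thesis using sums_mult2[OF G_power_sums[of n t], of "cis (real n * t)"] by (simp add: mult.assoc)
  qed
  have "summable (\<lambda>m. norm (complex_of_real ((g ^ n) $ m)))"
    using g_power_sums[of n] g_power_nonneg[of n] by (simp add: sums_iff)
  from fourier_coefficient[OF this f, of m]
  have "of_real (2 * pi) * of_real ((g ^ n) $ m) =
      (\<integral>t. indicator {-pi..pi} t *\<^sub>R (G t ^ n * cis (real n * t) * cis (- (real m * t))) \<partial>lborel)" by simp
  also have "\<dots> = (\<integral>t. indicator {-pi..pi} t *\<^sub>R (G t ^ n * cis ((real n - real m) * t)) \<partial>lborel)"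
  proof -
    have "real n * t + - (real m * t) = (real n - real m) * t" for t by (simp add: left_diff_distrib)
    hence "G t ^ n * cis (real n * t) * cis (- (real m * t)) = G t ^ n * cis ((real n - real m) * t)" for t
      by (simp only: mult.assoc cis_mult)
    thus ?thesis by (simp only:)
  qed
  finally have "of_real (sqrt (real n)) * (of_real (2 * pi) * of_real ((g ^ n) $ m)) =
      of_real (sqrt (real n)) * (\<integral>t. indicator {-pi..pi} t *\<^sub>R (G t ^ n * cis ((real n - real m) * t)) \<partial>lborel)" by simp
  also have "\<dots> = (\<integral>s. integrand n m s \<partial>lborel)"
    unfolding integrand_def using assms by (intro integral_rescale) simp
  finally show ?thesis by (simp add: mult.assoc)
qed

lemma integrand_bound:
  assumes "n > 0"
  shows "norm (integrand n m s) \<le> exp (- (b / 12) * s\<^sup>2)"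
proof (cases "s / sqrt (real n) \<in> {-pi..pi}")
  case True
  let ?t = "s / sqrt (real n)"
  have "norm (integrand n m s) = norm (G ?t) ^ n" using True by (simp add: integrand_def norm_mult norm_power)
  also have "\<dots> \<le> exp (- (b / 12) * ?t\<^sup>2) ^ n" by (intro power_mono norm_G_le) (use True in auto)
  also have "\<dots> = exp (real n * (- (b / 12) * ?t\<^sup>2))" by (simp only: exp_of_nat_mult)
  also have "real n * (- (b / 12) * ?t\<^sup>2) = - (b / 12) * s\<^sup>2" using assms by (simp add: power_divide)
  finally show ?thesis .
qed (simp add: integrand_def)

lemma G_measurable [measurable]: "G \<in> borel_measurable borel"
proof -
  have "(\<lambda>t. \<Sum>k. complex_of_real (p k) * cis ((real k - 1) * t)) \<in> borel_measurable borel"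
    by (intro borel_measurable_suminf borel_measurable_continuous_onI continuous_intros)
  thus ?thesis by (simp add: G_def[abs_def])
qed

lemma integrand_measurable: "integrand n m \<in> borel_measurable lborel"
proof -
  have c: "(\<lambda>s. cis ((real n - real m) * (s / sqrt (real n)))) \<in> borel_measurable borel"
    unfolding divide_inverse by (intro borel_measurable_continuous_onI continuous_intros)
  have i: "(\<lambda>s. indicat_real {-pi..pi} (s / sqrt (real n))) \<in> borel_measurable borel" by measurable
  have "(\<lambda>s. G (s / sqrt (real n)) ^ n) \<in> borel_measurable borel" by measurable
  hence "integrand n m \<in> borel_measurable borel"
    unfolding integrand_def[abs_def] by (intro borel_measurable_scaleR i borel_measurable_times c)
  thus ?thesis by simp
qed

text \<open>Uniform in \<open>m\<close>; this is the majorant for summing the local limit against a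
  summable sequence.\<close>

lemma coefficient_bound: "sqrt (real n) * (g ^ n) $ m \<le> sqrt (pi / (b / 12)) / (2 * pi)"
proof (cases "n > 0")
  case True
  have ig: "integrable lborel (\<lambda>s. exp (- (b / 12) * s\<^sup>2))" using b_pos by (intro integrable_gauss) simp
  have "integrable lborel (integrand n m)"
    by (rule Bochner_Integration.integrable_bound[OF ig integrand_measurable]) (use integrand_bound[OF True] in simp)
  hence "norm (\<integral>s. integrand n m s \<partial>lborel) \<le> (\<integral>s. exp (- (b / 12) * s\<^sup>2) \<partial>lborel)"
    using integrand_bound[OF True] ig
    by (intro order_trans[OF integral_norm_bound] integral_mono integrable_norm)
  also have "\<dots> = sqrt (pi / (b / 12))" using b_pos by (intro integral_gauss) simp
  finally have "norm (complex_of_real (sqrt (real n) * (2 * pi) * (g ^ n) $ m)) \<le> sqrt (pi / (b / 12))"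
    unfolding coefficient_integral[OF True] .
  hence "sqrt (real n) * (2 * pi) * (g ^ n) $ m \<le> sqrt (pi / (b / 12))"
    unfolding norm_of_real by linarith
  thus ?thesis by (simp add: field_simps)
qed (use b_pos in simp)

definition "llt_const = 1 / sqrt (2 * pi * \<sigma>2)"

lemma llt_const_pos: "llt_const > 0"
  using sigma_pos by (simp add: llt_const_def)

theorem local_limit: "(\<lambda>n. sqrt (real n) * (g ^ n) $ (n - j)) \<longlonglongrightarrow> llt_const"
proof -
  \<comment> \<open>Writing the exponent as \<open>n + Suc j\<close> and the index as
    \<open>Suc n\<close> keeps the exponent positive and avoids truncated subtraction.\<close>
  have "(\<lambda>n. \<integral>s. integrand (n + Suc j) (Suc n) s \<partial>lborel) \<longlonglongrightarrow> (\<integral>s. of_real (exp (- (\<sigma>2 / 2) * s\<^sup>2)) \<partial>lborel)"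
  proof (rule integral_dominated_convergence[where w = "\<lambda>s. exp (- (b / 12) * s\<^sup>2)"])
    show "integrable lborel (\<lambda>s. exp (- (b / 12) * s\<^sup>2))" using b_pos by (intro integrable_gauss) simp
    show "AE s in lborel. norm (integrand (n + Suc j) (Suc n) s) \<le> exp (- (b / 12) * s\<^sup>2)" for n
      by (intro AE_I2 integrand_bound) simp
    show "integrand (n + Suc j) (Suc n) \<in> borel_measurable lborel" for n by (rule integrand_measurable)
    show "(\<lambda>s. complex_of_real (exp (- (\<sigma>2 / 2) * s\<^sup>2))) \<in> borel_measurable lborel" by measurable
    show "AE s in lborel. (\<lambda>n. integrand (n + Suc j) (Suc n) s) \<longlonglongrightarrow> of_real (exp (- (\<sigma>2 / 2) * s\<^sup>2))"
    proof (rule AE_I2)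
      fix s
      have q: "(\<lambda>n. s / sqrt (real (n + Suc j))) \<longlonglongrightarrow> 0" by real_asymp
      have "(\<lambda>n. G (s / sqrt (real (n + Suc j))) ^ (n + Suc j)) \<longlonglongrightarrow> of_real (exp (- (\<sigma>2 / 2) * s\<^sup>2))"
        using G_power_limit[of s] by (rule LIMSEQ_ignore_initial_segment)
      hence l: "(\<lambda>n. G (s / sqrt (real (n + Suc j))) ^ (n + Suc j) * cis (real j * (s / sqrt (real (n + Suc j))))) \<longlonglongrightarrow>
          of_real (exp (- (\<sigma>2 / 2) * s\<^sup>2)) * cis (real j * 0)"
        by (intro tendsto_intros q)
      have "eventually (\<lambda>n. \<bar>s / sqrt (real (n + Suc j))\<bar> < pi) sequentially"
        using tendsto_rabs[OF q] by (rule order_tendstoD) simp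
      hence "eventually (\<lambda>n. G (s / sqrt (real (n + Suc j))) ^ (n + Suc j) * cis (real j * (s / sqrt (real (n + Suc j)))) =
          integrand (n + Suc j) (Suc n) s) sequentially"
      proof eventually_elim
        case (elim n)
        have "s / sqrt (real (n + Suc j)) \<in> {-pi..pi}"
          using elim unfolding abs_less_iff atLeastAtMost_iff by linarith
        moreover have "real (n + Suc j) - real (Suc n) = real j" by simp
        ultimately show ?case unfolding integrand_def by (simp only: indicator_simps scaleR_one)
      qed
      from Lim_transform_eventually[OF l this]
      show "(\<lambda>n. integrand (n + Suc j) (Suc n) s) \<longlonglongrightarrow> of_real (exp (- (\<sigma>2 / 2) * s\<^sup>2))" by simp
    qed
  qed
  moreover have "(\<integral>s. complex_of_real (exp (- (\<sigma>2 / 2) * s\<^sup>2)) \<partial>lborel) = of_real (sqrt (pi / (\<sigma>2 / 2)))"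
    using integral_gauss[of "\<sigma>2 / 2"] sigma_pos by (simp only: integral_complex_of_real half_gt_zero)
  moreover have "(\<integral>s. integrand (n + Suc j) (Suc n) s \<partial>lborel) =
      of_real (sqrt (real (n + Suc j)) * (2 * pi) * (g ^ (n + Suc j)) $ (Suc n))" for n
    by (rule coefficient_integral[symmetric]) simp
  ultimately have "(\<lambda>n. complex_of_real (sqrt (real (n + Suc j)) * (2 * pi) * (g ^ (n + Suc j)) $ (Suc n))) \<longlonglongrightarrow>
      of_real (sqrt (pi / (\<sigma>2 / 2)))" by simp
  hence "(\<lambda>n. sqrt (real (n + Suc j)) * (2 * pi) * (g ^ (n + Suc j)) $ (Suc n)) \<longlonglongrightarrow> sqrt (pi / (\<sigma>2 / 2))"
    unfolding tendsto_of_real_iff .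
  hence "(\<lambda>n. sqrt (real (n + Suc j)) * (2 * pi) * (g ^ (n + Suc j)) $ (Suc n) / (2 * pi)) \<longlonglongrightarrow> sqrt (pi / (\<sigma>2 / 2)) / (2 * pi)"
    by (intro tendsto_divide tendsto_const) auto
  moreover have "sqrt (pi / (\<sigma>2 / 2)) / (2 * pi) = llt_const"
  proof -
    have "sqrt (pi / (\<sigma>2 / 2)) * sqrt (2 * pi * \<sigma>2) = sqrt ((2 * pi)\<^sup>2)"
      unfolding real_sqrt_mult[symmetric] using sigma_pos by (simp add: power2_eq_square)
    hence "sqrt (pi / (\<sigma>2 / 2)) * sqrt (2 * pi * \<sigma>2) = 2 * pi" unfolding real_sqrt_abs by simp
    thus ?thesis using sigma_pos by (simp add: llt_const_def field_simps)
  qed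
  ultimately have "(\<lambda>n. sqrt (real (n + Suc j)) * (g ^ (n + Suc j)) $ (n + Suc j - j)) \<longlonglongrightarrow> llt_const" by simp
  thus ?thesis by (rule LIMSEQ_offset)
qed

text \<open>Tannery's theorem. For \<open>j \<le> n\<close> the index \<open>n - j\<close> is
  \<open>Suc n - Suc j\<close>, so the local limit is used with shift \<open>Suc j\<close>.\<close>

theorem local_limit_weighted:
  assumes h: "summable (\<lambda>j. \<bar>h j\<bar>)"
  shows "(\<lambda>n. sqrt (real (Suc n)) * (\<Sum>j\<le>n. h j * (g ^ Suc n) $ (n - j))) \<longlonglongrightarrow> llt_const * (\<Sum>j. h j)"
proof -
  define M where "M = sqrt (pi / (b / 12)) / (2 * pi)"
  define a where "a k n = (if k \<le> n then h k * (sqrt (real (Suc n)) * (g ^ Suc n) $ (n - k)) else 0)" for k n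
  have lim: "(\<lambda>n. a k n) \<longlonglongrightarrow> h k * llt_const" for k
  proof -
    have "(\<lambda>n. sqrt (real (Suc n)) * (g ^ Suc n) $ (Suc n - Suc k)) \<longlonglongrightarrow> llt_const"
      using local_limit[of "Suc k"] by (rule LIMSEQ_Suc)
    hence "(\<lambda>n. h k * (sqrt (real (Suc n)) * (g ^ Suc n) $ (n - k))) \<longlonglongrightarrow> h k * llt_const"
      by (intro tendsto_mult tendsto_const) simp
    moreover have "eventually (\<lambda>n. h k * (sqrt (real (Suc n)) * (g ^ Suc n) $ (n - k)) = a k n) sequentially"
      using eventually_ge_at_top[of k] by eventually_elim (simp add: a_def)
    ultimately show ?thesis by (rule Lim_transform_eventually)
  qed
  have bd: "norm (a k n) \<le> \<bar>h k\<bar> * M" for k n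
  proof (cases "k \<le> n")
    case True
    define X where "X = sqrt (real (Suc n)) * (g ^ Suc n) $ (n - k)"
    have X: "0 \<le> X" unfolding X_def by (intro mult_nonneg_nonneg g_power_nonneg) simp
    have "a k n = h k * X" using True by (simp only: a_def X_def if_True)
    hence "norm (a k n) = \<bar>h k\<bar> * X" using X by (simp add: abs_mult)
    also have "\<dots> \<le> \<bar>h k\<bar> * M"
      unfolding M_def X_def by (intro mult_left_mono coefficient_bound) simp
    finally show ?thesis .
  next
    case False
    have "0 \<le> M" using b_pos by (simp add: M_def)
    thus ?thesis using False by (simp add: a_def)
  qed
  have "(\<lambda>n. suminf (\<lambda>k. a k n)) \<longlonglongrightarrow> suminf (\<lambda>k. h k * llt_const)"
  proof (rule tannerys_theorem[THEN conjunct2, THEN conjunct2])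
    show "(\<lambda>n. a k n) \<longlonglongrightarrow> h k * llt_const" for k by (rule lim)
    show "eventually (\<lambda>(k, n). norm (a k n) \<le> \<bar>h k\<bar> * M) (at_top \<times>\<^sub>F sequentially)"
      by (rule always_eventually) (use bd in auto)
    show "summable (\<lambda>k. \<bar>h k\<bar> * M)" using h by (rule summable_mult2)
  qed simp
  moreover have "suminf (\<lambda>k. a k n) = sqrt (real (Suc n)) * (\<Sum>j\<le>n. h j * (g ^ Suc n) $ (n - j))" for n
  proof -
    have "suminf (\<lambda>k. a k n) = (\<Sum>k\<le>n. a k n)" by (rule suminf_finite) (auto simp: a_def)
    thus ?thesis by (simp add: a_def sum_distrib_left mult_ac)
  qed
  moreover have "suminf (\<lambda>k. h k * llt_const) = llt_const * (\<Sum>j. h j)"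
    using suminf_mult2[OF summable_rabs_cancel[OF h], of llt_const] by (simp add: mult.commute)
  ultimately show ?thesis by simp
qed

end

section \<open>Coefficients of Laguerre type\<close>

text \<open>The geometric series \<open>1 / (1 - X)\<close>.\<close>

definition ones_fps :: "real fps" where "ones_fps = Abs_fps (\<lambda>_. 1)"

lemma ones_fps_sums: "\<bar>z\<bar> < 1 \<Longrightarrow> fps_sums ones_fps z (1 / (1 - z))"
  using geometric_sums[of z] by (simp add: fps_sums_def ones_fps_def)

lemma nonneg_ones_fps: "nonneg_fps ones_fps"
  by (simp add: nonneg_fps_def ones_fps_def)

lemma ones_fps_power: "(ones_fps ^ Suc m) $ n = real ((n + m) choose m)"
proof (induction m arbitrary: n)
  case 0
  thus ?case by (simp add: ones_fps_def)
next
  case (Suc m)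
  have "(ones_fps ^ Suc (Suc m)) $ n = (ones_fps ^ Suc m * ones_fps) $ n" by (simp add: mult.commute)
  also have "\<dots> = (\<Sum>i\<le>n. (ones_fps ^ Suc m) $ i)"
    unfolding fps_mult_nth by (simp add: ones_fps_def atMost_atLeast0)
  also have "\<dots> = (\<Sum>i\<le>n. real ((m + i) choose m))" unfolding Suc by (simp add: add.commute)
  also have "\<dots> = real (\<Sum>i\<le>n. (m + i) choose m)" by simp
  also have "(\<Sum>i\<le>n. (m + i) choose m) = (m + n + 1) choose (m + 1)" by (rule choose_rising_sum)
  finally show ?case by (simp add: add_ac)
qed

text \<open>The generating function of the Laguerre polynomials with parameter 1, evaluated at
  \<open>- A\<close>.\<close>

definition laguerre_fps :: "real \<Rightarrow> real fps" where
  "laguerre_fps A = (fps_exp A oo (fps_X * ones_fps)) * ones_fps ^ 2"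

lemma laguerre_nth: "laguerre_fps A $ k = (\<Sum>j=0..k. A ^ j / fact j * real (Suc k choose Suc j))"
proof -
  have "laguerre_fps A $ k = (\<Sum>j=0..k. fps_exp A $ j * ((fps_X * ones_fps) ^ j * ones_fps ^ 2) $ k)"
    unfolding laguerre_fps_def by (rule fps_compose_mult_nth) simp
  also have "\<dots> = (\<Sum>j=0..k. A ^ j / fact j * real (Suc k choose Suc j))"
  proof (rule sum.cong[OF refl])
    fix j assume "j \<in> {0..k}"
    hence j: "j \<le> k" by simp
    have "(fps_X * ones_fps) ^ j * ones_fps ^ 2 = fps_X ^ j * ones_fps ^ Suc (Suc j)"
      by (simp add: power_mult_distrib power2_eq_square mult_ac)
    hence "((fps_X * ones_fps) ^ j * ones_fps ^ 2) $ k = (ones_fps ^ Suc (Suc j)) $ (k - j)"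
      using j by (simp add: fps_X_power_mult_nth del: power_Suc)
    also have "\<dots> = real (Suc k choose Suc j)" unfolding ones_fps_power using j by simp
    finally show "fps_exp A $ j * ((fps_X * ones_fps) ^ j * ones_fps ^ 2) $ k = A ^ j / fact j * real (Suc k choose Suc j)"
      by simp
  qed
  finally show ?thesis .
qed

lemma nonneg_fps_exp: "A \<ge> 0 \<Longrightarrow> nonneg_fps (fps_exp A)"
  by (simp add: nonneg_fps_def)

lemma nonneg_X_ones: "nonneg_fps (fps_X * ones_fps)"
  by (intro nonneg_fps_mult nonneg_ones_fps) (simp add: nonneg_fps_def fps_X_def)

lemma nonneg_laguerre: "A \<ge> 0 \<Longrightarrow> nonneg_fps (laguerre_fps A)"
  unfolding laguerre_fps_def
  by (intro nonneg_fps_mult nonneg_fps_compose nonneg_fps_power nonneg_ones_fps nonneg_X_ones nonneg_fps_exp)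

lemma laguerre_sums:
  assumes "A \<ge> 0" "\<bar>z\<bar> < 1"
  shows "fps_sums (laguerre_fps A) z (exp (A * (z / (1 - z))) * (1 / (1 - z)) ^ 2)"
proof -
  have s: "fps_sums (fps_exp A oo (fps_X * ones_fps)) z (exp (A * (z / (1 - z))))" if "\<bar>z\<bar> < 1" for z
  proof (rule fps_sums_compose_abs[OF nonneg_fps_exp[OF assms(1)] nonneg_X_ones])
    have "fps_sums (fps_X * ones_fps) z (z * (1 / (1 - z)))" if "\<bar>z\<bar> < 1" for z
      by (intro fps_sums_X_mult ones_fps_sums that)
    from this[of z] this[of "\<bar>z\<bar>"] that
    show "fps_sums (fps_X * ones_fps) \<bar>z\<bar> (\<bar>z\<bar> * (1 / (1 - \<bar>z\<bar>)))" "fps_sums (fps_X * ones_fps) z (z / (1 - z))"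
      by simp_all
    show "fps_sums (fps_exp A) (\<bar>z\<bar> * (1 / (1 - \<bar>z\<bar>))) (exp (A * (\<bar>z\<bar> * (1 / (1 - \<bar>z\<bar>)))))" by (rule fps_sums_exp)
    show "fps_sums (fps_exp A) (z / (1 - z)) (exp (A * (z / (1 - z))))" by (rule fps_sums_exp)
    show "(fps_X * ones_fps) $ 0 = 0" by simp
  qed
  have "fps_sums (ones_fps ^ 2) z ((1 / (1 - z)) ^ 2)" if "\<bar>z\<bar> < 1" for z
    using fps_sums_power_abs[OF nonneg_ones_fps ones_fps_sums[of "\<bar>z\<bar>"] ones_fps_sums[of z]] that by simp
  from this[of z] this[of "\<bar>z\<bar>"] s[of z] s[of "\<bar>z\<bar>"] assms(2)
  have t: "fps_sums (ones_fps ^ 2) z ((1 / (1 - z)) ^ 2)" "fps_sums (ones_fps ^ 2) \<bar>z\<bar> ((1 / (1 - \<bar>z\<bar>)) ^ 2)"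
    "fps_sums (fps_exp A oo (fps_X * ones_fps)) z (exp (A * (z / (1 - z))))"
    "fps_sums (fps_exp A oo (fps_X * ones_fps)) \<bar>z\<bar> (exp (A * (\<bar>z\<bar> / (1 - \<bar>z\<bar>))))" by simp_all
  have n: "nonneg_fps (fps_exp A oo (fps_X * ones_fps))" "nonneg_fps (ones_fps ^ 2)"
    by (intro nonneg_fps_compose nonneg_fps_power nonneg_ones_fps nonneg_X_ones nonneg_fps_exp assms)+
  show ?thesis unfolding laguerre_fps_def
    by (rule fps_sums_mult_abs[OF n t(4,2,3,1)])
qed

text \<open>In \<open>exp_laguerre_asymp\<close> this dominates the shifted coefficients.\<close>

lemma laguerre_mono: assumes "A \<ge> 0" "i \<le> k" shows "laguerre_fps A $ i \<le> laguerre_fps A $ k"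
proof -
  have "laguerre_fps A $ i \<le> (\<Sum>j=0..i. A ^ j / fact j * real (Suc k choose Suc j))"
    unfolding laguerre_nth
  proof (intro sum_mono mult_left_mono)
    fix j
    have "Suc i choose Suc j \<le> Suc k choose Suc j" using assms(2) by (intro binomial_right_mono) simp
    thus "real (Suc i choose Suc j) \<le> real (Suc k choose Suc j)" by (simp only: of_nat_le_iff)
    show "0 \<le> A ^ j / fact j" using assms(1) by simp
  qed
  also have "\<dots> \<le> laguerre_fps A $ k"
    unfolding laguerre_nth using assms by (intro sum_mono2) auto
  finally show ?thesis .
qed

section \<open>Gaussian approximation of falling factorials\<close>

definition ratio :: "nat \<Rightarrow> nat \<Rightarrow> real" where
  "ratio k j = (\<Prod>i<j. 1 - real i / real k)"

text \<open>\<open>real k ^ j * ratio k j\<close> is the falling factorial of \<open>k\<close> with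
  \<open>j\<close> factors, and the left side is that of \<open>k + 1\<close> with
  \<open>j + 1\<close> factors.\<close>

lemma choose_ratio:
  assumes "k > 0"
  shows "real (Suc k choose Suc j) * fact (Suc j) = (real k + 1) * real k ^ j * ratio k j"
proof (induction j)
  case 0
  show ?case by (simp add: ratio_def)
next
  case (Suc j)
  have "Suc (Suc j) * (Suc k choose Suc (Suc j)) = (Suc k - Suc j) * (Suc k choose Suc j)"
    by (metis binomial_absorb_comp binomial_absorption mult.commute)
  hence e: "real (Suc (Suc j)) * real (Suc k choose Suc (Suc j)) = real (k - j) * real (Suc k choose Suc j)"
    by (metis diff_Suc_Suc of_nat_mult)
  have "real (Suc k choose Suc (Suc j)) * fact (Suc (Suc j)) = real (k - j) * (real (Suc k choose Suc j) * fact (Suc j))"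
  proof -
    have "real (Suc k choose Suc (Suc j)) * fact (Suc (Suc j)) =
        (real (Suc (Suc j)) * real (Suc k choose Suc (Suc j))) * fact (Suc j)"
      unfolding fact_Suc[of "Suc j"] by (simp only: mult_ac)
    thus ?thesis unfolding e by (simp only: mult.assoc)
  qed
  also have "\<dots> = real (k - j) * ((real k + 1) * real k ^ j * ratio k j)" unfolding Suc ..
  also have "\<dots> = (real k + 1) * real k ^ Suc j * ratio k (Suc j)"
  proof (cases "j \<le> k")
    case True
    thus ?thesis using assms by (simp add: ratio_def of_nat_diff field_simps)
  next
    case False
    have "ratio k n = 0" if "k < n" for n unfolding ratio_def using assms that by (intro prod_zero) auto
    thus ?thesis using False by simp
  qed
  finally show ?case .
qed

lemma ratio_nonneg: "k > 0 \<Longrightarrow> 0 \<le> ratio k j"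
proof (cases "j \<le> k")
  case True
  assume "k > 0"
  thus ?thesis unfolding ratio_def using True by (intro prod_nonneg) (auto simp: field_simps)
next
  case False
  assume "k > 0"
  hence "ratio k j = 0" unfolding ratio_def using False by (intro prod_zero) auto
  thus ?thesis by simp
qed

text \<open>Each factor is bounded by \<open>1 - x \<le> exp (- x)\<close>.\<close>

lemma ratio_upper:
  assumes "k > 0" "j \<le> k"
  shows "ratio k j \<le> exp (- (real j * (real j - 1) / (2 * real k)))"
  using assms(2)
proof (induction j)
  case (Suc j)
  have "1 - real j / real k \<le> exp (- (real j / real k))" using exp_ge_add_one_self[of "- (real j / real k)"] by simp
  hence "ratio k j * (1 - real j / real k) \<le> exp (- (real j * (real j - 1) / (2 * real k))) * exp (- (real j / real k))"
    using Suc assms(1) by (intro mult_mono Suc.IH) (auto simp: field_simps)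
  also have "\<dots> = exp (- (real (Suc j) * (real (Suc j) - 1) / (2 * real k)))"
    unfolding exp_add[symmetric] using assms(1) by (intro arg_cong[of _ _ exp]) (simp add: field_simps)
  finally show ?case by (simp add: ratio_def)
qed (simp add: ratio_def)

text \<open>Each factor is bounded by \<open>ln (1 - x) \<ge> - x - 2 x^2\<close>, valid for
  \<open>x \<le> 1/2\<close>; the quadratic terms add up to at most
  \<open>2 j^3 / k^2\<close>.\<close>

lemma ratio_lower:
  assumes "k > 0" "2 * j \<le> k"
  shows "exp (- (real j * (real j - 1) / (2 * real k)) - 2 * real j ^ 3 / real k ^ 2) \<le> ratio k j"
  using assms(2)
proof (induction j)
  case (Suc j)
  let ?x = "real j / real k"
  have x: "0 \<le> ?x" "?x \<le> 1 / 2" using Suc assms(1) by (auto simp: field_simps)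
  have "- ?x - 2 * ?x\<^sup>2 \<le> ln (1 - ?x)" using ln_one_minus_pos_lower_bound[of ?x] x by simp
  hence "exp (- ?x - 2 * ?x\<^sup>2) \<le> exp (ln (1 - ?x))" by (simp only: exp_le_cancel_iff)
  also have "exp (ln (1 - ?x)) = 1 - ?x"
  proof (rule exp_ln)
    show "0 < 1 - ?x" using x(2) by linarith
  qed
  finally have "exp (- ?x - 2 * ?x\<^sup>2) \<le> 1 - ?x" .
  hence "exp (- (real j * (real j - 1) / (2 * real k)) - 2 * real j ^ 3 / real k ^ 2) * exp (- ?x - 2 * ?x\<^sup>2) \<le> ratio k j * (1 - ?x)"
    using Suc by (intro mult_mono Suc.IH ratio_nonneg assms) auto
  moreover have "exp (- (real (Suc j) * (real (Suc j) - 1) / (2 * real k)) - 2 * real (Suc j) ^ 3 / real k ^ 2) \<le>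
      exp (- (real j * (real j - 1) / (2 * real k)) - 2 * real j ^ 3 / real k ^ 2) * exp (- ?x - 2 * ?x\<^sup>2)"
  proof -
    have "real j ^ 3 + real j ^ 2 \<le> real (Suc j) ^ 3" by (simp add: power3_eq_cube power2_eq_square algebra_simps)
    hence "(real j ^ 3 + real j ^ 2) / real k ^ 2 \<le> real (Suc j) ^ 3 / real k ^ 2" by (rule divide_right_mono) simp
    hence "2 * real j ^ 3 / real k ^ 2 + 2 * ?x\<^sup>2 \<le> 2 * real (Suc j) ^ 3 / real k ^ 2"
      by (simp add: power_divide add_divide_distrib)
    moreover have "real (Suc j) * (real (Suc j) - 1) / (2 * real k) = real j * (real j - 1) / (2 * real k) + ?x"
      using assms(1) by (simp add: field_simps)
    ultimately show ?thesis unfolding exp_add[symmetric] exp_le_cancel_iff by linarith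
  qed
  ultimately show ?case by (simp add: ratio_def)
qed (simp add: ratio_def)

text \<open>The exponent is written with \<open>j (j + 1)\<close>, whose average under the Bessel
  weights is exact; the change from \<open>j (j - 1)\<close> costs a multiple of
  \<open>j / k\<close>. The error is polynomial in \<open>j\<close> and holds for all
  \<open>j\<close>, since for \<open>2 j > k\<close> the cubic term already exceeds 1.\<close>

lemma ratio_approx:
  assumes "k > 0"
  shows "\<bar>ratio k j - exp (- (real j * (real j + 1) / real k) / 2)\<bar> \<le> 2 * real j / real k + 8 * real j ^ 3 / real k ^ 2"
proof -
  define y where "y = real j * (real j - 1) / (2 * real k)"
  define z where "z = real j * (real j + 1) / real k"
  have zy: "z / 2 = y + real j / real k" using assms by (simp add: y_def z_def field_simps)
  have y0: "0 \<le> y" by (cases j) (simp_all add: y_def)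
  have z0: "0 \<le> z" by (simp add: z_def)
  have p: "0 \<le> real j ^ 3 / real k ^ 2" by simp
  have up: "ratio k j - exp (- z / 2) \<le> 2 * real j / real k"
  proof (cases "j \<le> k")
    case True
    have x: "real j / real k \<le> 1" using True assms by simp
    have "ratio k j \<le> exp (- z / 2) * exp (real j / real k)"
    proof -
      have "- z / 2 + real j / real k = - y" using zy by linarith
      hence "exp (- z / 2) * exp (real j / real k) = exp (- y)" by (simp only: exp_add[symmetric])
      thus ?thesis using ratio_upper[OF assms True] by (simp only: y_def)
    qed
    hence "ratio k j - exp (- z / 2) \<le> exp (- z / 2) * (exp (real j / real k) - 1)" by (simp add: algebra_simps)
    also have "\<dots> \<le> 1 * (exp (real j / real k) - 1)" using z0 by (intro mult_right_mono) auto
    also have "exp (real j / real k) \<le> 1 + real j / real k + (real j / real k)\<^sup>2"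
      using x by (intro exp_bound) auto
    also have "(real j / real k)\<^sup>2 \<le> real j / real k"
      using mult_left_le[OF x, of "real j / real k"] by (simp add: power2_eq_square)
    finally show ?thesis by simp
  next
    case False
    hence "ratio k j = 0" unfolding ratio_def using assms by (intro prod_zero) auto
    moreover have "0 \<le> 2 * real j / real k" by simp
    ultimately show ?thesis using exp_gt_zero[of "- z / 2"] by linarith
  qed
  have lo: "exp (- z / 2) - ratio k j \<le> 8 * real j ^ 3 / real k ^ 2"
  proof (cases "2 * j \<le> k")
    case True
    let ?d = "2 * real j ^ 3 / real k ^ 2"
    have "exp (- z / 2) \<le> exp (- y)" using zy by simp
    moreover have "exp (- y) * exp (- ?d) \<le> ratio k j"
    proof -
      have "exp (- y) * exp (- ?d) = exp (- y - ?d)" by (simp only: exp_add[symmetric] diff_conv_add_uminus)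
      thus ?thesis using ratio_lower[OF assms True] by (simp only: y_def)
    qed
    moreover have "exp (- y) - exp (- y) * exp (- ?d) = exp (- y) * (1 - exp (- ?d))" by (simp add: algebra_simps)
    moreover have "exp (- y) * (1 - exp (- ?d)) \<le> 1 * ?d"
      using y0 exp_ge_add_one_self[of "- ?d"] by (intro mult_mono) auto
    ultimately have "exp (- z / 2) - ratio k j \<le> ?d" by linarith
    moreover have "?d = 2 * (real j ^ 3 / real k ^ 2)" "8 * real j ^ 3 / real k ^ 2 = 8 * (real j ^ 3 / real k ^ 2)" by simp_all
    ultimately show ?thesis using p by linarith
  next
    case False
    hence "real k \<le> 2 * real j" by simp
    hence "real k ^ 3 \<le> (2 * real j) ^ 3" by (intro power_mono) auto
    moreover have "real k ^ 2 \<le> real k ^ 3" using assms by (intro power_increasing) auto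
    ultimately have "real k ^ 2 \<le> 8 * real j ^ 3" by (simp add: power_mult_distrib)
    hence "1 \<le> 8 * real j ^ 3 / real k ^ 2" using assms by (simp add: field_simps)
    moreover have "exp (- z / 2) \<le> 1" using z0 by simp
    ultimately show ?thesis using ratio_nonneg[OF assms, of j] by linarith
  qed
  have e: "8 * real j ^ 3 / real k ^ 2 = 8 * (real j ^ 3 / real k ^ 2)" "0 \<le> 2 * real j / real k" by simp_all
  have "\<bar>ratio k j - exp (- z / 2)\<bar> \<le> 2 * real j / real k + 8 * real j ^ 3 / real k ^ 2"
    using up lo p e by linarith
  thus ?thesis by (simp only: z_def)
qed

text \<open>The weights satisfy \<open>v (j + 1) * (j + 1) * (j + 2) = x * v j\<close>, so a factor
  of this kind shifts the series by one and multiplies it by \<open>x\<close>; the second moment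
  shifts twice.\<close>

lemma bessel_moments:
  fixes x :: real
  defines "v \<equiv> \<lambda>j. x ^ j / (fact j * fact (Suc j))"
  shows "(\<lambda>j. v j * (real j * (real j + 1))) sums (x * bessel_sum x)"
    and "(\<lambda>j. v j * ((real j + 1) * real j ^ 2 * (real j - 1))) sums (x\<^sup>2 * bessel_sum x)"
proof -
  have b: "v sums bessel_sum x" unfolding v_def by (rule bessel_sum_sums)
  have st: "v (Suc j) * (real (Suc j) * (real (Suc j) + 1)) = x * v j" for j
  proof -
    have "v (Suc j) * (a * b) = x * v j" if "a \<noteq> 0" "b \<noteq> 0" "fact (Suc j) = a * (fact j :: real)" "fact (Suc (Suc j)) = b * (fact (Suc j) :: real)" for a b
      unfolding v_def that(3,4) using that(1,2) by (simp add: divide_simps)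
    from this[of "real (Suc j)" "real (Suc (Suc j))"]
    have "v (Suc j) * (real (Suc j) * real (Suc (Suc j))) = x * v j" by (metis fact_Suc nat.distinct(1) of_nat_eq_0_iff)
    moreover have "real (Suc (Suc j)) = real (Suc j) + 1" by simp
    ultimately show ?thesis by (simp only:)
  qed
  have s1: "(\<lambda>j. v (Suc j) * (real (Suc j) * (real (Suc j) + 1))) sums (x * bessel_sum x)"
    unfolding st using b by (rule sums_mult)
  thus 1: "(\<lambda>j. v j * (real j * (real j + 1))) sums (x * bessel_sum x)"
    by (subst (asm) sums_Suc_iff) simp
  have st2: "v (Suc j) * ((real (Suc j) + 1) * real (Suc j) ^ 2 * (real (Suc j) - 1)) = x * (v j * (real j * (real j + 1)))" for j
  proof -
    have "v (Suc j) * ((real (Suc j) + 1) * real (Suc j) ^ 2 * (real (Suc j) - 1)) =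
       (v (Suc j) * (real (Suc j) * (real (Suc j) + 1))) * (real (Suc j) * (real (Suc j) - 1))"
      by (simp add: power2_eq_square)
    also have "\<dots> = x * v j * (real (Suc j) * (real (Suc j) - 1))" by (simp only: st)
    also have "\<dots> = x * (v j * (real j * (real j + 1)))" by simp
    finally show ?thesis .
  qed
  have "(\<lambda>j. v (Suc j) * ((real (Suc j) + 1) * real (Suc j) ^ 2 * (real (Suc j) - 1))) sums (x * (x * bessel_sum x))"
    unfolding st2 using 1 by (rule sums_mult)
  thus "(\<lambda>j. v j * ((real j + 1) * real j ^ 2 * (real j - 1))) sums (x\<^sup>2 * bessel_sum x)"
    by (subst (asm) sums_Suc_iff) (simp add: power2_eq_square mult.assoc)
qed

text \<open>The average of the pointwise bound \<open>B\<close> in \<open>ratio_average\<close>; it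
  is of order \<open>k powr (-1/4)\<close>.\<close>

definition laguerre_error :: "real \<Rightarrow> nat \<Rightarrow> real" where
  "laguerre_error A k = (2 * (1 + A) + 16 * (1 + A\<^sup>2)) / sqrt (real k) + real k powr (- (1/4)) / 4
     + 2 * (1 + A\<^sup>2) * real k powr (1/4) / sqrt (real k)"

text \<open>Under the weights \<open>x\<^sup>j / (j! (j+1)!)\<close>, \<open>x = A k\<close>, the variable \<open>j (j+1) / k\<close> has mean exactly \<open>A\<close>
  and vanishing variance, so \<open>ratio k j\<close> averages to \<open>exp (-A/2)\<close>.\<close>

lemma ratio_average:
  assumes A: "A > 0" and k: "k > 0"
  shows "\<exists>E. (\<lambda>j. (A * real k) ^ j / (fact j * fact (Suc j)) * ratio k j) sums E \<and>
     \<bar>E - exp (- A / 2) * bessel_sum (A * real k)\<bar> \<le> bessel_sum (A * real k) * laguerre_error A k"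
proof -
  define x where "x = A * real k"
  define v where "v j = x ^ j / (fact j * fact (Suc j))" for j
  define W where "W = bessel_sum x"
  \<comment> \<open>Parameter of the inequality
    \<open>2 \<epsilon> |z - A| \<le> \<epsilon>^2 + (z - A)^2\<close> below, balanced against a
    variance of order \<open>1 / sqrt k\<close>.\<close>
  define \<epsilon> where "\<epsilon> = real k powr (- (1/4))"
  define m2 where "m2 j = real j * (real j + 1)" for j
  define m4 where "m4 j = (real j + 1) * real j ^ 2 * (real j - 1)" for j
  define s where "s = sqrt (real k)"
  have s: "s > 0" "s * s = real k" "s \<ge> 1" using k by (auto simp: s_def real_le_rsqrt)
  have \<epsilon>: "\<epsilon> > 0" using k by (simp add: \<epsilon>_def)
  have v0: "0 \<le> v j" for j using A k by (simp add: v_def x_def)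
  have sv: "v sums W" unfolding v_def W_def by (rule bessel_sum_sums)
  have s2: "(\<lambda>j. v j * m2 j) sums (x * W)" and s4: "(\<lambda>j. v j * m4 j) sums (x\<^sup>2 * W)"
    using bessel_moments[of x] by (simp_all add: v_def m2_def m4_def W_def)
  have m4_nonneg: "0 \<le> m4 j" for j by (cases j) (simp_all add: m4_def)
  \<comment> \<open>A pointwise bound that is a combination of 1, \<open>m2\<close> and
    \<open>m4\<close>, the functions whose averages are known exactly.\<close>
  define B where "B j = 2 * (1 / s + m2 j / (real k * s)) + 8 * (2 / s + 2 * m4 j / (real k ^ 2 * s)) + \<epsilon> / 4 +
     1 / (4 * \<epsilon>) * (m4 j / real k ^ 2 + 4 * (2 / s + 2 * m4 j / (real k ^ 2 * s)) - 2 * A * m2 j / real k + A\<^sup>2)" for j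
  \<comment> \<open>Odd powers of \<open>j\<close> are reduced to \<open>m2\<close> and
    \<open>m4\<close> at the price of a factor \<open>1 / s\<close>, by comparing \<open>j\<close>
    with \<open>s = sqrt k\<close>.\<close>
  have j1: "real j / real k \<le> 1 / s + m2 j / (real k * s)" for j
  proof -
    have "real j * s \<le> s * s + real j * real j"
    proof -
      have "(real j - s)\<^sup>2 = real j * real j + s * s - 2 * (real j * s)" by (simp add: power2_eq_square algebra_simps)
      moreover have "0 \<le> real j * s" using s by simp
      ultimately show ?thesis using zero_le_power2[of "real j - s"] by linarith
    qed
    also have "\<dots> \<le> real k + m2 j" using s by (simp add: m2_def algebra_simps)
    finally show ?thesis using s k by (simp add: field_simps)
  qed
  have j3: "real j ^ 3 / real k ^ 2 \<le> 2 / s + 2 * m4 j / (real k ^ 2 * s)" for j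
  proof -
    have m: "real j ^ 4 \<le> 1 + 2 * m4 j"
    proof (cases "j \<le> 1")
      case True
      hence "j = 0 \<or> j = 1" by auto
      thus ?thesis by (auto simp: m4_def)
    next
      case False
      hence "2 * 2 \<le> real j * real j" by (intro mult_mono) auto
      hence "0 \<le> real j ^ 2 * (real j * real j - 2)" by simp
      thus ?thesis by (simp add: m4_def power2_eq_square power4_eq_xxxx algebra_simps)
    qed
    have "real j ^ 3 * s \<le> real k ^ 2 + real j ^ 4"
    proof (cases "real j \<le> s")
      case True
      hence "real j ^ 3 * s \<le> s ^ 3 * s" using s by (intro mult_right_mono power_mono) auto
      also have "s ^ 3 * s = real k ^ 2" using s(2) by (simp add: power3_eq_cube power2_eq_square flip: s(2))
      finally show ?thesis by (simp add: add_increasing2)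
    next
      case False
      hence "real j ^ 3 * s \<le> real j ^ 3 * real j" by (intro mult_left_mono) auto
      thus ?thesis by (simp add: power3_eq_cube power4_eq_xxxx add_increasing mult_ac)
    qed
    also have "\<dots> \<le> real k ^ 2 + (1 + 2 * m4 j)" using m by simp
    also have "\<dots> \<le> 2 * real k ^ 2 + 2 * m4 j"
    proof -
      have "1 \<le> real k ^ 2" using k by simp
      thus ?thesis by simp
    qed
    finally show ?thesis using s k by (simp add: field_simps)
  qed
  have pt: "\<bar>ratio k j - exp (- A / 2)\<bar> \<le> B j" for j
  proof -
    define z where "z = m2 j / real k"
    have z0: "0 \<le> z" by (simp add: z_def m2_def)
    have lip: "\<bar>exp (- z / 2) - exp (- A / 2)\<bar> \<le> \<bar>z - A\<bar> / 2"
    proof -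
      have *: "exp (- a) - exp (- b) \<le> b - a" if "0 \<le> a" "a \<le> b" for a b :: real
      proof -
        have "exp (- a) - exp (- b) = exp (- a) * (1 - exp (- (b - a)))" by (simp add: algebra_simps exp_add[symmetric])
        also have "\<dots> \<le> 1 * (b - a)"
        proof (rule mult_mono)
          show "1 - exp (- (b - a)) \<le> b - a" using exp_ge_add_one_self[of "- (b - a)"] by linarith
        qed (use that in auto)
        finally show ?thesis by simp
      qed
      show ?thesis
      proof (cases "z \<le> A")
        case True
        thus ?thesis using *[of "z / 2" "A / 2"] z0 by (simp add: abs_if)
      next
        case False
        thus ?thesis using *[of "A / 2" "z / 2"] A by (simp add: abs_if)
      qed
    qed
    have amgm: "\<bar>z - A\<bar> / 2 \<le> \<epsilon> / 4 + 1 / (4 * \<epsilon>) * (z - A)\<^sup>2"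
    proof -
      have "0 \<le> (\<epsilon> - \<bar>z - A\<bar>)\<^sup>2" by simp
      hence "2 * \<epsilon> * \<bar>z - A\<bar> \<le> \<epsilon>\<^sup>2 + (z - A)\<^sup>2" by (simp add: power2_diff)
      thus ?thesis using \<epsilon> by (simp add: field_simps power2_eq_square)
    qed
    \<comment> \<open>\<open>z^2\<close> exceeds \<open>m4 j / k^2\<close> by at most
      \<open>4 j^3 / k^2\<close>, so expanding the square leaves terms with known averages.\<close>
    have var: "(z - A)\<^sup>2 \<le> m4 j / real k ^ 2 + 4 * (2 / s + 2 * m4 j / (real k ^ 2 * s)) - 2 * A * m2 j / real k + A\<^sup>2"
    proof -
      have "m2 j ^ 2 \<le> m4 j + 4 * real j ^ 3"
      proof (cases j)
        case (Suc n)
        show ?thesis unfolding Suc m2_def m4_def by (simp add: power2_eq_square power3_eq_cube algebra_simps)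
      qed (simp add: m2_def m4_def)
      hence "m2 j ^ 2 / real k ^ 2 \<le> (m4 j + 4 * real j ^ 3) / real k ^ 2" by (rule divide_right_mono) simp
      hence "z\<^sup>2 \<le> m4 j / real k ^ 2 + 4 * (real j ^ 3 / real k ^ 2)" by (simp add: z_def power_divide add_divide_distrib)
      moreover have "(z - A)\<^sup>2 = z\<^sup>2 - 2 * A * m2 j / real k + A\<^sup>2" by (simp add: power2_diff z_def)
      moreover have "y \<le> b + 4 * Q - d + e" if "a \<le> b + 4 * c" "y = a - d + e" "c \<le> Q" for a b c d e y Q :: real
        using that by linarith
      ultimately show ?thesis using j3[of j] by blast
    qed
    have "\<bar>ratio k j - exp (- A / 2)\<bar> \<le> 2 * (real j / real k) + 8 * (real j ^ 3 / real k ^ 2) + \<bar>z - A\<bar> / 2"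
    proof -
      have "- (real j * (real j + 1) / real k) / 2 = - z / 2" by (simp only: z_def m2_def)
      moreover have "2 * real j / real k = 2 * (real j / real k)" "8 * real j ^ 3 / real k ^ 2 = 8 * (real j ^ 3 / real k ^ 2)" by simp_all
      ultimately have "\<bar>ratio k j - exp (- z / 2)\<bar> \<le> 2 * (real j / real k) + 8 * (real j ^ 3 / real k ^ 2)"
        using ratio_approx[OF k, of j] by (simp only:)
      thus ?thesis using lip by linarith
    qed
    also have "\<dots> \<le> 2 * (1 / s + m2 j / (real k * s)) + 8 * (2 / s + 2 * m4 j / (real k ^ 2 * s)) + (\<epsilon> / 4 + 1 / (4 * \<epsilon>) * (z - A)\<^sup>2)"
    proof -
      have "2 * a + 8 * b + c \<le> 2 * a' + 8 * b' + c'" if "a \<le> a'" "b \<le> b'" "c \<le> c'" for a b c a' b' c' :: real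
        using that by linarith
      from this[OF j1[of j] j3[of j] amgm] show ?thesis .
    qed
    also have "\<dots> \<le> B j"
    proof -
      have "1 / (4 * \<epsilon>) * (z - A)\<^sup>2 \<le> 1 / (4 * \<epsilon>) *
          (m4 j / real k ^ 2 + 4 * (2 / s + 2 * m4 j / (real k ^ 2 * s)) - 2 * A * m2 j / real k + A\<^sup>2)"
        by (rule mult_left_mono[OF var]) (use \<epsilon> in simp)
      from add_left_mono[OF this] show ?thesis unfolding B_def add.assoc[symmetric] .
    qed
    finally show ?thesis .
  qed
  have sB: "(\<lambda>j. v j * B j) sums (W * laguerre_error A k)"
  proof -
    define \<alpha> where "\<alpha> = 2 / s + 16 / s + \<epsilon> / 4 + 1 / (4 * \<epsilon>) * (8 / s + A\<^sup>2)"
    define \<beta> where "\<beta> = 2 / (real k * s) - 1 / (4 * \<epsilon>) * (2 * A / real k)"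
    define \<gamma> where "\<gamma> = 16 / (real k ^ 2 * s) + 1 / (4 * \<epsilon>) * (1 / real k ^ 2 + 8 / (real k ^ 2 * s))"
    have "B j = \<alpha> + \<beta> * m2 j + \<gamma> * m4 j" for j
    proof -
      have "B j = P + \<beta>' * x2 + \<gamma>' * x4" if "P = \<alpha>" "\<beta>' = \<beta>" "\<gamma>' = \<gamma>" "x2 = m2 j" "x4 = m4 j" for P \<beta>' \<gamma>' x2 x4
        unfolding B_def that \<alpha>_def \<beta>_def \<gamma>_def by (simp add: algebra_simps add_divide_distrib)
      thus ?thesis by simp
    qed
    hence e: "v j * B j = \<alpha> * v j + \<beta> * (v j * m2 j) + \<gamma> * (v j * m4 j)" for j by (simp add: algebra_simps)
    have "(\<lambda>j. v j * B j) sums (\<alpha> * W + \<beta> * (x * W) + \<gamma> * (x\<^sup>2 * W))"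
      unfolding e by (intro sums_add sums_mult sv s2 s4)
    moreover have "\<alpha> * W + \<beta> * (x * W) + \<gamma> * (x\<^sup>2 * W) = W * (\<alpha> + \<beta> * x + \<gamma> * x\<^sup>2)" by (simp add: algebra_simps)
    moreover have "\<alpha> + \<beta> * x + \<gamma> * x\<^sup>2 = laguerre_error A k"
    proof -
      have bx: "\<beta> * x = 2 * A / s - 1 / (4 * \<epsilon>) * (2 * A\<^sup>2)" using k s(1) \<epsilon> by (simp add: \<beta>_def x_def field_simps power2_eq_square)
      have gx: "\<gamma> * x\<^sup>2 = 16 * A\<^sup>2 / s + 1 / (4 * \<epsilon>) * (A\<^sup>2 + 8 * A\<^sup>2 / s)"
        using k s(1) \<epsilon> by (simp add: \<gamma>_def x_def field_simps power2_eq_square)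
      have "\<alpha> + \<beta> * x + \<gamma> * x\<^sup>2 = (2 * (1 + A) + 16 * (1 + A\<^sup>2)) / s + \<epsilon> / 4 + 2 * (1 + A\<^sup>2) * (1 / \<epsilon>) / s"
        unfolding bx gx \<alpha>_def using s(1) \<epsilon> by (simp add: field_simps)
      moreover have "1 / \<epsilon> = real k powr (1/4)" using k by (simp add: \<epsilon>_def powr_minus divide_simps)
      ultimately have "\<alpha> + \<beta> * x + \<gamma> * x\<^sup>2 = (2 * (1 + A) + 16 * (1 + A\<^sup>2)) / s + \<epsilon> / 4 +
          2 * (1 + A\<^sup>2) * real k powr (1/4) / s" by (simp only:)
      thus ?thesis by (simp only: laguerre_error_def \<epsilon>_def s_def)
    qed
    ultimately show ?thesis by simp
  qed
  have sd: "summable (\<lambda>j. v j * (ratio k j - exp (- A / 2)))"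
  proof (rule summable_comparison_test'[of "\<lambda>j. v j * B j" 0])
    show "summable (\<lambda>j. v j * B j)" using sB by (simp add: sums_iff)
    show "norm (v j * (ratio k j - exp (- A / 2))) \<le> v j * B j" for j
      using pt[of j] v0[of j] by (simp add: abs_mult mult_left_mono)
  qed
  define \<Delta> where "\<Delta> = (\<Sum>j. v j * (ratio k j - exp (- A / 2)))"
  have \<Delta>: "(\<lambda>j. v j * (ratio k j - exp (- A / 2))) sums \<Delta>" unfolding \<Delta>_def using sd by (rule summable_sums)
  have "\<bar>\<Delta>\<bar> \<le> W * laguerre_error A k"
  proof (rule abs_leI)
    show "\<Delta> \<le> W * laguerre_error A k"
      by (rule sums_le[OF _ \<Delta> sB]) (use pt v0 in \<open>auto intro!: mult_left_mono simp: abs_le_iff\<close>)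
    have "- \<Delta> \<le> W * laguerre_error A k"
    proof (rule sums_le[OF _ sums_minus[OF \<Delta>] sB])
      fix j
      have "v j * - (ratio k j - exp (- A / 2)) \<le> v j * B j" using pt[of j] by (intro mult_left_mono v0) (simp add: abs_le_iff)
      thus "- (v j * (ratio k j - exp (- A / 2))) \<le> v j * B j" by (simp only: mult_minus_right)
    qed
    thus "- \<Delta> \<le> W * laguerre_error A k" .
  qed
  moreover have "(\<lambda>j. v j * (ratio k j - exp (- A / 2)) + exp (- A / 2) * v j) sums (\<Delta> + exp (- A / 2) * W)"
    by (intro sums_add sums_mult \<Delta> sv)
  hence "(\<lambda>j. v j * ratio k j) sums (\<Delta> + exp (- A / 2) * W)" by (simp add: algebra_simps)
  ultimately show ?thesis unfolding v_def W_def x_def by (intro exI[of _ "\<Delta> + exp (- A / 2) * W"]) (simp add: W_def x_def)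
qed

text \<open>Binomial coefficients with \<open>j > k\<close> vanish, so the finite sum for the
  coefficient is the full series.\<close>

lemma laguerre_average:
  assumes k: "k > 0" and E: "(\<lambda>j. (A * real k) ^ j / (fact j * fact (Suc j)) * ratio k j) sums E"
  shows "laguerre_fps A $ k = (real k + 1) * E"
proof -
  have term_eq: "A ^ j / fact j * real (Suc k choose Suc j) = (real k + 1) * ((A * real k) ^ j / (fact j * fact (Suc j)) * ratio k j)" for j
  proof -
    have "real (Suc k choose Suc j) = (real k + 1) * real k ^ j * ratio k j / fact (Suc j)"
      using choose_ratio[OF k, of j] by (metis fact_nonzero nonzero_mult_div_cancel_right)
    thus ?thesis by (simp add: power_mult_distrib)
  qed
  have "(\<lambda>j. A ^ j / fact j * real (Suc k choose Suc j)) sums ((real k + 1) * E)"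
    unfolding term_eq using E by (rule sums_mult)
  moreover have "(\<lambda>j. A ^ j / fact j * real (Suc k choose Suc j)) sums (\<Sum>j\<in>{0..k}. A ^ j / fact j * real (Suc k choose Suc j))"
    by (rule sums_finite) (simp_all add: binomial_eq_0 not_le del: binomial_Suc_Suc)
  ultimately show ?thesis unfolding laguerre_nth by (rule sums_unique2[symmetric])
qed

text \<open>The growth order in Perron's formula for Laguerre polynomials at a negative
  argument.\<close>

definition perron :: "real \<Rightarrow> nat \<Rightarrow> real" where
  "perron A k = real k powr (1/4) * exp (2 * sqrt A * sqrt (real k))"

text \<open>The coefficient is \<open>k + 1\<close> times the weighted sum \<open>E k\<close>, which
  is asymptotically \<open>exp (- A / 2)\<close> times the Bessel series at \<open>A k\<close>;
  \<open>k * k powr (-3/4)\<close> gives the power \<open>1/4\<close>.\<close>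

lemma laguerre_asymp:
  assumes A: "A > 0"
  shows "(\<lambda>k. laguerre_fps A $ k / perron A k) \<longlonglongrightarrow> exp (- A / 2) / (2 * sqrt pi * A powr (3/4))"
proof -
  define good where "good k E \<longleftrightarrow> (\<lambda>j. (A * real k) ^ j / (fact j * fact (Suc j)) * ratio k j) sums E \<and>
     \<bar>E - exp (- A / 2) * bessel_sum (A * real k)\<bar> \<le> bessel_sum (A * real k) * laguerre_error A k" for k E
  define E where "E k = (SOME e. good k e)" for k
  have "good k (E k)" if "k > 0" for k
    unfolding E_def using ratio_average[OF A that] unfolding good_def[symmetric] by (rule someI_ex)
  hence E: "\<And>k. k > 0 \<Longrightarrow> (\<lambda>j. (A * real k) ^ j / (fact j * fact (Suc j)) * ratio k j) sums E k"
    "\<And>k. k > 0 \<Longrightarrow> \<bar>E k - exp (- A / 2) * bessel_sum (A * real k)\<bar> \<le> bessel_sum (A * real k) * laguerre_error A k"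
    by (simp_all only: good_def)
  define W where "W k = bessel_sum (A * real k)" for k :: nat
  have Wpos: "W k > 0" if "k > 0" for k
  proof -
    have "(\<Sum>j\<in>{0}. (A * real k) ^ j / (fact j * fact (Suc j))) \<le> W k"
      unfolding W_def using sum_le_suminf[of "\<lambda>j. (A * real k) ^ j / (fact j * fact (Suc j))" "{0}"] bessel_sum_sums[of "A * real k"] A
      by (simp add: sums_iff)
    thus ?thesis by simp
  qed
  have err: "(\<lambda>k. laguerre_error A k) \<longlonglongrightarrow> 0" unfolding laguerre_error_def by real_asymp
  have q: "(\<lambda>k. E k / W k) \<longlonglongrightarrow> exp (- A / 2)"
  proof (rule LIM_zero_cancel, rule Lim_null_comparison[OF _ err])
    show "eventually (\<lambda>k. norm (E k / W k - exp (- A / 2)) \<le> laguerre_error A k) sequentially"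
      using eventually_gt_at_top[of 0]
    proof eventually_elim
      case (elim k)
      have "E k / W k - exp (- A / 2) = (E k - exp (- A / 2) * W k) / W k" using Wpos[OF elim] by (simp add: field_simps)
      hence "\<bar>E k / W k - exp (- A / 2)\<bar> = \<bar>E k - exp (- A / 2) * W k\<bar> / W k" using Wpos[OF elim] by (simp add: abs_divide)
      also have "\<dots> \<le> laguerre_error A k" using E(2)[OF elim] Wpos[OF elim] by (simp add: W_def field_simps)
      finally show ?case by simp
    qed
  qed
  have "filterlim (\<lambda>k. A * real k) at_top sequentially" using A by real_asymp
  from bessel_sum_asymp[OF this]
  have b: "(\<lambda>k. W k * (A * real k) powr (3/4) * exp (- 2 * sqrt (A * real k))) \<longlonglongrightarrow> 1 / (2 * sqrt pi)"
    by (simp add: W_def)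
  have c: "(\<lambda>k. (real k + 1) / real k) \<longlonglongrightarrow> 1" by real_asymp
  have "(\<lambda>k. (real k + 1) / real k * (E k / W k) * (W k * (A * real k) powr (3/4) * exp (- 2 * sqrt (A * real k))) / A powr (3/4))
     \<longlonglongrightarrow> 1 * exp (- A / 2) * (1 / (2 * sqrt pi)) / A powr (3/4)"
    using A by (intro tendsto_divide tendsto_mult c q b tendsto_const) simp
  moreover have "eventually (\<lambda>k. (real k + 1) / real k * (E k / W k) * (W k * (A * real k) powr (3/4) * exp (- 2 * sqrt (A * real k))) / A powr (3/4)
     = laguerre_fps A $ k / perron A k) sequentially"
    using eventually_gt_at_top[of 0]
  proof eventually_elim
    case (elim k)
    have L: "laguerre_fps A $ k = (real k + 1) * E k" by (rule laguerre_average[OF elim E(1)[OF elim]])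
    have "real k powr (3/4) * real k powr (1/4) = real k" using elim by (simp add: powr_add[symmetric])
    hence k34: "real k powr (3/4) = real k / real k powr (1/4)" using elim by (simp add: field_simps)
    show ?case unfolding L perron_def using Wpos[OF elim] A elim
      by (simp add: powr_mult k34 exp_minus real_sqrt_mult field_simps)
  qed
  ultimately have "(\<lambda>k. laguerre_fps A $ k / perron A k) \<longlonglongrightarrow> 1 * exp (- A / 2) * (1 / (2 * sqrt pi)) / A powr (3/4)"
    by (rule Lim_transform_eventually)
  thus ?thesis by (simp only: mult_1 times_divide_eq_right divide_divide_eq_left mult_1_right)
qed

lemma perron_pos: "k > 0 \<Longrightarrow> perron A k > 0"
  by (simp add: perron_def)

text \<open>\<open>sqrt (k + i) - sqrt k\<close> tends to 0.\<close>

lemma perron_shift: "A > 0 \<Longrightarrow> (\<lambda>k. perron A (k - i) / perron A k) \<longlonglongrightarrow> 1"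
proof -
  assume A: "A > 0"
  have "(\<lambda>k. perron A k / perron A (k + i)) \<longlonglongrightarrow> 1" unfolding perron_def using A by real_asymp
  hence "(\<lambda>k. perron A (k + i - i) / perron A (k + i)) \<longlonglongrightarrow> 1" by simp
  thus ?thesis by (rule LIMSEQ_offset)
qed

lemma asymp_shift:
  assumes "A > 0" "(\<lambda>k. f k / perron A k) \<longlonglongrightarrow> c"
  shows "(\<lambda>k. f (k - i) / perron A k) \<longlonglongrightarrow> c"
proof -
  have "(\<lambda>k. f (k - i) / perron A (k - i)) \<longlonglongrightarrow> c"
    using LIMSEQ_offset[of "\<lambda>k. f (k - i) / perron A (k - i)" i c] assms(2) by simp
  hence "(\<lambda>k. f (k - i) / perron A (k - i) * (perron A (k - i) / perron A k)) \<longlonglongrightarrow> c * 1"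
    by (intro tendsto_mult perron_shift assms(1))
  moreover have "eventually (\<lambda>k. f (k - i) / perron A (k - i) * (perron A (k - i) / perron A k) = f (k - i) / perron A k) sequentially"
    using eventually_gt_at_top[of i] by eventually_elim (use perron_pos in \<open>simp add: less_imp_neq[symmetric]\<close>)
  ultimately have "(\<lambda>k. f (k - i) / perron A k) \<longlonglongrightarrow> c * 1" by (rule Lim_transform_eventually)
  thus ?thesis by simp
qed

text \<open>The factor \<open>exp (A z)\<close> is entire and contributes its value
  \<open>exp A\<close> at the singularity \<open>z = 1\<close>.\<close>

lemma exp_laguerre_asymp:
  assumes A: "A > 0"
  shows "(\<lambda>k. (fps_exp A * laguerre_fps A) $ k / perron A k) \<longlonglongrightarrow> exp (A / 2) / (2 * sqrt pi * A powr (3/4))"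
proof -
  define c where "c = exp (- A / 2) / (2 * sqrt pi * A powr (3/4))"
  define L where "L = fps_nth (laguerre_fps A)"
  define a where "a i k = (if i \<le> k then A ^ i / fact i * (L (k - i) / perron A k) else 0)" for i k
  have l: "(\<lambda>k. L k / perron A k) \<longlonglongrightarrow> c" unfolding L_def c_def by (rule laguerre_asymp[OF A])
  obtain K where "\<forall>k. norm (L k / perron A k) \<le> K"
    by (rule BseqE[OF convergent_imp_Bseq[OF convergentI[OF l]]])
  hence K: "\<bar>L k / perron A k\<bar> \<le> K" for k by simp
  have K0: "0 \<le> K" using K[of 0] by (meson abs_ge_zero order_trans)
  have lim: "(\<lambda>k. a i k) \<longlonglongrightarrow> A ^ i / fact i * c" for i
  proof -
    have "(\<lambda>k. A ^ i / fact i * (L (k - i) / perron A k)) \<longlonglongrightarrow> A ^ i / fact i * c"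
      by (intro tendsto_mult tendsto_const asymp_shift[OF A l])
    moreover have "eventually (\<lambda>k. A ^ i / fact i * (L (k - i) / perron A k) = a i k) sequentially"
      using eventually_ge_at_top[of i] by eventually_elim (simp add: a_def)
    ultimately show ?thesis by (rule Lim_transform_eventually)
  qed
  have bd: "norm (a i k) \<le> A ^ i / fact i * K" for i k
  proof (cases "i \<le> k")
    case True
    have "0 \<le> L (k - i)" "L (k - i) \<le> L k" using A nonneg_laguerre[of A] laguerre_mono[of A "k - i" k] by (simp_all add: L_def)
    moreover have "0 \<le> perron A k" by (simp add: perron_def)
    ultimately have "\<bar>L (k - i) / perron A k\<bar> \<le> \<bar>L k / perron A k\<bar>"
      by (simp add: abs_divide divide_right_mono)
    hence "\<bar>L (k - i) / perron A k\<bar> \<le> K" using K[of k] by linarith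
    hence "A ^ i / fact i * \<bar>L (k - i) / perron A k\<bar> \<le> A ^ i / fact i * K" using A by (intro mult_left_mono) auto
    thus ?thesis using True A by (simp add: a_def abs_mult)
  qed (use A K0 in \<open>simp add: a_def\<close>)
  have expA: "(\<lambda>i. A ^ i / fact i) sums exp A" using exp_converges[of A] by (simp add: divide_inverse mult.commute)
  have "(\<lambda>k. suminf (\<lambda>i. a i k)) \<longlonglongrightarrow> suminf (\<lambda>i. A ^ i / fact i * c)"
  proof (rule tannerys_theorem[THEN conjunct2, THEN conjunct2])
    show "(\<lambda>k. a i k) \<longlonglongrightarrow> A ^ i / fact i * c" for i by (rule lim)
    show "eventually (\<lambda>(i, k). norm (a i k) \<le> A ^ i / fact i * K) (at_top \<times>\<^sub>F sequentially)"
      by (rule always_eventually) (use bd in auto)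
    show "summable (\<lambda>i. A ^ i / fact i * K)" using expA by (intro summable_mult2) (simp add: sums_iff)
  qed simp
  moreover have "suminf (\<lambda>i. A ^ i / fact i * c) = exp A * c"
    using sums_mult2[OF expA, of c] by (simp add: sums_iff)
  moreover have "suminf (\<lambda>i. a i k) = (fps_exp A * laguerre_fps A) $ k / perron A k" for k
  proof -
    have "suminf (\<lambda>i. a i k) = (\<Sum>i\<le>k. a i k)" by (rule suminf_finite) (auto simp: a_def)
    also have "\<dots> = (fps_exp A * laguerre_fps A) $ k / perron A k"
      by (simp add: a_def fps_mult_nth atMost_atLeast0 sum_divide_distrib L_def)
    finally show ?thesis .
  qed
  moreover have "exp A * c = exp (A / 2) / (2 * sqrt pi * A powr (3/4))"
  proof -
    have "exp A * exp (- A / 2) = exp (A / 2)" by (simp add: exp_add[symmetric])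
    thus ?thesis by (simp add: c_def)
  qed
  ultimately show ?thesis by simp
qed

section \<open>The limit law in the variable \<open>z = q w\<close>\<close>

definition degree_fps :: "real \<Rightarrow> real \<Rightarrow> real \<Rightarrow> real \<Rightarrow> real fps" where
  "degree_fps A a1 a2 a3 = (let M = fps_exp A * laguerre_fps A in
     fps_const a1 * (fps_X * M) + fps_const a2 * (fps_X * (fps_X * M)) + fps_const a3 * (fps_X * (fps_X * (fps_X * M))))"

lemma degree_fps_sums:
  assumes "A > 0" "\<bar>z\<bar> < 1"
  shows "fps_sums (degree_fps A a1 a2 a3) z
     ((a1 * z + a2 * z\<^sup>2 + a3 * z ^ 3) * (exp (A * z) * (exp (A * (z / (1 - z))) * (1 / (1 - z)) ^ 2)))"
proof -
  let ?M = "exp (A * z) * (exp (A * (z / (1 - z))) * (1 / (1 - z)) ^ 2)"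
  have M: "fps_sums (fps_exp A * laguerre_fps A) z ?M"
    by (rule fps_sums_mult_abs[OF nonneg_fps_exp nonneg_laguerre fps_sums_exp laguerre_sums fps_sums_exp laguerre_sums])
      (use assms in auto)
  have "fps_sums (degree_fps A a1 a2 a3) z (a1 * (z * ?M) + a2 * (z * (z * ?M)) + a3 * (z * (z * (z * ?M))))"
    unfolding degree_fps_def Let_def by (intro fps_sums_add fps_sums_cmult fps_sums_X_mult M)
  moreover have "a1 * (z * m) + a2 * (z * (z * m)) + a3 * (z * (z * (z * m))) = (a1 * z + a2 * z\<^sup>2 + a3 * z ^ 3) * m" for m
    by (simp add: algebra_simps power2_eq_square power3_eq_cube)
  ultimately show ?thesis by (simp only:)
qed

text \<open>A shift of the index does not change the asymptotics, so the cubic factor contributes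
  its value at \<open>z = 1\<close>.\<close>

lemma degree_fps_asymp:
  assumes A: "A > 0"
  shows "(\<lambda>k. degree_fps A a1 a2 a3 $ k / perron A k) \<longlonglongrightarrow> (a1 + a2 + a3) * (exp (A / 2) / (2 * sqrt pi * A powr (3/4)))"
proof -
  define M where "M = fps_exp A * laguerre_fps A"
  define c where "c = exp (A / 2) / (2 * sqrt pi * A powr (3/4))"
  have l: "(\<lambda>k. M $ k / perron A k) \<longlonglongrightarrow> c" unfolding M_def c_def by (rule exp_laguerre_asymp[OF A])
  have "(\<lambda>k. a1 * (M $ (k - 1) / perron A k) + a2 * (M $ (k - 2) / perron A k) + a3 * (M $ (k - 3) / perron A k))
     \<longlonglongrightarrow> a1 * c + a2 * c + a3 * c"
    by (intro tendsto_add tendsto_mult tendsto_const asymp_shift[OF A l])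
  moreover have "eventually (\<lambda>k. a1 * (M $ (k - 1) / perron A k) + a2 * (M $ (k - 2) / perron A k) + a3 * (M $ (k - 3) / perron A k)
     = degree_fps A a1 a2 a3 $ k / perron A k) sequentially"
    using eventually_ge_at_top[of 3]
  proof eventually_elim
    case (elim k)
    define n where "n = k - 3"
    have n: "k = Suc (Suc (Suc n))" using elim by (simp add: n_def)
    show ?case unfolding degree_fps_def Let_def M_def[symmetric] n
      by (simp add: add_divide_distrib numeral_2_eq_2 numeral_3_eq_3)
  qed
  ultimately have "(\<lambda>k. degree_fps A a1 a2 a3 $ k / perron A k) \<longlonglongrightarrow> a1 * c + a2 * c + a3 * c"
    by (rule Lim_transform_eventually)
  thus ?thesis by (simp add: c_def algebra_simps add_divide_distrib)
qed

section \<open>The critical point\<close>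

lemma nonneg_dis_fps: "0 \<le> w \<Longrightarrow> nonneg_fps (dis_fps w)"
  by (auto simp: nonneg_fps_def dis_fps_def dis_sum_def intro!: sum_nonneg)

lemma nonneg_block_fps: "0 \<le> w \<Longrightarrow> nonneg_fps (block_fps w)"
  using nonneg_dis_fps[of w] by (simp add: nonneg_fps_def block_fps_def fps_X_def)

lemma nonneg_H_fps: "0 \<le> w \<Longrightarrow> nonneg_fps (H_fps w)"
  unfolding H_fps_def by (intro nonneg_fps_compose nonneg_block_fps) (simp_all add: nonneg_fps_def)

lemma nonneg_T_fps: "nonneg_fps T_fps"
  by (simp add: nonneg_fps_def T_fps_nth)

section \<open>Closed forms of the block series\<close>

definition disc_root :: "real \<Rightarrow> real" where
  "disc_root x = sqrt (1 - 6 * x + x\<^sup>2)"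

text \<open>For \<open>x > 0\<close>, \<open>1 / arm x\<close> is the pole of
  \<open>w \<mapsto> B_bullet x w\<close>; at \<open>tau\<close> the value is
  \<open>q\<close>.\<close>

definition arm :: "real \<Rightarrow> real" where
  "arm x = 2 * D x - x"

lemma D_eq: "D x = (1 + x - disc_root x) / 4"
  by (simp add: D_def disc_root_def)

lemma four_D: "4 * D x = 1 + x - disc_root x"
proof -
  have "4 * (y / 4) = y" for y :: real by simp
  thus ?thesis unfolding D_eq .
qed

lemma arm_eq: "arm x = (1 - x - disc_root x) / 2"
  by (simp add: arm_def D_eq)

text \<open>These conditions say \<open>0 \<le> x \<le> 3 - 2 sqrt 2\<close>, up to and including
  the branch point of \<open>D\<close>.\<close>

context
  fixes x :: real
  assumes x: "0 \<le> x" "x < 1" "0 \<le> 1 - 6 * x + x\<^sup>2"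
begin

lemma disc_root_sq: "disc_root x ^ 2 = 1 - 6 * x + x\<^sup>2"
  using x by (simp add: disc_root_def)

lemma disc_root_nonneg: "0 \<le> disc_root x"
  using x by (simp add: disc_root_def)

lemma disc_root_le: "disc_root x \<le> 1 - x"
proof (rule power2_le_imp_le)
  show "(disc_root x)\<^sup>2 \<le> (1 - x)\<^sup>2" using x unfolding disc_root_sq by (simp add: power2_eq_square algebra_simps)
qed (use x in simp)

lemma arm_nonneg: "0 \<le> arm x"
  using disc_root_le by (simp add: arm_eq)

lemma arm_less: "arm x < 1"
  using disc_root_nonneg x by (simp add: arm_eq)

lemma D_quadratic: "2 * D x * D x - (1 + x) * D x + x = 0"
proof -
  have "disc_root x * disc_root x = 1 - 6 * x + x * x" using disc_root_sq by (simp add: power2_eq_square)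
  moreover have "disc_root x = 1 + x - 4 * D x" using four_D[of x] by linarith
  ultimately have "8 * (2 * D x * D x - (1 + x) * D x + x) = 0" by algebra
  thus ?thesis by simp
qed

text \<open>The quadratic for \<open>F = dis_fps 1\<close> is rewritten as a tree equation
  \<open>F = X \<phi>(F)\<close> with \<open>\<phi>(u) = 1 + u / (1 - 2 u)\<close>, which has
  nonnegative coefficients, so that \<open>fps_tree_sums\<close> with the supersolution
  \<open>D x\<close> yields convergence.\<close>

lemma dis_fps_1_sums: "fps_sums (dis_fps 1) x (D x)"
proof -
  define F where "F = dis_fps 1"
  define G where "G = Abs_fps (\<lambda>i. 2 ^ i :: real)"
  define \<phi> where "\<phi> = 1 + fps_X * G"
  define g where "g = G oo F"
  have F0: "F $ 0 = 0" by (simp add: F_def)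
  have F: "F = fps_X + F * (2 * F - fps_X)" using dis_fps_eq[of 1] by (simp add: F_def)
  have G: "G = 1 + 2 * (fps_X * G)"
  proof (rule fps_ext)
    fix n show "G $ n = (1 + 2 * (fps_X * G)) $ n"
      by (cases n) (simp_all add: G_def numeral_fps_const)
  qed
  have "g = (1 + 2 * (fps_X * G)) oo F" unfolding g_def by (subst G) (rule refl)
  also have "\<dots> = 1 + 2 * (F * g)"
    using F0 by (simp add: fps_compose_add_distrib fps_compose_mult_distrib numeral_fps_const g_def)
  finally have g: "g = 1 + 2 * (F * g)" .
  have \<phi>F: "\<phi> oo F = 1 + F * g"
    using F0 by (simp add: \<phi>_def fps_compose_add_distrib fps_compose_mult_distrib g_def)
  have tree: "F = fps_X * (\<phi> oo F)"
  proof -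
    have "(1 - 2 * F) * F = fps_X * (1 - F)" using F by algebra
    moreover have "(1 - 2 * F) * (fps_X * (1 + F * g)) = fps_X * (1 - F)" using g by algebra
    ultimately have "(1 - 2 * F) * F = (1 - 2 * F) * (fps_X * (1 + F * g))" by simp
    moreover have "1 - 2 * F \<noteq> 0"
    proof
      assume "1 - 2 * F = 0"
      hence "(1 - 2 * F) $ 0 = 0" by simp
      thus False using F0 by (simp add: numeral_fps_const)
    qed
    ultimately show ?thesis unfolding \<phi>F by simp
  qed
  define d where "d = D x"
  have d: "0 \<le> d" "d < 1 / 2" using disc_root_le disc_root_nonneg x by (simp_all add: d_def D_eq)
  have q: "2 * d * d - (1 + x) * d + x = 0" unfolding d_def by (rule D_quadratic)
  have "fps_sums G d (1 / (1 - 2 * d))"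
    using geometric_sums[of "2 * d"] d by (simp add: fps_sums_def G_def power_mult_distrib)
  hence \<phi>s: "fps_sums \<phi> d (1 + d * (1 / (1 - 2 * d)))" unfolding \<phi>_def
    by (intro fps_sums_add fps_sums_X_mult) (simp_all add: fps_sums_one)
  have "nonneg_fps \<phi>" unfolding \<phi>_def by (auto simp: nonneg_fps_def G_def fps_X_mult_nth)
  moreover have "nonneg_fps F" unfolding F_def by (rule nonneg_dis_fps) simp
  moreover have "x * (1 + d * (1 / (1 - 2 * d))) \<le> d"
  proof -
    have "x * (1 + d * (1 / (1 - 2 * d))) = (x * (1 - d)) / (1 - 2 * d)" using d by (simp add: field_simps)
    also have "x * (1 - d) = d * (1 - 2 * d)" using q by (simp add: algebra_simps)
    also have "\<dots> / (1 - 2 * d) = d" using d by simp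
    finally show ?thesis by simp
  qed
  ultimately obtain t where t: "0 \<le> t" "t \<le> d" "fps_sums F x t"
    using fps_tree_sums[OF _ _ F0 tree x(1) d(1) \<phi>s] by blast
  have F2: "F + fps_X * F = fps_X + fps_const 2 * (F * F)" using F by (simp add: numeral_fps_const algebra_simps)
  have "fps_sums (F + fps_X * F) x (t + x * t)" by (intro fps_sums_add fps_sums_X_mult t)
  moreover have "fps_sums (fps_X + fps_const 2 * (F * F)) x (x + 2 * (t * t))"
    by (intro fps_sums_add fps_sums_X fps_sums_cmult fps_sums_mult t x nonneg_dis_fps[of 1, folded F_def]) auto
  ultimately have "t + x * t = x + 2 * (t * t)" unfolding F2 by (rule fps_sums_unique)
  \<comment> \<open>The two roots of the quadratic add up to \<open>(1 + x) / 2\<close>, and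
    \<open>d\<close> is the smaller one; a value \<open>t \<le> d\<close> must therefore be
    \<open>d\<close>.\<close>
  hence "(t - d) * (1 + x - 2 * (t + d)) = 0" using q by (simp add: algebra_simps)
  moreover have "4 * d \<le> 1 + x" using disc_root_nonneg by (simp add: d_def D_eq)
  ultimately have "t = d" using t(2) by auto
  thus ?thesis using t(3) by (simp add: F_def d_def)
qed

lemma dis_sum_mono: "0 \<le> w \<Longrightarrow> w \<le> 1 \<Longrightarrow> dis_sum w m \<le> dis_sum 1 m"
  unfolding dis_sum_def by (intro sum_mono) (simp add: power_le_one)

text \<open>Comparison with \<open>w = 1\<close> gives convergence, and the linear equation
  \<open>dis_fps_eq\<close> then determines the value.\<close>

lemma dis_fps_sums:
  assumes w: "0 \<le> w" "w \<le> 1"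
  shows "fps_sums (dis_fps w) x (w * x / (1 - w * arm x))"
proof -
  define F where "F = dis_fps w"
  have "summable (\<lambda>n. F $ n * x ^ n)"
  proof (rule summable_comparison_test'[of "\<lambda>n. dis_fps 1 $ n * x ^ n" 0])
    show "summable (\<lambda>n. dis_fps 1 $ n * x ^ n)" using dis_fps_1_sums by (auto simp: fps_sums_def sums_iff)
    show "norm (F $ n * x ^ n) \<le> dis_fps 1 $ n * x ^ n" for n
    proof -
      have "0 \<le> F $ n" using nonneg_dis_fps[OF w(1)] by (simp add: F_def)
      moreover have "F $ n \<le> dis_fps 1 $ n" using dis_sum_mono[OF w] by (simp add: F_def dis_fps_def)
      ultimately show ?thesis using x(1) by (simp add: abs_mult mult_right_mono)
    qed
  qed
  then obtain y where y: "fps_sums F x y" by (auto simp: fps_sums_def summable_def)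
  have "F = fps_const w * fps_X + fps_const w * (F * (2 * dis_fps 1 - fps_X))" unfolding F_def by (rule dis_fps_eq)
  hence e: "F + fps_const w * (fps_X * F) = fps_const w * fps_X + fps_const w * (F * (dis_fps 1 + dis_fps 1))"
    by (simp add: algebra_simps)
  have nF: "nonneg_fps F" and n1: "nonneg_fps (dis_fps 1 + dis_fps 1)"
    using nonneg_dis_fps[OF w(1)] nonneg_dis_fps[of 1] by (simp_all add: F_def nonneg_fps_def)
  have "fps_sums (F + fps_const w * (fps_X * F)) x (y + w * (x * y))"
    by (intro fps_sums_add fps_sums_cmult fps_sums_X_mult y)
  moreover have "fps_sums (fps_const w * fps_X + fps_const w * (F * (dis_fps 1 + dis_fps 1))) x (w * x + w * (y * (D x + D x)))"
    by (intro fps_sums_add fps_sums_cmult fps_sums_X fps_sums_mult[OF nF n1] y dis_fps_1_sums x)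
  ultimately have "y + w * (x * y) = w * x + w * (y * (D x + D x))" unfolding e by (rule fps_sums_unique)
  hence "y * (1 - w * arm x) = w * x" by (simp add: arm_def algebra_simps)
  moreover have "w * arm x \<le> 1 * arm x" using w arm_nonneg by (intro mult_right_mono) auto
  hence "1 - w * arm x \<noteq> 0" using arm_less by linarith
  ultimately have "y = w * x / (1 - w * arm x)" by (simp add: eq_divide_eq)
  thus ?thesis using y by (simp add: F_def)
qed

lemma H_fps_sums:
  assumes w: "0 \<le> w" "w \<le> 1"
  shows "fps_sums (H_fps w) x (exp (B_bullet x w))"
proof -
  have "fps_sums (block_fps w) x (1 / 2 * (w * x / (1 - w * arm x) + w * x))"
    unfolding block_fps_def by (intro fps_sums_cmult fps_sums_add dis_fps_sums fps_sums_X w)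
  moreover have "w * arm x \<le> 1 * arm x" using w arm_nonneg by (intro mult_right_mono) auto
  hence "1 - w * arm x \<noteq> 0" using arm_less by linarith
  hence "1 / 2 * (w * x / (1 - w * arm x) + w * x) = B_bullet x w"
    by (simp add: B_bullet_def arm_def[symmetric] divide_simps power2_eq_square) (simp add: algebra_simps)
  ultimately have "fps_sums (block_fps w) x (B_bullet x w)" by simp
  moreover have "fps_sums (fps_exp 1) (B_bullet x w) (exp (B_bullet x w))"
    using fps_sums_exp[of 1 "B_bullet x w"] by simp
  ultimately show ?thesis unfolding H_fps_def
    by (intro fps_sums_compose nonneg_block_fps x w) (auto simp: nonneg_fps_def)
qed

text \<open>The right side is \<open>B'(x)\<close>. By \<open>D_quadratic\<close>,
  \<open>x * arm x / (1 - arm x) = D x - x\<close>.\<close>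

lemma B_bullet_1: "B_bullet x 1 = (1 + 5 * x - disc_root x) / 8"
proof -
  have "(D x - x) * (1 - arm x) = x * arm x" using D_quadratic by (simp add: arm_def algebra_simps)
  hence "x * arm x / (1 - arm x) = D x - x" using arm_less by (simp add: field_simps)
  moreover have "B_bullet x 1 = x + (x * arm x / (1 - arm x)) / 2" by (simp add: B_bullet_def arm_def)
  ultimately have "B_bullet x 1 = x + (D x - x) / 2" by (simp only:)
  moreover have "2 * (x + (d - x) / 2) = x + d" for d by (simp add: field_simps)
  ultimately have "2 * B_bullet x 1 = x + D x" by simp
  hence "8 * B_bullet x 1 = 1 + 5 * x - disc_root x" using four_D[of x] by linarith
  thus ?thesis by simp
qed

end

text \<open>The derivative series is summed by differentiating the closed form \<open>F\<close>; the
  room between \<open>t\<close> and \<open>r\<close> makes \<open>t\<close> an interior point of the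
  disc.\<close>

lemma fps_sums_deriv:
  assumes r: "0 < t" "t < r" and f: "\<And>x. 0 \<le> x \<Longrightarrow> x \<le> r \<Longrightarrow> fps_sums f x (F x)"
    and F: "(F has_real_derivative F') (at t)"
  shows "fps_sums (fps_deriv f) t F'"
proof -
  have "summable (\<lambda>n. f $ n * r ^ n)" using f[of r] r by (auto simp: fps_sums_def sums_iff)
  hence R: "fps_conv_radius f \<ge> norm r" unfolding fps_conv_radius_def by (rule conv_radius_geI)
  have tr: "ereal (norm t) < norm r" using r by simp
  have t1: "ereal (norm t) < fps_conv_radius f" using tr R by (rule less_le_trans)
  have t2: "ereal (norm t) < fps_conv_radius (fps_deriv f)" using t1 fps_conv_radius_deriv[of f] by (rule less_le_trans)
  have "(eval_fps f has_real_derivative eval_fps (fps_deriv f) t) (at t)" by (rule has_field_derivative_eval_fps[OF t1])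
  moreover have "eventually (\<lambda>x. eval_fps f x = F x) (nhds t)"
  proof -
    have "eventually (\<lambda>x. x \<in> {0<..<r}) (nhds t)" using r by (intro eventually_nhds_in_open) auto
    thus ?thesis
    proof eventually_elim
      case (elim x)
      hence "fps_sums f x (F x)" by (intro f) auto
      thus ?case by (simp add: fps_sums_def eval_fps_def sums_iff)
    qed
  qed
  hence "((eval_fps f has_real_derivative F') (at t)) = ((F has_real_derivative F') (at t))"
    by (intro DERIV_cong_ev) auto
  ultimately have "eval_fps (fps_deriv f) t = F'" using F DERIV_unique by blast
  thus ?thesis using sums_eval_fps[OF t2] by (simp add: fps_sums_def)
qed

text \<open>Apply \<open>x d/dx\<close> three times; this does not shrink the disc of
  convergence.\<close>

lemma third_moment_summable:
  assumes r: "0 < t" "t < r" and s: "summable (\<lambda>n. f $ n * r ^ n)"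
  shows "summable (\<lambda>n. real n ^ 3 * (f $ n * t ^ n))"
proof -
  have R: "fps_conv_radius f \<ge> ereal r" using conv_radius_geI[OF s] r by (simp add: fps_conv_radius_def)
  have step: "fps_conv_radius (fps_X * fps_deriv h) \<ge> ereal r" if "fps_conv_radius h \<ge> ereal r" for h :: "real fps"
  proof -
    have "ereal r \<le> fps_conv_radius (fps_deriv h)" using that fps_conv_radius_deriv[of h] by (rule order_trans)
    thus ?thesis using fps_conv_radius_mult[of fps_X "fps_deriv h"] by (simp add: min_def split: if_splits)
  qed
  define h where "h = fps_X * fps_deriv (fps_X * fps_deriv (fps_X * fps_deriv f))"
  have "fps_conv_radius h \<ge> ereal r" unfolding h_def by (intro step R)
  moreover have "ereal (norm t) < ereal r" using r by simp
  ultimately have "ereal (norm t) < fps_conv_radius h" by (rule less_le_trans[rotated])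
  hence "summable (\<lambda>n. h $ n * t ^ n)" by (rule summable_fps)
  moreover have e: "(fps_X * fps_deriv k) $ n = real n * k $ n" for k :: "real fps" and n by (cases n) simp_all
  have "h $ n = real n ^ 3 * f $ n" for n unfolding h_def e power3_eq_cube by (simp only: mult.assoc)
  ultimately show ?thesis by (simp add: mult.assoc)
qed

text \<open>\<open>crit\<close> is \<open>t B''(t) = 1\<close>, that is
  \<open>\<psi>'(t) = 0\<close>, cleared of denominators. The interval is narrow enough for the
  digits of the final constants. The number stays abstract because \<open>tau\<close> is a value of
  the counting series, computed only in \<open>tau_eq\<close>.\<close>

locale critical_point =
  fixes t :: real
  assumes t_lower: "0.1707649868 \<le> t" and t_upper: "t \<le> 0.1707649869"
    and crit: "(8 - 5 * t) * disc_root t = (3 - t) * t"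

lemma critical_point_exists: "\<exists>t. critical_point t"
proof -
  let ?f = "\<lambda>x. (8 - 5 * x) * disc_root x - (3 - x) * x"
  have "\<exists>x\<ge>0.1707649868. x \<le> 0.1707649869 \<and> ?f x = 0"
  proof (rule IVT2')
    have "(3 - 0.1707649868) * 0.1707649868 / (8 - 5 * 0.1707649868) \<le> disc_root 0.1707649868"
      unfolding disc_root_def by (rule real_le_rsqrt) (simp add: power2_eq_square)
    thus "0 \<le> ?f 0.1707649868" by simp
    have "disc_root 0.1707649869 \<le> (3 - 0.1707649869) * 0.1707649869 / (8 - 5 * 0.1707649869)"
      unfolding disc_root_def by (rule real_le_lsqrt) (simp_all add: power2_eq_square)
    thus "?f 0.1707649869 \<le> 0" by simp
    show "continuous_on {0.1707649868..0.1707649869} ?f" unfolding disc_root_def by (intro continuous_intros)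
  qed simp
  thus ?thesis unfolding critical_point_def by auto
qed

context critical_point
begin

text \<open>A point strictly between \<open>t\<close> and the branch point
  \<open>3 - 2 sqrt 2\<close> of \<open>D\<close>; it makes \<open>t\<close> an interior point for
  derivatives and moments.\<close>

definition r :: real where "r = 0.1715"
definition \<Phi> :: real where "\<Phi> = exp (B_bullet t 1)"
definition radius :: real where "radius = t / \<Phi>"
text \<open>\<open>arm'\<close> and \<open>H' w\<close> are the derivatives of \<open>arm\<close>
  and of \<open>x \<mapsto> exp (B_bullet x w)\<close> at \<open>t\<close>, in closed form.\<close>

definition arm' :: real where "arm' = ((3 - t) / disc_root t - 1) / 2"
definition H' :: "real \<Rightarrow> real" where
  "H' w = exp (B_bullet t w) * (w + w\<^sup>2 / 2 * (arm t / (1 - arm t * w)) + t * w\<^sup>2 / 2 * (arm' / (1 - arm t * w)\<^sup>2))"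

lemma t_r: "0 < t" "t < r"
  using t_lower t_upper by (simp_all add: r_def)

lemma dom: "0 \<le> x \<Longrightarrow> x \<le> r \<Longrightarrow> x < 1 \<and> 0 \<le> 1 - 6 * x + x\<^sup>2"
proof -
  assume x: "0 \<le> x" "x \<le> r"
  have "0 \<le> (r - x) * (6 - r - x)" using x by (intro mult_nonneg_nonneg) (auto simp: r_def)
  also have "\<dots> = (1 - 6 * x + x\<^sup>2) - (1 - 6 * r + r\<^sup>2)" by (simp add: power2_eq_square algebra_simps)
  finally show ?thesis using x by (simp add: r_def power2_eq_square)
qed

lemma t_dom: "0 \<le> t" "t < 1" "0 \<le> 1 - 6 * t + t\<^sup>2"
  using dom[of t] t_r by auto

lemma disc_root_pos: "0 < disc_root t"
proof -
  have "0 < (3 - t) * t" using t_dom t_r by simp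
  hence "0 < (8 - 5 * t) * disc_root t" unfolding crit .
  thus ?thesis using disc_root_nonneg[OF t_dom] by (cases "disc_root t = 0") auto
qed

lemma \<Phi>_pos: "0 < \<Phi>" by (simp add: \<Phi>_def)

lemma radius_pos: "0 < radius" using t_r \<Phi>_pos by (simp add: radius_def)

lemma disc_root_deriv: "(disc_root has_real_derivative ((t - 3) / disc_root t)) (at t)"
proof -
  have p: "0 < 1 - 6 * t + t\<^sup>2" using disc_root_pos by (simp add: disc_root_def)
  have "((\<lambda>x. sqrt (1 - 6 * x + x\<^sup>2)) has_real_derivative (inverse (sqrt (1 - 6 * t + t\<^sup>2)) / 2) * (2 * t - 6)) (at t)"
    by (rule DERIV_chain2[where g = "\<lambda>x. 1 - 6 * x + x\<^sup>2", OF DERIV_real_sqrt[OF p]])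
      (auto intro!: derivative_eq_intros)
  moreover have "(inverse (sqrt (1 - 6 * t + t\<^sup>2)) / 2) * (2 * t - 6) = (t - 3) / disc_root t"
  proof -
    have e: "2 * t - 6 = 2 * (t - 3)" by simp
    have "inverse s / 2 * (2 * y) = y / s" for s y :: real by (cases "s = 0") (simp_all add: field_simps)
    thus ?thesis unfolding e disc_root_def .
  qed
  ultimately have "((\<lambda>x. sqrt (1 - 6 * x + x\<^sup>2)) has_real_derivative (t - 3) / disc_root t) (at t)" by (simp only:)
  moreover have "disc_root = (\<lambda>x. sqrt (1 - 6 * x + x\<^sup>2))" by (rule ext) (rule disc_root_def)
  ultimately show ?thesis by (simp only:)
qed

lemma arm_deriv: "(arm has_real_derivative arm') (at t)"
proof -
  have "((\<lambda>x. (1 - x - disc_root x) / 2) has_real_derivative (0 - 1 - (t - 3) / disc_root t) / 2) (at t)"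
    by (intro DERIV_cdivide DERIV_diff DERIV_const DERIV_ident disc_root_deriv)
  moreover have "(0 - 1 - (t - 3) / disc_root t) / 2 = arm'" by (simp add: arm'_def diff_divide_distrib)
  ultimately show ?thesis using arm_eq[abs_def] by simp
qed

lemma exp_B_deriv:
  assumes "\<bar>w\<bar> * arm t < 1"
  shows "((\<lambda>x. exp (B_bullet x w)) has_real_derivative H' w) (at t)"
proof -
  have "arm t * w \<le> \<bar>w\<bar> * arm t" using arm_nonneg[OF t_dom] by (simp add: mult.commute[of "arm t"] mult_right_mono)
  hence n: "1 - arm t * w \<noteq> 0" using assms by linarith
  have q: "((\<lambda>x. arm x / (1 - arm x * w)) has_real_derivative (arm' * (1 - arm t * w) - arm t * (0 - arm' * w)) / ((1 - arm t * w) * (1 - arm t * w))) (at t)"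
    using n by (intro DERIV_divide DERIV_diff DERIV_const DERIV_cmult_right arm_deriv)
  have "(arm' * (1 - arm t * w) - arm t * (0 - arm' * w)) / ((1 - arm t * w) * (1 - arm t * w)) = arm' / (1 - arm t * w)\<^sup>2"
    by (simp add: power2_eq_square algebra_simps)
  note q = q[unfolded this]
  have der: "((\<lambda>x. x * w + x * w\<^sup>2 / 2 * (arm x / (1 - arm x * w))) has_real_derivative
     (1 * w + (w\<^sup>2 / 2 * 1 * (arm t / (1 - arm t * w)) + arm' / (1 - arm t * w)\<^sup>2 * (t * w\<^sup>2 / 2)))) (at t)"
    by (intro DERIV_add DERIV_mult q DERIV_cmult_right DERIV_ident) (auto intro!: derivative_eq_intros)
  have B: "((\<lambda>x. B_bullet x w) has_real_derivative
      (w + w\<^sup>2 / 2 * (arm t / (1 - arm t * w)) + t * w\<^sup>2 / 2 * (arm' / (1 - arm t * w)\<^sup>2))) (at t)"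
  proof -
    have e: "B_bullet x w = x * w + x * w\<^sup>2 / 2 * (arm x / (1 - arm x * w))" for x by (simp add: B_bullet_def arm_def)
    have "1 * w + (w\<^sup>2 / 2 * 1 * Q + X * (t * w\<^sup>2 / 2)) = w + w\<^sup>2 / 2 * Q + t * w\<^sup>2 / 2 * X" for Q X by simp
    thus ?thesis using der unfolding e by (simp only:)
  qed
  show ?thesis unfolding H'_def by (rule DERIV_chain2[OF DERIV_exp B])
qed

text \<open>The logarithmic derivative of \<open>exp (B')\<close> at \<open>t\<close> is
  \<open>B''(t)\<close>, which is \<open>1 / t\<close> by \<open>crit\<close>. This identity makes
  the offspring law critical and the limit probabilities sum to 1.\<close>

lemma H'_1: "H' 1 = 1 / radius"
proof -
  have "eventually (\<lambda>x. x \<in> {0<..<r}) (nhds t)" using t_r by (intro eventually_nhds_in_open) auto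
  hence ev: "eventually (\<lambda>x. exp (B_bullet x 1) = exp ((1 + 5 * x - disc_root x) / 8)) (nhds t)"
  proof eventually_elim
    case (elim x)
    hence "B_bullet x 1 = (1 + 5 * x - disc_root x) / 8" using dom[of x] by (intro B_bullet_1) auto
    thus ?case by simp
  qed
  have "((\<lambda>x. (1 + 5 * x - disc_root x) / 8) has_real_derivative (0 + 5 * 1 - (t - 3) / disc_root t) / 8) (at t)"
    by (intro DERIV_cdivide DERIV_diff DERIV_add DERIV_const DERIV_cmult DERIV_ident disc_root_deriv)
  hence "((\<lambda>x. exp ((1 + 5 * x - disc_root x) / 8)) has_real_derivative
     exp ((1 + 5 * t - disc_root t) / 8) * ((0 + 5 * 1 - (t - 3) / disc_root t) / 8)) (at t)"
    by (rule DERIV_chain2[OF DERIV_exp])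
  moreover have "(0 + 5 * 1 - (t - 3) / disc_root t) / 8 = 1 / t"
  proof -
    have "(8 - 5 * t) * disc_root t / t = (3 - t) * t / t" unfolding crit ..
    hence "3 - t = (8 - 5 * t) / t * disc_root t" using t_r by simp
    hence "(3 - t) / disc_root t = (8 - 5 * t) / t" using disc_root_pos by (metis less_irrefl nonzero_mult_div_cancel_right)
    moreover have "(t - 3) / disc_root t = - ((3 - t) / disc_root t)" by (simp add: minus_divide_left)
    ultimately show ?thesis using t_r by (simp add: field_simps)
  qed
  moreover have "(1 + 5 * t - disc_root t) / 8 = B_bullet t 1" by (rule B_bullet_1[OF t_dom, symmetric])
  ultimately have "((\<lambda>x. exp ((1 + 5 * x - disc_root x) / 8)) has_real_derivative \<Phi> * (1 / t)) (at t)" by (simp add: \<Phi>_def)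
  hence "((\<lambda>x. exp (B_bullet x 1)) has_real_derivative \<Phi> * (1 / t)) (at t)"
    by (subst DERIV_cong_ev[OF refl ev refl])
  moreover have "((\<lambda>x. exp (B_bullet x 1)) has_real_derivative H' 1) (at t)"
    using arm_less[OF t_dom] by (intro exp_B_deriv) simp
  ultimately show ?thesis by (simp add: radius_def DERIV_unique)
qed

lemma H_sums: "0 \<le> w \<Longrightarrow> w \<le> 1 \<Longrightarrow> 0 \<le> x \<Longrightarrow> x \<le> r \<Longrightarrow> fps_sums (H_fps w) x (exp (B_bullet x w))"
  using dom[of x] by (intro H_fps_sums) auto

lemma H'_sums:
  assumes w: "0 \<le> w" "w \<le> 1"
  shows "fps_sums (fps_deriv (H_fps w)) t (H' w)"
proof (rule fps_sums_deriv[OF t_r H_sums[OF w]])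
  have "\<bar>w\<bar> * arm t \<le> 1 * arm t" using w arm_nonneg[OF t_dom] by (intro mult_right_mono) auto
  thus "((\<lambda>x. exp (B_bullet x w)) has_real_derivative H' w) (at t)"
    using arm_less[OF t_dom] by (intro exp_B_deriv) linarith
qed

lemma H_sums_t: "fps_sums (H_fps 1) t \<Phi>"
  unfolding \<Phi>_def using t_r by (intro H_sums) auto

text \<open>The coefficients of \<open>exp (B')\<close> tilted by \<open>t\<close> and normalised:
  the offspring law of the tree equation for \<open>T_fps\<close>.\<close>

definition p :: "nat \<Rightarrow> real" where "p k = H_fps 1 $ k * t ^ k / \<Phi>"

lemma H_0: "H_fps 1 $ 0 = 1"
  by (simp add: H_fps_def)

lemma H_deriv_eq: "fps_deriv (H_fps 1) = H_fps 1 * fps_deriv (block_fps 1)"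
  unfolding H_fps_def by (subst fps_compose_deriv) simp_all

lemma block_1: "block_fps 1 $ 1 = 1"
  using dis_sum_1[of 1] by (simp add: block_fps_def dis_fps_def)

lemma H_1: "H_fps 1 $ 1 = 1"
  using arg_cong[OF H_deriv_eq, of "\<lambda>f. f $ 0"] block_1 H_0 by simp

text \<open>The term with index 2 decides the equality case of Bernoulli's inequality in
  \<open>T_sums\<close>.\<close>

lemma H_2: "0 < H_fps 1 $ 2"
proof -
  have "2 * H_fps 1 $ 2 = (H_fps 1 * fps_deriv (block_fps 1)) $ 1"
    using arg_cong[OF H_deriv_eq, of "\<lambda>f. f $ 1"] by (simp add: numeral_2_eq_2)
  also have "\<dots> = H_fps 1 $ 0 * (2 * block_fps 1 $ 2) + H_fps 1 $ 1 * block_fps 1 $ 1"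
    by (simp add: fps_mult_nth numeral_2_eq_2)
  also have "\<dots> \<ge> 1" using nonneg_block_fps[of 1] by (simp add: H_0 H_1[unfolded One_nat_def] block_1[unfolded One_nat_def])
  finally show ?thesis by simp
qed

lemma mean_sums: "(\<lambda>k. real k * p k) sums 1"
proof -
  have "fps_sums (fps_X * fps_deriv (H_fps 1)) t (t * H' 1)" by (intro fps_sums_X_mult H'_sums) auto
  moreover have e: "(fps_X * fps_deriv k) $ n = real n * k $ n" for k :: "real fps" and n by (cases n) simp_all
  have "(fps_X * fps_deriv (H_fps 1)) $ n * t ^ n / \<Phi> = real n * p n" for n unfolding e p_def by simp
  ultimately have "(\<lambda>n. real n * p n) sums (t * H' 1 / \<Phi>)"
    using sums_divide[of "\<lambda>n. (fps_X * fps_deriv (H_fps 1)) $ n * t ^ n" "t * H' 1" \<Phi>] by (simp add: fps_sums_def)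
  moreover have "t * H' 1 / \<Phi> = 1" using t_r \<Phi>_pos by (simp add: H'_1 radius_def)
  ultimately show ?thesis by simp
qed

sublocale L: critical_offspring p
proof
  show "0 \<le> p k" for k using nonneg_H_fps[of 1] t_r \<Phi>_pos by (simp add: p_def)
  show "p sums 1"
    using sums_divide[OF H_sums_t[unfolded fps_sums_def], of \<Phi>] \<Phi>_pos by (simp add: p_def[abs_def])
  show "(\<lambda>k. real k * p k) sums 1" by (rule mean_sums)
  have "summable (\<lambda>n. H_fps 1 $ n * r ^ n)" using H_sums[of 1 r] t_r by (auto simp: fps_sums_def sums_iff)
  from summable_divide[OF third_moment_summable[OF t_r this], of \<Phi>]
  show "summable (\<lambda>k. real k ^ 3 * p k)" by (simp add: p_def)
  show "0 < p 0" "0 < p 1" using t_r \<Phi>_pos H_0 H_1 by (simp_all add: p_def)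
qed

lemma g_power: "(L.g ^ n) $ k = (H_fps 1 ^ n) $ k * t ^ k / \<Phi> ^ n"
proof (induction n arbitrary: k)
  case (Suc n)
  have "(L.g ^ Suc n) $ k = (\<Sum>i=0..k. p i * (L.g ^ n) $ (k - i))" by (simp add: fps_mult_nth L.g_def)
  also have "\<dots> = (\<Sum>i=0..k. (H_fps 1 $ i * (H_fps 1 ^ n) $ (k - i)) * t ^ k / \<Phi> ^ Suc n)"
  proof (rule sum.cong[OF refl])
    fix i assume "i \<in> {0..k}"
    hence "t ^ k = t ^ i * t ^ (k - i)" by (simp add: power_add[symmetric])
    thus "p i * (L.g ^ n) $ (k - i) = (H_fps 1 $ i * (H_fps 1 ^ n) $ (k - i)) * t ^ k / \<Phi> ^ Suc n"
      unfolding Suc by (simp add: p_def)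
  qed
  also have "\<dots> = (H_fps 1 ^ Suc n) $ k * t ^ k / \<Phi> ^ Suc n"
    by (simp add: fps_mult_nth sum_distrib_right sum_divide_distrib)
  finally show ?case .
qed (simp add: fps_one_nth)

text \<open>The tree function reaches \<open>t\<close> and not a smaller fixed point: the generating function of a critical
  offspring law has no fixed point below 1, by Bernoulli's inequality applied termwise.\<close>

lemma T_sums: "fps_sums T_fps radius t"
proof -
  have "radius * \<Phi> \<le> t" using \<Phi>_pos by (simp add: radius_def)
  hence "\<exists>y\<ge>0. y \<le> t \<and> fps_sums T_fps radius y"
    by (rule fps_tree_sums[OF nonneg_H_fps[OF zero_le_one] nonneg_T_fps T_fps_0 T_fps_eq
          less_imp_le[OF radius_pos] less_imp_le[OF t_r(1)] H_sums_t])
  then obtain y where y: "0 \<le> y" "y \<le> t" "fps_sums T_fps radius y" by blast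
  have yr: "y \<le> r" using y t_r by simp
  have Hy: "fps_sums (H_fps 1) y (exp (B_bullet y 1))" by (intro H_sums y yr) auto
  have "fps_sums (H_fps 1 oo T_fps) radius (exp (B_bullet y 1))"
    by (rule fps_sums_compose[OF nonneg_H_fps[OF zero_le_one] nonneg_T_fps T_fps_0 less_imp_le[OF radius_pos] y(3) Hy])
  from fps_sums_X_mult[OF this] have "fps_sums T_fps radius (radius * exp (B_bullet y 1))"
    by (simp only: T_fps_eq[symmetric])
  hence fixp: "y = radius * exp (B_bullet y 1)" by (rule fps_sums_unique[OF y(3)])
  define u where "u = y / t"
  have u: "0 \<le> u" "u \<le> 1" using y t_r by (simp_all add: u_def)
  have "exp (B_bullet y 1) = radius * exp (B_bullet y 1) / radius" using radius_pos by simp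
  hence "exp (B_bullet y 1) = y / radius" by (simp only: fixp[symmetric])
  hence "fps_sums (H_fps 1) y (y / radius)" using Hy by (simp only:)
  hence "(\<lambda>k. H_fps 1 $ k * y ^ k / \<Phi>) sums (y / radius / \<Phi>)" unfolding fps_sums_def by (rule sums_divide)
  moreover have "H_fps 1 $ k * y ^ k / \<Phi> = p k * u ^ k" for k using t_r by (simp add: p_def u_def power_divide)
  moreover have "y / radius / \<Phi> = u" using \<Phi>_pos by (simp add: radius_def u_def)
  ultimately have s: "(\<lambda>k. p k * u ^ k) sums u" by simp
  \<comment> \<open>Subtracting the tangent at 1 cancels the sum: total mass and mean are both 1, so
    nonnegative terms add up to 0.\<close>
  have "(\<lambda>k. p k * u ^ k - p k + (1 - u) * (real k * p k)) sums (u - 1 + (1 - u) * 1)"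
    by (intro sums_add sums_diff sums_mult s L.total L.mean)
  hence z: "(\<lambda>k. p k * (u ^ k - 1 + real k * (1 - u))) sums 0" by (simp add: algebra_simps)
  have nn: "0 \<le> p k * (u ^ k - 1 + real k * (1 - u))" for k
  proof -
    have "1 + real k * (u - 1) \<le> (1 + (u - 1)) ^ k" using u by (intro Bernoulli_inequality) simp
    thus ?thesis by (intro mult_nonneg_nonneg L.nonneg) (simp add: algebra_simps)
  qed
  have "\<forall>k. p k * (u ^ k - 1 + real k * (1 - u)) = 0"
    using suminf_eq_zero_iff[of "\<lambda>k. p k * (u ^ k - 1 + real k * (1 - u))"] z nn by (simp add: sums_iff)
  hence "p 2 * (u ^ 2 - 1 + real 2 * (1 - u)) = 0" by blast
  moreover have "u ^ 2 - 1 + real 2 * (1 - u) = (u - 1)\<^sup>2" by (simp add: power2_eq_square algebra_simps)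
  moreover have "p 2 \<noteq> 0" using H_2 t_r \<Phi>_pos by (simp add: p_def)
  ultimately have "(u - 1)\<^sup>2 = 0" by (simp only: mult_eq_0_iff simp_thms)
  hence "y = t" using t_r by (simp add: u_def)
  thus ?thesis using y by simp
qed

section \<open>Coefficient asymptotics and the identification of \<open>rho\<close> and
  \<open>tau\<close>\<close>

definition a :: "real \<Rightarrow> nat \<Rightarrow> real" where "a w m = (H_fps w oo T_fps) $ Suc m"
definition scale :: "nat \<Rightarrow> real" where "scale m = real (Suc m) * sqrt (real (Suc m)) * (t ^ m / \<Phi> ^ Suc m)"

lemma scale_pos: "0 < scale m"
  using t_r \<Phi>_pos by (simp add: scale_def)

text \<open>Lagrange inversion turns the coefficient into one of
  \<open>fps_deriv (H_fps w) * H_fps 1 ^ Suc m\<close>. Rescaled by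
  \<open>t ^ m / \<Phi> ^ Suc m\<close> this is a convolution of a summable sequence with the law of
  a sum of \<open>Suc m\<close> offspring variables.\<close>

lemma coeff_limit:
  assumes w: "0 \<le> w" "w \<le> 1"
  shows "(\<lambda>m. scale m * a w m) \<longlonglongrightarrow> L.llt_const * H' w"
proof -
  define h where "h j = fps_deriv (H_fps w) $ j * t ^ j" for j
  have s: "h sums H' w" using H'_sums[OF w] by (simp add: fps_sums_def h_def[abs_def])
  have nn: "0 \<le> h j" for j using nonneg_H_fps[OF w(1)] t_r by (simp add: h_def)
  have "summable (\<lambda>j. \<bar>h j\<bar>)" using s nn by (simp add: sums_iff)
  note lim = L.local_limit_weighted[OF this]
  have "sqrt (real (Suc m)) * (\<Sum>j\<le>m. h j * (L.g ^ Suc m) $ (m - j)) = scale m * a w m" for m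
  proof -
    have "real (Suc m) * a w m = (fps_deriv (H_fps w) * H_fps 1 ^ Suc m) $ m"
      using fps_lagrange_inversion[OF _ T_fps_0 T_fps_eq, of "Suc m" "H_fps w"] H_0 by (simp add: a_def)
    also have "\<dots> = (\<Sum>j\<le>m. fps_deriv (H_fps w) $ j * (H_fps 1 ^ Suc m) $ (m - j))"
      unfolding fps_mult_nth atMost_atLeast0 ..
    finally have e: "real (Suc m) * a w m = (\<Sum>j\<le>m. fps_deriv (H_fps w) $ j * (H_fps 1 ^ Suc m) $ (m - j))" .
    have "(\<Sum>j\<le>m. h j * (L.g ^ Suc m) $ (m - j)) =
        (\<Sum>j\<le>m. fps_deriv (H_fps w) $ j * (H_fps 1 ^ Suc m) $ (m - j)) * (t ^ m / \<Phi> ^ Suc m)"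
      unfolding sum_distrib_right
    proof (rule sum.cong[OF refl])
      fix j assume "j \<in> {..m}"
      hence "t ^ m = t ^ j * t ^ (m - j)" by (simp add: power_add[symmetric])
      thus "h j * (L.g ^ Suc m) $ (m - j) = fps_deriv (H_fps w) $ j * (H_fps 1 ^ Suc m) $ (m - j) * (t ^ m / \<Phi> ^ Suc m)"
        unfolding g_power h_def by (simp only: times_divide_eq_right mult_ac)
    qed
    thus ?thesis unfolding e[symmetric] scale_def by (simp only: mult_ac)
  qed
  with lim show ?thesis using s by (simp add: sums_iff)
qed

text \<open>The factor \<open>scale\<close> and the constant of the local limit cancel, and
  \<open>H' 1 = 1 / radius\<close>.\<close>

lemma ratio_limit:
  assumes w: "0 \<le> w" "w \<le> 1"
  shows "(\<lambda>m. a w m / a 1 m) \<longlonglongrightarrow> radius * H' w"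
proof -
  have "L.llt_const * H' 1 \<noteq> 0" using L.llt_const_pos radius_pos by (simp add: H'_1)
  hence "(\<lambda>m. (scale m * a w m) / (scale m * a 1 m)) \<longlonglongrightarrow> (L.llt_const * H' w) / (L.llt_const * H' 1)"
    by (intro tendsto_divide coeff_limit w) auto
  moreover have "(scale m * a w m) / (scale m * a 1 m) = a w m / a 1 m" for m using scale_pos[of m] by simp
  moreover have "(L.llt_const * H' w) / (L.llt_const * H' 1) = radius * H' w"
    using L.llt_const_pos radius_pos by (simp add: H'_1)
  ultimately show ?thesis by simp
qed

text \<open>\<open>a 1 m\<close> has index \<open>Suc m\<close> in \<open>H_fps 1 oo T_fps\<close>;
  the root vertex is not counted there, which gives \<open>m + 2\<close> vertices.\<close>

lemma card_graphs: "real (card (connected_outerplanar_graphs (Suc (Suc m)))) = fact (Suc m) * a 1 m"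
  using graph_degree_fps[of 1 "Suc (Suc m)" 1] by (simp add: a_def)

lemma C_egf_nth: "C_egf $ Suc (Suc m) = a 1 m / real (Suc (Suc m))"
  unfolding C_egf_def by (simp add: card_graphs del: fact_Suc) (simp add: fact_Suc[of "Suc m"] del: fact_Suc)

text \<open>Ratio test: \<open>scale m * a 1 m\<close> has a nonzero limit, and
  \<open>scale (Suc m) / scale m\<close> tends to \<open>radius\<close>.\<close>

lemma C_egf_radius: "fps_conv_radius C_egf = ereal radius"
  unfolding fps_conv_radius_def
proof (rule conv_radius_ratio_limit_nonzero[OF refl])
  show "radius \<noteq> 0" using radius_pos by simp
  define b where "b m = scale m * a 1 m" for m
  have b: "b \<longlonglongrightarrow> L.llt_const * H' 1" unfolding b_def by (rule coeff_limit) auto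
  have nz: "L.llt_const * H' 1 \<noteq> 0" using L.llt_const_pos radius_pos by (simp add: H'_1)
  \<comment> \<open>The factors are arranged so that their product is exactly the quotient of
    consecutive coefficients.\<close>
  have "(\<lambda>m. b m / b (Suc m) * (real (m + 2) / real (m + 1) * (sqrt (real (m + 2)) / sqrt (real (m + 1))) * radius) * (real (m + 3) / real (m + 2)))
     \<longlonglongrightarrow> (L.llt_const * H' 1) / (L.llt_const * H' 1) * (1 * 1 * radius) * 1"
    by (intro tendsto_mult tendsto_divide b LIMSEQ_Suc[OF b] nz tendsto_const; real_asymp)
  also have "(L.llt_const * H' 1) / (L.llt_const * H' 1) * (1 * 1 * radius) * 1 = radius" using nz by simp
  also have "(\<lambda>m. b m / b (Suc m) * (real (m + 2) / real (m + 1) * (sqrt (real (m + 2)) / sqrt (real (m + 1))) * radius) * (real (m + 3) / real (m + 2)))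
     = (\<lambda>m. norm (C_egf $ (m + 2)) / norm (C_egf $ Suc (m + 2)))"
  proof
    fix m
    have e: "b m / b (Suc m) = (scale m / scale (Suc m)) * (a 1 m / a 1 (Suc m))" by (simp add: b_def)
    have "scale m / scale (Suc m) * (real (m + 2) / real (m + 1) * (sqrt (real (m + 2)) / sqrt (real (m + 1))) * radius) = 1"
    proof -
      have "scale (Suc m) = real (m + 2) * sqrt (real (m + 2)) * (t ^ m / \<Phi> ^ Suc m) * radius"
        by (simp add: scale_def radius_def mult_ac)
      note s2 = this
      have s1: "scale m = real (m + 1) * sqrt (real (m + 1)) * (t ^ m / \<Phi> ^ Suc m)" by (simp add: scale_def)
      have gen: "X * Y * Z / (X' * Y' * Z * W) * (X' / X * (Y' / Y) * W) = 1"
        if "X \<noteq> 0" "Y \<noteq> 0" "Z \<noteq> 0" "X' \<noteq> 0" "Y' \<noteq> 0" "W \<noteq> 0" for X Y Z X' Y' W :: real using that by simp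
      show ?thesis unfolding s2 s1 by (rule gen) (use t_r \<Phi>_pos radius_pos in simp_all)
    qed
    moreover have "S * Q * K = Q" if "S * K = 1" for S Q K :: real using that by algebra
    ultimately have x: "b m / b (Suc m) * (real (m + 2) / real (m + 1) * (sqrt (real (m + 2)) / sqrt (real (m + 1))) * radius) = a 1 m / a 1 (Suc m)"
      unfolding e by blast
    have y: "C_egf $ (m + 2) = a 1 m / real (m + 2)" using C_egf_nth[of m] by simp
    have z: "C_egf $ Suc (m + 2) = a 1 (Suc m) / real (m + 3)" using C_egf_nth[of "Suc m"] by simp
    have "0 \<le> C_egf $ k" for k by (simp add: C_egf_def)
    hence n: "norm (C_egf $ k) = C_egf $ k" for k by simp
    have "g / h * (u / v) = (g / v) / (h / u)" for g h u v :: real by simp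
    thus "b m / b (Suc m) * (real (m + 2) / real (m + 1) * (sqrt (real (m + 2)) / sqrt (real (m + 1))) * radius) * (real (m + 3) / real (m + 2))
       = norm (C_egf $ (m + 2)) / norm (C_egf $ Suc (m + 2))" unfolding n unfolding x y z .
  qed
  finally show "(\<lambda>n. norm (C_egf $ n) / norm (C_egf $ Suc n)) \<longlonglongrightarrow> radius" by (rule LIMSEQ_offset)
qed

lemma rho_eq: "rho = radius"
  by (simp add: rho_def C_egf_radius)

text \<open>\<open>T_sums\<close> gives the value of \<open>x C'(x)\<close> at the boundary point
  \<open>rho\<close>, and division by \<open>rho\<close> that of \<open>C'\<close>.\<close>

lemma C_deriv_sums: "(\<lambda>n. fps_deriv C_egf $ n * rho ^ n) sums (t / rho)"
proof -
  have "(\<lambda>n. T_fps $ n * rho ^ n) sums t" using T_sums by (simp add: fps_sums_def rho_eq)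
  hence "(\<lambda>n. T_fps $ Suc n * rho ^ Suc n) sums t" by (subst sums_Suc_iff) simp
  hence "(\<lambda>n. T_fps $ Suc n * rho ^ Suc n / rho) sums (t / rho)" by (rule sums_divide)
  moreover have "T_fps $ Suc n * rho ^ Suc n / rho = fps_deriv C_egf $ n * rho ^ n" for n
    using radius_pos by (simp add: T_fps_def rho_eq fps_X_mult_nth del: fps_deriv_nth)
  ultimately show ?thesis by simp
qed

lemma tau_eq: "tau = t"
  using C_deriv_sums radius_pos by (simp add: tau_def sums_iff rho_eq)

end

section \<open>The degree distribution\<close>

text \<open>Induction on \<open>k\<close>: after the terms below \<open>k\<close> are subtracted and
  the rest is divided by \<open>w ^ k\<close>, the tail is at most \<open>2 w\<close>, uniformly in
  \<open>m\<close>, so a small fixed \<open>w\<close> isolates the coefficient.\<close>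

lemma pgf_coeff_limit:
  fixes P :: "nat \<Rightarrow> nat \<Rightarrow> real" and d :: "nat \<Rightarrow> real"
  assumes P: "\<And>k m. 0 \<le> P k m" "\<And>k m. P k m \<le> 1" and d: "\<And>k. 0 \<le> d k" "\<And>k. d k \<le> 1"
    and conv: "\<And>w. 0 < w \<Longrightarrow> w \<le> 1 / 2 \<Longrightarrow> (\<lambda>m. \<Sum>k. P k m * w ^ k) \<longlonglongrightarrow> (\<Sum>k. d k * w ^ k)"
  shows "P k \<longlonglongrightarrow> d k"
proof (induction k rule: less_induct)
  case (less k)
  define e where "e j m = P j m - d j" for j m
  have e1: "\<bar>e j m\<bar> \<le> 1" for j m using P[of j m] d[of j] by (simp add: e_def abs_le_iff)
  have "(\<lambda>m. e k m) \<longlonglongrightarrow> 0"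
  proof (rule LIMSEQ_I)
    fix \<epsilon> :: real assume \<epsilon>: "0 < \<epsilon>"
    \<comment> \<open>Small enough that the tail bound \<open>2 w\<close> is at most half of
      \<open>\<epsilon>\<close>.\<close>
    define w where "w = min (1 / 2) (\<epsilon> / 4)"
    have w: "0 < w" "w \<le> 1 / 2" "2 * w \<le> \<epsilon> / 2" using \<epsilon> by (auto simp: w_def)
    have geo: "summable (\<lambda>j. w ^ j)" using w by (intro summable_geometric) simp
    have sP: "summable (\<lambda>j. P j m * w ^ j)" for m
      by (rule summable_comparison_test'[OF geo, of 0]) (use P w in \<open>simp add: abs_mult mult_left_le_one_le\<close>)
    have sd: "summable (\<lambda>j. d j * w ^ j)"
      by (rule summable_comparison_test'[OF geo, of 0]) (use d w in \<open>simp add: abs_mult mult_left_le_one_le\<close>)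
    have se: "summable (\<lambda>j. e j m * w ^ j)" for m
      using summable_diff[OF sP[of m] sd] by (simp add: e_def algebra_simps)
    define S where "S m = (\<Sum>j. e j m * w ^ j)" for m
    have "S m = (\<Sum>j. P j m * w ^ j) - (\<Sum>j. d j * w ^ j)" for m
      unfolding S_def using suminf_diff[OF sP[of m] sd] by (simp add: e_def algebra_simps)
    hence S0: "S \<longlonglongrightarrow> 0" using LIM_zero[OF conv[OF w(1,2)]] by presburger
    have E0: "(\<lambda>m. (\<bar>S m\<bar> + (\<Sum>j<k. \<bar>e j m\<bar>)) / w ^ k) \<longlonglongrightarrow> (\<bar>0\<bar> + (\<Sum>j<k. \<bar>0\<bar>)) / w ^ k"
    proof (intro tendsto_divide tendsto_add tendsto_rabs tendsto_sum S0 tendsto_const)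
      show "w ^ k \<noteq> 0" using w by simp
      fix j assume "j \<in> {..<k}"
      hence "P j \<longlonglongrightarrow> d j" using less by simp
      thus "e j \<longlonglongrightarrow> 0" unfolding e_def by (rule LIM_zero)
    qed
    have main: "\<bar>e k m\<bar> \<le> (\<bar>S m\<bar> + (\<Sum>j<k. \<bar>e j m\<bar>)) / w ^ k + 2 * w" for m
    proof -
      have split: "S m = (\<Sum>j. e (j + Suc k) m * w ^ (j + Suc k)) + (\<Sum>j<Suc k. e j m * w ^ j)"
        unfolding S_def by (rule suminf_split_initial_segment[OF se])
      have "norm (\<Sum>j. e (j + Suc k) m * w ^ (j + Suc k)) \<le> (\<Sum>j. w ^ Suc k * w ^ j)"
      proof (rule norm_suminf_le)
        fix j
        have "norm (e (j + Suc k) m * w ^ (j + Suc k)) \<le> 1 * w ^ (j + Suc k)"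
          unfolding norm_mult using e1 w by (intro mult_mono) auto
        thus "norm (e (j + Suc k) m * w ^ (j + Suc k)) \<le> w ^ Suc k * w ^ j" by (simp add: power_add mult_ac)
      qed (intro summable_mult geo)
      also have "\<dots> = w ^ Suc k * (1 / (1 - w))" using suminf_mult[OF geo, of "w ^ Suc k"] suminf_geometric[of w] w by simp
      also have "\<dots> \<le> w ^ Suc k * 2" using w by (intro mult_left_mono) (auto simp: divide_simps)
      finally have tail: "\<bar>\<Sum>j. e (j + Suc k) m * w ^ (j + Suc k)\<bar> \<le> w ^ k * (2 * w)" by (simp add: mult_ac)
      have "\<bar>\<Sum>j<k. e j m * w ^ j\<bar> \<le> (\<Sum>j<k. \<bar>e j m * w ^ j\<bar>)" by (rule sum_abs)
      also have "\<dots> \<le> (\<Sum>j<k. \<bar>e j m\<bar> * 1)" using w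
        by (intro sum_mono) (simp add: abs_mult mult_left_le power_le_one)
      finally have init: "\<bar>\<Sum>j<k. e j m * w ^ j\<bar> \<le> (\<Sum>j<k. \<bar>e j m\<bar>)" by simp
      have "e k m * w ^ k = S m - (\<Sum>j<k. e j m * w ^ j) - (\<Sum>j. e (j + Suc k) m * w ^ (j + Suc k))"
        using split by simp
      hence "\<bar>e k m * w ^ k\<bar> \<le> (\<bar>S m\<bar> + (\<Sum>j<k. \<bar>e j m\<bar>)) + w ^ k * (2 * w)"
        using tail init by linarith
      moreover have "\<bar>e k m * w ^ k\<bar> = \<bar>e k m\<bar> * w ^ k" using w by (simp add: abs_mult)
      moreover have "X + w ^ k * (2 * w) = (X / w ^ k + 2 * w) * w ^ k" for X using w by (simp add: distrib_right)
      ultimately have "\<bar>e k m\<bar> * w ^ k \<le> ((\<bar>S m\<bar> + (\<Sum>j<k. \<bar>e j m\<bar>)) / w ^ k + 2 * w) * w ^ k" by (simp only:)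
      thus ?thesis by (rule mult_right_le_imp_le) (use w in simp)
    qed
    have "eventually (\<lambda>m. (\<bar>S m\<bar> + (\<Sum>j<k. \<bar>e j m\<bar>)) / w ^ k < \<epsilon> / 2) sequentially"
      using order_tendstoD(2)[OF E0, of "\<epsilon> / 2"] \<epsilon> by simp
    then obtain N where N: "\<forall>m\<ge>N. (\<bar>S m\<bar> + (\<Sum>j<k. \<bar>e j m\<bar>)) / w ^ k < \<epsilon> / 2"
      unfolding eventually_sequentially by blast
    have "norm (e k m - 0) < \<epsilon>" if "m \<ge> N" for m
    proof -
      have "(\<bar>S m\<bar> + (\<Sum>j<k. \<bar>e j m\<bar>)) / w ^ k < \<epsilon> / 2" using N that by blast
      hence "\<bar>e k m\<bar> < \<epsilon> / 2 + \<epsilon> / 2" using main[of m] w(3) by linarith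
      thus ?thesis by simp
    qed
    thus "\<exists>N. \<forall>m\<ge>N. norm (e k m - 0) < \<epsilon>" by blast
  qed
  thus "P k \<longlonglongrightarrow> d k" unfolding e_def by (rule LIM_zero_cancel)
qed

context critical_point
begin

text \<open>Solving the critical equation for the square root makes it a rational function of
  \<open>t\<close>, which can be enclosed without extracting roots.\<close>

lemma disc_root_val: "disc_root t = (3 - t) * t / (8 - 5 * t)"
  using crit t_r by (simp add: r_def eq_divide_eq mult.commute)

lemma disc_root_bounds: "0.0676073948936 \<le> disc_root t" "disc_root t \<le> 0.0676073949404"
proof -
  have "(3 - 0.1707649869) * 0.1707649868 / (8 - 5 * 0.1707649868) \<le> (3 - t) * t / (8 - 5 * t)"
    using t_lower t_upper by (intro frac_le mult_mono) auto
  thus "0.0676073948936 \<le> disc_root t" unfolding disc_root_val by simp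
  have "(3 - t) * t / (8 - 5 * t) \<le> (3 - 0.1707649868) * 0.1707649869 / (8 - 5 * 0.1707649869)"
    using t_lower t_upper by (intro frac_le mult_mono) auto
  thus "disc_root t \<le> 0.0676073949404" unfolding disc_root_val by simp
qed

lemma arm_bounds: "0.3808138090798 \<le> arm t" "arm t \<le> 0.3808138091532"
  unfolding arm_eq using disc_root_bounds t_lower t_upper by simp_all

text \<open>The critical equation also removes the root from \<open>arm'\<close>.\<close>

lemma t_arm': "t * arm' = 4 - 3 * t"
proof -
  have "(3 - t) / disc_root t * t = 8 - 5 * t" using t_r unfolding disc_root_val by (simp add: r_def field_simps)
  moreover have "2 * arm' = (3 - t) / disc_root t - 1" by (simp add: arm'_def)
  ultimately have "2 * (t * arm') = 8 - 5 * t - t" by algebra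
  thus ?thesis by simp
qed

definition A where "A = t / (2 * arm t)"
text \<open>\<open>radius * \<kappa>\<close> is the value at \<open>z = 1\<close> of the cubic
  factor whose coefficients occur in \<open>d\<close>.\<close>

definition \<kappa> where "\<kappa> = t * arm' / (2 * (arm t)\<^sup>2)"
text \<open>The three coefficients come from writing
  \<open>radius * H' w / exp (B_bullet t w)\<close> over the common denominator
  \<open>(1 - z)^2\<close> with \<open>z = arm t * w\<close>.\<close>

definition d where "d k = degree_fps A (radius / arm t) (radius * (\<kappa> - 3 / (2 * arm t))) (radius / (2 * arm t)) $ k * arm t ^ k"

lemma arm_pos: "0 < arm t" using arm_bounds by simp

lemma A_pos: "0 < A" using arm_pos t_r by (simp add: A_def)

text \<open>Makes the middle coefficient in \<open>d\<close> nonnegative, so that all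
  \<open>d k\<close> are.\<close>

lemma \<kappa>_ge: "3 / (2 * arm t) \<le> \<kappa>"
proof -
  have "3 * arm t \<le> t * arm'" unfolding t_arm' using arm_bounds t_upper by simp
  hence "3 * arm t / (2 * (arm t)\<^sup>2) \<le> t * arm' / (2 * (arm t)\<^sup>2)" by (rule divide_right_mono) simp
  moreover have "3 * arm t / (2 * (arm t)\<^sup>2) = 3 / (2 * arm t)" using arm_pos by (simp add: power2_eq_square)
  ultimately show ?thesis by (simp add: \<kappa>_def)
qed

lemma d_nonneg: "0 \<le> d k"
proof -
  have X: "nonneg_fps (fps_X * M)" if "nonneg_fps M" for M using that by (simp add: nonneg_fps_def fps_X_mult_nth)
  have c: "nonneg_fps (fps_const c * M)" if "nonneg_fps M" "0 \<le> c" for M c using that by (simp add: nonneg_fps_def)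
  have p: "nonneg_fps (f + g)" if "nonneg_fps f" "nonneg_fps g" for f g using that by (simp add: nonneg_fps_def)
  have A0: "0 \<le> A" using A_pos by simp
  have M: "nonneg_fps (fps_exp A * laguerre_fps A)"
    by (rule nonneg_fps_mult[OF nonneg_fps_exp[OF A0] nonneg_laguerre[OF A0]])
  have "nonneg_fps (degree_fps A (radius / arm t) (radius * (\<kappa> - 3 / (2 * arm t))) (radius / (2 * arm t)))"
    unfolding degree_fps_def Let_def by (intro p c X M) (use radius_pos arm_pos \<kappa>_ge in simp_all)
  thus ?thesis using arm_pos by (simp add: d_def)
qed

lemma d_sums:
  assumes w: "\<bar>w\<bar> * arm t < 1"
  shows "(\<lambda>k. d k * w ^ k) sums (radius * H' w)"
proof -
  define u where "u = arm t"
  define z where "z = w * u"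
  have u: "0 < u" using arm_pos by (simp add: u_def)
  have z1: "\<bar>z\<bar> < 1" using w u by (simp add: z_def u_def abs_mult)
  define n where "n = 1 - z"
  have n: "n \<noteq> 0" using z1 by (auto simp: n_def)
  have wu: "u * w = 1 - n" by (simp add: n_def z_def mult.commute)
  have Az: "A * z = t * w / 2" using u by (simp add: A_def u_def[symmetric] z_def)
  \<comment> \<open>Since \<open>A z = t w / 2\<close>, the two exponents add up to
    \<open>B_bullet t w\<close>.\<close>
  have "A * z + A * (z / (1 - z)) = A * z + A * z / n" by (simp add: n_def)
  also have "\<dots> = t * w / 2 + t * w / 2 / n" unfolding Az ..
  also have "\<dots> = t * w + t * w\<^sup>2 / 2 * (u / n)"
  proof -
    have "t * w + t * w\<^sup>2 / 2 * (u / n) = t * w + t * w / 2 * ((u * w) / n)" by (simp add: power2_eq_square mult_ac)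
    also have "(u * w) / n = 1 / n - 1" unfolding wu using n by (simp add: diff_divide_distrib)
    also have "t * w + t * w / 2 * (1 / n - 1) = t * w / 2 + t * w / 2 * (1 / n)"
    proof -
      have "x + x / 2 * (y - 1) = x / 2 + x / 2 * y" for x y :: real by (simp add: field_simps)
      thus ?thesis .
    qed
    finally show ?thesis by simp
  qed
  also have "\<dots> = B_bullet t w" using wu by (simp add: B_bullet_def arm_def[symmetric] u_def[symmetric])
  finally have ex: "exp (A * z) * exp (A * (z / (1 - z))) = exp (B_bullet t w)" by (simp add: exp_add[symmetric])
  have k: "\<kappa> * u\<^sup>2 = t * arm' / 2"
  proof -
    have "x / (2 * y) * y = x / 2" if "y \<noteq> 0" for x y :: real using that by simp
    thus ?thesis using u unfolding \<kappa>_def u_def[symmetric] by simp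
  qed
  have p1: "radius / u * z = radius * w" using u by (simp add: z_def)
  have p2: "radius * (\<kappa> - 3 / (2 * u)) * z\<^sup>2 = radius * (t * arm' / 2 * w\<^sup>2 - 3 / 2 * u * w\<^sup>2)"
  proof -
    have "(\<kappa> - 3 / (2 * u)) * z\<^sup>2 = \<kappa> * u\<^sup>2 * w\<^sup>2 - 3 / (2 * u) * (u * u) * w\<^sup>2"
    proof -
      have "(x - y) * (w * u)\<^sup>2 = x * u\<^sup>2 * w\<^sup>2 - y * (u * u) * w\<^sup>2" for x y
        by (simp add: power2_eq_square algebra_simps)
      thus ?thesis unfolding z_def .
    qed
    also have "3 / (2 * u) * (u * u) = 3 / 2 * u" using u by simp
    finally show ?thesis unfolding k by (simp add: mult.assoc)
  qed
  have p3: "radius / (2 * u) * z ^ 3 = radius * (u\<^sup>2 * w ^ 3 / 2)" using u by (simp add: z_def power3_eq_cube power2_eq_square)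
  have br: "(w + (t * arm' / 2 * w\<^sup>2 - 3 / 2 * u * w\<^sup>2) + u\<^sup>2 * w ^ 3 / 2) * (1 / n)\<^sup>2 =
     w + w\<^sup>2 / 2 * (u / n) + t * w\<^sup>2 / 2 * (arm' / n\<^sup>2)"
  proof -
    have "(w + w\<^sup>2 / 2 * (u / n) + t * w\<^sup>2 / 2 * (arm' / n\<^sup>2)) * n\<^sup>2 = w * n\<^sup>2 + w\<^sup>2 / 2 * u * n + t * w\<^sup>2 / 2 * arm'"
      using n by (simp add: distrib_right power2_eq_square)
    also have "\<dots> = w + (t * arm' / 2 * w\<^sup>2 - 3 / 2 * u * w\<^sup>2) + u\<^sup>2 * w ^ 3 / 2"
      unfolding n_def z_def by (simp add: power2_eq_square power3_eq_cube field_simps)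
    finally have "w + (t * arm' / 2 * w\<^sup>2 - 3 / 2 * u * w\<^sup>2) + u\<^sup>2 * w ^ 3 / 2 =
      (w + w\<^sup>2 / 2 * (u / n) + t * w\<^sup>2 / 2 * (arm' / n\<^sup>2)) * n\<^sup>2" ..
    moreover have "X * n\<^sup>2 * (1 / n)\<^sup>2 = X" for X using n by (simp add: power2_eq_square)
    ultimately show ?thesis by (simp only:)
  qed
  have un: "1 - u * w = n" using wu by simp
  have "fps_sums (degree_fps A (radius / u) (radius * (\<kappa> - 3 / (2 * u))) (radius / (2 * u))) z
     ((radius / u * z + radius * (\<kappa> - 3 / (2 * u)) * z\<^sup>2 + radius / (2 * u) * z ^ 3) *
       (exp (A * z) * (exp (A * (z / (1 - z))) * (1 / (1 - z)) ^ 2)))"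
    by (rule degree_fps_sums[OF A_pos z1])
  also have "(radius / u * z + radius * (\<kappa> - 3 / (2 * u)) * z\<^sup>2 + radius / (2 * u) * z ^ 3) *
       (exp (A * z) * (exp (A * (z / (1 - z))) * (1 / (1 - z)) ^ 2)) = radius * H' w"
  proof -
    have g: "(radius * a + radius * b + radius * c) * (E1 * (E2 * I)) = radius * ((E1 * E2) * ((a + b + c) * I))" for a b c E1 E2 I
      by (simp add: algebra_simps)
    show ?thesis unfolding p1 p2 p3 g ex unfolding n_def[symmetric] unfolding br H'_def u_def[symmetric] un ..
  qed
  finally show ?thesis unfolding fps_sums_def d_def u_def z_def by (simp only: power_mult_distrib mult_ac)
qed

lemma d_summable: "\<bar>w\<bar> * arm t < 1 \<Longrightarrow> summable (\<lambda>k. norm (d k * w ^ k))"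
proof -
  assume "\<bar>w\<bar> * arm t < 1"
  hence "summable (\<lambda>k. d k * \<bar>w\<bar> ^ k)" using d_sums[of "\<bar>w\<bar>"] by (simp add: sums_iff)
  thus ?thesis using d_nonneg by (simp add: abs_mult power_abs)
qed

lemma d_sums_1: "d sums 1"
proof -
  have "\<bar>1\<bar> * arm t < 1" using arm_bounds by simp
  from d_sums[OF this] show ?thesis using radius_pos by (simp add: H'_1)
qed

lemma d_le_1: "d k \<le> 1"
  using sum_le_suminf[of d "{k}"] d_sums_1 d_nonneg by (simp add: sums_iff)

lemma d_0: "d 0 = 0"
  by (simp add: d_def degree_fps_def Let_def)

lemma a_nonzero: "eventually (\<lambda>m. a 1 m \<noteq> 0) sequentially"
proof -
  have "0 < L.llt_const * H' 1" using L.llt_const_pos radius_pos by (simp add: H'_1)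
  hence "eventually (\<lambda>m. 0 < scale m * a 1 m) sequentially"
    using order_tendstoD(1)[OF coeff_limit[of 1]] by simp
  thus ?thesis by eventually_elim auto
qed

text \<open>\<open>a 1 m \<noteq> 0\<close> says that graphs exist, so that
  \<open>pmf_of_set\<close> is the uniform distribution on them.\<close>

lemma degree_prob_sum:
  assumes v: "v \<in> {1..Suc (Suc m)}" and nz: "a 1 m \<noteq> 0"
  shows "(\<Sum>k. degree_prob v k (Suc (Suc m)) * w ^ k) = a w m / a 1 m"
proof -
  define G where "G = connected_outerplanar_graphs (Suc (Suc m))"
  have cG: "real (card G) = fact (Suc m) * a 1 m" unfolding G_def by (rule card_graphs)
  have "card G \<noteq> 0"
  proof
    assume "card G = 0"
    hence "fact (Suc m) * a 1 m = 0" using cG by linarith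
    thus False using nz by (simp del: fact_Suc)
  qed
  hence G: "finite G" "G \<noteq> {}" by (auto intro: card_ge_0_finite)
  have dp: "degree_prob v k (Suc (Suc m)) = real (card {E \<in> G. degree_of E v = k}) / real (card G)" for k
    unfolding degree_prob_def G_def[symmetric] measure_pmf_of_set[OF G(2,1)] by (simp add: Collect_conj_eq)
  have z: "degree_prob v k (Suc (Suc m)) = 0" if "k \<notin> (\<lambda>E. degree_of E v) ` G" for k
  proof -
    have e: "{E \<in> G. degree_of E v = k} = {}" using that by blast
    show ?thesis unfolding dp e by simp
  qed
  have "(\<Sum>k. degree_prob v k (Suc (Suc m)) * w ^ k) = (\<Sum>k\<in>(\<lambda>E. degree_of E v) ` G. degree_prob v k (Suc (Suc m)) * w ^ k)"
    by (rule suminf_finite) (use G z in simp_all)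
  also have "\<dots> = (\<Sum>k\<in>(\<lambda>E. degree_of E v) ` G. (\<Sum>E | E \<in> G \<and> degree_of E v = k. w ^ degree_of E v)) / real (card G)"
    unfolding sum_divide_distrib by (rule sum.cong[OF refl]) (simp add: dp)
  also have "(\<Sum>k\<in>(\<lambda>E. degree_of E v) ` G. (\<Sum>E | E \<in> G \<and> degree_of E v = k. w ^ degree_of E v)) = (\<Sum>E\<in>G. w ^ degree_of E v)"
    by (rule sum.image_gen[OF G(1), symmetric])
  also have "\<dots> = fact (Suc m) * a w m"
    unfolding G_def using graph_degree_fps[OF v, of w] by (simp add: a_def del: fact_Suc)
  also have "fact (Suc m) * a w m / real (card G) = a w m / a 1 m" unfolding cG by (simp del: fact_Suc)
  finally show ?thesis .
qed

lemma degree_prob_limit: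
  assumes "v \<ge> 1"
  shows "degree_prob v k \<longlonglongrightarrow> d k"
proof -
  have "(\<lambda>m. degree_prob v k (Suc (Suc m))) \<longlonglongrightarrow> d k"
  proof (rule pgf_coeff_limit[where P = "\<lambda>k m. degree_prob v k (Suc (Suc m))" and d = d])
    show "0 \<le> degree_prob v k (Suc (Suc m))" "degree_prob v k (Suc (Suc m)) \<le> 1" for k m
      by (simp_all add: degree_prob_def)
    show "0 \<le> d k" "d k \<le> 1" for k by (rule d_nonneg, rule d_le_1)
    fix w :: real assume w: "0 < w" "w \<le> 1 / 2"
    have "\<bar>w\<bar> * arm t \<le> 1 / 2 * 1" using w arm_bounds by (intro mult_mono) auto
    hence "\<bar>w\<bar> * arm t < 1" by simp
    hence dw: "(\<Sum>k. d k * w ^ k) = radius * H' w" using d_sums[of w] by (simp add: sums_iff)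
    have "(\<lambda>m. a w m / a 1 m) \<longlonglongrightarrow> radius * H' w" using w by (intro ratio_limit) auto
    \<comment> \<open>Once \<open>m \<ge> v\<close>, the fixed vertex \<open>v\<close> belongs to
      the graphs on \<open>m + 2\<close> vertices.\<close>
    moreover have "eventually (\<lambda>m. a w m / a 1 m = (\<Sum>k. degree_prob v k (Suc (Suc m)) * w ^ k)) sequentially"
      using a_nonzero eventually_ge_at_top[of v]
      by eventually_elim (use assms in \<open>simp add: degree_prob_sum\<close>)
    ultimately show "(\<lambda>m. \<Sum>k. degree_prob v k (Suc (Suc m)) * w ^ k) \<longlonglongrightarrow> (\<Sum>k. d k * w ^ k)"
      unfolding dw by (rule Lim_transform_eventually)
  qed
  hence "(\<lambda>m. degree_prob v k (m + 2)) \<longlonglongrightarrow> d k" by simp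
  thus ?thesis by (rule LIMSEQ_offset)
qed

lemma degree_limit_eq: "v \<ge> 1 \<Longrightarrow> degree_limit v k = d k"
  unfolding degree_limit_def by (rule limI[OF degree_prob_limit])

lemma d_has_sum:
  assumes w: "\<bar>w\<bar> * arm t < 1"
  shows "((\<lambda>k. d k * w ^ k) has_sum (radius * H' w)) {1..}"
proof -
  have "((\<lambda>k. d k * w ^ k) has_sum (radius * H' w)) UNIV"
    by (rule norm_summable_imp_has_sum[OF d_summable[OF w] d_sums[OF w]])
  also have "((\<lambda>k. d k * w ^ k) has_sum (radius * H' w)) UNIV \<longleftrightarrow> ((\<lambda>k. d k * w ^ k) has_sum (radius * H' w)) {1..}"
  proof (rule has_sum_cong_neutral)
    fix k :: nat assume "k \<in> UNIV - {1..}"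
    hence "k = 0" by simp
    thus "d k * w ^ k = 0" by (simp add: d_0)
  qed auto
  finally show ?thesis .
qed

section \<open>The asymptotic constants and their enclosures\<close>

definition c1 where "c1 = radius * \<kappa> * (exp (A / 2) / (2 * sqrt pi * A powr (3/4)))"
definition c2 where "c2 = 2 * sqrt A"

lemma \<kappa>_pos: "0 < \<kappa>"
proof -
  have "0 < 3 / (2 * arm t)" using arm_pos by simp
  thus ?thesis using \<kappa>_ge by (rule less_le_trans)
qed

lemma c1_pos: "0 < c1"
  using radius_pos \<kappa>_pos A_pos by (simp add: c1_def)

lemma d_asymp: "d \<sim>[at_top] (\<lambda>k. c1 * real k powr (1/4) * exp (c2 * sqrt (real k)) * arm t ^ k)"
proof (rule asymp_equivI')
  define a1 a2 a3 where "a1 = radius / arm t" and "a2 = radius * (\<kappa> - 3 / (2 * arm t))" and "a3 = radius / (2 * arm t)"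
  have "a1 + a2 + a3 = radius * \<kappa>" using arm_pos by (simp add: a1_def a2_def a3_def field_simps)
  hence "(\<lambda>k. degree_fps A a1 a2 a3 $ k / perron A k) \<longlonglongrightarrow> c1"
    using degree_fps_asymp[OF A_pos, of a1 a2 a3] by (simp only: c1_def)
  hence "(\<lambda>k. degree_fps A a1 a2 a3 $ k / perron A k / c1) \<longlonglongrightarrow> c1 / c1"
    using c1_pos by (intro tendsto_divide tendsto_const) auto
  moreover have "degree_fps A a1 a2 a3 $ k / perron A k / c1 = d k / (c1 * real k powr (1/4) * exp (c2 * sqrt (real k)) * arm t ^ k)" for k
  proof -
    have "x / y / c = x * p / (c * y * p)" if "p \<noteq> 0" for x y c p :: real using that by simp
    from this[of "arm t ^ k" "degree_fps A a1 a2 a3 $ k" "perron A k" c1] show ?thesis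
      using arm_pos by (simp add: d_def a1_def a2_def a3_def perron_def c2_def mult.assoc)
  qed
  ultimately show "(\<lambda>k. d k / (c1 * real k powr (1/4) * exp (c2 * sqrt (real k)) * arm t ^ k)) \<longlonglongrightarrow> 1"
    using c1_pos by simp
qed

lemma A_bounds: "0.2242106019996 \<le> A" "A \<le> 0.2242106021742"
proof -
  have "0.1707649868 / (2 * 0.3808138091532) \<le> A" unfolding A_def
    using t_lower arm_bounds arm_pos by (intro frac_le) auto
  thus "0.2242106019996 \<le> A" by simp
  have "A \<le> 0.1707649869 / (2 * 0.3808138090798)" unfolding A_def
    using t_upper t_r arm_bounds by (intro frac_le) auto
  thus "A \<le> 0.2242106021742" by simp
qed

lemma \<kappa>_bounds: "12.02498037374 \<le> \<kappa>" "\<kappa> \<le> 12.02498037942"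
proof -
  have "(4 - 3 * 0.1707649869) / (2 * (0.3808138091532)\<^sup>2) \<le> \<kappa>" unfolding \<kappa>_def t_arm'
    using t_upper arm_bounds arm_pos by (intro frac_le mult_left_mono power_mono) auto
  thus "12.02498037374 \<le> \<kappa>" by (simp add: power2_eq_square)
  have "\<kappa> \<le> (4 - 3 * 0.1707649868) / (2 * (0.3808138090798)\<^sup>2)" unfolding \<kappa>_def t_arm'
    using t_lower arm_bounds arm_pos by (intro frac_le mult_left_mono power_mono) auto
  thus "\<kappa> \<le> 12.02498037942" by (simp add: power2_eq_square)
qed

text \<open>The interval contains the exponent \<open>A / 2 - B_bullet t 1\<close>. The Taylor
  remainder of even order is positive, and at a negative argument that of odd order is negative, so
  polynomials of degree 5 and 4 bound from below and above.\<close>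

lemma exp_bounds:
  assumes "-0.111171891451 \<le> x" "x \<le> -0.1111718912953"
  shows "0.89478492724 \<le> exp x" "exp x \<le> (0.8947850689 :: real)"
proof -
  have "\<exists>s. \<bar>s\<bar> \<le> \<bar>y\<bar> \<and> exp y = (\<Sum>m<6. y ^ m / fact m) + exp s / fact 6 * y ^ 6" for y :: real
    by (rule Maclaurin_exp_le)
  from this[of "-0.111171891451"] have "(\<Sum>m<6. (-0.111171891451 :: real) ^ m / fact m) \<le> exp (-0.111171891451)"
    by (auto simp del: power_minus_Bit0)
  moreover have "0.89478492724 \<le> (\<Sum>m<6. (-0.111171891451 :: real) ^ m / fact m)"
    by (simp add: eval_nat_numeral lessThan_Suc fact_reduce)
  moreover have "exp (-0.111171891451) \<le> exp x" using assms by simp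
  ultimately show "0.89478492724 \<le> exp x" by linarith
  have "\<exists>s. \<bar>s\<bar> \<le> \<bar>y\<bar> \<and> exp y = (\<Sum>m<5. y ^ m / fact m) + exp s / fact 5 * y ^ 5" for y :: real
    by (rule Maclaurin_exp_le)
  from this[of "-0.1111718912953"] obtain s where
    s: "exp (-0.1111718912953) = (\<Sum>m<5. (-0.1111718912953 :: real) ^ m / fact m) + exp s / fact 5 * (-0.1111718912953) ^ 5" by blast
  have "exp s / fact 5 * (-0.1111718912953 :: real) ^ 5 \<le> 0"
    by (rule mult_nonneg_nonpos) (simp_all add: eval_nat_numeral)
  hence "exp (-0.1111718912953) \<le> (\<Sum>m<5. (-0.1111718912953 :: real) ^ m / fact m)" using s by linarith
  moreover have "(\<Sum>m<5. (-0.1111718912953 :: real) ^ m / fact m) \<le> 0.8947850689"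
    by (simp add: eval_nat_numeral lessThan_Suc fact_reduce)
  moreover have "exp x \<le> exp (-0.1111718912953)" using assms by simp
  ultimately show "exp x \<le> 0.8947850689" by linarith
qed

text \<open>The factors \<open>exp (A / 2)\<close> and \<open>1 / \<Phi>\<close> are merged into one
  exponential. Passing to fourth powers removes \<open>sqrt pi\<close> and
  \<open>A powr (3/4)\<close>: \<open>c1^4 = N^4 / (16 pi^2 A^3)\<close>.\<close>

lemma c1_bounds: "1.5907605 < c1" "c1 < 1.5907614"
proof -
  define E where "E = A / 2 - B_bullet t 1"
  define N where "N = t * \<kappa> * exp E"
  have "8 * B_bullet t 1 = 1 + 5 * t - disc_root t" using B_bullet_1[OF t_dom] by simp
  hence "-0.111171891451 \<le> E" "E \<le> -0.1111718912953"
    using A_bounds t_lower t_upper disc_root_bounds by (simp_all add: E_def; linarith)+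
  note e = exp_bounds[OF this]
  have "0.1707649868 * 12.02498037374 * 0.89478492724 \<le> N" unfolding N_def
    using t_lower \<kappa>_bounds e t_r \<kappa>_pos by (intro mult_mono) auto
  hence Nl: "1.83739218502 \<le> N" by simp
  have "N \<le> 0.1707649869 * 12.02498037942 * 0.8947850689" unfolding N_def
    using t_upper \<kappa>_bounds e t_r \<kappa>_pos by (intro mult_mono) auto
  hence Nu: "N \<le> 1.83739247786" by simp
  have c: "c1 = N / (2 * sqrt pi * A powr (3/4))"
    by (simp add: c1_def N_def E_def radius_def \<Phi>_def exp_diff)
  have "(A powr (3/4)) ^ 4 = A ^ 3" using A_pos by (simp add: powr_powr flip: powr_realpow powr_numeral)
  moreover have "sqrt pi ^ 4 = pi\<^sup>2"
  proof -
    have s: "sqrt pi * sqrt pi = pi" by simp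
    show ?thesis unfolding power4_eq_xxxx power2_eq_square by (metis s mult.assoc)
  qed
  moreover define K where "K = 16 * (pi\<^sup>2 * A ^ 3)"
  ultimately have c4: "c1 ^ 4 = N ^ 4 / K" unfolding c by (simp add: power_divide power_mult_distrib)
  have K: "0 < K" using A_pos by (simp add: K_def)
  have N0: "0 \<le> N" using Nl by simp
  have "pi\<^sup>2 * A ^ 3 \<le> 3.1415926535899\<^sup>2 * 0.2242106021742 ^ 3"
    by (rule mult_mono[OF power_mono power_mono]) (use pi_approx A_bounds A_pos in simp_all)
  hence Ku: "K \<le> 16 * (3.1415926535899\<^sup>2 * 0.2242106021742 ^ 3)" unfolding K_def by (rule mult_left_mono) simp
  have "3.141592653588\<^sup>2 * 0.2242106019996 ^ 3 \<le> pi\<^sup>2 * A ^ 3"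
    by (rule mult_mono[OF power_mono power_mono]) (use pi_approx A_bounds A_pos in simp_all)
  hence Kl: "16 * (3.141592653588\<^sup>2 * 0.2242106019996 ^ 3) \<le> K" unfolding K_def by (rule mult_left_mono) simp
  have "1.5907605 ^ 4 * K \<le> 1.5907605 ^ 4 * (16 * (3.1415926535899\<^sup>2 * 0.2242106021742 ^ 3))"
    by (rule mult_left_mono[OF Ku]) simp
  also have "\<dots> < (1.83739218502 :: real) ^ 4" by (simp add: power2_eq_square power3_eq_cube power4_eq_xxxx)
  also have "\<dots> \<le> N ^ 4" by (rule power_mono[OF Nl]) simp
  finally have "1.5907605 ^ 4 < c1 ^ 4" unfolding c4 by (rule pos_less_divide_eq[OF K, THEN iffD2])
  thus "1.5907605 < c1" by (rule power_less_imp_less_base) (use c1_pos in simp)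
  have "N ^ 4 \<le> 1.83739247786 ^ 4" by (rule power_mono[OF Nu N0])
  also have "(1.83739247786 :: real) ^ 4 < 1.5907614 ^ 4 * (16 * (3.141592653588\<^sup>2 * 0.2242106019996 ^ 3))"
    by (simp add: power2_eq_square power3_eq_cube power4_eq_xxxx)
  also have "\<dots> \<le> 1.5907614 ^ 4 * K" by (rule mult_left_mono[OF Kl]) simp
  finally have "c1 ^ 4 < 1.5907614 ^ 4" unfolding c4 by (rule pos_divide_less_eq[OF K, THEN iffD2])
  thus "c1 < 1.5907614" by (rule power_less_imp_less_base) simp
qed

lemma c2_bounds: "0.9470176 \<le> c2" "c2 \<le> 0.9470178"
proof -
  have "0.4735088 \<le> sqrt A" using A_bounds by (intro real_le_rsqrt) (simp add: power2_eq_square)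
  thus "0.9470176 \<le> c2" by (simp add: c2_def)
  have "sqrt A \<le> 0.4735089" using A_bounds by (intro real_le_lsqrt) (simp_all add: power2_eq_square)
  thus "c2 \<le> 0.9470178" by (simp add: c2_def)
qed

lemma q_eq: "q = arm t"
  by (simp add: q_def tau_eq arm_def)

end

theorem theorem3p3:
  fixes v :: nat
  assumes "v \<ge> 1"
  shows
    "fps_conv_radius C_egf = ereal rho
     \<and> summable (\<lambda>n. fps_nth (fps_deriv C_egf) n * rho ^ n)
     \<and> (\<forall>k\<ge>1. convergent (degree_prob v k))
     \<and> (\<forall>w::real. \<bar>w\<bar> * q < 1 \<longrightarrow>
          (\<lambda>x. exp (B_bullet x w)) field_differentiable (at tau) \<and>
          ((\<lambda>k. degree_limit v k * w ^ k) has_sum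
             (rho * deriv (\<lambda>x. exp (B_bullet x w)) tau)) {1..})
     \<and> (\<forall>k\<ge>1. degree_limit v k \<ge> 0)
     \<and> ((\<lambda>k. degree_limit v k) has_sum 1) {1..}
     \<and> (\<exists>c1 c2 :: real.
          degree_limit v \<sim>[at_top]
            (\<lambda>k. c1 * real k powr (1 / 4) * exp (c2 * sqrt (real k)) * q ^ k)
          \<and> \<bar>c1 - 1.590761\<bar> < 0.0000005
          \<and> \<bar>c2 - 0.947018\<bar> < 0.0000005
          \<and> \<bar>q - 0.3808138\<bar> < 0.00000005)"
proof -
  \<comment> \<open>Any root in the enclosure will do: the locale proves that it equals
    \<open>tau\<close>.\<close>
  obtain t where "critical_point t" using critical_point_exists by blast
  then interpret critical_point t .
  have dl: "degree_limit v = d" using degree_limit_eq[OF assms] by blast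
  have 1: "fps_conv_radius C_egf = ereal rho" by (simp add: rho_eq C_egf_radius)
  have 2: "summable (\<lambda>n. fps_nth (fps_deriv C_egf) n * rho ^ n)" using C_deriv_sums by (rule sums_summable)
  have 3: "\<forall>k\<ge>1. convergent (degree_prob v k)" using degree_prob_limit[OF assms] convergentI by blast
  have 4: "(\<lambda>x. exp (B_bullet x w)) field_differentiable (at tau) \<and>
      ((\<lambda>k. degree_limit v k * w ^ k) has_sum (rho * deriv (\<lambda>x. exp (B_bullet x w)) tau)) {1..}" if "\<bar>w\<bar> * q < 1" for w
  proof -
    have w: "\<bar>w\<bar> * arm t < 1" using that by (simp add: q_eq)
    note D = exp_B_deriv[OF w]
    have "(\<lambda>x. exp (B_bullet x w)) field_differentiable (at t)" using D unfolding field_differentiable_def by blast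
    moreover have "deriv (\<lambda>x. exp (B_bullet x w)) t = H' w" using D by (rule DERIV_imp_deriv)
    ultimately show ?thesis using d_has_sum[OF w] by (simp add: tau_eq rho_eq dl)
  qed
  have 5: "\<forall>k\<ge>1. degree_limit v k \<ge> 0" by (simp add: dl d_nonneg)
  have "\<bar>1\<bar> * arm t < 1" using arm_bounds by simp
  from d_has_sum[OF this] have 6: "((\<lambda>k. degree_limit v k) has_sum 1) {1..}" using radius_pos by (simp add: H'_1 dl)
  have 7: "degree_limit v \<sim>[at_top] (\<lambda>k. c1 * real k powr (1 / 4) * exp (c2 * sqrt (real k)) * q ^ k)"
    unfolding dl q_eq by (rule d_asymp)
  have near: "\<bar>x - c\<bar> < e" if "c - e < x" "x < c + e" for x c e :: real using that by linarith
  have 8: "\<bar>c1 - 1.590761\<bar> < 0.0000005" by (rule near) (use c1_bounds in simp_all)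
  have 9: "\<bar>c2 - 0.947018\<bar> < 0.0000005" by (rule near) (use c2_bounds in simp_all)
  have 10: "\<bar>q - 0.3808138\<bar> < 0.00000005" unfolding q_eq by (rule near) (use arm_bounds in simp_all)
  show ?thesis using 1 2 3 4 5 6 7 8 9 10 by blast
qed

end
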